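(* Let $n\ge 2$ be an integer, let $1\le p<\infty$ and let $q\in(-\infty,-n)\cup[\frac{n}{n-1},\infty]$ be defined by $\frac1q=\frac1p-\frac1n$ (with $\frac1q=0$, i.e. $q=\infty$, when $p=n$). Then $$\mathcal{E}_p^+(f)\ \ge\ \Big(1-\frac1q\Big)\,n\,\omega_n^{1/n}\,\Vert f\Vert_{\infty,p}\qquad\text{for all } f\in W^{1,p}(\mathbb{R}^n).$$ Moreover the constant is sharp, i.e. $\big(1-\frac1q\big)n\,\omega_n^{1/n}$ cannot be replaced by any larger constant in this inequality.
   Context: Functions are real-valued on $\mathbb{R}^n$. $W^{1,p}(\mathbb{R}^n)$ is the usual Sobolev space, $\nabla f$ the (weak) gradient, $\Vert\cdot\Vert_p$ the $L_p(\mathbb{R}^n)$-norm with respect to Lebesgue measure, $|\cdot|_n$ is $n$-dimensional Lebesgue measure, $\omega_n$ is the Lebesgue measure of the Euclidean unit ball of $\mathbb{R}^n$, and $du$ is the normalized (probability) Haar measure on the unit sphere $S^{n-1}$. The decreasing rearrangement of $f$ is $f^*(t)=\inf\{\lambda>0 : |\{|f|>\lambda\}|_n\le t\}$, $t\ge 0$, and its Hardy transform is $f^{**}(t)=\frac1t\int_0^t f^*(s)\,ds$. For $1\le p<\infty$ set $$\Vert f\Vert_{\infty,p}=\left(\int_0^\infty \big(f^{**}(t)-f^*(t)\big)^p\,\frac{dt}{t^{p/n}}\right)^{1/p}.$$ For $u\in S^{n-1}$ set $D_u^+f(x)=\max\{\langle\nabla f(x),u\rangle,0\}$. Let $I_p>0$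 be given by $I_p^p=\int_{S^{n-1}}|u_1|^p\,du$, where $u_1$ is the first coordinate of $u$, and define $$\mathcal{E}_p^+(f)=\frac{2^{1/p}}{I_p}\left(\int_{S^{n-1}}\Vert D_u^+f\Vert_p^{-n}\,du\right)^{-1/n}$$ (with the usual conventions $0^{-n}=\infty$ and $\infty^{-1/n}=0$). *)

theory Defs
  imports "HOL-Probability.Probability"
begin

text \<open>Real powers of extended nonnegative reals, with the conventions that for \<open>a < 0\<close> the
  power of \<open>0\<close> is \<open>\<infinity>\<close> and that of \<open>\<infinity>\<close> is \<open>0\<close>.\<close>

definition epowr :: "ennreal \<Rightarrow> real \<Rightarrow> ennreal" (infixr "epowr" 80) where
  "x epowr a =
     (if a = 0 then 1
      else if x = 0 then (if a < 0 then \<infinity> else 0)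
      else if x = \<infinity> then (if a < 0 then 0 else \<infinity>)
      else ennreal (enn2real x powr a))"

primrec Ck :: "nat \<Rightarrow> (real^'n \<Rightarrow> real) \<Rightarrow> bool" where
  "Ck 0 \<phi> \<longleftrightarrow> continuous_on UNIV \<phi>"
| "Ck (Suc k) \<phi> \<longleftrightarrow> (\<forall>x. \<phi> differentiable (at x)) \<and>
     (\<forall>i. Ck k (\<lambda>x. frechet_derivative \<phi> (at x) (axis i 1)))"

definition test_function :: "(real^'n \<Rightarrow> real) \<Rightarrow> bool" where
  "test_function \<phi> \<longleftrightarrow> (\<forall>k. Ck k \<phi>) \<and> compact (closure {x. \<phi> x \<noteq> 0})"

definition locally_integrable :: "(real^'n \<Rightarrow> 'b::{banach, second_countable_topology}) \<Rightarrow> bool" where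
  "locally_integrable f \<longleftrightarrow> (\<forall>K. compact K \<longrightarrow> set_integrable lebesgue K f)"

definition has_weak_gradient :: "(real^'n \<Rightarrow> real) \<Rightarrow> (real^'n \<Rightarrow> real^'n) \<Rightarrow> bool" where
  "has_weak_gradient f g \<longleftrightarrow> locally_integrable f \<and> locally_integrable g \<and>
     (\<forall>\<phi> i. test_function \<phi> \<longrightarrow>
        (LINT x|lebesgue. f x * frechet_derivative \<phi> (at x) (axis i 1)) =
        - (LINT x|lebesgue. g x $ i * \<phi> x))"

text \<open>Weak gradients are determined only up to null sets; \<open>weak_gradient\<close> picks a representative.\<close>

definition weak_gradient :: "(real^'n \<Rightarrow> real) \<Rightarrow> real^'n \<Rightarrow> real^'n" where
  "weak_gradient f = (SOME g. has_weak_gradient f g)"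

definition Lp_functions :: "real \<Rightarrow> (real^'n \<Rightarrow> 'b::euclidean_space) set" where
  "Lp_functions p = {f. f \<in> borel_measurable lebesgue \<and> integrable lebesgue (\<lambda>x. norm (f x) powr p)}"

definition sobolev_W1 :: "real \<Rightarrow> (real^'n \<Rightarrow> real) set" where
  "sobolev_W1 p = {f. f \<in> Lp_functions p \<and> (\<exists>g. has_weak_gradient f g \<and> g \<in> Lp_functions p)}"

definition Lp_norm :: "real \<Rightarrow> (real^'n \<Rightarrow> real) \<Rightarrow> ennreal" where
  "Lp_norm p f = (\<integral>\<^sup>+ x. ennreal (\<bar>f x\<bar> powr p) \<partial>lebesgue) epowr (1 / p)"

definition decreasing_rearrangement :: "(real^'n \<Rightarrow> real) \<Rightarrow> real \<Rightarrow> ennreal" where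
  "decreasing_rearrangement f t =
     Inf {ennreal l | l. l > 0 \<and> emeasure lebesgue {x. \<bar>f x\<bar> > l} \<le> ennreal t}"

definition hardy_transform :: "(real^'n \<Rightarrow> real) \<Rightarrow> real \<Rightarrow> ennreal" where
  "hardy_transform f t =
     ennreal (1 / t) * (\<integral>\<^sup>+ s \<in> {0..t}. decreasing_rearrangement f s \<partial>lborel)"

text \<open>
  For \<open>f\<close> in a Sobolev space and \<open>t > 0\<close> both terms of the difference are finite, and the
  Hardy transform dominates the (decreasing) rearrangement; so the truncated subtraction on
  \<open>ennreal\<close> is the subtraction of real numbers here.
\<close>

definition norm_inf_p :: "real \<Rightarrow> (real^'n \<Rightarrow> real) \<Rightarrow> ennreal" where
  "norm_inf_p p f =
     (\<integral>\<^sup>+ t \<in> {0<..}. (hardy_transform f t - decreasing_rearrangement f t) epowr p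
         * ennreal (1 / t powr (p / real CARD('n))) \<partial>lborel) epowr (1 / p)"

text \<open>
  The normalized Haar measure on the unit sphere is the unique probability measure on its Borel sets
  that is invariant under the orthogonal group; existence and uniqueness are proved below, and
  the measure is identified with the radial projection of the uniform distribution on the ball.
\<close>

definition is_sphere_haar :: "(real^'n) measure \<Rightarrow> bool" where
  "is_sphere_haar \<sigma> \<longleftrightarrow> prob_space \<sigma> \<and> sets \<sigma> = sets (restrict_space borel (sphere 0 1)) \<and>
     (\<forall>T. orthogonal_transformation T \<longrightarrow> distr \<sigma> \<sigma> T = \<sigma>)"

definition sphere_haar :: "(real^'n) measure" where
  "sphere_haar = (THE \<sigma>. is_sphere_haar \<sigma>)"

definition cone_measure :: "(real^'n) measure" where
  "cone_measure = distr (uniform_measure (restrict_space lborel (ball 0 1 - {0})) (ball 0 1 - {0}))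
     (restrict_space borel (sphere 0 1)) sgn"

lemma sphere_haar_space: "is_sphere_haar \<sigma> \<Longrightarrow> space \<sigma> = sphere 0 1"
  unfolding is_sphere_haar_def by (metis inf_top_right sets_eq_imp_space_eq space_borel space_restrict_space)

lemma sphere_haar_id:
  assumes "is_sphere_haar \<sigma>" shows "(\<lambda>x. x) \<in> borel_measurable \<sigma>"
proof -
  have "(\<lambda>x. x) \<in> borel_measurable (restrict_space borel (sphere (0::real^'a) 1))"
    by (intro measurable_restrict_space1) auto
  moreover have "sets \<sigma> = sets (restrict_space borel (sphere 0 1))"
    using assms by (simp add: is_sphere_haar_def)
  ultimately show ?thesis using measurable_cong_sets by blast
qed

lemma sphere_haar_trans:
  assumes "is_sphere_haar \<sigma>" "orthogonal_transformation T" shows "T \<in> measurable \<sigma> \<sigma>"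
proof -
  have "T \<in> borel_measurable borel"
    by (intro borel_measurable_continuous_onI linear_continuous_on linear_linear[THEN iffD2])
      (simp add: assms orthogonal_transformation_linear linear_linear)
  then have "T \<in> measurable (restrict_space borel (sphere 0 1)) (restrict_space borel (sphere 0 1))"
    by (intro measurable_restrict_space3) (auto simp: orthogonal_transformation_norm assms)
  then show ?thesis
    using assms measurable_cong_sets unfolding is_sphere_haar_def by blast
qed

lemma sphere_haar_ball_set:
  assumes "is_sphere_haar \<sigma>" shows "ball y e \<inter> space \<sigma> \<in> sets \<sigma>"
  using measurable_sets[OF sphere_haar_id[OF assms], of "ball y e"] by (simp add: vimage_def Int_def)

lemma sphere_haar_cap_eq:
  assumes s: "is_sphere_haar \<sigma>" and y: "y \<in> sphere 0 1" "z \<in> sphere 0 1"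
  shows "emeasure \<sigma> (ball y e \<inter> space \<sigma>) = emeasure \<sigma> (ball z e \<inter> space \<sigma>)"
proof -
  obtain T where T: "orthogonal_transformation T" "T y = z"
    using orthogonal_transformation_exists[of y z] y by auto
  have "emeasure \<sigma> (ball z e \<inter> space \<sigma>) = emeasure (distr \<sigma> \<sigma> T) (ball z e \<inter> space \<sigma>)"
    using s T by (simp add: is_sphere_haar_def)
  also have "\<dots> = emeasure \<sigma> (T -` (ball z e \<inter> space \<sigma>) \<inter> space \<sigma>)"
    by (intro emeasure_distr sphere_haar_trans sphere_haar_ball_set s T)
  also have "T -` (ball z e \<inter> space \<sigma>) \<inter> space \<sigma> = ball y e \<inter> space \<sigma>"
    using T by (auto simp: sphere_haar_space[OF s] orthogonal_transformation_norm
        orthogonal_transformation_isometry dest: sym)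
  finally show ?thesis by simp
qed

lemma sphere_haar_cap_pos:
  assumes s: "is_sphere_haar \<sigma>" and y: "y \<in> sphere 0 1" and e: "e > 0"
  shows "emeasure \<sigma> (ball y e \<inter> space \<sigma>) \<noteq> 0"
proof
  assume 0: "emeasure \<sigma> (ball y e \<inter> space \<sigma>) = 0"
  have "compact (sphere (0::real^'a) 1)" by simp
  then obtain F where F: "F \<subseteq> sphere 0 1" "finite F" "sphere (0::real^'a) 1 \<subseteq> (\<Union>z\<in>F. ball z e)"
    using e compact_eq_totally_bounded[of "sphere (0::real^'a) 1"]
    by (metis (no_types, lifting) centre_in_ball compactE_image open_ball UN_I subsetI)
  have "emeasure \<sigma> (\<Union>z\<in>F. ball z e \<inter> space \<sigma>) \<le> (\<Sum>z\<in>F. emeasure \<sigma> (ball z e \<inter> space \<sigma>))"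
    by (intro emeasure_subadditive_finite F) (auto intro: sphere_haar_ball_set s)
  also have "\<dots> = 0"
    using F 0 sphere_haar_cap_eq[OF s y] by (intro sum.neutral) (metis subsetD)
  finally have "emeasure \<sigma> (\<Union>z\<in>F. ball z e \<inter> space \<sigma>) = 0" by simp
  moreover have "(\<Union>z\<in>F. ball z e \<inter> space \<sigma>) = space \<sigma>"
    using F sphere_haar_space[OF s] by blast
  ultimately show False
    using s prob_space.emeasure_space_1 unfolding is_sphere_haar_def by fastforce
qed

lemma sphere_haar_fubini:
  assumes m: "is_sphere_haar \<mu>" and n: "is_sphere_haar \<nu>" and U: "U \<in> sets \<mu>"
  shows "(\<integral>\<^sup>+ y. emeasure \<mu> (ball y e \<inter> U) \<partial>\<nu>) = (\<integral>\<^sup>+ x. indicator U x * emeasure \<nu> (ball x e \<inter> space \<nu>) \<partial>\<mu>)"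
proof -
  interpret M: prob_space \<mu> using m by (simp add: is_sphere_haar_def)
  interpret N: prob_space \<nu> using n by (simp add: is_sphere_haar_def)
  interpret P: pair_sigma_finite \<mu> \<nu> ..
  note [measurable] = sphere_haar_id[OF m] sphere_haar_id[OF n] U
  let ?f = "\<lambda>x y. indicator U x * (if dist y x < e then 1 else 0) :: ennreal"
  have 1: "emeasure \<mu> (ball y e \<inter> U) = (\<integral>\<^sup>+ x. ?f x y \<partial>\<mu>)" for y
  proof -
    have "ball y e \<inter> U = (ball y e \<inter> space \<mu>) \<inter> U" using sets.sets_into_space[OF U] by blast
    then have "ball y e \<inter> U \<in> sets \<mu>" using sphere_haar_ball_set[OF m] U by auto
    then have "emeasure \<mu> (ball y e \<inter> U) = (\<integral>\<^sup>+ x. indicator (ball y e \<inter> U) x \<partial>\<mu>)" by simp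
    also have "\<dots> = (\<integral>\<^sup>+ x. ?f x y \<partial>\<mu>)" by (intro nn_integral_cong) (auto simp: indicator_def)
    finally show ?thesis .
  qed
  have 2: "indicator U x * emeasure \<nu> (ball x e \<inter> space \<nu>) = (\<integral>\<^sup>+ y. ?f x y \<partial>\<nu>)" for x
  proof -
    have "emeasure \<nu> (ball x e \<inter> space \<nu>) = (\<integral>\<^sup>+ y. indicator (ball x e \<inter> space \<nu>) y \<partial>\<nu>)"
      using sphere_haar_ball_set[OF n] by simp
    also have "\<dots> = (\<integral>\<^sup>+ y. (if dist y x < e then 1 else 0) \<partial>\<nu>)"
      by (intro nn_integral_cong) (auto simp: indicator_def dist_commute)
    finally show ?thesis by (simp add: nn_integral_cmult)
  qed
  have "(\<integral>\<^sup>+ y. (\<integral>\<^sup>+ x. ?f x y \<partial>\<mu>) \<partial>\<nu>) = (\<integral>\<^sup>+ x. (\<integral>\<^sup>+ y. ?f x y \<partial>\<nu>) \<partial>\<mu>)"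
    by (rule P.Fubini') measurable
  then show ?thesis unfolding 1 2 .
qed

lemma sphere_haar_le:
  assumes m: "is_sphere_haar \<mu>" and n: "is_sphere_haar \<nu>" and U: "open U"
  shows "emeasure \<nu> (U \<inter> sphere 0 1) \<le> emeasure \<mu> (U \<inter> sphere 0 1)"
proof -
  interpret M: prob_space \<mu> using m by (simp add: is_sphere_haar_def)
  interpret N: prob_space \<nu> using n by (simp add: is_sphere_haar_def)
  have smn: "sets \<mu> = sets \<nu>" using m n by (simp add: is_sphere_haar_def)
  have sp: "space \<mu> = sphere 0 1" "space \<nu> = sphere 0 1" using sphere_haar_space m n by auto
  define V where "V = U \<inter> sphere 0 1"
  have V: "V \<in> sets \<mu>"
    using measurable_sets[OF sphere_haar_id[OF m], of U] U by (simp add: V_def sp vimage_def Int_def)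
  have V': "V \<in> sets \<nu>" using V smn by simp
  obtain z :: "real^'a" where z: "z \<in> sphere 0 1" using vector_choose_size[of 1] by auto
  define c where "c k = emeasure \<mu> (ball z (1 / Suc k) \<inter> sphere 0 1)" for k
  have c: "emeasure \<mu> (ball y (1 / Suc k) \<inter> sphere 0 1) = c k" if "y \<in> sphere 0 1" for y k
    using sphere_haar_cap_eq[OF m that z] by (simp add: c_def sp)
  have c': "emeasure \<nu> (ball y (1 / Suc k) \<inter> sphere 0 1) = c k" if "y \<in> sphere 0 1" for y k
  proof -
    have "c k = (\<integral>\<^sup>+ y. c k \<partial>\<nu>)" using N.emeasure_space_1 by simp
    also have "\<dots> = (\<integral>\<^sup>+ y. emeasure \<mu> (ball y (1 / Suc k) \<inter> sphere 0 1) \<partial>\<nu>)"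
      by (intro nn_integral_cong) (metis c sp(2))
    also have "\<dots> = (\<integral>\<^sup>+ x. indicator (sphere 0 1) x * emeasure \<nu> (ball x (1 / Suc k) \<inter> sphere 0 1) \<partial>\<mu>)"
      using sphere_haar_fubini[OF m n sets.top] by (simp add: sp)
    also have "\<dots> = (\<integral>\<^sup>+ x. emeasure \<nu> (ball y (1 / Suc k) \<inter> sphere 0 1) \<partial>\<mu>)"
      using sphere_haar_cap_eq[OF n _ that] by (intro nn_integral_cong) (auto simp: sp)
    also have "\<dots> = emeasure \<nu> (ball y (1 / Suc k) \<inter> sphere 0 1)" using M.emeasure_space_1 by simp
    finally show ?thesis by simp
  qed
  have c0: "c k \<noteq> 0" for k using sphere_haar_cap_pos[OF m z] by (simp add: c_def sp)
  have ct: "c k \<noteq> \<top>" for k by (simp add: c_def)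
  define g where "g k y = emeasure \<mu> (ball y (1 / Suc k) \<inter> V) / c k" for k y
  have em: "(\<lambda>y. emeasure \<mu> (ball y (1 / Suc k) \<inter> V)) \<in> borel_measurable \<nu>" for k
  proof -
    note [measurable] = sphere_haar_id[OF m] sphere_haar_id[OF n] V
    have "(\<lambda>y. emeasure \<mu> {x \<in> space \<mu>. dist y x < 1 / Suc k \<and> x \<in> V}) \<in> borel_measurable \<nu>"
      by measurable
    also have "(\<lambda>y. emeasure \<mu> {x \<in> space \<mu>. dist y x < 1 / Suc k \<and> x \<in> V}) = (\<lambda>y. emeasure \<mu> (ball y (1 / Suc k) \<inter> V))"
      by (intro ext arg_cong[where f="emeasure \<mu>"]) (auto simp: V_def sp)
    finally show ?thesis .
  qed
  have gm: "g k \<in> borel_measurable \<nu>" for k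
    unfolding g_def[abs_def] using em by measurable
  have gi: "(\<integral>\<^sup>+ y. g k y \<partial>\<nu>) = emeasure \<mu> V" for k
  proof -
    have "(\<integral>\<^sup>+ y. g k y \<partial>\<nu>) = (\<integral>\<^sup>+ y. emeasure \<mu> (ball y (1 / Suc k) \<inter> V) \<partial>\<nu>) / c k"
      unfolding g_def by (rule nn_integral_divide[OF em])
    also have "(\<integral>\<^sup>+ y. emeasure \<mu> (ball y (1 / Suc k) \<inter> V) \<partial>\<nu>)
        = (\<integral>\<^sup>+ x. indicator V x * emeasure \<nu> (ball x (1 / Suc k) \<inter> sphere 0 1) \<partial>\<mu>)"
      using sphere_haar_fubini[OF m n V] by (simp add: sp)
    also have "\<dots> = (\<integral>\<^sup>+ x. c k * indicator V x \<partial>\<mu>)"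
      using c' by (intro nn_integral_cong) (auto simp: sp mult.commute)
    also have "\<dots> = c k * emeasure \<mu> V" using V by (simp add: nn_integral_cmult)
    also have "c k * emeasure \<mu> V / c k = emeasure \<mu> V"
      using c0 ct by (metis ennreal_mult_divide_eq mult.commute)
    finally show ?thesis .
  qed
  have lim: "indicator V y \<le> liminf (\<lambda>k. g k y)" if "y \<in> space \<nu>" for y
  proof (cases "y \<in> V")
    case True
    then obtain e where e: "e > 0" "ball y e \<subseteq> U" using U by (auto simp: V_def open_contains_ball)
    have "eventually (\<lambda>k. 1 / Suc k < e) sequentially"
      using order_tendstoD(2)[OF LIMSEQ_inverse_real_of_nat e(1)] by (simp add: inverse_eq_divide)
    then have "eventually (\<lambda>k. g k y = 1) sequentially"
    proof eventually_elim
      case (elim k)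
      then have "ball y (1 / Suc k) \<inter> V = ball y (1 / Suc k) \<inter> sphere 0 1"
        using e by (auto simp: V_def)
      then show ?case using c[of y k] c0[of k] ct[of k] that
        by (simp add: g_def sp top.not_eq_extremum)
    qed
    then have "1 \<le> liminf (\<lambda>k. g k y)"
      by (intro Liminf_bounded) (auto elim: eventually_mono)
    then show ?thesis by (simp add: True)
  qed simp
  have "emeasure \<nu> V = (\<integral>\<^sup>+ y. indicator V y \<partial>\<nu>)" using V' by simp
  also have "\<dots> \<le> (\<integral>\<^sup>+ y. liminf (\<lambda>k. g k y) \<partial>\<nu>)" by (intro nn_integral_mono lim)
  also have "\<dots> \<le> liminf (\<lambda>k. \<integral>\<^sup>+ y. g k y \<partial>\<nu>)" by (rule nn_integral_liminf[OF gm])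
  also have "\<dots> = emeasure \<mu> V" by (simp add: gi Liminf_const)
  finally show ?thesis by (simp add: V_def)
qed

lemma sphere_haar_unique:
  assumes m: "is_sphere_haar \<mu>" and n: "is_sphere_haar \<nu>"
  shows "\<mu> = \<nu>"
proof -
  interpret M: prob_space \<mu> using m by (simp add: is_sphere_haar_def)
  let ?E = "(\<lambda>U. U \<inter> sphere (0::real^'a) 1) ` {U. open U}"
  have sets: "sets (restrict_space borel (sphere (0::real^'a) 1)) = sigma_sets (sphere 0 1) ?E"
  proof -
    have "sphere (0::real^'a) 1 \<in> sets borel" by simp
    then have "sphere (0::real^'a) 1 \<in> sigma_sets UNIV {U. open U}" unfolding borel_def by simp
    from sigma_sets_Int[OF this] show ?thesis
      by (simp add: sets_restrict_space borel_def Int_commute)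
  qed
  show ?thesis
  proof (rule measure_eqI_generator_eq[where E="?E" and \<Omega>="sphere 0 1" and A="\<lambda>_. sphere 0 1"])
    show "Int_stable ?E"
    proof (rule Int_stableI)
      fix X Y assume "X \<in> ?E" "Y \<in> ?E"
      then obtain A B where "open A" "open B" "X = A \<inter> sphere 0 1" "Y = B \<inter> sphere 0 1" by blast
      then have "X \<inter> Y = (A \<inter> B) \<inter> sphere 0 1" "open (A \<inter> B)" by auto
      then show "X \<inter> Y \<in> ?E" by blast
    qed
    show "range (\<lambda>_::nat. sphere (0::real^'a) 1) \<subseteq> ?E" by (auto intro!: image_eqI[where x=UNIV])
    show "emeasure \<mu> X = emeasure \<nu> X" if "X \<in> ?E" for X
      using that sphere_haar_le[OF m n] sphere_haar_le[OF n m] by (auto intro: antisym)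
  qed (use m n sets in \<open>auto simp: is_sphere_haar_def\<close>)
qed


lemma cone_measure_is_sphere_haar:
  "is_sphere_haar (cone_measure :: (real^'n::{finite,wellorder}) measure)"
proof -
  define B :: "((real, 'n) vec) set" where "B = ball 0 1 - {0}"
  define S :: "((real, 'n) vec) set" where "S = sphere 0 1"
  define L where "L = restrict_space lborel B"
  define U where "U = uniform_measure L B"
  define R where "R = restrict_space borel S"
  define P where "P A = sgn -` A \<inter> B" for A
  have B [measurable]: "B \<in> sets borel" by (simp add: B_def)
  have spL: "space L = B" by (simp add: L_def space_restrict_space)
  have spU: "space U = B" by (simp add: U_def spL)
  have setsU: "sets U = sets L" by (simp add: U_def)
  have BL: "B \<in> sets L" using sets.top[of L] spL by simp
  have emB: "emeasure lborel B = emeasure lborel (ball (0::(real, 'n) vec) 1)"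
    unfolding B_def by (intro emeasure_Diff_null_set) (auto intro: finite_imp_null_set_lborel)
  have finB: "emeasure lborel B \<noteq> \<infinity>" unfolding emB
    using emeasure_lborel_ball_finite[of "0::(real, 'n) vec" 1] by simp
  have posB: "emeasure lborel B \<noteq> 0" unfolding emB
    using unit_ball_vol_pos[of "real CARD('n)"] by (simp add: emeasure_ball less_imp_neq[symmetric])
  have emL: "emeasure L X = emeasure lborel X" if "X \<subseteq> B" for X
    unfolding L_def by (rule emeasure_restrict_space) (use that in \<open>auto\<close>)
  have cone: "cone_measure = distr U R sgn"
    by (simp add: cone_measure_def U_def L_def R_def B_def S_def)
  have sgn_meas: "(sgn :: (real, 'n) vec \<Rightarrow> _) \<in> borel_measurable borel"
    unfolding sgn_div_norm[abs_def] by measurable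
  have sm: "sgn \<in> measurable U R"
    unfolding R_def
  proof (rule measurable_restrict_space2)
    show "sgn \<in> space U \<rightarrow> S" by (auto simp: spU B_def S_def norm_sgn)
    have "sgn \<in> borel_measurable L" unfolding L_def by (intro measurable_restrict_space1) (simp add: sgn_meas)
    then show "sgn \<in> borel_measurable U" using setsU measurable_cong_sets by blast
  qed
  have pU: "prob_space U" unfolding U_def
    using posB finB by (intro prob_space_uniform_measure) (simp_all add: emL)
  have Rset: "A \<in> sets R \<Longrightarrow> A \<in> sets borel \<and> A \<subseteq> S" for A
    by (auto simp: R_def S_def sets_restrict_space)
  have Pm: "P A \<in> sets borel" if "A \<in> sets borel" for A
    using measurable_sets[OF sgn_meas that] B by (simp add: P_def)
  have em: "emeasure cone_measure A = emeasure lborel (P A) / emeasure lborel B" if A: "A \<in> sets R" for A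
  proof -
    have "emeasure cone_measure A = emeasure U (P A)"
      unfolding cone using A sm by (simp add: emeasure_distr P_def spU)
    also have "\<dots> = emeasure L (B \<inter> P A) / emeasure L B"
      unfolding U_def using measurable_sets[OF sm A] setsU by (intro emeasure_uniform_measure) (auto simp: BL P_def spU)
    also have "B \<inter> P A = P A" by (auto simp: P_def)
    finally show ?thesis by (simp add: emL P_def)
  qed
  have finP: "emeasure lborel (P A) \<noteq> \<infinity>" for A
    using emeasure_mono[of "P A" B lborel] finB by (auto simp: P_def top_unique)
  have setsC: "sets cone_measure = sets R" by (simp add: cone)
  have inv: "distr cone_measure cone_measure T = cone_measure" if T: "orthogonal_transformation T" for T :: "(real, 'n) vec \<Rightarrow> (real, 'n) vec"
  proof (rule measure_eqI)
    fix A assume "A \<in> sets (distr cone_measure cone_measure T)"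
    then have A: "A \<in> sets R" by (simp add: setsC)
    have linT: "linear T" using T orthogonal_transformation_linear by blast
    have "T \<in> borel_measurable borel"
      by (intro borel_measurable_continuous_onI linear_continuous_on) (simp add: linT linear_linear)
    then have TR: "T \<in> measurable R R" unfolding R_def S_def
      by (intro measurable_restrict_space3) (auto simp: orthogonal_transformation_norm T)
    then have TC: "T \<in> measurable cone_measure cone_measure"
      using setsC measurable_cong_sets by blast
    have spC: "space cone_measure = S" by (simp add: cone R_def S_def space_restrict_space)
    let ?A = "T -` A \<inter> S"
    have A': "?A \<in> sets R" using measurable_sets[OF TR A] by (simp add: R_def S_def space_restrict_space)
    have sgnT: "sgn (T x) = T (sgn x)" for x
      using T by (simp add: sgn_div_norm orthogonal_transformation_norm linear_scale[OF linT])
    have T0: "T x = 0 \<longleftrightarrow> x = 0" for x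
      using orthogonal_transformation_norm[OF T, of x] by (metis norm_eq_zero)
    have bij: "bij T" using T orthogonal_transformation_bij by blast
    have im: "T ` P ?A = P A"
    proof (intro equalityI subsetI)
      fix y assume "y \<in> T ` P ?A"
      then show "y \<in> P A"
        by (auto simp: P_def sgnT B_def orthogonal_transformation_norm[OF T] T0)
    next
      fix y assume y: "y \<in> P A"
      obtain x where x: "y = T x" using bij by (metis bij_pointE)
      have "x \<in> P ?A" using y
        by (auto simp: x P_def sgnT B_def S_def orthogonal_transformation_norm[OF T] T0 norm_sgn)
      then show "y \<in> T ` P ?A" using x by blast
    qed
    have PA: "P ?A \<in> sets borel" "P A \<in> sets borel" using Pm Rset A A' by auto
    have lm: "P ?A \<in> lmeasurable"
      using PA finP[of ?A] by (intro fmeasurableI) (auto simp: top.not_eq_extremum)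
    have "measure lborel (P A) = measure lborel (P ?A)"
      using measure_orthogonal_image[OF T lm] PA unfolding im by simp
    then have "emeasure lborel (P A) = emeasure lborel (P ?A)"
      using finP by (simp add: emeasure_eq_ennreal_measure)
    then show "emeasure (distr cone_measure cone_measure T) A = emeasure cone_measure A"
      using TC A A' by (simp add: emeasure_distr setsC spC em)
  qed simp
  have "prob_space (cone_measure :: ((real, 'n) vec) measure)"
    unfolding cone by (rule prob_space.prob_space_distr[OF pU sm])
  with inv setsC show ?thesis by (simp add: is_sphere_haar_def R_def S_def)
qed

theorem sphere_haar_eq_cone_measure:
  "sphere_haar = (cone_measure :: (real^'n::{finite,wellorder}) measure)"
  unfolding sphere_haar_def
  by (intro the_equality cone_measure_is_sphere_haar sphere_haar_unique) 

corollary is_sphere_haar_sphere_haar: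
  "is_sphere_haar (sphere_haar :: (real^'n::{finite,wellorder}) measure)"
  by (simp add: sphere_haar_eq_cone_measure cone_measure_is_sphere_haar)

definition D_plus :: "real^'n \<Rightarrow> (real^'n \<Rightarrow> real) \<Rightarrow> real^'n \<Rightarrow> real" where
  "D_plus u f x = max (weak_gradient f x \<bullet> u) 0"

text \<open>
  The index type is well-ordered so that the first coordinate of \<open>u\<close>, the one at the least index,
  makes sense.
\<close>

definition I_const :: "'n::{finite,wellorder} itself \<Rightarrow> real \<Rightarrow> real" where
  "I_const _ p = (LINT u|(sphere_haar :: (real, 'n) vec measure). \<bar>u $ (LEAST i. True)\<bar> powr p) powr (1 / p)"

definition energy_plus :: "real \<Rightarrow> (real^'n::{finite,wellorder} \<Rightarrow> real) \<Rightarrow> ennreal" where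
  "energy_plus p f =
     ennreal (2 powr (1 / p) / I_const TYPE('n) p) *
     (\<integral>\<^sup>+ u. Lp_norm p (D_plus u f) epowr (- real CARD('n)) \<partial>sphere_haar) epowr (- 1 / real CARD('n))"

text \<open>The real number \<open>1 / q\<close> is the value of the extended real \<open>1 / q\<close>, which is \<open>0\<close> for \<open>q = \<infinity>\<close>.\<close>

definition affine_const :: "'n::finite itself \<Rightarrow> ereal \<Rightarrow> real" where
  "affine_const _ q = (1 - real_of_ereal (1 / q)) * real CARD('n)
     * measure lebesgue (ball (0 :: real^'n) 1) powr (1 / real CARD('n))"

end

theory Submission
  imports Defs
begin

text \<open>
  Write \<open>N u = \<parallel>D\<^sub>u\<^sup>+ f\<parallel>\<^sub>p\<close> and let \<open>K\<close> be the set \<open>N \<le> 1\<close>. Since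
  \<open>f (x + u) - f x\<close> is the mean of \<open>\<langle>\<nabla>f, u\<rangle>\<close> over a segment, Jensen's inequality bounds the nonlocal
  energy \<open>\<integral>\<^sub>K \<integral> (f (x + u) - f x)\<^sub>+\<^sup>p dx du\<close> by the integral of \<open>N\<^sup>p\<close> over \<open>K\<close>, which polar coordinates express
  by the volume of \<open>K\<close>, that is by the integral of \<open>N\<close> to the power \<open>-n\<close> over the sphere. By Riesz's inequality the energy
  does not increase when \<open>f\<close> is replaced by its symmetric decreasing rearrangement and \<open>K\<close> by a ball of the
  same volume. Applied to the dilates \<open>\<epsilon> K\<close> with \<open>\<epsilon> \<rightarrow> 0\<close>, this bounds a weighted \<open>L\<^sub>p\<close> norm of the logarithmic
  derivative of \<open>f\<^sup>*\<close>. Now \<open>f\<^sup>*\<^sup>* - f\<^sup>*\<close> is the Hardy average of this derivative, and Hardy's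
  inequality gives the factor \<open>1 - 1/q\<close>.
  As \<open>f\<^sup>*\<close> need not be absolutely continuous, difference quotients in the logarithmic scale
  replace the derivative. The constant is approached by radial functions with \<open>|\<nabla>f| = |x| powr (- n/p)\<close> on
  \<open>1 < |x| < R\<close> and zero elsewhere, as \<open>R \<rightarrow> \<infinity>\<close>: both sides to the power \<open>p\<close> grow like \<open>ln R\<close>, with errors that stay bounded.
\<close>

text \<open>Everything is reduced to sets. The power \<open>max 0 t powr p\<close> is a mixture of
  hinges, \<open>t - h\<close> cut off at zero with h >= 0, and by layers a hinge energy counts
  pairs whose first point lies outside a superlevel set and whose second lies inside a higher one.
  The complement of a superlevel set has infinite measure, so this count enters as a product of two
  measures minus a Riesz integral. Only upward increments count and \<open>K\<close> need not be
  symmetric, so \<open>f\<close> cannot simply be replaced by its absolute value: \<open>f\<close>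
  climbs where its positive part climbs or its negative part falls, and the latter sees the
  reflected \<open>K\<close>. Hence Riesz's inequality is needed for two triples at once; the second
  triple is reflected and moved away from the first, and the unions form a single triple. The volume
  of the unit ball and the factor n/(n+p) occur both in the integral over \<open>K\<close> and in
  the limit of small balls, and cancel. What remains of the limit is half of the moment I_p^p, which
  is exactly the normalisation in \<open>energy_plus\<close>.\<close>

abbreviation lborel_nn_integral :: "('a::euclidean_space \<Rightarrow> ennreal) \<Rightarrow> ennreal" (binder "LINT+ " 10)
  where "lborel_nn_integral f \<equiv> nn_integral lborel f"

abbreviation vol :: "'a::euclidean_space set \<Rightarrow> ennreal"
  where "vol \<equiv> emeasure lborel"

section \<open>Riesz's inequality on the line\<close>

text \<open>The coordinate that flattens \<open>A\<close> onto the interval from 0 to its measure: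
  the gaps of \<open>A\<close> disappear and only the order of its points remains.\<close>

definition mass_below :: "real set \<Rightarrow> real \<Rightarrow> real" where
  "mass_below A x = measure lborel (A \<inter> {..x})"

locale finite_borel_set =
  fixes A :: "real set"
  assumes borel [measurable]: "A \<in> sets borel" and finite: "vol A < \<infinity>"
begin

lemma fmeasurable: "A \<inter> B \<in> fmeasurable lborel" if "B \<in> sets borel"
  using that finite by (intro fmeasurableI) (auto intro: le_less_trans[OF emeasure_mono])

lemma fmeasurable_self: "A \<in> fmeasurable lborel"
  using fmeasurable[of UNIV] by simp

lemma mass_below_nonneg: "0 \<le> mass_below A x"
  by (simp add: mass_below_def)

lemma mass_below_le: "mass_below A x \<le> measure lborel A"
  unfolding mass_below_def using fmeasurable_self by (intro measure_mono_fmeasurable) auto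

lemma mass_below_diff:
  assumes "x \<le> y" shows "mass_below A y - mass_below A x = measure lborel (A \<inter> {x<..y})"
proof -
  have "A \<inter> {..y} = (A \<inter> {..x}) \<union> (A \<inter> {x<..y})" using assms by auto
  then have "measure lborel (A \<inter> {..y}) = measure lborel (A \<inter> {..x}) + measure lborel (A \<inter> {x<..y})"
    using fmeasurable[of "{..x}"] fmeasurable[of "{x<..y}"]
    by (simp only:) (intro measure_Un_AE AE_I2, auto)
  then show ?thesis by (simp add: mass_below_def)
qed

lemma mass_below_mono: "x \<le> y \<Longrightarrow> mass_below A x \<le> mass_below A y"
  using mass_below_diff[of x y] by (metis diff_ge_0_iff_ge measure_nonneg)

lemma mass_below_lipschitz:
  assumes "x \<le> y" shows "mass_below A y - mass_below A x \<le> y - x"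
proof -
  have "measure lborel (A \<inter> {x<..y}) \<le> measure lborel {x<..y}"
    using assms by (intro measure_mono_fmeasurable) (auto simp: fmeasurable_def)
  then show ?thesis using mass_below_diff[OF assms] assms by simp
qed

lemma continuous_mass_below: "continuous_on UNIV (mass_below A)"
proof (rule continuous_on_iff[THEN iffD2], intro ballI allI impI)
  fix x e :: real assume "e > 0"
  have "dist (mass_below A y) (mass_below A x) \<le> dist y x" for y
    using mass_below_lipschitz[of x y] mass_below_lipschitz[of y x] mass_below_mono[of x y] mass_below_mono[of y x]
    by (cases "x \<le> y") (auto simp: dist_real_def)
  with \<open>e > 0\<close> show "\<exists>d>0. \<forall>x'\<in>UNIV. dist x' x < d \<longrightarrow> dist (mass_below A x') (mass_below A x) < e"
    by (meson le_less_trans)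
qed

lemma borel_measurable_mass_below [measurable]: "mass_below A \<in> borel_measurable borel"
  using continuous_mass_below by (rule borel_measurable_continuous_onI)

lemma mass_below_at_top: "(mass_below A \<longlongrightarrow> measure lborel A) at_top"
proof (rule tendsto_at_topI_sequentially)
  fix X :: "nat \<Rightarrow> real" assume X: "filterlim X at_top sequentially"
  have "(\<lambda>n. LINT x|lborel. indicator (A \<inter> {..X n}) x) \<longlonglongrightarrow> (LINT x|lborel. indicator A x :: real)"
  proof (rule integral_dominated_convergence[where w="indicator A"])
    show "integrable lborel (indicator A :: real \<Rightarrow> real)" using finite by simp
    show "AE x in lborel. (\<lambda>n. indicator (A \<inter> {..X n}) x :: real) \<longlonglongrightarrow> indicator A x"
    proof (rule AE_I2)
      fix x
      have "eventually (\<lambda>n. x \<le> X n) sequentially" using X by (simp add: filterlim_at_top)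
      then show "(\<lambda>n. indicator (A \<inter> {..X n}) x :: real) \<longlonglongrightarrow> indicator A x"
        by (intro tendsto_eventually) (auto elim!: eventually_mono simp: indicator_def)
    qed
  qed (auto simp: indicator_def)
  then show "(\<lambda>n. mass_below A (X n)) \<longlonglongrightarrow> measure lborel A"
    by (simp add: mass_below_def fmeasurable fmeasurable_self)
qed

lemma mass_below_at_bot: "(mass_below A \<longlongrightarrow> 0) at_bot"
proof (subst filterlim_at_bot_mirror, rule tendsto_at_topI_sequentially)
  fix X :: "nat \<Rightarrow> real" assume X: "filterlim X at_top sequentially"
  have "(\<lambda>n. LINT x|lborel. indicator (A \<inter> {..- X n}) x) \<longlonglongrightarrow> (LINT x|(lborel :: real measure). 0 :: real)"
  proof (rule integral_dominated_convergence[where w="indicator A"])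
    show "integrable lborel (indicator A :: real \<Rightarrow> real)" using finite by simp
    show "AE x in lborel. (\<lambda>n. indicator (A \<inter> {..- X n}) x :: real) \<longlonglongrightarrow> 0"
    proof (rule AE_I2)
      fix x
      have "eventually (\<lambda>n. -x < X n) sequentially" using X by (simp add: filterlim_at_top_dense)
      then show "(\<lambda>n. indicator (A \<inter> {..- X n}) x :: real) \<longlonglongrightarrow> 0"
        by (intro tendsto_eventually) (auto elim!: eventually_mono simp: indicator_def)
    qed
  qed (auto simp: indicator_def)
  then show "(\<lambda>n. mass_below A (- X n)) \<longlonglongrightarrow> 0"
    by (simp add: mass_below_def fmeasurable)
qed

lemma mass_below_attains:
  assumes "0 < c" "c < measure lborel A" obtains x where "mass_below A x = c"
proof -
  obtain u where u: "mass_below A u < c"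
    using order_tendstoD(2)[OF mass_below_at_bot assms(1)]
    by (metis eventually_at_bot_linorder order_refl)
  obtain w where w: "c < mass_below A w"
    using order_tendstoD(1)[OF mass_below_at_top assms(2)]
    by (metis eventually_at_top_linorder order_refl)
  have "u \<le> w" using u w mass_below_mono[of w u] by (cases "u \<le> w") auto
  then show ?thesis
    using IVT'[of "mass_below A" u c w] u w continuous_on_subset[OF continuous_mass_below] that by fastforce
qed

text \<open>\<open>mass_below\<close> is constant across the gaps of \<open>A\<close>, so the level
  \<open>c\<close> may be taken on a whole interval. The sublevel set is the half-line up to the
  largest such point, where the mass is still \<open>c\<close> by continuity.\<close>

lemma emeasure_mass_below_le:
  assumes "0 < c" "c < measure lborel A"
  shows "vol {x \<in> A. mass_below A x \<le> c} = ennreal c"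
proof -
  define S where "S = {x. mass_below A x \<le> c}"
  obtain x0 where x0: "mass_below A x0 = c" using mass_below_attains assms .
  obtain w where w: "c < mass_below A w"
    using order_tendstoD(1)[OF mass_below_at_top assms(2)]
    by (metis eventually_at_top_linorder order_refl)
  have bdd: "bdd_above S"
  proof (rule bdd_aboveI[of _ w])
    fix x assume "x \<in> S"
    then show "x \<le> w" using mass_below_mono[of w x] w by (cases "x \<le> w") (auto simp: S_def)
  qed
  have cl: "closed S" unfolding S_def
    by (intro closed_Collect_le continuous_mass_below continuous_on_const)
  have ne: "S \<noteq> {}" using x0 by (auto simp: S_def)
  define m where "m = Sup S"
  have mS: "m \<in> S" unfolding m_def using closed_contains_Sup[OF ne bdd cl] .
  have up: "x \<le> m" if "x \<in> S" for x
    using cSup_upper[OF that bdd] by (simp add: m_def)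
  have "S = {..m}" using mS up mass_below_mono by (auto simp: S_def intro: order_trans)
  then have "{x \<in> A. mass_below A x \<le> c} = A \<inter> {..m}" by (auto simp: S_def)
  moreover have "mass_below A m = c"
    using mS x0 up[of x0] mass_below_mono[of x0 m] by (auto simp: S_def)
  ultimately show ?thesis
    using fmeasurable[of "{..m}"] by (simp add: mass_below_def emeasure_eq_measure2)
qed

text \<open>The probability integral transform: a distribution function without atoms carries its
  measure to the uniform one. Half-lines form a generator, so sublevel sets suffice.\<close>

lemma distr_mass_below:
  "distr (restrict_space lborel A) borel (mass_below A) = distr (restrict_space lborel {0<..<measure lborel A}) borel (\<lambda>x. x)"
  (is "?L = ?R")
proof -
  define a where "a = measure lborel A"
  have em: "vol A = ennreal a" unfolding a_def using fmeasurable_self by (simp add: emeasure_eq_measure2)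
  have a0: "a \<ge> 0" by (simp add: a_def)
  have m1: "mass_below A \<in> borel_measurable (restrict_space lborel A)"
    by (intro measurable_restrict_space1) simp
  have m2: "(\<lambda>x. x) \<in> borel_measurable (restrict_space lborel {0<..<a})"
    by (intro measurable_restrict_space1) simp
  have L: "emeasure ?L T = vol {x\<in>A. mass_below A x \<in> T}" if [measurable]: "T \<in> sets borel" for T
    using m1 by (subst emeasure_distr) (auto simp: emeasure_restrict_space space_restrict_space intro!: arg_cong[where f="vol"])
  have R: "emeasure ?R T = vol ({0<..<a} \<inter> T)" if [measurable]: "T \<in> sets borel" for T
    using m2 by (subst emeasure_distr) (auto simp: a_def[symmetric] emeasure_restrict_space space_restrict_space intro!: arg_cong[where f="vol"])
  have le: "emeasure ?L {..c} = emeasure ?R {..c}" for c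
  proof -
    consider "c < 0" | "c \<ge> a" | "c = 0" "a > 0" | "0 < c" "c < a" by linarith
    then show ?thesis
    proof cases
      case 1
      then have e: "{x \<in> A. mass_below A x \<le> c} = {}" "{0<..<a} \<inter> {..c} = {}"
        using mass_below_nonneg by (auto simp: not_le intro: less_le_trans)
      show ?thesis unfolding L[OF atMost_borel] R[OF atMost_borel] atMost_iff e by (simp only: emeasure_empty)
    next
      case 2
      then have "{x \<in> A. mass_below A x \<le> c} = A" "{0<..<a} \<inter> {..c} = {0<..<a}"
        using mass_below_le by (auto simp: a_def intro: order_trans)
      then show ?thesis using a0 by (simp add: L R em)
    next
      case 4
      then have "{0<..<a} \<inter> {..c} = {0<..c}" by auto
      then show ?thesis using 4 emeasure_mass_below_le[of c]
        unfolding L[OF atMost_borel] R[OF atMost_borel] unfolding a_def[symmetric] by simp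
    next
      case 3
      \<comment> \<open>\<open>emeasure_mass_below_le\<close> covers positive levels only; the level
        0 is squeezed between 0 and small positive levels. The minimum with \<open>a / 2\<close>
        keeps these below the total mass.\<close>
      have le_e: "vol {x \<in> A. mass_below A x \<le> 0} \<le> ennreal e" if "0 < e" for e
      proof -
        define e' where "e' = min e (a/2)"
        have "vol {x \<in> A. mass_below A x \<le> 0} \<le> vol {x \<in> A. mass_below A x \<le> e'}"
          using 3 that by (intro emeasure_mono) (auto simp: e'_def)
        also have "\<dots> = ennreal e'" using 3 that by (intro emeasure_mass_below_le) (auto simp: e'_def a_def[symmetric])
        also have "\<dots> \<le> ennreal e" by (auto simp: e'_def intro: ennreal_leI)
        finally show ?thesis .
      qed
      have "vol {x \<in> A. mass_below A x \<le> 0} \<le> 0"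
      proof (rule ennreal_le_epsilon)
        fix e :: real assume "0 < e"
        from le_e[OF this] show "vol {x \<in> A. mass_below A x \<le> 0} \<le> 0 + ennreal e" by simp
      qed
      moreover have "{0<..<a} \<inter> {..0} = {}" by auto
      ultimately show ?thesis using 3 by (simp add: L R)
    qed
  qed
  show ?thesis
  proof (rule measure_eqI_generator_eq[where E="range atMost" and \<Omega>=UNIV and A="\<lambda>n. {..real n}"])
    show "Int_stable (range (atMost :: real \<Rightarrow> _))"
      by (auto simp: Int_stable_def)
    show "sets ?L = sigma_sets UNIV (range atMost)" "sets ?R = sigma_sets UNIV (range atMost)"
      by (simp_all add: borel_eq_atMost)
    show "(\<Union>n. {..real n}) = UNIV" using real_arch_simple by auto
    show "emeasure ?L {..real n} \<noteq> \<infinity>" for n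
    proof -
      have "emeasure ?L {..real n} \<le> vol A" unfolding L[OF atMost_borel] by (intro emeasure_mono) auto
      then show ?thesis using finite by auto
    qed
    show "emeasure ?L X = emeasure ?R X" if "X \<in> range atMost" for X
      using that le by blast
  qed auto
qed

lemma nn_integral_mass_below:
  assumes [measurable]: "h \<in> borel_measurable borel"
  shows "(\<integral>\<^sup>+x\<in>A. h (mass_below A x) \<partial>lborel) = (\<integral>\<^sup>+v\<in>{0<..<measure lborel A}. h v \<partial>lborel)"
proof -
  have m1: "mass_below A \<in> borel_measurable (restrict_space lborel A)"
    by (intro measurable_restrict_space1) simp
  have m2: "(\<lambda>x. x) \<in> borel_measurable (restrict_space lborel {0<..<measure lborel A})"
    by (intro measurable_restrict_space1) simp
  have "(\<integral>\<^sup>+x\<in>A. h (mass_below A x) \<partial>lborel) = (\<integral>\<^sup>+x. h (mass_below A x) \<partial>restrict_space lborel A)"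
    by (subst nn_integral_restrict_space) auto
  also have "\<dots> = (\<integral>\<^sup>+v. h v \<partial>distr (restrict_space lborel A) borel (mass_below A))"
    using m1 by (subst nn_integral_distr) auto
  also have "\<dots> = (\<integral>\<^sup>+v. h v \<partial>restrict_space lborel {0<..<measure lborel A})"
    unfolding distr_mass_below using m2 by (subst nn_integral_distr) auto
  also have "\<dots> = (\<integral>\<^sup>+v\<in>{0<..<measure lborel A}. h v \<partial>lborel)"
    by (subst nn_integral_restrict_space) auto
  finally show ?thesis .
qed

end

text \<open>The following region of \<open>A \<times> D\<close> is the continuous form of a family of \<open>t\<close> nested hooks in
  a grid: along each hook the sum of the coordinates is strictly increasing.\<close>

definition hook_region :: "real \<Rightarrow> real set \<Rightarrow> real set \<Rightarrow> (real \<times> real) set" where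
  "hook_region t A D = {(x, y). x \<in> A \<and> y \<in> D \<and>
     (mass_below D y < t \<and> mass_below A x + mass_below D y < measure lborel A \<or>
      measure lborel A - t < mass_below A x \<and> measure lborel A < mass_below A x + mass_below D y)}"

locale two_borel_sets = A: finite_borel_set A + D: finite_borel_set D for A D :: "real set"
begin

abbreviation "a \<equiv> measure lborel A"
abbreviation "d \<equiv> measure lborel D"

lemma hook_region_borel [measurable]: "hook_region t A D \<in> sets (borel \<Otimes>\<^sub>M borel)"
proof -
  have "hook_region t A D = {z \<in> space (borel \<Otimes>\<^sub>M borel). fst z \<in> A \<and> snd z \<in> D \<and>
     (mass_below D (snd z) < t \<and> mass_below A (fst z) + mass_below D (snd z) < a \<or>
      a - t < mass_below A (fst z) \<and> a < mass_below A (fst z) + mass_below D (snd z))}"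
    by (auto simp: hook_region_def space_pair_measure)
  also have "\<dots> \<in> sets (borel \<Otimes>\<^sub>M borel)" by measurable
  finally show ?thesis .
qed

lemma emeasure_section_below:
  assumes [measurable]: "T \<in> sets borel"
  shows "vol {x\<in>A. mass_below A x \<in> T} = vol (T \<inter> {0<..<a})"
proof -
  have "vol {x\<in>A. mass_below A x \<in> T} = (\<integral>\<^sup>+x\<in>A. indicator T (mass_below A x) \<partial>lborel)"
  proof -
    have "vol {x\<in>A. mass_below A x \<in> T} = (LINT+ x. indicator {x\<in>A. mass_below A x \<in> T} x)"
      by (subst nn_integral_indicator) auto
    also have "\<dots> = (\<integral>\<^sup>+x\<in>A. indicator T (mass_below A x) \<partial>lborel)"
      by (intro nn_integral_cong) (auto simp: indicator_def)
    finally show ?thesis .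
  qed
  also have "\<dots> = (\<integral>\<^sup>+v\<in>{0<..<a}. indicator T v \<partial>lborel)"
    by (rule A.nn_integral_mass_below) simp
  also have "\<dots> = (LINT+ v. indicator (T \<inter> {0<..<a}) v)"
    by (intro nn_integral_cong) (simp add: indicator_def)
  also have "\<dots> = vol (T \<inter> {0<..<a})"
    by (subst nn_integral_indicator) auto
  finally show ?thesis .
qed

text \<open>On the fibre over \<open>z\<close> the hooks are indexed by \<open>\<tau> \<in> (0,t)\<close>; each hook meets the fibre
  in at most one of its two arms, according to whether \<open>\<alpha> \<tau> + \<delta> \<tau> > z\<close>.\<close>

lemma hook_region_fibre:
  assumes t: "0 \<le> t" "t \<le> a" "t \<le> d"
  shows "vol {x. (x, z - x) \<in> hook_region t A D} \<le> ennreal t"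
proof -
  \<comment> \<open>The corner of the hook with label \<tau>. On its first arm the point of
    \<open>D\<close> has mass \<tau> and the point of \<open>A\<close> has mass below
    \<open>a - \<tau>\<close>; on the second arm the point of \<open>A\<close> has mass
    \<open>a - \<tau>\<close> and the point of \<open>D\<close> has mass above \<tau>. With these
    extreme choices the sum of coordinates is below \<open>\<alpha> \<tau> + \<delta> \<tau>\<close>
    on the first arm and at least that on the second.\<close>
  define \<delta> where "\<delta> \<tau> = Sup {y. mass_below D y \<le> \<tau>}" for \<tau>
  define \<alpha> where "\<alpha> \<tau> = Inf {x. a - \<tau> \<le> mass_below A x}" for \<tau>
  define T1 where "T1 = {\<tau>\<in>{0<..<t}. z < \<alpha> \<tau> + \<delta> \<tau>}"
  define T2 where "T2 = {\<tau>\<in>{0<..<t}. \<alpha> \<tau> + \<delta> \<tau> \<le> z}"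
  have D_ne: "{y. mass_below D y \<le> \<tau>} \<noteq> {}" "bdd_above {y. mass_below D y \<le> \<tau>}" if "\<tau> \<in> {0<..<t}" for \<tau>
  proof -
    show "{y. mass_below D y \<le> \<tau>} \<noteq> {}"
    proof -
      have "0 < \<tau>" "\<tau> < d" using that t by auto
      then obtain y where "mass_below D y = \<tau>" by (rule D.mass_below_attains)
      then show ?thesis by auto
    qed
    have "0 < (\<tau> + t)/2" "(\<tau> + t)/2 < d" using that t by auto
    then obtain w where w: "mass_below D w = (\<tau> + t)/2"
      by (rule D.mass_below_attains)
    show "bdd_above {y. mass_below D y \<le> \<tau>}"
    proof (rule bdd_aboveI[of _ w])
      fix y assume "y \<in> {y. mass_below D y \<le> \<tau>}"
      then show "y \<le> w" using D.mass_below_mono[of w y] w that by (cases "y \<le> w") auto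
    qed
  qed
  have A_ne: "{x. a - \<tau> \<le> mass_below A x} \<noteq> {}" "bdd_below {x. a - \<tau> \<le> mass_below A x}" if "\<tau> \<in> {0<..<t}" for \<tau>
  proof -
    show "{x. a - \<tau> \<le> mass_below A x} \<noteq> {}"
    proof -
      have "0 < a - \<tau>" "a - \<tau> < a" using that t by auto
      then obtain x where "mass_below A x = a - \<tau>" by (rule A.mass_below_attains)
      then have "x \<in> {x. a - \<tau> \<le> mass_below A x}" by simp
      then show ?thesis by blast
    qed
    have "0 < a - (\<tau> + t)/2" "a - (\<tau> + t)/2 < a" using that t by auto
    then obtain w where w: "mass_below A w = a - (\<tau> + t)/2"
      by (rule A.mass_below_attains)
    show "bdd_below {x. a - \<tau> \<le> mass_below A x}"
    proof (rule bdd_belowI[of _ w])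
      fix y assume "y \<in> {x. a - \<tau> \<le> mass_below A x}"
      then show "w \<le> y" using A.mass_below_mono[of y w] w that by (cases "w \<le> y") (auto simp: field_simps)
    qed
  qed
  have mono: "\<delta> \<tau> \<le> \<delta> \<tau>'" "\<alpha> \<tau>' \<le> \<alpha> \<tau>" if "\<tau> \<in> {0<..<t}" "\<tau>' \<in> {0<..<t}" "\<tau> \<le> \<tau>'" for \<tau> \<tau>'
  proof -
    show "\<delta> \<tau> \<le> \<delta> \<tau>'" unfolding \<delta>_def
      using that by (intro cSup_subset_mono D_ne) auto
    show "\<alpha> \<tau>' \<le> \<alpha> \<tau>" unfolding \<alpha>_def
      using that by (intro cInf_superset_mono A_ne) auto
  qed
  have dm: "\<delta> \<in> borel_measurable (restrict_space borel {0<..<t})"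
    by (intro borel_measurable_mono_on_fnc monotone_onI mono(1))
  have am: "\<alpha> \<in> borel_measurable (restrict_space borel {0<..<t})"
  proof -
    have "(\<lambda>\<tau>. - \<alpha> \<tau>) \<in> borel_measurable (restrict_space borel {0<..<t})"
      by (intro borel_measurable_mono_on_fnc monotone_onI le_imp_neg_le mono(2))
    then show ?thesis by simp
  qed
  have s: "{w \<in> space (restrict_space borel {0<..<t}). z < \<alpha> w + \<delta> w} \<in> sets (restrict_space borel {0<..<t})"
    "{w \<in> space (restrict_space borel {0<..<t}). \<alpha> w + \<delta> w \<le> z} \<in> sets (restrict_space borel {0<..<t})"
    by (intro borel_measurable_less borel_measurable_le borel_measurable_add borel_measurable_const dm am)+
  have T_meas [measurable]: "T1 \<in> sets borel" "T2 \<in> sets borel"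
  proof -
    have "T1 = {w \<in> space (restrict_space borel {0<..<t}). z < \<alpha> w + \<delta> w}"
      "T2 = {w \<in> space (restrict_space borel {0<..<t}). \<alpha> w + \<delta> w \<le> z}"
      by (auto simp: T1_def T2_def space_restrict_space)
    then have "T1 \<in> sets (restrict_space borel {0<..<t})" "T2 \<in> sets (restrict_space borel {0<..<t})"
      using s by (simp_all only:)
    then show "T1 \<in> sets borel" "T2 \<in> sets borel"
      by (simp_all add: sets_restrict_space_iff)
  qed
  have m1: "vol {y\<in>D. mass_below D y \<in> T1} \<le> vol T1"
  proof -
    interpret d: two_borel_sets D A ..
    show ?thesis by (subst d.emeasure_section_below) (auto intro!: emeasure_mono)
  qed
  have m2: "vol {x\<in>A. mass_below A x \<in> (\<lambda>\<tau>. a - \<tau>) -` T2} \<le> vol T2"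
  proof -
    have [measurable]: "(\<lambda>\<tau>. a - \<tau>) -` T2 \<in> sets borel"
      using measurable_sets[of "(\<lambda>\<tau>. a - \<tau>)" borel borel T2] by simp
    have "vol {x\<in>A. mass_below A x \<in> (\<lambda>\<tau>. a - \<tau>) -` T2} \<le> vol ((\<lambda>\<tau>. a - \<tau>) -` T2)"
      by (subst emeasure_section_below) (auto intro!: emeasure_mono)
    also have "\<dots> = (LINT+ \<tau>. indicator ((\<lambda>\<tau>. a - \<tau>) -` T2) \<tau>)"
      by (subst nn_integral_indicator) auto
    also have "\<dots> = (LINT+ \<tau>. indicator T2 (a + (-1) * \<tau>))"
      by (intro nn_integral_cong) (simp add: indicator_def)
    also have "\<dots> = vol T2"
      using nn_integral_real_affine[of "indicator T2" "-1" a] by simp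
    finally show ?thesis .
  qed
  define D1 where "D1 = {y\<in>D. mass_below D y \<in> T1}"
  define A2 where "A2 = {x\<in>A. mass_below A x \<in> (\<lambda>\<tau>. a - \<tau>) -` T2}"
  \<comment> \<open>The label of a point is \<open>mass_below D y\<close> on the first arm and
    \<open>a - mass_below A x\<close> on the second. \<open>N\<close> contains the points where it
    would be 0, outside the open range of labels.\<close>
  define N where "N = {x\<in>A. mass_below A x \<in> {a}} \<union> (\<lambda>y. z - y) -` {y\<in>D. mass_below D y \<in> {0}}"
  have [measurable]: "D1 \<in> sets borel" unfolding D1_def by measurable
  have [measurable]: "A2 \<in> sets borel" unfolding A2_def by measurable
  have refl: "(\<lambda>y. z - y) -` X \<in> sets borel \<and> vol ((\<lambda>y. z - y) -` X) = vol X"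
    if [measurable]: "X \<in> sets borel" for X
  proof
    show [measurable]: "(\<lambda>y. z - y) -` X \<in> sets borel"
      using measurable_sets[of "(\<lambda>y. z - y)" borel borel X] by simp
    have "vol ((\<lambda>y. z - y) -` X) = (LINT+ y. indicator ((\<lambda>y. z - y) -` X) y)"
      by (subst nn_integral_indicator) auto
    also have "\<dots> = (LINT+ y. indicator X (z + (-1) * y))"
      by (intro nn_integral_cong) (simp add: indicator_def)
    also have "\<dots> = vol X"
      using nn_integral_real_affine[of "indicator X" "-1" z] by simp
    finally show "vol ((\<lambda>y. z - y) -` X) = vol X" .
  qed
  have N: "N \<in> null_sets lborel"
  proof -
    interpret d: two_borel_sets D A ..
    have "{x\<in>A. mass_below A x \<in> {a}} \<in> null_sets lborel"
      by (intro null_setsI) (subst emeasure_section_below, auto)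
    moreover have "(\<lambda>y. z - y) -` {y\<in>D. mass_below D y \<in> {0}} \<in> null_sets lborel"
    proof -
      have [measurable]: "{y\<in>D. mass_below D y \<in> {0}} \<in> sets borel" by measurable
      have "vol {y\<in>D. mass_below D y \<in> {0}} = 0"
        by (subst d.emeasure_section_below) auto
      then show ?thesis using refl[of "{y\<in>D. mass_below D y \<in> {0}}"] by (intro null_setsI) auto
    qed
    ultimately show ?thesis unfolding N_def by (rule null_sets.Un)
  qed
  have sub: "{x. (x, z - x) \<in> hook_region t A D} \<subseteq> (\<lambda>y. z - y) -` D1 \<union> A2 \<union> N"
  proof (intro subsetI)
    fix x assume "x \<in> {x. (x, z - x) \<in> hook_region t A D}"
    then have xA: "x \<in> A" and yD: "z - x \<in> D" and alt: 
      "mass_below D (z - x) < t \<and> mass_below A x + mass_below D (z - x) < a \<or>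
       a - t < mass_below A x \<and> a < mass_below A x + mass_below D (z - x)"
      by (auto simp: hook_region_def)
    show "x \<in> (\<lambda>y. z - y) -` D1 \<union> A2 \<union> N"
    proof (rule ccontr)
      assume not: "x \<notin> (\<lambda>y. z - y) -` D1 \<union> A2 \<union> N"
      then have ne: "mass_below A x \<noteq> a" "mass_below D (z - x) \<noteq> 0" using xA yD by (auto simp: N_def)
      have pos: "mass_below A x < a" "0 < mass_below D (z - x)"
        using ne A.mass_below_le[of x] D.mass_below_nonneg[of "z - x"] by auto
      from alt show False
      proof
        assume 1: "mass_below D (z - x) < t \<and> mass_below A x + mass_below D (z - x) < a"
        define \<tau> where "\<tau> = mass_below D (z - x)"
        have \<tau>: "\<tau> \<in> {0<..<t}" using 1 pos by (auto simp: \<tau>_def)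
        have "z - x \<le> \<delta> \<tau>" unfolding \<delta>_def using D_ne[OF \<tau>] by (intro cSup_upper) (auto simp: \<tau>_def)
        moreover have "x < \<alpha> \<tau>"
        proof -
          \<comment> \<open>A point whose mass lies strictly between that of \<open>x\<close> and
            \<open>a - \<tau>\<close> separates \<open>x\<close> from the infimum; without it only a
            weak inequality would follow.\<close>
          obtain w where w: "mass_below A w = (mass_below A x + (a - \<tau>)) / 2"
            using A.mass_below_attains[of "(mass_below A x + (a - \<tau>)) / 2"] 1 pos A.mass_below_nonneg[of x] \<tau>
            by (auto simp: \<tau>_def)
          have "x < w" using A.mass_below_mono[of w x] w 1 by (cases "x < w") (auto simp: \<tau>_def)
          moreover have "w \<le> \<alpha> \<tau>" unfolding \<alpha>_def
          proof (rule cInf_greatest[OF A_ne(1)[OF \<tau>]])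
            fix v assume "v \<in> {x. a - \<tau> \<le> mass_below A x}"
            then show "w \<le> v" using A.mass_below_mono[of v w] w 1 by (cases "w \<le> v") (auto simp: \<tau>_def)
          qed
          ultimately show ?thesis by simp
        qed
        ultimately have "\<tau> \<in> T1" using \<tau> by (auto simp: T1_def)
        then show False using not yD by (auto simp: D1_def \<tau>_def)
      next
        assume 2: "a - t < mass_below A x \<and> a < mass_below A x + mass_below D (z - x)"
        define \<tau> where "\<tau> = a - mass_below A x"
        have \<tau>: "\<tau> \<in> {0<..<t}" using 2 pos by (auto simp: \<tau>_def)
        have "\<alpha> \<tau> \<le> x" unfolding \<alpha>_def using A_ne[OF \<tau>] by (intro cInf_lower) (auto simp: \<tau>_def)
        moreover have "\<delta> \<tau> \<le> z - x" unfolding \<delta>_def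
        proof (rule cSup_least[OF D_ne(1)[OF \<tau>]])
          fix v assume "v \<in> {y. mass_below D y \<le> \<tau>}"
          then show "v \<le> z - x" using D.mass_below_mono[of "z - x" v] 2 by (cases "v \<le> z - x") (auto simp: \<tau>_def)
        qed
        ultimately have "\<tau> \<in> T2" using \<tau> by (auto simp: T2_def)
        then show False using not xA by (auto simp: A2_def \<tau>_def)
      qed
    qed
  qed
  have "vol {x. (x, z - x) \<in> hook_region t A D} \<le> vol ((\<lambda>y. z - y) -` D1 \<union> A2 \<union> N)"
    using N refl[of D1] by (intro emeasure_mono sub) auto
  also have "\<dots> = vol ((\<lambda>y. z - y) -` D1 \<union> A2)"
    using refl[of D1] by (intro emeasure_Un_null_set[OF _ N]) auto
  also have "\<dots> \<le> vol ((\<lambda>y. z - y) -` D1) + vol A2"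
    using refl[of D1] by (intro emeasure_subadditive) auto
  also have "\<dots> \<le> vol T1 + vol T2"
    using refl[of D1] m1 m2 by (intro add_mono) (auto simp: D1_def A2_def)
  also have "\<dots> = vol (T1 \<union> T2)"
  proof (rule plus_emeasure)
    show "T1 \<inter> T2 = {}" by (auto simp: T1_def T2_def)
  qed simp_all
  also have "T1 \<union> T2 = {0<..<t}" by (auto simp: T1_def T2_def)
  also have "vol {0<..<t} = ennreal t" using t by simp
  finally show ?thesis .
qed

text \<open>In the flattened coordinates the two arms are trapezoids in the rectangle with sides
  \<open>a\<close> and \<open>d\<close>, of areas \<open>a * t - t\<^sup>2 / 2\<close> and
  \<open>d * t - t\<^sup>2 / 2\<close>.\<close>

lemma emeasure_hook_region:
  assumes t: "0 \<le> t" "t \<le> a" "t \<le> d"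
  shows "emeasure (lborel \<Otimes>\<^sub>M lborel) (hook_region t A D) = ennreal (t * (a + d - t))"
proof -
  interpret d: two_borel_sets D A ..
  define P1 where "P1 = {(x, y). x \<in> A \<and> y \<in> D \<and> mass_below D y < t \<and> mass_below A x + mass_below D y < a}"
  define P2 where "P2 = {(x, y). x \<in> A \<and> y \<in> D \<and> a - t < mass_below A x \<and> a < mass_below A x + mass_below D y}"
  have P1 [measurable]: "P1 \<in> sets (lborel \<Otimes>\<^sub>M lborel)"
  proof -
    have "P1 = {z \<in> space (lborel \<Otimes>\<^sub>M lborel). fst z \<in> A \<and> snd z \<in> D \<and>
      mass_below D (snd z) < t \<and> mass_below A (fst z) + mass_below D (snd z) < a}"
      by (auto simp: P1_def space_pair_measure)
    also have "\<dots> \<in> sets (lborel \<Otimes>\<^sub>M lborel)" by measurable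
    finally show ?thesis .
  qed
  have P2 [measurable]: "P2 \<in> sets (lborel \<Otimes>\<^sub>M lborel)"
  proof -
    have "P2 = {z \<in> space (lborel \<Otimes>\<^sub>M lborel). fst z \<in> A \<and> snd z \<in> D \<and>
      a - t < mass_below A (fst z) \<and> a < mass_below A (fst z) + mass_below D (snd z)}"
      by (auto simp: P2_def space_pair_measure)
    also have "\<dots> \<in> sets (lborel \<Otimes>\<^sub>M lborel)" by measurable
    finally show ?thesis .
  qed
  have "emeasure (lborel \<Otimes>\<^sub>M lborel) P1 = (LINT+ y. vol ((\<lambda>x. (x, y)) -` P1))"
    by (rule lborel_pair.emeasure_pair_measure_alt2[OF P1])
  also have "\<dots> = (\<integral>\<^sup>+y\<in>D. (ennreal (a - mass_below D y) * indicator {..<t} (mass_below D y)) \<partial>lborel)"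
  proof (rule nn_integral_cong)
    fix y
    show "vol ((\<lambda>x. (x, y)) -` P1) = ennreal (a - mass_below D y) * indicator {..<t} (mass_below D y) * indicator D y"
    proof (cases "y \<in> D \<and> mass_below D y < t")
      case True
      have "vol ((\<lambda>x. (x, y)) -` P1) = vol {x\<in>A. mass_below A x \<in> {..< a - mass_below D y}}"
        using True by (intro arg_cong[where f="vol"]) (auto simp: P1_def)
      also have "\<dots> = vol ({..< a - mass_below D y} \<inter> {0<..<a})"
        by (rule emeasure_section_below) simp
      also have "{..< a - mass_below D y} \<inter> {0<..<a} = {0<..< a - mass_below D y}"
        using D.mass_below_nonneg[of y] by auto
      finally show ?thesis using True t by simp
    next
      case False
      then have e: "(\<lambda>x. (x, y)) -` P1 = {}" by (auto simp: P1_def)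
      show ?thesis unfolding e using False by (auto simp: indicator_def)
    qed
  qed
  also have "\<dots> = (\<integral>\<^sup>+v\<in>{0<..<d}. (ennreal (a - v) * indicator {..<t} v) \<partial>lborel)"
    by (rule D.nn_integral_mass_below) simp
  also have "\<dots> = (LINT+ v. ennreal (a - v) * indicator {0..t} v)"
    using AE_lborel_singleton[of 0] AE_lborel_singleton[of t]
    by (intro nn_integral_cong_AE, eventually_elim) (use t in \<open>auto simp: indicator_def\<close>)
  also have "\<dots> = ennreal ((a * t - t\<^sup>2 / 2) - (a * 0 - 0\<^sup>2 / 2))"
    using t by (intro nn_integral_FTC_Icc[where F="\<lambda>v. a * v - v\<^sup>2/2"])
      (auto intro!: derivative_eq_intros)
  finally have 1: "emeasure (lborel \<Otimes>\<^sub>M lborel) P1 = ennreal (a * t - t\<^sup>2 / 2)" by simp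
  have "emeasure (lborel \<Otimes>\<^sub>M lborel) P2 = (LINT+ x. vol (Pair x -` P2))"
    by (rule lborel.emeasure_pair_measure_alt[OF P2])
  also have "\<dots> = (\<integral>\<^sup>+x\<in>A. (ennreal (d - (a - mass_below A x)) * indicator {a - t<..} (mass_below A x)) \<partial>lborel)"
  proof (rule nn_integral_cong)
    fix x
    show "vol (Pair x -` P2) = ennreal (d - (a - mass_below A x)) * indicator {a - t<..} (mass_below A x) * indicator A x"
    proof (cases "x \<in> A \<and> a - t < mass_below A x")
      case True
      have "vol (Pair x -` P2) = vol {y\<in>D. mass_below D y \<in> {a - mass_below A x <..}}"
        using True by (intro arg_cong[where f="vol"]) (auto simp: P2_def)
      also have "\<dots> = vol ({a - mass_below A x <..} \<inter> {0<..<d})"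
        by (rule d.emeasure_section_below) simp
      also have "{a - mass_below A x <..} \<inter> {0<..<d} = {a - mass_below A x <..<d}"
        using A.mass_below_le[of x] by auto
      finally show ?thesis using True t by simp
    next
      case False
      then have e: "Pair x -` P2 = {}" by (auto simp: P2_def)
      show ?thesis unfolding e using False by (auto simp: indicator_def)
    qed
  qed
  also have "\<dots> = (\<integral>\<^sup>+v\<in>{0<..<a}. (ennreal (d - (a - v)) * indicator {a - t<..} v) \<partial>lborel)"
    by (rule A.nn_integral_mass_below) simp
  also have "\<dots> = (LINT+ v. ennreal (d - (a - v)) * indicator {a - t..a} v)"
    using AE_lborel_singleton[of a] AE_lborel_singleton[of "a - t"]
    by (intro nn_integral_cong_AE, eventually_elim) (use t in \<open>auto simp: indicator_def\<close>)
  also have "\<dots> = ennreal (((d - a) * a + a\<^sup>2 / 2) - ((d - a) * (a - t) + (a - t)\<^sup>2 / 2))"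
    using t by (intro nn_integral_FTC_Icc[where F="\<lambda>v. (d - a) * v + v\<^sup>2/2"])
      (auto intro!: derivative_eq_intros)
  also have "((d - a) * a + a\<^sup>2 / 2) - ((d - a) * (a - t) + (a - t)\<^sup>2 / 2) = d * t - t\<^sup>2 / 2"
    by (simp add: field_simps power2_eq_square)
  finally have 2: "emeasure (lborel \<Otimes>\<^sub>M lborel) P2 = ennreal (d * t - t\<^sup>2 / 2)" .
  have nn: "0 \<le> a * t - t\<^sup>2 / 2" "0 \<le> d * t - t\<^sup>2 / 2"
    using t mult_right_mono[of t a t] mult_right_mono[of t d t] zero_le_square[of t]
    unfolding power2_eq_square by linarith+
  have "hook_region t A D = P1 \<union> P2" by (auto simp: hook_region_def P1_def P2_def)
  moreover have "P1 \<inter> P2 = {}" by (auto simp: P1_def P2_def)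
  ultimately have "emeasure (lborel \<Otimes>\<^sub>M lborel) (hook_region t A D) = ennreal (a * t - t\<^sup>2 / 2) + ennreal (d * t - t\<^sup>2 / 2)"
    using plus_emeasure[OF P1 P2] unfolding 1 2 by simp
  also have "\<dots> = ennreal (t * (a + d - t))"
    using nn by (simp add: ennreal_plus[symmetric] algebra_simps power2_eq_square del: ennreal_plus)
  finally show ?thesis .
qed

end

section \<open>Changes of variable and the Riesz integral of three sets\<close>

lemma nn_integral_lborel_affine:
  fixes f :: "'a::euclidean_space \<Rightarrow> ennreal"
  assumes [measurable]: "f \<in> borel_measurable borel" and c: "c \<noteq> 0"
  shows "(LINT+ x. f x) = ennreal (\<bar>c\<bar> ^ DIM('a)) * (LINT+ x. f (t + c *\<^sub>R x))"
proof -
  have "(LINT+ x. f x) = (\<integral>\<^sup>+x. f x \<partial>density (distr lborel borel (\<lambda>x. t + c *\<^sub>R x)) (\<lambda>_. \<bar>c\<bar> ^ DIM('a)))"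
    using lborel_affine[OF c, of t] by simp
  also have "\<dots> = ennreal (\<bar>c\<bar> ^ DIM('a)) * (LINT+ x. f (t + c *\<^sub>R x))"
    by (simp add: nn_integral_density nn_integral_distr nn_integral_cmult)
  finally show ?thesis .
qed

lemma nn_integral_lborel_translate:
  fixes f :: "'a::euclidean_space \<Rightarrow> ennreal"
  assumes "f \<in> borel_measurable borel"
  shows "(LINT+ x. f (t + x)) = (LINT+ x. f x)"
  using nn_integral_lborel_affine[OF assms, of 1 t] by simp

lemma nn_integral_lborel_reflect:
  fixes f :: "'a::euclidean_space \<Rightarrow> ennreal"
  assumes "f \<in> borel_measurable borel"
  shows "(LINT+ x. f (t - x)) = (LINT+ x. f x)"
  using nn_integral_lborel_affine[OF assms, of "-1" t] by simp

definition riesz :: "'a::euclidean_space set \<Rightarrow> 'a set \<Rightarrow> 'a set \<Rightarrow> ennreal" where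
  "riesz X Y Z = (LINT+ x. LINT+ y. indicator X x * indicator Y y * indicator Z (x + y))"

context
  fixes X Y Z :: "'a::euclidean_space set"
  assumes sets [measurable]: "X \<in> sets borel" "Y \<in> sets borel" "Z \<in> sets borel"
begin

lemma riesz_eq_XZ:
  "riesz X Y Z = (LINT+ x. LINT+ z. indicator X x * indicator Y (z - x) * indicator Z z)"
  unfolding riesz_def
proof (rule nn_integral_cong)
  fix x :: 'a
  show "(LINT+ y. indicator X x * indicator Y y * indicator Z (x + y)) =
      (LINT+ z. indicator X x * indicator Y (z - x) * indicator Z z)"
    using nn_integral_lborel_translate[of "\<lambda>z. indicator X x * indicator Y (z - x) * indicator Z z" x] by simp
qed

lemma riesz_swap: "riesz X Y Z = (LINT+ y. LINT+ x. indicator X x * indicator Y y * indicator Z (x + y))"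
  unfolding riesz_def by (rule lborel_pair.Fubini') measurable

lemma riesz_commute: "riesz X Y Z = riesz Y X Z"
  unfolding riesz_swap by (simp add: riesz_def mult_ac add.commute)

lemma riesz_le_XY: "riesz X Y Z \<le> vol X * vol Y"
proof -
  have "riesz X Y Z \<le> (LINT+ x. LINT+ y. indicator X x * indicator Y y)"
    unfolding riesz_def by (intro nn_integral_mono) (auto simp: indicator_def)
  also have "\<dots> = vol X * vol Y"
    by (simp add: nn_integral_cmult nn_integral_multc)
  finally show ?thesis .
qed

lemma riesz_le_XZ: "riesz X Y Z \<le> vol X * vol Z"
proof -
  have "riesz X Y Z \<le> (LINT+ x. LINT+ y. indicator X x * indicator Z y)"
    unfolding riesz_eq_XZ by (intro nn_integral_mono) (auto simp: indicator_def)
  also have "\<dots> = vol X * vol Z"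
    by (simp add: nn_integral_cmult nn_integral_multc)
  finally show ?thesis .
qed

end

lemma riesz_le_YZ:
  fixes X Y Z :: "'a::euclidean_space set"
  assumes "X \<in> sets borel" "Y \<in> sets borel" "Z \<in> sets borel"
  shows "riesz X Y Z \<le> vol Y * vol Z"
  using riesz_le_XZ[OF assms(2,1,3)] riesz_commute[OF assms] by simp

context two_borel_sets
begin

text \<open>Pairs off the hooks are all counted, whether or not their sum lies in \<open>K\<close>.
  On the hooks each fibre of constant sum has length at most \<open>t\<close>, so they contribute at
  most \<open>t\<close> times the measure of \<open>K\<close>.\<close>

lemma riesz_le_hook_bound:
  assumes K: "finite_borel_set K" and t: "0 \<le> t" "t \<le> a" "t \<le> d"
  shows "riesz A D K \<le> ennreal (a * d - t * (a + d - t)) + ennreal t * vol K"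
proof -
  interpret K: finite_borel_set K by fact
  note [measurable] = A.borel D.borel K.borel
  define H where "H = hook_region t A D"
  have H [measurable]: "H \<in> sets (borel \<Otimes>\<^sub>M borel)" unfolding H_def by measurable
  have eA: "vol A = ennreal a" "vol D = ennreal d"
    using A.fmeasurable_self D.fmeasurable_self by (simp_all add: emeasure_eq_measure2)
  have "riesz A D K \<le> (LINT+ x. LINT+ y. indicator (A \<times> D - H) (x, y) + indicator H (x, y) * indicator K (x + y))"
    unfolding riesz_def by (intro nn_integral_mono) (auto simp: indicator_def)
  also have "\<dots> = (LINT+ x. LINT+ y. indicator (A \<times> D - H) (x, y)) +
     (LINT+ x. LINT+ y. indicator H (x, y) * indicator K (x + y))"
    by (simp add: nn_integral_add)
  also have "(LINT+ x. LINT+ y. indicator (A \<times> D - H) (x, y)) = emeasure (lborel \<Otimes>\<^sub>M lborel) (A \<times> D - H)"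
    by (rule lborel.emeasure_pair_measure[symmetric]) measurable
  also have "\<dots> = emeasure (lborel \<Otimes>\<^sub>M lborel) (A \<times> D) - emeasure (lborel \<Otimes>\<^sub>M lborel) H"
  proof (rule emeasure_Diff)
    show "H \<subseteq> A \<times> D" by (auto simp: H_def hook_region_def)
    show "emeasure (lborel \<Otimes>\<^sub>M lborel) H \<noteq> \<infinity>" unfolding H_def emeasure_hook_region[OF t] by simp
  qed measurable
  also have "\<dots> = ennreal (a * d) - ennreal (t * (a + d - t))"
    unfolding H_def emeasure_hook_region[OF t] by (simp add: lborel.emeasure_pair_measure_Times eA ennreal_mult)
  also have "\<dots> = ennreal (a * d - t * (a + d - t))"
    using t by (intro ennreal_minus) simp
  also have "(LINT+ x. LINT+ y. indicator H (x, y) * indicator K (x + y)) \<le> ennreal t * vol K"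
  proof -
    have "(LINT+ x. LINT+ y. indicator H (x, y) * indicator K (x + y)) =
      (LINT+ x. LINT+ z. indicator H (x, z - x) * indicator K z)"
    proof (rule nn_integral_cong)
      fix x :: real
      show "(LINT+ y. indicator H (x, y) * indicator K (x + y)) = (LINT+ z. indicator H (x, z - x) * indicator K z)"
        using nn_integral_lborel_translate[of "\<lambda>z. indicator H (x, z - x) * indicator K z" x] by simp
    qed
    also have "\<dots> = (LINT+ z. LINT+ x. indicator H (x, z - x) * indicator K z)"
      by (rule lborel_pair.Fubini') measurable
    also have "\<dots> \<le> (LINT+ z. ennreal t * indicator K z)"
    proof (rule nn_integral_mono)
      fix z :: real
      have [measurable]: "{x. (x, z - x) \<in> H} \<in> sets borel"
        using measurable_sets[of "\<lambda>x. (x, z - x)" borel "borel \<Otimes>\<^sub>M borel" H] by (simp add: vimage_def)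
      have "(LINT+ x. indicator H (x, z - x) * indicator K z) = (LINT+ x. indicator {x. (x, z - x) \<in> H} x) * indicator K z"
        by (subst nn_integral_multc[symmetric]) (auto intro!: nn_integral_cong simp: indicator_def)
      also have "\<dots> \<le> ennreal t * indicator K z"
        using hook_region_fibre[OF t, of z] unfolding H_def[symmetric] by (intro mult_right_mono) auto
      finally show "(LINT+ x. indicator H (x, z - x) * indicator K z) \<le> ennreal t * indicator K z" .
    qed
    also have "\<dots> = ennreal t * vol K" by (simp add: nn_integral_cmult)
    finally show ?thesis .
  qed
  finally show ?thesis by (simp add: add_left_mono)
qed

end

section \<open>Centred intervals and the inequality on the line\<close>

definition centred_interval :: "real \<Rightarrow> real set" where
  "centred_interval l = {s. 2 * \<bar>s\<bar> < l}"

lemma centred_interval_eq: "centred_interval l = {-l/2<..<l/2}"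
  by (auto simp: centred_interval_def)

lemma centred_interval_borel [measurable]: "centred_interval l \<in> sets borel"
  by (simp add: centred_interval_eq)

lemma emeasure_centred_interval: "0 \<le> l \<Longrightarrow> vol (centred_interval l) = ennreal l"
  by (simp add: centred_interval_eq)

text \<open>For this \<open>k\<close> the part of the rectangle that the condition on x + y removes
  consists of two opposite corner triangles with legs \<open>t\<close>, of total area
  \<open>t\<^sup>2\<close>.\<close>

lemma riesz_centred_intervals_ge:
  assumes t: "0 \<le> t" "t \<le> a" "t \<le> d" and k: "k = a + d - 2 * t" "0 \<le> k"
  shows "ennreal (a * d) \<le> riesz (centred_interval a) (centred_interval d) (centred_interval k) + ennreal (t\<^sup>2)"
proof -
  let ?I = centred_interval
  have inner: "(LINT+ y. indicator (?I d) y * indicator (- ?I k) (x + y))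
      \<le> ennreal (t - a/2 + x) + ennreal (t - a/2 - x)" for x
  proof -
    have "(LINT+ y. indicator (?I d) y * indicator (- ?I k) (x + y)) \<le>
        (LINT+ y. indicator {k/2 - x..d/2} y + indicator {-d/2.. - k/2 - x} y)"
    proof (intro nn_integral_mono)
      fix y show "indicator (?I d) y * indicator (- ?I k) (x + y) \<le> (indicator {k/2 - x..d/2} y + indicator {-d/2.. - k/2 - x} y :: ennreal)"
      proof (cases "y \<in> ?I d \<and> x + y \<notin> ?I k")
        case True
        then have "y \<in> {k/2 - x..d/2} \<or> y \<in> {-d/2.. - k/2 - x}"
          by (auto simp: centred_interval_def abs_if split: if_splits)
        then show ?thesis using True by (auto simp: indicator_def)
      next
        case False then show ?thesis by (auto simp: indicator_def)
      qed
    qed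
    also have "\<dots> = vol {k/2 - x..d/2} + vol {-d/2.. - k/2 - x}"
      by (simp add: nn_integral_add)
    also have "\<dots> \<le> ennreal (t - a/2 + x) + ennreal (t - a/2 - x)"
    proof (intro add_mono)
      have "d/2 - (k/2 - x) = t - a/2 + x" "- k/2 - x - (-d/2) = t - a/2 - x"
        using k by (simp_all add: field_simps)
      then show "vol {k/2 - x..d/2} \<le> ennreal (t - a/2 + x)"
        "vol {-d/2.. - k/2 - x} \<le> ennreal (t - a/2 - x)"
        by (simp_all add: emeasure_lborel_Icc_eq)
    qed
    finally show ?thesis .
  qed
  have half: "(LINT+ x. indicator (?I a) x * ennreal (t - a/2 + x)) \<le> ennreal (t\<^sup>2/2)"
  proof -
    have "(LINT+ x. indicator (?I a) x * ennreal (t - a/2 + x)) \<le> (LINT+ x. ennreal (t - a/2 + x) * indicator {a/2 - t..a/2} x)"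
      by (intro nn_integral_mono) (auto simp: indicator_def centred_interval_eq ennreal_neg)
    also have "\<dots> = ennreal (((t - a/2) * (a/2) + (a/2)\<^sup>2/2) - ((t - a/2) * (a/2 - t) + (a/2 - t)\<^sup>2/2))"
      using t by (intro nn_integral_FTC_Icc[where F="\<lambda>x. (t - a/2) * x + x\<^sup>2/2"]) (auto intro!: derivative_eq_intros)
    also have "((t - a/2) * (a/2) + (a/2)\<^sup>2/2) - ((t - a/2) * (a/2 - t) + (a/2 - t)\<^sup>2/2) = t\<^sup>2/2"
      by (simp add: field_simps power2_eq_square)
    finally show ?thesis .
  qed
  have half': "(LINT+ x. indicator (?I a) x * ennreal (t - a/2 - x)) = (LINT+ x. indicator (?I a) x * ennreal (t - a/2 + x))"
  proof -
    have "(LINT+ x. indicator (?I a) x * ennreal (t - a/2 + x)) = (LINT+ x. indicator (?I a) (0 - x) * ennreal (t - a/2 + (0 - x)))"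
      by (rule nn_integral_lborel_reflect[symmetric]) measurable
    then show ?thesis by (simp add: centred_interval_def indicator_def)
  qed
  have ad: "0 \<le> a" "0 \<le> d" using t by auto
  have "ennreal (a * d) = (LINT+ x. indicator (?I a) x) * (LINT+ y. indicator (?I d) y)"
    using ad by (simp add: emeasure_centred_interval ennreal_mult)
  also have "\<dots> = (LINT+ x. LINT+ y. indicator (?I a) x * indicator (?I d) y)"
    by (simp add: nn_integral_cmult nn_integral_multc)
  also have "\<dots> = (LINT+ x. LINT+ y. indicator (?I a) x * indicator (?I d) y * indicator (?I k) (x + y) + indicator (?I a) x * (indicator (?I d) y * indicator (- ?I k) (x + y)))"
    by (intro nn_integral_cong) (auto simp: indicator_def)
  also have "\<dots> = riesz (?I a) (?I d) (?I k) + (LINT+ x. indicator (?I a) x * (LINT+ y. indicator (?I d) y * indicator (- ?I k) (x + y)))"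
    by (simp add: nn_integral_add riesz_def nn_integral_cmult)
  also have "(LINT+ x. indicator (?I a) x * (LINT+ y. indicator (?I d) y * indicator (- ?I k) (x + y))) \<le>
     (LINT+ x. indicator (?I a) x * (ennreal (t - a/2 + x) + ennreal (t - a/2 - x)))"
    by (intro nn_integral_mono mult_left_mono inner) auto
  also have "\<dots> = (LINT+ x. indicator (?I a) x * ennreal (t - a/2 + x)) + (LINT+ x. indicator (?I a) x * ennreal (t - a/2 - x))"
    by (simp add: distrib_left nn_integral_add)
  also have "\<dots> \<le> ennreal (t\<^sup>2/2) + ennreal (t\<^sup>2/2)"
    unfolding half' by (intro add_mono half)
  also have "\<dots> = ennreal (t\<^sup>2)" by (simp add: ennreal_plus[symmetric] del: ennreal_plus)
  finally show ?thesis by (simp add: add_left_mono)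
qed

text \<open>If one measure is at least the sum of the other two, the bound by a product of two
  measures is attained by centred intervals. Otherwise the hook bound, for the right
  \<open>t\<close>, is the value that centred intervals have.\<close>

theorem riesz_real:
  fixes A D K :: "real set"
  assumes "finite_borel_set A" "finite_borel_set D" "finite_borel_set K"
  shows "riesz A D K \<le> riesz (centred_interval (measure lborel A)) (centred_interval (measure lborel D)) (centred_interval (measure lborel K))"
proof -
  interpret A: finite_borel_set A by fact
  interpret D: finite_borel_set D by fact
  interpret K: finite_borel_set K by fact
  interpret AD: two_borel_sets A D ..
  note [measurable] = A.borel D.borel K.borel
  let ?I = centred_interval
  define a d k where "a = measure lborel A" and "d = measure lborel D" and "k = measure lborel K"
  have e: "vol A = ennreal a" "vol D = ennreal d" "vol K = ennreal k"
    using A.fmeasurable_self D.fmeasurable_self K.fmeasurable_self by (simp_all add: emeasure_eq_measure2 a_def d_def k_def)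
  have nn: "0 \<le> a" "0 \<le> d" "0 \<le> k" by (simp_all add: a_def d_def k_def)
  consider "a + d \<le> k" | "a + k \<le> d" | "d + k \<le> a" | "k < a + d" "d < a + k" "a < d + k" by linarith
  then have "riesz A D K \<le> riesz (?I a) (?I d) (?I k)"
  proof cases
    case 1
    have "riesz (?I a) (?I d) (?I k) = (LINT+ x. LINT+ y. indicator (?I a) x * indicator (?I d) y)"
      unfolding riesz_def using 1 by (intro nn_integral_cong) (auto simp: indicator_def centred_interval_eq)
    also have "\<dots> = ennreal a * ennreal d"
      using nn by (simp add: nn_integral_cmult nn_integral_multc emeasure_centred_interval)
    finally show ?thesis using riesz_le_XY[of A D K] by (simp add: e)
  next
    case 2
    have "riesz (?I a) (?I d) (?I k) = (LINT+ x. LINT+ y. indicator (?I a) x * indicator (?I k) y)"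
      unfolding riesz_eq_XZ[OF centred_interval_borel centred_interval_borel centred_interval_borel]
      using 2 by (intro nn_integral_cong) (auto simp: indicator_def centred_interval_eq)
    also have "\<dots> = ennreal a * ennreal k"
      using nn by (simp add: nn_integral_cmult nn_integral_multc emeasure_centred_interval)
    finally show ?thesis using riesz_le_XZ[of A D K] by (simp add: e)
  next
    case 3
    have "riesz (?I a) (?I d) (?I k) = riesz (?I d) (?I a) (?I k)" by (rule riesz_commute) auto
    also have "\<dots> = (LINT+ x. LINT+ y. indicator (?I d) x * indicator (?I k) y)"
      unfolding riesz_eq_XZ[OF centred_interval_borel centred_interval_borel centred_interval_borel]
      using 3 by (intro nn_integral_cong) (auto simp: indicator_def centred_interval_eq)
    also have "\<dots> = ennreal d * ennreal k"
      using nn by (simp add: nn_integral_cmult nn_integral_multc emeasure_centred_interval)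
    finally show ?thesis using riesz_le_YZ[of A D K] by (simp add: e)
  next
    case 4
    \<comment> \<open>The minimiser of the hook bound
      \<open>a * d - t * (a + d - t) + t * k\<close>; its minimum is
      \<open>a * d - t\<^sup>2\<close>.\<close>
    define t where "t = (a + d - k) / 2"
    have t: "0 \<le> t" "t \<le> a" "t \<le> d" using 4 by (auto simp: t_def)
    have eq: "(a * d - t * (a + d - t)) + t * k = a * d - t\<^sup>2"
      by (simp add: t_def field_simps power2_eq_square)
    have t2: "t\<^sup>2 \<le> a * d" unfolding power2_eq_square using t by (intro mult_mono) auto
    have nn': "0 \<le> a * d - t * (a + d - t)"
    proof -
      have "0 \<le> (a - t) * (d - t)" using t by simp
      then show ?thesis by (simp add: algebra_simps)
    qed
    have "riesz A D K \<le> ennreal (a * d - t * (a + d - t)) + ennreal t * ennreal k"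
      using AD.riesz_le_hook_bound[OF assms(3), of t] t by (simp add: e a_def d_def)
    also have "\<dots> = ennreal (a * d - t\<^sup>2)"
      unfolding eq[symmetric] using nn nn' t by (simp add: ennreal_mult)
    also have "\<dots> = ennreal (a * d) - ennreal (t\<^sup>2)" by (simp add: ennreal_minus)
    also have "\<dots> \<le> riesz (?I a) (?I d) (?I k)"
    proof -
      have "k = a + d - 2 * t" by (simp add: t_def field_simps)
      from riesz_centred_intervals_ge[OF t this nn(3)] show ?thesis
        by (simp add: ennreal_minus_le_iff add.commute)
    qed
    finally show ?thesis .
  qed
  then show ?thesis by (simp add: a_def d_def k_def)
qed

section \<open>Steiner symmetrization and Riesz's inequality\<close>

definition line_measure :: "'a::euclidean_space \<Rightarrow> 'a set \<Rightarrow> 'a \<Rightarrow> ennreal" where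
  "line_measure v A x = (LINT+ t. indicator A (x + t *\<^sub>R v))"

text \<open>For a unit vector \<open>v\<close>, the strict inequality makes each section an open
  segment centred on the hyperplane orthogonal to \<open>v\<close>; a section of infinite measure
  becomes the whole line.\<close>

definition steiner :: "'a::euclidean_space \<Rightarrow> 'a set \<Rightarrow> 'a set" where
  "steiner v A = {x. ennreal (2 * \<bar>x \<bullet> v\<bar>) < line_measure v A x}"

lemma line_measure_measurable [measurable]:
  assumes [measurable]: "A \<in> sets borel" shows "line_measure v A \<in> borel_measurable borel"
  unfolding line_measure_def[abs_def] by measurable

lemma steiner_borel [measurable]:
  assumes [measurable]: "A \<in> sets borel" shows "steiner v A \<in> sets borel"
  unfolding steiner_def by measurable

lemma line_measure_mono: "A \<subseteq> B \<Longrightarrow> line_measure v A x \<le> line_measure v B x"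
  unfolding line_measure_def by (intro nn_integral_mono) (auto simp: indicator_def)

lemma steiner_mono: "A \<subseteq> B \<Longrightarrow> steiner v A \<subseteq> steiner v B"
  using line_measure_mono[of A B v] by (auto simp: steiner_def intro: less_le_trans)

lemma line_measure_shift:
  assumes [measurable]: "A \<in> sets borel" shows "line_measure v A (x + s *\<^sub>R v) = line_measure v A x"
  using nn_integral_lborel_translate[of "\<lambda>t. indicator A (x + t *\<^sub>R v)" s]
  by (simp add: line_measure_def algebra_simps)

context
  fixes v :: "'a::euclidean_space" assumes v: "norm v = 1"
begin

lemma inner_v: "v \<bullet> v = 1" using v by (simp add: dot_square_norm)

text \<open>Fubini along the direction \<open>v\<close>, without choosing an orthonormal basis: the slab
  \<open>0 \<le> \<langle>x, v\<rangle> < 1\<close> meets every line parallel to \<open>v\<close> in a segment of length one.\<close>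

lemma nn_integral_lines:
  fixes F :: "'a \<Rightarrow> ennreal"
  assumes [measurable]: "F \<in> borel_measurable borel"
  shows "(LINT+ x. F x) = (LINT+ x. indicator {0..<1} (x \<bullet> v) * (LINT+ t. F (x + t *\<^sub>R v)))"
proof -
  have "(LINT+ x. indicator {0..<1} (x \<bullet> v) * (LINT+ t. F (x + t *\<^sub>R v)))
     = (LINT+ x. (LINT+ t. indicator {0..<1} (x \<bullet> v) * F (x + t *\<^sub>R v)))"
    by (simp add: nn_integral_cmult)
  also have "\<dots> = (LINT+ t. (LINT+ x. indicator {0..<1} (x \<bullet> v) * F (x + t *\<^sub>R v)))"
    by (rule lborel_pair.Fubini') measurable
  also have "\<dots> = (LINT+ t. (LINT+ x. indicator {0..<1} (x \<bullet> v - t) * F x))"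
  proof (rule nn_integral_cong)
    fix t :: real
    show "(LINT+ x. indicator {0..<1} (x \<bullet> v) * F (x + t *\<^sub>R v)) = (LINT+ x. indicator {0..<1} (x \<bullet> v - t) * F x)"
      using nn_integral_lborel_translate[of "\<lambda>x. indicator {0..<1} (x \<bullet> v - t) * F x" "t *\<^sub>R v"]
      by (simp add: inner_add_left inner_v add.commute)
  qed
  also have "\<dots> = (LINT+ x. (LINT+ t. indicator {0..<1} (x \<bullet> v - t) * F x))"
    by (rule lborel_pair.Fubini') measurable
  also have "\<dots> = (LINT+ x. F x)"
  proof (rule nn_integral_cong)
    fix x :: 'a
    have "(LINT+ t. indicator {0..<1::real} (x \<bullet> v - t) * F x) = (LINT+ t. indicator {0..<1::real} (x \<bullet> v - t)) * F x"
      by (simp add: nn_integral_multc)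
    also have "(LINT+ t. indicator {0..<1::real} (x \<bullet> v - t)) = (LINT+ t. indicator {0..<1::real} t)"
      by (rule nn_integral_lborel_reflect) measurable
    also have "\<dots> = 1" by simp
    finally show "(LINT+ t. indicator {0..<1::real} (x \<bullet> v - t) * F x) = F x" by simp
  qed
  finally show ?thesis ..
qed

lemma emeasure_lines:
  assumes [measurable]: "A \<in> sets borel"
  shows "vol A = (LINT+ x. indicator {0..<1} (x \<bullet> v) * line_measure v A x)"
  using nn_integral_lines[of "indicator A"] by (simp add: line_measure_def)

lemma indicator_steiner:
  assumes [measurable]: "A \<in> sets borel" and l: "line_measure v A x = ennreal l"
  shows "indicator (steiner v A) (x + t *\<^sub>R v) = indicator (centred_interval l) (x \<bullet> v + t)"
proof -
  have "x + t *\<^sub>R v \<in> steiner v A \<longleftrightarrow> ennreal (2 * \<bar>x \<bullet> v + t\<bar>) < ennreal l"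
    by (simp add: steiner_def line_measure_shift inner_add_left inner_v l)
  also have "\<dots> \<longleftrightarrow> x \<bullet> v + t \<in> centred_interval l"
    by (simp add: centred_interval_def ennreal_less_iff)
  finally show ?thesis by (simp add: indicator_def)
qed

lemma line_measure_ball_finite: "line_measure v (ball 0 R) x < \<infinity>"
proof -
  have "line_measure v (ball 0 R) x \<le> (LINT+ t. indicator {-(R + norm x)..R + norm x} t)"
    unfolding line_measure_def
  proof (intro nn_integral_mono)
    fix t :: real
    have "\<bar>t\<bar> \<le> R + norm x" if "norm (x + t *\<^sub>R v) < R"
    proof -
      have "norm (t *\<^sub>R v) \<le> norm (x + t *\<^sub>R v) + norm x"
        using norm_triangle_ineq4[of "x + t *\<^sub>R v" x] by simp
      then show ?thesis using that v by simp
    qed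
    then show "indicator (ball 0 R) (x + t *\<^sub>R v) \<le> (indicator {-(R + norm x)..R + norm x} t :: ennreal)"
      by (auto simp: indicator_def abs_le_iff)
  qed
  also have "\<dots> < \<infinity>" by (simp add: emeasure_lborel_Icc_eq)
  finally show ?thesis .
qed

lemma line_measure_bounded_finite:
  assumes "A \<subseteq> ball 0 R" obtains l where "line_measure v A x = ennreal l" "0 \<le> l"
proof -
  have "line_measure v A x < \<infinity>"
    using line_measure_mono[OF assms] line_measure_ball_finite le_less_trans by blast
  then show ?thesis using that[of "enn2real (line_measure v A x)"] by simp
qed

lemma line_measure_steiner:
  assumes [measurable]: "A \<in> sets borel" and A: "A \<subseteq> ball 0 R"
  shows "line_measure v (steiner v A) x = line_measure v A x"
proof -
  obtain l where l: "line_measure v A x = ennreal l" "0 \<le> l" using line_measure_bounded_finite[OF A] .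
  have "line_measure v (steiner v A) x = (LINT+ t. indicator (centred_interval l) (x \<bullet> v + t))"
    unfolding line_measure_def using l by (simp add: indicator_steiner)
  also have "\<dots> = ennreal l"
    by (subst nn_integral_lborel_translate) (simp_all add: l emeasure_centred_interval)
  finally show ?thesis using l by simp
qed

lemma emeasure_steiner:
  assumes [measurable]: "A \<in> sets borel" and A: "A \<subseteq> ball 0 R"
  shows "vol (steiner v A) = vol A"
  by (simp add: emeasure_lines line_measure_steiner[OF _ A])

lemma steiner_ball: "steiner v (ball 0 R) = ball 0 R"
proof (intro set_eqI)
  fix x :: 'a
  \<comment> \<open>The squared half-length of the section of the ball by the line through
    \<open>x\<close>; for positive \<open>R\<close> the line misses the ball exactly if it is not
    positive.\<close>
  define s where "s = R\<^sup>2 - (norm x)\<^sup>2 + (x \<bullet> v)\<^sup>2"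
  have n: "(norm (x + t *\<^sub>R v))\<^sup>2 = (norm x)\<^sup>2 - (x \<bullet> v)\<^sup>2 + (x \<bullet> v + t)\<^sup>2" for t
    unfolding power2_norm_eq_inner by (simp add: inner_add_left inner_add_right inner_v inner_commute power2_eq_square algebra_simps)
  have mem: "x + t *\<^sub>R v \<in> ball 0 R \<longleftrightarrow> 0 < R \<and> (x \<bullet> v + t)\<^sup>2 < s" for t
  proof -
    have "norm (x + t *\<^sub>R v) < R \<longleftrightarrow> 0 < R \<and> (norm (x + t *\<^sub>R v))\<^sup>2 < R\<^sup>2"
      by (auto intro: power2_less_imp_less power_strict_mono le_less_trans[OF norm_ge_zero])
    then show ?thesis by (simp add: n s_def algebra_simps)
  qed
  have x0: "x \<in> ball 0 R \<longleftrightarrow> 0 < R \<and> (x \<bullet> v)\<^sup>2 < s" using mem[of 0] by simp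
  show "x \<in> steiner v (ball 0 R) \<longleftrightarrow> x \<in> ball 0 R"
  proof (cases "0 < R \<and> 0 < s")
    case True
    have sq: "y\<^sup>2 < s \<longleftrightarrow> y \<in> centred_interval (2 * sqrt s)" for y
      using real_sqrt_less_iff[of "y\<^sup>2" s] by (simp add: centred_interval_def)
    have "line_measure v (ball 0 R) x = (LINT+ t. indicator (centred_interval (2 * sqrt s)) (x \<bullet> v + t))"
      unfolding line_measure_def using True by (intro nn_integral_cong) (simp only: indicator_def mem sq simp_thms)
    also have "\<dots> = ennreal (2 * sqrt s)"
      using True by (subst nn_integral_lborel_translate) (simp_all add: emeasure_centred_interval)
    finally have "x \<in> steiner v (ball 0 R) \<longleftrightarrow> x \<bullet> v \<in> centred_interval (2 * sqrt s)"
      by (simp add: steiner_def centred_interval_def ennreal_less_iff)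
    then show ?thesis using x0 True sq by blast
  next
    case False
    have "x + t *\<^sub>R v \<notin> ball 0 R" for t
      using False mem[of t] by (meson le_less_trans zero_le_power2)
    then have "line_measure v (ball 0 R) x = 0"
      unfolding line_measure_def by (simp add: indicator_def)
    then have "x \<notin> steiner v (ball 0 R)" by (simp add: steiner_def)
    moreover have "x \<notin> ball 0 R" using x0 False by (meson le_less_trans zero_le_power2)
    ultimately show ?thesis by simp
  qed
qed

lemma steiner_subset_ball: "A \<subseteq> ball 0 R \<Longrightarrow> steiner v A \<subseteq> ball 0 R"
  using steiner_mono[of A "ball 0 R" v] steiner_ball by simp

text \<open>On each line the symmetrized set and the ball are concentric segments, so they overlap
  in the shorter one. Both lengths dominate the old overlap plus the section of \<open>W\<close>:
  that of \<open>A\<close> because \<open>W\<close> lies in \<open>A\<close> outside the ball, that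
  of the ball because the translate of \<open>W\<close> lies in the ball outside
  \<open>A\<close>.\<close>

lemma steiner_overlap:
  assumes [measurable]: "A \<in> sets borel" "W \<in> sets borel" and A: "A \<subseteq> ball 0 R"
    and W: "W \<subseteq> A - ball 0 r" "(\<lambda>x. x + s *\<^sub>R v) ` W \<subseteq> ball 0 r - A"
  shows "vol (A \<inter> ball 0 r) + vol W \<le> vol (steiner v A \<inter> ball 0 r)"
proof -
  have [measurable]: "ball (0::'a) r \<in> sets borel" by simp
  have lm: "line_measure v (A \<inter> ball 0 r) x + line_measure v W x \<le> line_measure v (steiner v A \<inter> ball 0 r) x" for x
  proof -
    obtain l where l: "line_measure v A x = ennreal l" "0 \<le> l" using line_measure_bounded_finite[OF A] .
    obtain b where b: "line_measure v (ball 0 r) x = ennreal b" "0 \<le> b" using line_measure_bounded_finite[OF order_refl] .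
    have "indicator (steiner v A \<inter> ball 0 r) (x + t *\<^sub>R v) = (indicator (centred_interval (min l b)) (x \<bullet> v + t) :: ennreal)" for t
    proof -
      have "indicator (steiner v A \<inter> ball 0 r) (x + t *\<^sub>R v) = (indicator (steiner v A) (x + t *\<^sub>R v) * indicator (steiner v (ball 0 r)) (x + t *\<^sub>R v) :: ennreal)"
        unfolding steiner_ball by (rule indicator_inter_arith)
      then show ?thesis using l b by (simp add: indicator_steiner) (auto simp: centred_interval_def indicator_def)
    qed
    then have "line_measure v (steiner v A \<inter> ball 0 r) x = (LINT+ t. indicator (centred_interval (min l b)) (x \<bullet> v + t))"
      by (simp add: line_measure_def)
    also have "\<dots> = ennreal (min l b)"
      using l b by (subst nn_integral_lborel_translate) (simp_all add: emeasure_centred_interval)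
    also have "\<dots> = min (line_measure v A x) (line_measure v (ball 0 r) x)"
      using l b by (simp add: min_def ennreal_le_iff)
    finally have eq: "line_measure v (steiner v A \<inter> ball 0 r) x = min (line_measure v A x) (line_measure v (ball 0 r) x)" .
    have 1: "line_measure v (A \<inter> ball 0 r) x + line_measure v W x \<le> line_measure v A x"
    proof -
      have "line_measure v (A \<inter> ball 0 r) x + line_measure v W x = (LINT+ t. indicator (A \<inter> ball 0 r) (x + t *\<^sub>R v) + indicator W (x + t *\<^sub>R v))"
        unfolding line_measure_def by (simp add: nn_integral_add)
      also have "\<dots> \<le> line_measure v A x"
        unfolding line_measure_def using W by (intro nn_integral_mono) (auto simp: indicator_def)
      finally show ?thesis .
    qed
    have 2: "line_measure v (A \<inter> ball 0 r) x + line_measure v W x \<le> line_measure v (ball 0 r) x"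
    proof -
      have "line_measure v W x = (LINT+ t. indicator W (x + (- s + t) *\<^sub>R v))"
        unfolding line_measure_def using nn_integral_lborel_translate[of "\<lambda>t. indicator W (x + t *\<^sub>R v)" "-s"] by simp
      then have "line_measure v (A \<inter> ball 0 r) x + line_measure v W x = (LINT+ t. indicator (A \<inter> ball 0 r) (x + t *\<^sub>R v) + indicator W (x + (- s + t) *\<^sub>R v))"
        unfolding line_measure_def by (simp add: nn_integral_add)
      also have "\<dots> \<le> line_measure v (ball 0 r) x"
        unfolding line_measure_def
      proof (intro nn_integral_mono)
        fix t
        have "x + t *\<^sub>R v \<in> ball 0 r - A" if "x + (- s + t) *\<^sub>R v \<in> W"
        proof -
          have "x + t *\<^sub>R v = (x + (- s + t) *\<^sub>R v) + s *\<^sub>R v" by (simp add: algebra_simps)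
          then show ?thesis using W(2) that by blast
        qed
        then show "indicator (A \<inter> ball 0 r) (x + t *\<^sub>R v) + indicator W (x + (- s + t) *\<^sub>R v) \<le> (indicator (ball 0 r) (x + t *\<^sub>R v) :: ennreal)"
          by (cases "x + (- s + t) *\<^sub>R v \<in> W") (auto simp: indicator_def)
      qed
      finally show ?thesis .
    qed
    show ?thesis unfolding eq using 1 2 by simp
  qed
  have "vol (A \<inter> ball 0 r) + vol W =
    (LINT+ x. indicator {0..<1} (x \<bullet> v) * (line_measure v (A \<inter> ball 0 r) x + line_measure v W x))"
    by (simp add: emeasure_lines nn_integral_add distrib_left)
  also have "\<dots> \<le> vol (steiner v A \<inter> ball 0 r)"
    by (subst emeasure_lines) (auto intro!: nn_integral_mono mult_left_mono lm)
  finally show ?thesis .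
qed

lemma nn_integral_lines2:
  fixes F :: "'a \<Rightarrow> 'a \<Rightarrow> ennreal"
  assumes [measurable]: "(\<lambda>(x, y). F x y) \<in> borel_measurable (borel \<Otimes>\<^sub>M borel)"
  shows "(LINT+ x. LINT+ y. F x y) = (LINT+ x. LINT+ y. indicator {0..<1} (x \<bullet> v) * indicator {0..<1} (y \<bullet> v) *
      (LINT+ s. LINT+ t. F (x + s *\<^sub>R v) (y + t *\<^sub>R v)))"
proof -
  have "(LINT+ x. LINT+ y. F x y) = (LINT+ x. indicator {0..<1} (x \<bullet> v) * (LINT+ s. LINT+ y. F (x + s *\<^sub>R v) y))"
    by (rule nn_integral_lines) measurable
  also have "\<dots> = (LINT+ x. indicator {0..<1} (x \<bullet> v) * (LINT+ s. LINT+ y. indicator {0..<1} (y \<bullet> v) * (LINT+ t. F (x + s *\<^sub>R v) (y + t *\<^sub>R v))))"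
  proof (rule nn_integral_cong, rule arg_cong2[where f="(*)", OF refl], rule nn_integral_cong)
    fix x :: 'a and s :: real
    show "(LINT+ y. F (x + s *\<^sub>R v) y) = (LINT+ y. indicator {0..<1} (y \<bullet> v) * (LINT+ t. F (x + s *\<^sub>R v) (y + t *\<^sub>R v)))"
      by (rule nn_integral_lines) measurable
  qed
  also have "\<dots> = (LINT+ x. indicator {0..<1} (x \<bullet> v) * (LINT+ y. LINT+ s. indicator {0..<1} (y \<bullet> v) * (LINT+ t. F (x + s *\<^sub>R v) (y + t *\<^sub>R v))))"
    by (intro nn_integral_cong arg_cong2[where f="(*)"] refl lborel_pair.Fubini') measurable
  also have "\<dots> = (LINT+ x. LINT+ y. indicator {0..<1} (x \<bullet> v) * indicator {0..<1} (y \<bullet> v) *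
      (LINT+ s. LINT+ t. F (x + s *\<^sub>R v) (y + t *\<^sub>R v)))"
    by (simp add: nn_integral_cmult mult.assoc)
  finally show ?thesis .
qed

text \<open>For points x on one line parallel to \<open>v\<close> and y on another, the sums x + y
  run through a third parallel line. So \<open>riesz_real\<close> applies to each pair of lines, and
  boundedness makes the sections finite.\<close>

lemma riesz_steiner:
  assumes [measurable]: "X \<in> sets borel" "Y \<in> sets borel" "Z \<in> sets borel"
    and sub: "X \<subseteq> ball 0 R" "Y \<subseteq> ball 0 R" "Z \<subseteq> ball 0 R"
  shows "riesz X Y Z \<le> riesz (steiner v X) (steiner v Y) (steiner v Z)"
proof -
  let ?\<phi> = "\<lambda>X Y Z x y. \<integral>\<^sup>+s. (LINT+ t. indicator X (x + s *\<^sub>R v) * indicator Y (y + t *\<^sub>R v) * indicator Z ((x + s *\<^sub>R v) + (y + t *\<^sub>R v))) \<partial>(lborel :: real measure)"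
  have fibre: "?\<phi> X Y Z x y \<le> ?\<phi> (steiner v X) (steiner v Y) (steiner v Z) x y" for x y
  proof -
    obtain a where a: "line_measure v X x = ennreal a" "0 \<le> a" using line_measure_bounded_finite[OF sub(1)] .
    obtain b where b: "line_measure v Y y = ennreal b" "0 \<le> b" using line_measure_bounded_finite[OF sub(2)] .
    obtain c where c: "line_measure v Z (x + y) = ennreal c" "0 \<le> c" using line_measure_bounded_finite[OF sub(3)] .
    let ?I = centred_interval
    have sec: "finite_borel_set {t. w + t *\<^sub>R v \<in> B} \<and> measure lborel {t. w + t *\<^sub>R v \<in> B} = l"
      if [measurable]: "B \<in> sets borel" and l: "line_measure v B w = ennreal l" "0 \<le> l" for B w l
    proof -
      have m: "{t. w + t *\<^sub>R v \<in> B} \<in> sets borel"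
        using measurable_sets[of "\<lambda>t. w + t *\<^sub>R v" borel borel B] by (simp add: vimage_def)
      have "vol {t. w + t *\<^sub>R v \<in> B} = (LINT+ t. indicator {t. w + t *\<^sub>R v \<in> B} t)"
        using m by (subst nn_integral_indicator) auto
      also have "\<dots> = ennreal l" unfolding l(1)[symmetric] line_measure_def
        by (intro nn_integral_cong) (simp add: indicator_def)
      finally have e: "vol {t. w + t *\<^sub>R v \<in> B} = ennreal l" .
      then show ?thesis using m l by (simp add: finite_borel_set_def measure_def)
    qed
    have "?\<phi> X Y Z x y = riesz {t. x + t *\<^sub>R v \<in> X} {t. y + t *\<^sub>R v \<in> Y} {t. (x + y) + t *\<^sub>R v \<in> Z}"
      unfolding riesz_def by (intro nn_integral_cong) (simp add: indicator_def algebra_simps)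
    also have "\<dots> \<le> riesz (?I a) (?I b) (?I c)"
      using riesz_real[of "{t. x + t *\<^sub>R v \<in> X}" "{t. y + t *\<^sub>R v \<in> Y}" "{t. (x + y) + t *\<^sub>R v \<in> Z}"]
        sec[OF _ a] sec[OF _ b] sec[OF _ c] by simp
    also have "\<dots> = (LINT+ s. LINT+ t. indicator (?I a) (x \<bullet> v + s) * indicator (?I b) (y \<bullet> v + t) * indicator (?I c) ((x \<bullet> v + s) + (y \<bullet> v + t)))"
    proof -
      have "(LINT+ t. indicator (?I a) s * indicator (?I b) t * indicator (?I c) (s + t)) =
         (LINT+ t. indicator (?I a) s * indicator (?I b) (y \<bullet> v + t) * indicator (?I c) (s + (y \<bullet> v + t)))" for s
        by (rule nn_integral_lborel_translate[symmetric]) measurable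
      then have "riesz (?I a) (?I b) (?I c) = (LINT+ s. LINT+ t. indicator (?I a) s * indicator (?I b) (y \<bullet> v + t) * indicator (?I c) (s + (y \<bullet> v + t)))"
        by (simp add: riesz_def)
      also have "\<dots> = (LINT+ s. LINT+ t. indicator (?I a) (x \<bullet> v + s) * indicator (?I b) (y \<bullet> v + t) * indicator (?I c) ((x \<bullet> v + s) + (y \<bullet> v + t)))"
        by (rule nn_integral_lborel_translate[symmetric]) measurable
      finally show ?thesis .
    qed
    also have "\<dots> = ?\<phi> (steiner v X) (steiner v Y) (steiner v Z) x y"
    proof (intro nn_integral_cong)
      fix s t :: real
      have 1: "indicator (?I a) (x \<bullet> v + s) = (indicator (steiner v X) (x + s *\<^sub>R v) :: ennreal)"
        "indicator (?I b) (y \<bullet> v + t) = (indicator (steiner v Y) (y + t *\<^sub>R v) :: ennreal)"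
        using a b by (simp_all add: indicator_steiner)
      have "(x + s *\<^sub>R v) + (y + t *\<^sub>R v) = (x + y) + (s + t) *\<^sub>R v" by (simp add: algebra_simps)
      moreover have "indicator (steiner v Z) ((x + y) + (s + t) *\<^sub>R v) = (indicator (?I c) ((x + y) \<bullet> v + (s + t)) :: ennreal)"
        using c by (intro indicator_steiner) auto
      ultimately have 2: "indicator (?I c) ((x \<bullet> v + s) + (y \<bullet> v + t)) = (indicator (steiner v Z) ((x + s *\<^sub>R v) + (y + t *\<^sub>R v)) :: ennreal)"
        by (simp add: inner_add_left algebra_simps)
      show "indicator (?I a) (x \<bullet> v + s) * indicator (?I b) (y \<bullet> v + t) * indicator (?I c) ((x \<bullet> v + s) + (y \<bullet> v + t)) =
          (indicator (steiner v X) (x + s *\<^sub>R v) * indicator (steiner v Y) (y + t *\<^sub>R v) *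
           indicator (steiner v Z) ((x + s *\<^sub>R v) + (y + t *\<^sub>R v)) :: ennreal)"
        unfolding 1 2 ..
    qed
    finally show ?thesis .
  qed
  have "riesz X Y Z = (LINT+ x. LINT+ y. indicator {0..<1} (x \<bullet> v) * indicator {0..<1} (y \<bullet> v) * ?\<phi> X Y Z x y)"
    unfolding riesz_def by (rule nn_integral_lines2) measurable
  also have "\<dots> \<le> (LINT+ x. LINT+ y. indicator {0..<1} (x \<bullet> v) * indicator {0..<1} (y \<bullet> v) * ?\<phi> (steiner v X) (steiner v Y) (steiner v Z) x y)"
    by (intro nn_integral_mono mult_left_mono fibre) auto
  also have "\<dots> = riesz (steiner v X) (steiner v Y) (steiner v Z)"
    unfolding riesz_def by (rule nn_integral_lines2[symmetric]) measurable
  finally show ?thesis .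
qed

end

section \<open>Balls of prescribed volume and the deviation from them\<close>

definition centred_ball :: "real \<Rightarrow> 'a::euclidean_space set" where
  "centred_ball m = ball 0 (root DIM('a) (m / unit_ball_vol (DIM('a))))"

lemma unit_ball_vol_nonzero: "unit_ball_vol (real DIM('a::euclidean_space)) \<noteq> 0"
  by (intro less_imp_neq[symmetric] unit_ball_vol_pos) simp

lemma ball_fmeasurable: "ball (x::'a::euclidean_space) r \<in> fmeasurable lborel"
  using emeasure_lborel_ball_finite[of x r] by (intro fmeasurableI) simp_all

lemma centred_ball_borel [measurable]: "centred_ball m \<in> sets borel"
  by (simp add: centred_ball_def)

lemma emeasure_centred_ball:
  "0 \<le> m \<Longrightarrow> vol (centred_ball m :: 'a::euclidean_space set) = ennreal m"
  using unit_ball_vol_pos[of "real DIM('a)"] unit_ball_vol_nonzero[where 'a='a]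
  by (simp add: centred_ball_def emeasure_ball real_root_pow_pos2)

lemma centred_ball_measure_ball: "0 \<le> r \<Longrightarrow> centred_ball (measure lborel (ball (0::'a::euclidean_space) r)) = ball (0::'a) r"
  using unit_ball_vol_pos[of "real DIM('a)"] emeasure_ball[of r "0::'a"] unit_ball_vol_nonzero[where 'a='a]
  by (simp add: centred_ball_def measure_def real_root_power_cancel)

lemma centred_ball_subset:
  fixes A :: "'a::euclidean_space set"
  assumes "A \<subseteq> ball 0 R" shows "centred_ball (measure lborel A) \<subseteq> (ball 0 R :: 'a set)"
proof (cases "R \<ge> 0")
  case True
  have "measure lborel A \<le> measure lborel (ball (0::'a) R)"
  proof (cases "A \<in> sets lborel")
    case True then show ?thesis using assms by (intro measure_mono_fmeasurable) (auto simp: ball_fmeasurable)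
  qed (simp add: measure_notin_sets)
  then have "centred_ball (measure lborel A) \<subseteq> (centred_ball (measure lborel (ball (0::'a) R)) :: 'a set)"
    unfolding centred_ball_def using unit_ball_vol_pos[of "real DIM('a)"]
    by (intro ball_subset_ball_iff[THEN iffD2]) (auto simp: divide_right_mono)
  then show ?thesis using True by (simp add: centred_ball_measure_ball)
next
  case False
  then have "A = {}" using assms ball_empty[of R "0::'a"] by auto
  then show ?thesis by (simp add: centred_ball_def)
qed

text \<open>Averaging: the overlaps of \<open>U\<close> with the translates of \<open>V\<close>
  integrate to the product of the measures, and only shifts of length below \<open>2 * R\<close>
  contribute.\<close>

lemma exists_overlap_shift:
  fixes U V :: "'a::euclidean_space set"
  assumes [measurable]: "U \<in> sets borel" "V \<in> sets borel" and sub: "U \<subseteq> ball 0 R" "V \<subseteq> ball 0 R"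
    and c: "ennreal c * vol (ball (0::'a) (2 * R)) < vol U * vol V"
  obtains z where "ennreal c < vol {x \<in> U. x + z \<in> V}"
proof (rule ccontr)
  assume neg: "\<not> thesis"
  have le: "(LINT+ x. indicator U x * indicator V (x + z)) \<le> ennreal c * indicator (ball 0 (2 * R)) z" for z
  proof (cases "z \<in> ball 0 (2 * R)")
    case True
    have "(LINT+ x. indicator U x * indicator V (x + z)) = (LINT+ x. indicator {x \<in> U. x + z \<in> V} x)"
      by (intro nn_integral_cong) (simp add: indicator_def)
    also have "\<dots> = vol {x \<in> U. x + z \<in> V}" by (subst nn_integral_indicator) auto
    also have "\<dots> \<le> ennreal c" using neg that not_le by blast
    finally show ?thesis using True by simp
  next
    case False
    have "x \<notin> U \<or> x + z \<notin> V" for x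
    proof (rule ccontr)
      assume "\<not> (x \<notin> U \<or> x + z \<notin> V)"
      then have "norm x < R" "norm (x + z) < R" using sub by auto
      moreover have "norm z \<le> norm (x + z) + norm x" using norm_triangle_ineq4[of "x + z" x] by simp
      ultimately show False using False by simp
    qed
    then have "(\<lambda>x. indicator U x * indicator V (x + z)) = (\<lambda>x. 0 :: ennreal)" by (auto simp: indicator_def)
    then show ?thesis by (simp only: nn_integral_0_iff_AE) simp
  qed
  have "vol U * vol V = (LINT+ x. LINT+ z. indicator U x * indicator V z)"
    by (simp add: nn_integral_cmult nn_integral_multc)
  also have "\<dots> = (LINT+ x. LINT+ z. indicator U x * indicator V (x + z))"
  proof (rule nn_integral_cong)
    fix x :: 'a
    show "(LINT+ z. indicator U x * indicator V z) = (LINT+ z. indicator U x * indicator V (x + z))"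
      by (rule nn_integral_lborel_translate[symmetric]) measurable
  qed
  also have "\<dots> = (LINT+ z. LINT+ x. indicator U x * indicator V (x + z))"
    by (rule lborel_pair.Fubini') measurable
  also have "\<dots> \<le> (LINT+ z. ennreal c * indicator (ball (0::'a) (2 * R)) z)"
    by (intro nn_integral_mono le)
  also have "\<dots> = ennreal c * vol (ball (0::'a) (2 * R))"
    by (rule nn_integral_cmult_indicator) simp
  finally show False using c by simp
qed

text \<open>For a set of finite measure, half the measure of the symmetric difference with the
  centred ball of the same volume.\<close>

definition deficit :: "'a::euclidean_space set \<Rightarrow> real" where
  "deficit A = measure lborel (A - centred_ball (measure lborel A))"

definition rearr_of :: "real \<Rightarrow> 'a::euclidean_space set \<Rightarrow> 'a set \<Rightarrow> bool" where
  "rearr_of R A A' \<longleftrightarrow> A' \<in> sets borel \<and> A' \<subseteq> ball 0 R \<and> vol A' = vol A"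

lemma bounded_fmeasurable:
  fixes A :: "'a::euclidean_space set"
  assumes "A \<in> sets borel" "A \<subseteq> ball 0 R" shows "A \<in> fmeasurable lborel"
  by (rule fmeasurableI2[of "ball 0 R"]) (use assms ball_fmeasurable in auto)

lemma rearr_of_steiner:
  assumes "rearr_of R A A'" "norm v = 1" shows "rearr_of R A (steiner v A')"
  using assms emeasure_steiner[OF assms(2), of A' R] steiner_subset_ball[OF assms(2), of A' R]
  by (auto simp: rearr_of_def)

text \<open>The deficit is the measure of \<open>A\<close> minus that of its overlap with the ball,
  and symmetrization preserves the former. So what \<open>steiner_overlap\<close> adds to the
  overlap leaves the deficit; an empty \<open>W\<close> gives monotonicity.\<close>

lemma
  fixes A :: "'a::euclidean_space set"
  assumes A [measurable]: "A \<in> sets borel" and sub: "A \<subseteq> ball 0 R" and v: "norm v = 1"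
  shows deficit_steiner_le: "deficit (steiner v A) \<le> deficit A"
    and deficit_steiner_overlap: "\<And>W s. W \<in> sets borel \<Longrightarrow> W \<subseteq> A - centred_ball (measure lborel A) \<Longrightarrow>
      (\<lambda>x. x + s *\<^sub>R v) ` W \<subseteq> centred_ball (measure lborel A) - A \<Longrightarrow> deficit (steiner v A) \<le> deficit A - measure lborel W"
proof -
  let ?B = "centred_ball (measure lborel A) :: 'a set"
  let ?S = "steiner v A"
  have subS: "?S \<subseteq> ball 0 R" using steiner_subset_ball[OF v sub] .
  have eqm: "measure lborel ?S = measure lborel A" using emeasure_steiner[OF v A sub] by (simp add: measure_def)
  note fm = bounded_fmeasurable
  have split: "measure lborel X = measure lborel (X \<inter> ?B) + measure lborel (X - ?B)"
    if X: "X \<in> sets borel" "X \<subseteq> ball 0 R" for X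
  proof -
    have "measure lborel (X - ?B) = measure lborel X - measure lborel (X \<inter> ?B)"
      using fm[OF X] fm[of "X \<inter> ?B" R] X measure_Diff[of lborel X "X \<inter> ?B"]
      by (simp add: Diff_Int_distrib Diff_Int fmeasurableD2 fmeasurable_def less_top)
    then show ?thesis by simp
  qed
  show ov: "deficit ?S \<le> deficit A - measure lborel W"
    if W: "W \<in> sets borel" "W \<subseteq> A - ?B" "(\<lambda>x. x + s *\<^sub>R v) ` W \<subseteq> ?B - A" for W s
  proof -
    have "vol (A \<inter> ?B) + vol W \<le> vol (?S \<inter> ?B)"
      using steiner_overlap[OF v A W(1) sub, of "root DIM('a) (measure lborel A / unit_ball_vol (DIM('a)))" s] W
      by (simp add: centred_ball_def)
    moreover have "A \<inter> ?B \<in> fmeasurable lborel" "?S \<inter> ?B \<in> fmeasurable lborel" "W \<in> fmeasurable lborel"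
      using W sub subS by (auto intro!: fm[of _ R])
    ultimately have "measure lborel (A \<inter> ?B) + measure lborel W \<le> measure lborel (?S \<inter> ?B)"
      by (simp add: emeasure_eq_measure2 ennreal_plus[symmetric] del: ennreal_plus)
    then show ?thesis using split[OF A sub] split[of ?S] subS by (simp add: deficit_def eqm)
  qed
  show "deficit ?S \<le> deficit A" using ov[of "{}" 0] by simp
qed

text \<open>The parts of \<open>A\<close> outside the ball and of the ball outside \<open>A\<close>
  have equal measure, so some translation moves a substantial part of the former into the latter.
  Its direction is the one to symmetrize in.\<close>

lemma deficit_improve:
  fixes A :: "'a::euclidean_space set"
  assumes A [measurable]: "A \<in> sets borel" and sub: "A \<subseteq> ball 0 R" and pos: "deficit A > 0"
  obtains v :: 'a where "norm v = 1"
    "deficit (steiner v A) \<le> deficit A - (deficit A)\<^sup>2 / (2 * measure lborel (ball (0::'a) (2 * R)))"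
proof -
  let ?B = "centred_ball (measure lborel A) :: 'a set"
  define V where "V = measure lborel (ball (0::'a) (2 * R))"
  have fA: "A \<in> fmeasurable lborel" using bounded_fmeasurable[OF A sub] .
  have fB: "?B \<in> fmeasurable lborel" using bounded_fmeasurable[OF centred_ball_borel centred_ball_subset[OF sub]] .
  have mB: "measure lborel ?B = measure lborel A" by (simp add: measure_def emeasure_centred_ball)
  have U: "measure lborel (A - ?B) = deficit A" by (simp add: deficit_def)
  have W: "measure lborel (?B - A) = deficit A"
  proof -
    have "measure lborel (A - ?B) = measure lborel A - measure lborel (A \<inter> ?B)"
      using measure_Diff[of lborel A "A \<inter> ?B"] fA fB by (simp add: Diff_Int fmeasurableD2 fmeasurable_Int_fmeasurable)
    moreover have "measure lborel (?B - A) = measure lborel ?B - measure lborel (A \<inter> ?B)"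
      using measure_Diff[of lborel ?B "A \<inter> ?B"] fA fB by (simp add: Diff_Int fmeasurableD2 fmeasurable_Int_fmeasurable)
    ultimately show ?thesis by (simp add: U mB)
  qed
  have R: "R > 0"
  proof (rule ccontr)
    assume "\<not> R > 0" then have "A = {}" using sub ball_empty[of R "0::'a"] by auto
    then show False using pos by (simp add: deficit_def)
  qed
  have V: "V > 0" unfolding V_def using R by (intro content_ball_pos) simp
  \<comment> \<open>Half of the average overlap of the two parts over all shifts; the factor 2
    provides the strict inequality that \<open>exists_overlap_shift\<close> asks for.\<close>
  define c where "c = (deficit A)\<^sup>2 / (2 * V)"
  have "ennreal c * vol (ball (0::'a) (2 * R)) < vol (A - ?B) * vol (?B - A)"
  proof -
    have e: "vol (ball (0::'a) (2 * R)) = ennreal V" unfolding V_def by (intro emeasure_eq_measure2 ball_fmeasurable)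
    have e1: "vol (A - ?B) = ennreal (deficit A)" unfolding U[symmetric] using fA by (intro emeasure_eq_measure2 fmeasurable_Diff) auto
    have e2: "vol (?B - A) = ennreal (deficit A)" unfolding W[symmetric] using fB by (intro emeasure_eq_measure2 fmeasurable_Diff) auto
    have "c * V < deficit A * deficit A" using V pos by (simp add: c_def power2_eq_square)
    then show ?thesis unfolding e e1 e2 using V pos by (simp add: ennreal_mult[symmetric] ennreal_less_iff c_def)
  qed
  then obtain z where z: "ennreal c < vol {x \<in> A - ?B. x + z \<in> ?B - A}"
    using exists_overlap_shift[of "A - ?B" "?B - A" R c] sub centred_ball_subset[OF sub] by auto
  define W where "W = {x \<in> A - ?B. x + z \<in> ?B - A}"
  have Wm [measurable]: "W \<in> sets borel" unfolding W_def by measurable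
  have z0: "z \<noteq> 0"
  proof
    assume "z = 0" then have "W = {}" by (auto simp: W_def)
    then show False using z unfolding W_def[symmetric] by simp
  qed
  define v where "v = z /\<^sub>R norm z"
  have v: "norm v = 1" using z0 by (simp add: v_def)
  have zv: "z = norm z *\<^sub>R v" using z0 by (simp add: v_def)
  have "deficit (steiner v A) \<le> deficit A - measure lborel W"
    by (rule deficit_steiner_overlap[OF A sub v Wm, of "norm z"]) (auto simp: W_def zv[symmetric])
  moreover have "c \<le> measure lborel W"
  proof -
    have "W \<in> fmeasurable lborel" using sub by (intro bounded_fmeasurable[of _ R]) (auto simp: W_def)
    then have "ennreal c < ennreal (measure lborel W)" using z by (simp add: W_def emeasure_eq_measure2)
    then show ?thesis using V by (simp add: ennreal_less_iff c_def)
  qed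
  ultimately show ?thesis using that[OF v] by (simp add: c_def V_def)
qed

section \<open>Riesz's inequality for bounded sets\<close>

lemma riesz_mono: "X \<subseteq> X' \<Longrightarrow> Y \<subseteq> Y' \<Longrightarrow> Z \<subseteq> Z' \<Longrightarrow> riesz X Y Z \<le> riesz X' Y' Z'"
  unfolding riesz_def by (intro nn_integral_mono) (auto simp: indicator_def)

text \<open>Continuity of the Riesz integral in its sets, exchanged one at a time. It carries the
  inequality from sets close to balls to balls, and from truncated sets to unbounded ones.\<close>

lemma riesz_perturb:
  fixes X Y Z X' Y' Z' :: "'a::euclidean_space set"
  assumes [measurable]: "X \<in> sets borel" "Y \<in> sets borel" "Z \<in> sets borel" "X' \<in> sets borel" "Y' \<in> sets borel" "Z' \<in> sets borel"
  shows "riesz X Y Z \<le> riesz X' Y' Z' + vol (X - X') * vol Y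
     + vol (Y - Y') * vol Z + vol X' * vol (Z - Z')"
proof -
  have 1: "riesz X Y Z \<le> riesz X' Y Z + riesz (X - X') Y Z"
    unfolding riesz_def by (subst nn_integral_add[symmetric], measurable, subst nn_integral_add[symmetric], measurable)
      (intro nn_integral_mono, auto simp: indicator_def)
  have 2: "riesz X' Y Z \<le> riesz X' Y' Z + riesz X' (Y - Y') Z"
    unfolding riesz_def by (subst nn_integral_add[symmetric], measurable, subst nn_integral_add[symmetric], measurable)
      (intro nn_integral_mono, auto simp: indicator_def)
  have 3: "riesz X' Y' Z \<le> riesz X' Y' Z' + riesz X' Y' (Z - Z')"
    unfolding riesz_def by (subst nn_integral_add[symmetric], measurable, subst nn_integral_add[symmetric], measurable)
      (intro nn_integral_mono, auto simp: indicator_def)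
  have "riesz X Y Z \<le> riesz X' Y Z + vol (X - X') * vol Y"
    by (rule order_trans[OF 1]) (intro add_left_mono riesz_le_XY; simp)
  also have "\<dots> \<le> (riesz X' Y' Z + vol (Y - Y') * vol Z) + vol (X - X') * vol Y"
    by (rule add_right_mono, rule order_trans[OF 2]) (intro add_left_mono riesz_le_YZ; simp)
  also have "\<dots> \<le> ((riesz X' Y' Z' + vol X' * vol (Z - Z')) + vol (Y - Y') * vol Z) + vol (X - X') * vol Y"
    by (rule add_right_mono, rule add_right_mono, rule order_trans[OF 3]) (intro add_left_mono riesz_le_XZ; simp)
  finally show ?thesis by (simp only: ac_simps)
qed

text \<open>Among all triples of sets with prescribed measures whose Riesz integral is not smaller, the
  infimum of the total deviation from balls is zero, because a suitable Steiner symmetrization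
  lowers a positive deviation by a fixed amount.\<close>

lemma riesz_bounded:
  fixes X Y Z :: "'a::euclidean_space set"
  assumes [measurable]: "X \<in> sets borel" "Y \<in> sets borel" "Z \<in> sets borel"
    and sub: "X \<subseteq> ball 0 R" "Y \<subseteq> ball 0 R" "Z \<subseteq> ball 0 R"
  shows "riesz X Y Z \<le> riesz (centred_ball (measure lborel X)) (centred_ball (measure lborel Y)) (centred_ball (measure lborel Z) :: 'a set)"
proof -
  define T where "T = {(X', Y', Z'). rearr_of R X X' \<and> rearr_of R Y Y' \<and> rearr_of R Z Z' \<and> riesz X Y Z \<le> riesz X' Y' Z'}"
  define \<delta> where "\<delta> = (\<lambda>(X'::'a set, Y'::'a set, Z'::'a set). deficit X' + deficit Y' + deficit Z')"
  define V where "V = measure lborel (ball (0::'a) (2 * R))"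
  have XT: "(X, Y, Z) \<in> T" using assms by (auto simp: T_def rearr_of_def)
  have \<delta>0: "0 \<le> \<delta> \<tau>" for \<tau> by (auto simp: \<delta>_def deficit_def split: prod.split)
  have bdd: "bdd_below (\<delta> ` T)" using \<delta>0 by (auto intro!: bdd_belowI[of _ 0])
  \<comment> \<open>One of the three deficits is at least a third of the total. Symmetrizing all
    three sets in the direction chosen for that one cannot raise the other two.\<close>
  have improve: "\<exists>\<tau>'\<in>T. \<delta> \<tau>' \<le> \<delta> \<tau> - (\<delta> \<tau> / 3)\<^sup>2 / (2 * V)" if \<tau>: "\<tau> \<in> T" "\<delta> \<tau> > 0" for \<tau>
  proof -
    obtain X' Y' Z' where t: "\<tau> = (X', Y', Z')" by (metis prod_cases3)
    have r: "rearr_of R X X'" "rearr_of R Y Y'" "rearr_of R Z Z'" "riesz X Y Z \<le> riesz X' Y' Z'"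
      using \<tau>(1) by (auto simp: T_def t)
    have d: "deficit X' + deficit Y' + deficit Z' = \<delta> \<tau>" by (simp add: \<delta>_def t)
    have "\<exists>v. norm v = 1 \<and> deficit (steiner v X') + deficit (steiner v Y') + deficit (steiner v Z') \<le> \<delta> \<tau> - (\<delta> \<tau> / 3)\<^sup>2 / (2 * V)"
    proof -
      have V0: "0 \<le> V" by (simp add: V_def)
      have b: "X' \<in> sets borel" "Y' \<in> sets borel" "Z' \<in> sets borel" "X' \<subseteq> ball 0 R" "Y' \<subseteq> ball 0 R" "Z' \<subseteq> ball 0 R"
        using r by (auto simp: rearr_of_def)
      have sq: "(\<delta> \<tau> / 3)\<^sup>2 / (2 * V) \<le> e\<^sup>2 / (2 * V)" if "\<delta> \<tau> / 3 \<le> e" for e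
        using that \<tau>(2) V0 by (intro divide_right_mono power_mono) auto
      consider "deficit X' \<ge> \<delta> \<tau> / 3" | "deficit Y' \<ge> \<delta> \<tau> / 3" | "deficit Z' \<ge> \<delta> \<tau> / 3" using d by linarith
      then show ?thesis
      proof cases
        case 1
        then obtain v :: 'a where v: "norm v = 1" "deficit (steiner v X') \<le> deficit X' - (deficit X')\<^sup>2 / (2 * V)"
          using deficit_improve[OF b(1,4)] \<tau>(2) by (auto simp: V_def)
        show ?thesis using v sq[OF 1] d deficit_steiner_le[OF b(2,5) v(1)] deficit_steiner_le[OF b(3,6) v(1)]
          by (intro exI[of _ v]) simp
      next
        case 2
        then obtain v :: 'a where v: "norm v = 1" "deficit (steiner v Y') \<le> deficit Y' - (deficit Y')\<^sup>2 / (2 * V)"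
          using deficit_improve[OF b(2,5)] \<tau>(2) by (auto simp: V_def)
        show ?thesis using v sq[OF 2] d deficit_steiner_le[OF b(1,4) v(1)] deficit_steiner_le[OF b(3,6) v(1)]
          by (intro exI[of _ v]) simp
      next
        case 3
        then obtain v :: 'a where v: "norm v = 1" "deficit (steiner v Z') \<le> deficit Z' - (deficit Z')\<^sup>2 / (2 * V)"
          using deficit_improve[OF b(3,6)] \<tau>(2) by (auto simp: V_def)
        show ?thesis using v sq[OF 3] d deficit_steiner_le[OF b(1,4) v(1)] deficit_steiner_le[OF b(2,5) v(1)]
          by (intro exI[of _ v]) simp
      qed
    qed
    then obtain v :: 'a where v: "norm v = 1"
      "deficit (steiner v X') + deficit (steiner v Y') + deficit (steiner v Z') \<le> \<delta> \<tau> - (\<delta> \<tau> / 3)\<^sup>2 / (2 * V)" by blast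
    have "(steiner v X', steiner v Y', steiner v Z') \<in> T"
      using r rearr_of_steiner[OF _ v(1)] order_trans[OF r(4) riesz_steiner[OF v(1), of X' Y' Z' R]]
      by (auto simp: T_def rearr_of_def)
    then show ?thesis using v(2) by (intro bexI[of _ "(steiner v X', steiner v Y', steiner v Z')"]) (auto simp: \<delta>_def)
  qed
  have small: "\<exists>\<tau>\<in>T. \<delta> \<tau> < e" if e: "e > 0" for e
  proof (rule ccontr)
    assume neg: "\<not> (\<exists>\<tau>\<in>T. \<delta> \<tau> < e)"
    define d where "d = Inf (\<delta> ` T)"
    have ed: "e \<le> d" unfolding d_def using XT neg by (intro cInf_greatest) (auto simp: not_less)
    have V: "V > 0"
    proof (rule ccontr)
      assume "\<not> V > 0"
      then have "\<not> (2 * R > 0)" unfolding V_def using content_ball_pos by blast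
      then have "X = {}" "Y = {}" "Z = {}" using sub ball_empty[of R "0::'a"] by auto
      then have "\<delta> (X, Y, Z) = 0" by (simp add: \<delta>_def deficit_def)
      then show False using neg XT e by force
    qed
    have "0 < (d / 3)\<^sup>2 / (2 * V)" using V ed e by simp
    \<comment> \<open>So close to the infimum \<open>d\<close> the guaranteed drop, at least
      \<open>(d / 3)\<^sup>2 / (2 * V)\<close>, leads below \<open>d\<close>.\<close>
    then obtain \<tau> where \<tau>: "\<tau> \<in> T" "\<delta> \<tau> < d + (d / 3)\<^sup>2 / (2 * V)"
      using cInf_lessD[of "\<delta> ` T" "d + (d / 3)\<^sup>2 / (2 * V)"] XT by (force simp: d_def)
    have d\<tau>: "d \<le> \<delta> \<tau>" unfolding d_def using \<tau>(1) bdd by (intro cInf_lower) auto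
    then have "\<delta> \<tau> > 0" using ed e by linarith
    then obtain \<tau>' where \<tau>': "\<tau>' \<in> T" "\<delta> \<tau>' \<le> \<delta> \<tau> - (\<delta> \<tau> / 3)\<^sup>2 / (2 * V)" using improve[OF \<tau>(1)] by blast
    have "(d / 3)\<^sup>2 / (2 * V) \<le> (\<delta> \<tau> / 3)\<^sup>2 / (2 * V)" using d\<tau> ed e V by (intro divide_right_mono power_mono) auto
    then have "\<delta> \<tau>' < d" using \<tau> \<tau>' by linarith
    moreover have "d \<le> \<delta> \<tau>'" unfolding d_def using \<tau>'(1) bdd by (intro cInf_lower) auto
    ultimately show False by simp
  qed
  define C where "C = measure lborel X + measure lborel Y + measure lborel Z"
  have fm: "measure lborel X' = measure lborel X \<and> vol X = ennreal (measure lborel X) \<and> vol (X' - centred_ball (measure lborel X)) = ennreal (deficit X')"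
    if "rearr_of R X X'" "X \<in> sets borel" "X \<subseteq> ball 0 R" for X X' :: "'a set"
  proof (intro conjI)
    show m: "measure lborel X' = measure lborel X" using that by (simp add: rearr_of_def measure_def)
    show "vol X = ennreal (measure lborel X)" using bounded_fmeasurable[OF that(2,3)] by (rule emeasure_eq_measure2)
    have "X' - centred_ball (measure lborel X) \<in> fmeasurable lborel"
      using that(1) by (intro bounded_fmeasurable[of _ R]) (auto simp: rearr_of_def)
    then show "vol (X' - centred_ball (measure lborel X)) = ennreal (deficit X')"
      unfolding deficit_def m by (rule emeasure_eq_measure2)
  qed
  show ?thesis
  proof (rule ennreal_le_epsilon)
    fix e :: real assume e: "0 < e"
    have C0: "0 \<le> C" by (simp add: C_def)
    obtain \<tau> where \<tau>: "\<tau> \<in> T" "\<delta> \<tau> < e / (C + 1)" using small[of "e / (C + 1)"] e C0 by auto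
    obtain X' Y' Z' where t: "\<tau> = (X', Y', Z')" by (metis prod_cases3)
    have r: "rearr_of R X X'" "rearr_of R Y Y'" "rearr_of R Z Z'" "riesz X Y Z \<le> riesz X' Y' Z'"
      using \<tau>(1) by (auto simp: T_def t)
    have b: "X' \<in> sets borel" "Y' \<in> sets borel" "Z' \<in> sets borel" using r by (auto simp: rearr_of_def)
    note fX = fm[OF r(1) assms(1) sub(1)] and fY = fm[OF r(2) assms(2) sub(2)] and fZ = fm[OF r(3) assms(3) sub(3)]
    have d0: "0 \<le> deficit X'" "0 \<le> deficit Y'" "0 \<le> deficit Z'" by (simp_all add: deficit_def)
    let ?x = "measure lborel X" and ?y = "measure lborel Y" and ?z = "measure lborel Z"
    have eY: "vol Y' = ennreal ?y" "vol Z' = ennreal ?z"       using r(2,3) fY[THEN conjunct2, THEN conjunct1] fZ[THEN conjunct2, THEN conjunct1]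
      unfolding rearr_of_def by metis+
    have "riesz X Y Z \<le> riesz X' Y' Z'" by fact
    also have "\<dots> \<le> riesz (centred_ball ?x) (centred_ball ?y) (centred_ball ?z :: 'a set) + vol (X' - centred_ball ?x) * vol Y'
       + vol (Y' - centred_ball ?y) * vol Z' + vol (centred_ball ?x :: 'a set) * vol (Z' - centred_ball ?z)"
      using b by (intro riesz_perturb) auto
    also have "\<dots> = riesz (centred_ball ?x) (centred_ball ?y) (centred_ball ?z :: 'a set) + ennreal (deficit X' * ?y + deficit Y' * ?z + ?x * deficit Z')"
      using d0 by (simp add: fX fY fZ eY emeasure_centred_ball ennreal_mult[symmetric] ennreal_plus[symmetric] add.assoc del: ennreal_plus)
    also have "deficit X' * ?y + deficit Y' * ?z + ?x * deficit Z' \<le> e"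
    proof -
      have "deficit X' * ?y + deficit Y' * ?z + ?x * deficit Z' \<le> deficit X' * C + deficit Y' * C + C * deficit Z'"
        using d0 by (intro add_mono mult_left_mono mult_right_mono) (auto simp: C_def)
      also have "\<dots> = \<delta> \<tau> * C" by (simp add: \<delta>_def t algebra_simps)
      also have "\<dots> \<le> \<delta> \<tau> * (C + 1)" using \<delta>0[of \<tau>] by (intro mult_left_mono) auto
      also have "\<dots> \<le> e" using \<tau>(2) C0 by (simp add: pos_less_divide_eq)
      finally show ?thesis .
    qed
    finally show "riesz X Y Z \<le> riesz (centred_ball ?x) (centred_ball ?y) (centred_ball ?z :: 'a set) + ennreal e"
      by (simp add: ennreal_leI add_left_mono)
  qed
qed

section \<open>Two triples of sets with one kernel\<close>

lemma centred_ball_mono: "m \<le> m' \<Longrightarrow> centred_ball m \<subseteq> (centred_ball m' :: 'a::euclidean_space set)"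
  unfolding centred_ball_def using unit_ball_vol_pos[of "real DIM('a)"]
  by (intro subset_ball) (auto simp: divide_right_mono)

lemma emeasure_lborel_reflect:
  fixes X :: "'a::euclidean_space set"
  assumes [measurable]: "X \<in> sets borel"
  shows "vol {x. w - x \<in> X} = vol X"
proof -
  have m: "{x. w - x \<in> X} \<in> sets borel"
    using measurable_sets[of "\<lambda>x. w - x" borel borel X] by (simp add: vimage_def)
  have "vol {x. w - x \<in> X} = (LINT+ x. indicator {x. w - x \<in> X} x)"
    using m by (subst nn_integral_indicator) auto
  also have "\<dots> = (LINT+ x. indicator X (w - x))"
    by (intro nn_integral_cong) (simp add: indicator_def)
  also have "\<dots> = vol X" by (subst nn_integral_lborel_reflect) auto
  finally show ?thesis .
qed

lemma riesz_reflect: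
  fixes X Y Z :: "'a::euclidean_space set"
  assumes [measurable]: "X \<in> sets borel" "Y \<in> sets borel" "Z \<in> sets borel"
  shows "riesz {x. w - x \<in> X} Y {z. w - z \<in> Z} = riesz X {y. - y \<in> Y} Z"
proof -
  have "riesz {x. w - x \<in> X} Y {z. w - z \<in> Z} =
      (LINT+ x. LINT+ y. indicator X (w - x) * indicator Y y * indicator Z ((w - x) - y))"
    unfolding riesz_def by (intro nn_integral_cong) (simp add: indicator_def algebra_simps)
  also have "\<dots> = (LINT+ x. LINT+ y. indicator X x * indicator Y y * indicator Z (x - y))"
    by (rule nn_integral_lborel_reflect) measurable
  also have "\<dots> = (LINT+ x. LINT+ y. indicator X x * indicator Y (0 - y) * indicator Z (x - (0 - y)))"
  proof (rule nn_integral_cong)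
    fix x :: 'a
    show "(LINT+ y. indicator X x * indicator Y y * indicator Z (x - y)) = (LINT+ y. indicator X x * indicator Y (0 - y) * indicator Z (x - (0 - y)))"
      by (rule nn_integral_lborel_reflect[symmetric]) measurable
  qed
  also have "\<dots> = riesz X {y. - y \<in> Y} Z"
    unfolding riesz_def by (intro nn_integral_cong) (simp add: indicator_def)
  finally show ?thesis .
qed

text \<open>Reflecting \<open>X2\<close> and \<open>Z2\<close> in a point turns the reflected kernel
  back into \<open>Y\<close>, and a distant point makes the copies disjoint from \<open>X1\<close>
  and \<open>Z1\<close>. Both integrals are then disjoint portions of the Riesz integral of the
  unions, to which \<open>riesz_bounded\<close> applies.\<close>

lemma riesz_pair_bounded:
  fixes X1 X2 Y Z1 Z2 :: "'a::euclidean_space set"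
  assumes m [measurable]: "X1 \<in> sets borel" "X2 \<in> sets borel" "Y \<in> sets borel" "Z1 \<in> sets borel" "Z2 \<in> sets borel"
    and sub: "X1 \<subseteq> ball 0 R" "X2 \<subseteq> ball 0 R" "Y \<subseteq> ball 0 R" "Z1 \<subseteq> ball 0 R" "Z2 \<subseteq> ball 0 R" and R: "0 \<le> R"
  shows "riesz X1 Y Z1 + riesz X2 {y. - y \<in> Y} Z2 \<le>
     riesz (centred_ball (measure lborel X1 + measure lborel X2)) (centred_ball (measure lborel Y))
       (centred_ball (measure lborel Z1 + measure lborel Z2) :: 'a set)"
proof -
  obtain b :: 'a where b: "b \<in> Basis" using nonempty_Basis by blast
  \<comment> \<open>The open balls of radius \<open>R\<close> about 0 and about a point at distance
    \<open>2 * R\<close> are disjoint.\<close>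
  define w where "w = (2 * R) *\<^sub>R b"
  have w: "norm w = 2 * R" using b R by (simp add: w_def)
  define X2' where "X2' = {x. w - x \<in> X2}"
  define Z2' where "Z2' = {x. w - x \<in> Z2}"
  have m2 [measurable]: "X2' \<in> sets borel" "Z2' \<in> sets borel"
    unfolding X2'_def Z2'_def
    using measurable_sets[of "\<lambda>x. w - x" borel borel X2] measurable_sets[of "\<lambda>x. w - x" borel borel Z2] by (simp_all add: vimage_def)
  have far: "x \<notin> ball 0 R" if "w - x \<in> ball 0 R" for x
  proof
    assume "x \<in> ball 0 R"
    then have "norm (w - x) + norm x < 2 * R" using that by simp
    moreover have "norm w \<le> norm (w - x) + norm x" using norm_triangle_ineq[of "w - x" x] by simp
    ultimately show False using w by simp
  qed
  have disj: "X1 \<inter> X2' = {}" "Z1 \<inter> Z2' = {}" using far sub unfolding X2'_def Z2'_def by blast+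
  have in3: "x \<in> ball 0 (3 * R)" if "w - x \<in> ball 0 R" for x
    using that norm_triangle_ineq4[of w "w - x"] w by simp
  have sub3: "X1 \<union> X2' \<subseteq> ball 0 (3 * R)" "Y \<subseteq> ball 0 (3 * R)" "Z1 \<union> Z2' \<subseteq> ball 0 (3 * R)"
  proof -
    have "ball 0 R \<subseteq> ball (0::'a) (3 * R)" using R by (intro subset_ball) simp
    then show "X1 \<union> X2' \<subseteq> ball 0 (3 * R)" "Y \<subseteq> ball 0 (3 * R)" "Z1 \<union> Z2' \<subseteq> ball 0 (3 * R)"
      using in3 sub unfolding X2'_def Z2'_def by blast+
  qed
  have meas: "measure lborel (X1 \<union> X2') = measure lborel X1 + measure lborel X2"
    "measure lborel (Z1 \<union> Z2') = measure lborel Z1 + measure lborel Z2"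
  proof -
    have "vol X2' = vol X2" "vol Z2' = vol Z2"
      unfolding X2'_def Z2'_def by (simp_all add: emeasure_lborel_reflect)
    then have e: "measure lborel X2' = measure lborel X2" "measure lborel Z2' = measure lborel Z2" by (simp_all add: measure_def)
    have fm: "X1 \<in> fmeasurable lborel" "Z1 \<in> fmeasurable lborel" "X2' \<in> fmeasurable lborel" "Z2' \<in> fmeasurable lborel"
      using sub3 by (auto intro!: bounded_fmeasurable[of _ "3 * R"])
    show "measure lborel (X1 \<union> X2') = measure lborel X1 + measure lborel X2"
      using disj(1) fm by (subst measure_Un_AE) (auto simp: e)
    show "measure lborel (Z1 \<union> Z2') = measure lborel Z1 + measure lborel Z2"
      using disj(2) fm by (subst measure_Un_AE) (auto simp: e)
  qed
  have "riesz X1 Y Z1 + riesz X2' Y Z2' \<le> riesz (X1 \<union> X2') Y (Z1 \<union> Z2')"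
    unfolding riesz_def using disj
    by (subst nn_integral_add[symmetric], measurable, subst nn_integral_add[symmetric], measurable)
      (intro nn_integral_mono, auto simp: indicator_def)
  also have "\<dots> \<le> riesz (centred_ball (measure lborel (X1 \<union> X2'))) (centred_ball (measure lborel Y)) (centred_ball (measure lborel (Z1 \<union> Z2')) :: 'a set)"
    by (rule riesz_bounded) (use sub3 in auto)
  finally have "riesz X1 Y Z1 + riesz X2' Y Z2' \<le> riesz (centred_ball (measure lborel (X1 \<union> X2'))) (centred_ball (measure lborel Y))
      (centred_ball (measure lborel (Z1 \<union> Z2')) :: 'a set)" .
  moreover have "riesz X2' Y Z2' = riesz X2 {y. - y \<in> Y} Z2"
    unfolding X2'_def Z2'_def by (rule riesz_reflect) auto
  ultimately show ?thesis by (simp only: meas)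
qed

lemma emeasure_minus_ball_tendsto:
  fixes A :: "'a::euclidean_space set"
  assumes A [measurable]: "A \<in> sets borel" and fin: "vol A < \<infinity>"
  shows "(\<lambda>k. vol (A - ball 0 (real k))) \<longlonglongrightarrow> 0"
proof -
  have "(\<lambda>k. vol (A - ball 0 (real k))) \<longlonglongrightarrow> vol (\<Inter>k. A - ball 0 (real k))"
  proof (rule Lim_emeasure_decseq)
    show "range (\<lambda>k. A - ball 0 (real k)) \<subseteq> sets lborel" by auto
    show "decseq (\<lambda>k. A - ball 0 (real k))" by (auto simp: decseq_def)
    show "vol (A - ball 0 (real k)) \<noteq> \<infinity>" for k
      using emeasure_mono[of "A - ball 0 (real k)" A lborel] fin by (auto simp: top_unique)
  qed
  also have "(\<Inter>k. A - ball 0 (real k)) = {}"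
  proof -
    have "x \<notin> (\<Inter>k. A - ball 0 (real k))" for x
    proof -
      obtain k where "norm x < real k" using reals_Archimedean2 by blast
      then show ?thesis by (auto intro!: exI[of _ k])
    qed
    then show ?thesis by blast
  qed
  finally show ?thesis by simp
qed

text \<open>Truncation to balls about 0 leaves errors that are products of a finite measure and the
  tail of a set of finite measure.\<close>

theorem riesz_pair:
  fixes X1 X2 Y Z1 Z2 :: "'a::euclidean_space set"
  assumes m [measurable]: "X1 \<in> sets borel" "X2 \<in> sets borel" "Y \<in> sets borel" "Z1 \<in> sets borel" "Z2 \<in> sets borel"
    and fin: "vol X1 < \<infinity>" "vol X2 < \<infinity>" "vol Y < \<infinity>" "vol Z1 < \<infinity>" "vol Z2 < \<infinity>"
  shows "riesz X1 Y Z1 + riesz X2 {y. - y \<in> Y} Z2 \<le>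
     riesz (centred_ball (measure lborel X1 + measure lborel X2)) (centred_ball (measure lborel Y))
       (centred_ball (measure lborel Z1 + measure lborel Z2) :: 'a set)" (is "?L \<le> ?R")
proof -
  define Y' where "Y' = {y. - y \<in> Y}"
  have Y'm [measurable]: "Y' \<in> sets borel"
    unfolding Y'_def using measurable_sets[of "\<lambda>x. - x" borel borel Y] by (simp add: vimage_def)
  have Y'e: "vol Y' = vol Y" using emeasure_lborel_reflect[of Y 0] by (simp add: Y'_def)
  let ?B = "\<lambda>k. ball (0::'a) (real k)"
  define err where "err k = (vol (X1 - ?B k) * vol Y + vol (Y - ?B k) * vol Z1 + vol X1 * vol (Z1 - ?B k))
    + (vol (X2 - ?B k) * vol Y + vol (Y' - ?B k) * vol Z2 + vol X2 * vol (Z2 - ?B k))" for k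
  have step: "?L \<le> ?R + err k" for k
  proof -
    have lift: "riesz X V Z \<le> riesz (X \<inter> ?B k) (V \<inter> ?B k) (Z \<inter> ?B k) + (vol (X - ?B k) * vol V
        + vol (V - ?B k) * vol Z + vol X * vol (Z - ?B k))"
      if [measurable]: "X \<in> sets borel" "V \<in> sets borel" "Z \<in> sets borel" for X V Z :: "'a set"
    proof -
      have d: "W - W \<inter> ?B k = W - ?B k" for W by auto
      have "riesz X V Z \<le> riesz (X \<inter> ?B k) (V \<inter> ?B k) (Z \<inter> ?B k) + vol (X - ?B k) * vol V
        + vol (V - ?B k) * vol Z + vol (X \<inter> ?B k) * vol (Z - ?B k)"
        using riesz_perturb[of X V Z "X \<inter> ?B k" "V \<inter> ?B k" "Z \<inter> ?B k"] by (simp add: d)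
      also have "\<dots> \<le> riesz (X \<inter> ?B k) (V \<inter> ?B k) (Z \<inter> ?B k) + vol (X - ?B k) * vol V
        + vol (V - ?B k) * vol Z + vol X * vol (Z - ?B k)"
        by (intro add_left_mono mult_right_mono emeasure_mono) auto
      finally show ?thesis by (simp add: add.assoc)
    qed
    have cut: "measure lborel (W \<inter> ?B k) \<le> measure lborel W" if "W \<in> sets borel" "vol W < \<infinity>" for W
      using that by (intro measure_mono_fmeasurable) (auto simp: fmeasurable_def)
    have Yk: "Y' \<inter> ?B k = {y. - y \<in> Y \<inter> ?B k}" by (auto simp: Y'_def)
    have "riesz (X1 \<inter> ?B k) (Y \<inter> ?B k) (Z1 \<inter> ?B k) + riesz (X2 \<inter> ?B k) (Y' \<inter> ?B k) (Z2 \<inter> ?B k)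
        \<le> riesz (centred_ball (measure lborel (X1 \<inter> ?B k) + measure lborel (X2 \<inter> ?B k))) (centred_ball (measure lborel (Y \<inter> ?B k)))
           (centred_ball (measure lborel (Z1 \<inter> ?B k) + measure lborel (Z2 \<inter> ?B k)) :: 'a set)"
      unfolding Yk by (rule riesz_pair_bounded[of _ _ _ _ _ "real k"]) auto
    also have "\<dots> \<le> ?R"
      using fin m by (intro riesz_mono centred_ball_mono add_mono cut)
    finally have "riesz (X1 \<inter> ?B k) (Y \<inter> ?B k) (Z1 \<inter> ?B k) + riesz (X2 \<inter> ?B k) (Y' \<inter> ?B k) (Z2 \<inter> ?B k) \<le> ?R" .
    moreover have "?L \<le> (riesz (X1 \<inter> ?B k) (Y \<inter> ?B k) (Z1 \<inter> ?B k) + riesz (X2 \<inter> ?B k) (Y' \<inter> ?B k) (Z2 \<inter> ?B k)) + err k"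
      using add_mono[OF lift[of X1 Y Z1] lift[of X2 Y' Z2]] unfolding err_def Y'_def[symmetric] Y'e
      by (simp add: ac_simps)
    ultimately show ?thesis by (meson add_right_mono order_trans)
  qed
  have lim: "(\<lambda>k. vol W * vol (A - ?B k)) \<longlonglongrightarrow> vol W * 0"
    if "A \<in> sets borel" "vol A < \<infinity>" "vol W < \<infinity>" for A W :: "'a set"
    using that by (intro ennreal_tendsto_cmult emeasure_minus_ball_tendsto) auto
  have "(\<lambda>k. ?R + err k) \<longlonglongrightarrow> ?R + ((vol Y * 0 + vol Z1 * 0 + vol X1 * 0)
    + (vol Y * 0 + vol Z2 * 0 + vol X2 * 0))"
    unfolding err_def mult.commute[of _ "vol Y"] mult.commute[of _ "vol Z1"] mult.commute[of _ "vol Z2"]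
    by (intro tendsto_add tendsto_const lim fin m Y'm) (use fin Y'e in auto)
  then have "(\<lambda>k. ?R + err k) \<longlonglongrightarrow> ?R" by simp
  then show ?thesis using step by (intro LIMSEQ_le_const) auto
qed

text \<open>A Riesz integral with the complement of \<open>X\<close>. That complement has infinite
  measure when \<open>X\<close> is a superlevel set, so it is reached only through
  \<open>gap_plus_riesz\<close>.\<close>

definition gap :: "'a::euclidean_space set \<Rightarrow> 'a set \<Rightarrow> 'a set \<Rightarrow> ennreal" where
  "gap X Y Z = (LINT+ x. LINT+ y. indicator (- X) x * indicator Y y * indicator Z (x + y))"

lemma gap_plus_riesz:
  fixes X Y Z :: "'a::euclidean_space set"
  assumes [measurable]: "X \<in> sets borel" "Y \<in> sets borel" "Z \<in> sets borel"
  shows "gap X Y Z + riesz X Y Z = vol Y * vol Z"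
proof -
  have "gap X Y Z + riesz X Y Z = (LINT+ x. LINT+ y. indicator Y y * indicator Z (x + y))"
    unfolding gap_def riesz_def
    by (subst nn_integral_add[symmetric], measurable, subst nn_integral_add[symmetric], measurable)
      (intro nn_integral_cong, auto simp: indicator_def)
  also have "\<dots> = (LINT+ y. LINT+ x. indicator Y y * indicator Z (x + y))"
    by (rule lborel_pair.Fubini') measurable
  also have "\<dots> = (LINT+ y. indicator Y y * vol Z)"
  proof (rule nn_integral_cong)
    fix y :: 'a
    have "(LINT+ x. indicator Z (x + y)) = vol Z"
      using nn_integral_lborel_translate[of "indicator Z" y] by (simp add: add.commute)
    then show "(LINT+ x. indicator Y y * indicator Z (x + y)) = indicator Y y * vol Z"
      by (simp add: nn_integral_cmult)
  qed
  also have "\<dots> = vol Y * vol Z" by (simp add: nn_integral_multc)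
  finally show ?thesis .
qed

text \<open>The level sets of the radial rearrangement are known only away from the origin.\<close>

lemma riesz_null_cong:
  fixes X Y Z X' Z' :: "'a::euclidean_space set"
  assumes [measurable]: "X \<in> sets borel" "Y \<in> sets borel" "Z \<in> sets borel" "X' \<in> sets borel" "Z' \<in> sets borel"
    and eq: "X - {0} = X' - {0}" "Z - {0} = Z' - {0}"
  shows "riesz X Y Z = riesz X' Y Z'"
proof (rule antisym)
  have n: "vol (X - X') = 0" "vol (Z - Z') = 0" "vol (X' - X) = 0" "vol (Z' - Z) = 0"
  proof -
    have z: "vol W = 0" if "W \<subseteq> {0}" for W :: "'a set"
      using that emeasure_mono[of W "{0}" lborel] by simp
    have "X - X' \<subseteq> {0}" "Z - Z' \<subseteq> {0}" "X' - X \<subseteq> {0}" "Z' - Z \<subseteq> {0}" using eq by blast+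
    then show "vol (X - X') = 0" "vol (Z - Z') = 0" "vol (X' - X) = 0" "vol (Z' - Z) = 0"
      by (simp_all only: z)
  qed
  show "riesz X Y Z \<le> riesz X' Y Z'" using riesz_perturb[of X Y Z X' Y Z'] by (simp add: n)
  show "riesz X' Y Z' \<le> riesz X Y Z" using riesz_perturb[of X' Y Z' X Y Z] by (simp add: n)
qed

text \<open>Gap and Riesz integral add up to the same total before and after rearrangement, so an
  increase of the Riesz integrals is a decrease of the gaps. Finiteness of the Riesz integral
  permits the cancellation.\<close>

lemma gap_rearrangement:
  fixes C1 C2 K A1 A2 Cs As :: "'a::euclidean_space set"
  assumes m [measurable]: "C1 \<in> sets borel" "C2 \<in> sets borel" "K \<in> sets borel" "A1 \<in> sets borel" "A2 \<in> sets borel" "Cs \<in> sets borel" "As \<in> sets borel"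
    and fin: "vol C1 < \<infinity>" "vol C2 < \<infinity>" "vol K < \<infinity>" "vol A1 < \<infinity>" "vol A2 < \<infinity>"
    and Cs: "Cs - {0} = centred_ball (measure lborel C1 + measure lborel C2) - {0}"
    and As: "As - {0} = centred_ball (measure lborel A1 + measure lborel A2) - {0}"
  shows "gap Cs (centred_ball (measure lborel K)) As \<le> gap C1 K A1 + gap C2 {y. - y \<in> K} A2"
proof -
  define K' where "K' = {y. - y \<in> K}"
  have K'm [measurable]: "K' \<in> sets borel"
    unfolding K'_def using measurable_sets[of "\<lambda>x. - x" borel borel K] by (simp add: vimage_def)
  have K'e: "vol K' = vol K" using emeasure_lborel_reflect[of K 0] by (simp add: K'_def)
  let ?B = "centred_ball (measure lborel K) :: 'a set"
  have eA: "vol As = vol A1 + vol A2"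
  proof -
    have "vol As = vol (As - {0})" by (rule emeasure_Diff_null_set[symmetric]) auto
    also have "\<dots> = vol (centred_ball (measure lborel A1 + measure lborel A2) :: 'a set)"
      unfolding As by (rule emeasure_Diff_null_set) auto
    also have "\<dots> = ennreal (measure lborel A1) + ennreal (measure lborel A2)" by (simp add: emeasure_centred_ball)
    also have "\<dots> = vol A1 + vol A2" using fin by (simp add: emeasure_eq_ennreal_measure)
    finally show ?thesis .
  qed
  have eB: "vol ?B = vol K"
    using emeasure_eq_ennreal_measure[of lborel K] fin by (simp only: emeasure_centred_ball measure_nonneg) (simp add: less_top)
  have R: "riesz C1 K A1 + riesz C2 K' A2 \<le> riesz Cs ?B As"
    using riesz_pair[OF m(1,2,3,4,5) fin] riesz_null_cong[OF _ _ _ _ _ Cs As, of ?B] by (simp add: K'_def)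
  have Rfin: "riesz Cs ?B As < \<infinity>"
    using riesz_le_YZ[of Cs ?B As] fin by (simp add: eB eA le_less_trans ennreal_mult_less_top)
  have "gap Cs ?B As + riesz Cs ?B As = vol K * (vol A1 + vol A2)"
    by (simp add: gap_plus_riesz eB eA)
  also have "\<dots> = (gap C1 K A1 + riesz C1 K A1) + (gap C2 K' A2 + riesz C2 K' A2)"
    by (simp add: gap_plus_riesz K'e distrib_left)
  also have "\<dots> = (gap C1 K A1 + gap C2 K' A2) + (riesz C1 K A1 + riesz C2 K' A2)" by (simp add: ac_simps)
  also have "\<dots> \<le> (gap C1 K A1 + gap C2 K' A2) + riesz Cs ?B As" by (intro add_left_mono R)
  finally have "riesz Cs ?B As + gap Cs ?B As \<le> riesz Cs ?B As + (gap C1 K A1 + gap C2 K' A2)"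
    by (simp only: add.commute)
  then have "riesz Cs ?B As = \<infinity> \<or> gap Cs ?B As \<le> gap C1 K A1 + gap C2 K' A2"
    by (simp only: ennreal_add_left_cancel_le)
  then show ?thesis unfolding K'_def[symmetric]
  proof
    assume "riesz Cs ?B As = \<infinity>" with Rfin show "gap Cs ?B As \<le> gap C1 K A1 + gap C2 K' A2" by (simp only: less_irrefl)
  qed
qed

section \<open>Nonlocal energies under rearrangement\<close>

text \<open>\<open>ennreal\<close> sends negative numbers to 0, so the integrand is the positive
  part of the increment minus \<open>h\<close>.\<close>

definition hinge_energy :: "real \<Rightarrow> ('a::euclidean_space \<Rightarrow> real) \<Rightarrow> 'a set \<Rightarrow> ennreal" where
  "hinge_energy h g K = (LINT+ x. LINT+ u. ennreal (g (x + u) - g x - h) * indicator K u)"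

definition nonlocal_energy :: "real \<Rightarrow> ('a::euclidean_space \<Rightarrow> real) \<Rightarrow> 'a set \<Rightarrow> ennreal" where
  "nonlocal_energy p g K = (LINT+ x. LINT+ u. ennreal (max 0 (g (x + u) - g x) powr p) * indicator K u)"

text \<open>Layer cake: the positive part of \<open>a - b - h\<close> is the length of the interval
  from \<open>b + h\<close> to \<open>a\<close>. A pair therefore counts at the levels
  \<open>r\<close> for which x lies outside the superlevel set of \<open>r - h\<close> and x + u
  inside that of \<open>r\<close>.\<close>

lemma hinge_energy_layers:
  fixes g :: "'a::euclidean_space \<Rightarrow> real"
  assumes [measurable]: "g \<in> borel_measurable borel" "K \<in> sets borel"
  shows "hinge_energy h g K = (LINT+ r. gap {x. r - h < g x} K {x. r < g x})"
proof -
  let ?c = "\<lambda>x u r. if g x \<le> r - h \<and> u \<in> K \<and> r < g (x + u) then 1 else 0 :: ennreal"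
  have layer: "ennreal (a - b - h) * indicator K u = (LINT+ r. (if b \<le> r - h \<and> u \<in> K \<and> r < a then 1 else 0))" for a b :: real and u
  proof -
    have "(LINT+ r. (if b \<le> r - h \<and> u \<in> K \<and> r < a then 1 else 0)) = (LINT+ r. indicator {b + h..<a} r * indicator K u)"
      by (intro nn_integral_cong) (auto simp: indicator_def)
    also have "\<dots> = vol {b + h..<a} * indicator K u" by (simp add: nn_integral_multc)
    also have "vol {b + h..<a} = ennreal (a - b - h)"
      by (cases "b + h \<le> a") (auto simp: ennreal_neg algebra_simps)
    finally show ?thesis by simp
  qed
  have "hinge_energy h g K = (LINT+ x. LINT+ u. LINT+ r. ?c x u r)"
    unfolding hinge_energy_def layer ..
  also have "\<dots> = (LINT+ x. LINT+ r. LINT+ u. ?c x u r)"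
  proof (rule nn_integral_cong)
    fix x :: 'a
    show "(LINT+ u. LINT+ r. ?c x u r) = (LINT+ r. LINT+ u. ?c x u r)"
      by (rule lborel_pair.Fubini') measurable
  qed
  also have "\<dots> = (LINT+ r. LINT+ x. LINT+ u. ?c x u r)"
    by (rule lborel_pair.Fubini') measurable
  also have "\<dots> = (LINT+ r. gap {x. r - h < g x} K {x. r < g x})"
    unfolding gap_def by (intro nn_integral_cong) (auto simp: indicator_def)
  finally show ?thesis .
qed

lemma hinge_energy_reflect:
  fixes g :: "'a::euclidean_space \<Rightarrow> real"
  assumes [measurable]: "g \<in> borel_measurable borel" "K \<in> sets borel"
  shows "hinge_energy h g {y. - y \<in> K} = (LINT+ x. LINT+ u. ennreal (g x - g (x + u) - h) * indicator K u)"
proof -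
  have "hinge_energy h g {y. - y \<in> K} = (LINT+ x. LINT+ u. ennreal (g (x - (0 - u)) - g x - h) * indicator K (0 - u))"
    unfolding hinge_energy_def by (intro nn_integral_cong) (simp add: indicator_def)
  also have "\<dots> = (LINT+ x. LINT+ u. ennreal (g (x - u) - g x - h) * indicator K u)"
  proof (rule nn_integral_cong)
    fix x :: 'a
    show "(LINT+ u. ennreal (g (x - (0 - u)) - g x - h) * indicator K (0 - u)) = (LINT+ u. ennreal (g (x - u) - g x - h) * indicator K u)"
      by (rule nn_integral_lborel_reflect) measurable
  qed
  also have "\<dots> = (LINT+ u. LINT+ x. ennreal (g (x - u) - g x - h) * indicator K u)"
    by (rule lborel_pair.Fubini') measurable
  also have "\<dots> = (LINT+ u. LINT+ x. ennreal (g ((u + x) - u) - g (u + x) - h) * indicator K u)"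
  proof (rule nn_integral_cong)
    fix u :: 'a
    show "(LINT+ x. ennreal (g (x - u) - g x - h) * indicator K u) = (LINT+ x. ennreal (g ((u + x) - u) - g (u + x) - h) * indicator K u)"
      by (rule nn_integral_lborel_translate[symmetric]) measurable
  qed
  also have "\<dots> = (LINT+ u. LINT+ x. ennreal (g x - g (x + u) - h) * indicator K u)"
    by (simp add: add.commute)
  also have "\<dots> = (LINT+ x. LINT+ u. ennreal (g x - g (x + u) - h) * indicator K u)"
    by (rule lborel_pair.Fubini') measurable
  finally show ?thesis .
qed

text \<open>If the positive part of \<open>f\<close> climbs from x to x + u, the negative part does
  not climb, and conversely a falling negative part goes with a positive part that does not fall. So
  if only one hinge is active it is at most the hinge of \<open>f\<close>, and if both are,
  \<open>h\<close> is subtracted once more on the left. A fall of the negative part along u is a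
  climb along -u, whence the reflected \<open>K\<close>.\<close>

lemma hinge_energy_pos_neg:
  fixes f :: "'a::euclidean_space \<Rightarrow> real"
  assumes [measurable]: "f \<in> borel_measurable borel" "K \<in> sets borel" and h: "0 \<le> h"
  shows "hinge_energy h (\<lambda>x. max 0 (f x)) K + hinge_energy h (\<lambda>x. max 0 (- f x)) {y. - y \<in> K} \<le> hinge_energy h f K"
proof -
  have "hinge_energy h (\<lambda>x. max 0 (f x)) K + hinge_energy h (\<lambda>x. max 0 (- f x)) {y. - y \<in> K} =
     (LINT+ x. LINT+ u. ennreal (max 0 (f (x + u)) - max 0 (f x) - h) * indicator K u + ennreal (max 0 (- f x) - max 0 (- f (x + u)) - h) * indicator K u)"
    by (subst hinge_energy_reflect, measurable)
      (simp add: hinge_energy_def nn_integral_add)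
  also have "\<dots> \<le> hinge_energy h f K"
    unfolding hinge_energy_def
  proof (intro nn_integral_mono)
    fix x u :: 'a
    have "ennreal (max 0 (f (x + u)) - max 0 (f x) - h) + ennreal (max 0 (- f x) - max 0 (- f (x + u)) - h) =
        ennreal (max 0 (max 0 (f (x + u)) - max 0 (f x) - h)) + ennreal (max 0 (max 0 (- f x) - max 0 (- f (x + u)) - h))"
      by (simp add: max_def ennreal_neg)
    also have "\<dots> = ennreal (max 0 (max 0 (f (x + u)) - max 0 (f x) - h) + max 0 (max 0 (- f x) - max 0 (- f (x + u)) - h))"
      by (rule ennreal_plus[symmetric]) auto
    also have "\<dots> \<le> ennreal (max 0 (f (x + u) - f x - h))"
      using h by (intro ennreal_leI) (auto simp: max_def)
    also have "\<dots> = ennreal (f (x + u) - f x - h)" by (simp add: max_def ennreal_neg)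
    finally show "ennreal (max 0 (f (x + u)) - max 0 (f x) - h) * indicator K u + ennreal (max 0 (- f x) - max 0 (- f (x + u)) - h) * indicator K u
      \<le> ennreal (f (x + u) - f x - h) * indicator K u"
      by (auto simp: indicator_def)
  qed
  finally show ?thesis .
qed

text \<open>For p > 1 the measure has the second derivative p(p-1)h^(p-2) of the power as density,
  which is integrable at 0 also for p < 2; for p = 1 it is the unit mass at 0. The same mixture
  later proves Jensen's inequality.\<close>

lemma powr_hinge_mixture:
  assumes p: "1 \<le> (p::real)"
  shows "\<exists>M :: real measure. sigma_finite_measure M \<and> sets M = sets borel \<and> (AE h in M. 0 \<le> h) \<and>
    (\<forall>t. ennreal (max 0 t powr p) = (\<integral>\<^sup>+h. ennreal (t - h) \<partial>M))"
proof (cases "p = 1")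
  case True
  define M where "M = return borel (0::real)"
  interpret prob_space M unfolding M_def by (rule prob_space_return) simp
  show ?thesis
  proof (intro exI[of _ M] conjI allI)
    show "sigma_finite_measure M" by unfold_locales
    show "sets M = sets borel" by (simp add: M_def)
    show "AE h in M. 0 \<le> h" unfolding M_def by (subst AE_return) auto
    show "ennreal (max 0 t powr p) = (\<integral>\<^sup>+h. ennreal (t - h) \<partial>M)" for t
      unfolding M_def using True by (subst nn_integral_return) (auto simp: max_def ennreal_neg)
  qed
next
  case False
  then have p1: "1 < p" using p by simp
  define k where "k h = p * (p - 1) * h powr (p - 2)" for h :: real
  define M where "M = density lborel (\<lambda>h. ennreal (k h) * indicator {0..} h)"
  have km [measurable]: "k \<in> borel_measurable borel" unfolding k_def[abs_def] by measurable
  have int: "(\<integral>\<^sup>+h. ennreal (t - h) \<partial>M) = ennreal (max 0 t powr p)" for t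
  proof -
    have "(\<integral>\<^sup>+h. ennreal (t - h) \<partial>M) = (LINT+ h. ennreal (k h) * indicator {0..} h * ennreal (t - h))"
      unfolding M_def by (rule nn_integral_density) measurable
    also have "\<dots> = (LINT+ h. ennreal ((k h * (t - h)) * indicator {0..t} h))"
    proof (rule nn_integral_cong)
      fix h :: real
      have "k h \<ge> 0" using p1 by (simp add: k_def)
      then show "ennreal (k h) * indicator {0..} h * ennreal (t - h) = ennreal ((k h * (t - h)) * indicator {0..t} h)"
        by (cases "h \<le> t") (auto simp: indicator_def ennreal_mult ennreal_neg)
    qed
    also have "\<dots> = ennreal (max 0 t powr p)"
    proof (cases "0 \<le> t")
      case True
      have "((\<lambda>h. (p * (p - 1)) * (t * h powr (p - 2) - h powr (p - 1))) has_integral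
          (p * (p - 1)) * (t * (t powr (p - 2 + 1) / (p - 2 + 1)) - t powr (p - 1 + 1) / (p - 1 + 1))) {0..t}"
        using p1 True by (intro has_integral_mult_right has_integral_diff has_integral_powr_from_0) auto
      also have "(p * (p - 1)) * (t * (t powr (p - 2 + 1) / (p - 2 + 1)) - t powr (p - 1 + 1) / (p - 1 + 1)) = t powr p"
      proof -
        have "t * t powr (p - 1) = t powr p" using True p1 by (cases "t = 0") (auto simp: powr_mult_base)
        moreover have "(p * (p - 1)) * (s / (p - 1) - s / p) = s" for s :: real
        proof -
          have "(p * (p - 1)) * (s / (p - 1)) = p * s" "(p * (p - 1)) * (s / p) = (p - 1) * s" using p1 by auto
          then have "(p * (p - 1)) * (s / (p - 1) - s / p) = p * s - (p - 1) * s" by (simp only: right_diff_distrib)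
          then show ?thesis by (simp add: algebra_simps)
        qed
        ultimately show ?thesis by simp
      qed
      also have "((\<lambda>h. (p * (p - 1)) * (t * h powr (p - 2) - h powr (p - 1))) has_integral t powr p) {0..t}
         \<longleftrightarrow> ((\<lambda>h. k h * (t - h)) has_integral t powr p) {0..t}"
      proof (rule has_integral_cong)
        fix h assume "h \<in> {0..t}"
        then have "h * h powr (p - 2) = h powr (p - 1)" using p1 by (cases "h = 0") (auto simp: powr_mult_base)
        then show "(p * (p - 1)) * (t * h powr (p - 2) - h powr (p - 1)) = k h * (t - h)"
          by (simp add: k_def algebra_simps)
      qed
      finally have "((\<lambda>h. k h * (t - h)) has_integral t powr p) {0..t}" .
      then have hi: "((\<lambda>h. (k h * (t - h)) * indicator {0..t} h) has_integral t powr p) UNIV"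
      proof -
        assume "((\<lambda>h. k h * (t - h)) has_integral t powr p) {0..t}"
        then have "((\<lambda>h. if h \<in> {0..t} then k h * (t - h) else 0) has_integral t powr p) UNIV"
          by (simp only: has_integral_restrict_UNIV)
        also have "(\<lambda>h. if h \<in> {0..t} then k h * (t - h) else 0) = (\<lambda>h. (k h * (t - h)) * indicator {0..t} h)"
          by (auto simp: fun_eq_iff indicator_def)
        finally show ?thesis .
      qed
      have "(LINT+ h. ennreal ((k h * (t - h)) * indicator {0..t} h)) = ennreal (t powr p)"
        using p1 by (intro nn_integral_has_integral_lborel[OF _ _ hi]) (auto simp: indicator_def k_def)
      then show ?thesis using True by (simp add: max_def)
    next
      case False
      then have "max 0 t powr p = 0" by simp
      moreover have "{0..t} = {}" using False by simp
      ultimately show ?thesis by simp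
    qed
    finally show ?thesis .
  qed
  show ?thesis
  proof (intro exI[of _ M] conjI allI)
    show "sigma_finite_measure M" unfolding M_def
      by (rule sigma_finite_measure.sigma_finite_iff_density_finite[OF sigma_finite_lborel, THEN iffD2]) (auto simp: indicator_def)
    show "sets M = sets borel" by (simp add: M_def)
    show "AE h in M. 0 \<le> h" unfolding M_def by (subst AE_density) (auto simp: indicator_def)
    show "ennreal (max 0 t powr p) = (\<integral>\<^sup>+h. ennreal (t - h) \<partial>M)" for t by (simp add: int)
  qed
qed

lemma nonlocal_energy_mixture:
  fixes g :: "'a::euclidean_space \<Rightarrow> real"
  assumes [measurable]: "g \<in> borel_measurable borel" "K \<in> sets borel"
    and M: "sigma_finite_measure M" and sM [measurable_cong]: "sets M = sets borel"
    and mix: "\<And>t. ennreal (max 0 t powr p) = (\<integral>\<^sup>+h. ennreal (t - h) \<partial>M)"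
  shows "nonlocal_energy p g K = (\<integral>\<^sup>+h. hinge_energy h g K \<partial>M)"
proof -
  interpret M: sigma_finite_measure M by fact
  interpret P: pair_sigma_finite "lborel :: 'a measure" M by unfold_locales
  have "nonlocal_energy p g K = (LINT+ x. LINT+ u. \<integral>\<^sup>+h. ennreal (g (x + u) - g x - h) * indicator K u \<partial>M)"
    unfolding nonlocal_energy_def mix
    by (intro nn_integral_cong, subst nn_integral_multc) (auto simp: measurable_cong_sets[OF sM refl])
  also have "\<dots> = (LINT+ x. \<integral>\<^sup>+h. (LINT+ u. ennreal (g (x + u) - g x - h) * indicator K u) \<partial>M)"
  proof (rule nn_integral_cong)
    fix x :: 'a
    show "(LINT+ u. \<integral>\<^sup>+h. ennreal (g (x + u) - g x - h) * indicator K u \<partial>M) = (\<integral>\<^sup>+h. (LINT+ u. ennreal (g (x + u) - g x - h) * indicator K u) \<partial>M)"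
      by (rule P.Fubini'[symmetric]) measurable
  qed
  also have "\<dots> = (\<integral>\<^sup>+h. (LINT+ x. LINT+ u. ennreal (g (x + u) - g x - h) * indicator K u) \<partial>M)"
    by (rule P.Fubini'[symmetric]) measurable
  also have "\<dots> = (\<integral>\<^sup>+h. hinge_energy h g K \<partial>M)" by (simp add: hinge_energy_def)
  finally show ?thesis .
qed

text \<open>The mixture and the layers reduce the claim to one hinge and one level, where the level
  sets of the positive and the negative part of \<open>f\<close> are the two triples of
  \<open>gap_rearrangement\<close>.\<close>

theorem nonlocal_energy_rearrangement:
  fixes f fs :: "'a::euclidean_space \<Rightarrow> real"
  assumes p: "1 \<le> p" and [measurable]: "f \<in> borel_measurable borel" "K \<in> sets borel" "fs \<in> borel_measurable borel"
    and K: "vol K < \<infinity>"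
    and fin: "\<And>s. 0 < s \<Longrightarrow> vol {x. s < \<bar>f x\<bar>} < \<infinity>"
    and fs0: "\<And>x. 0 \<le> fs x"
    and fs: "\<And>s. 0 < s \<Longrightarrow> {x. s < fs x} - {0} = centred_ball (measure lborel {x. s < \<bar>f x\<bar>}) - {0}"
  shows "nonlocal_energy p fs (centred_ball (measure lborel K)) \<le> nonlocal_energy p f K"
proof -
  let ?f1 = "\<lambda>x. max 0 (f x)" and ?f2 = "\<lambda>x. max 0 (- f x)"
  let ?B = "centred_ball (measure lborel K) :: 'a set"
  define K' where "K' = {y. - y \<in> K}"
  have K'm [measurable]: "K' \<in> sets borel"
    unfolding K'_def using measurable_sets[of "\<lambda>x. - x" borel borel K] by (simp add: vimage_def)
  have fin12: "vol {x. s < ?f1 x} < \<infinity>" "vol {x. s < ?f2 x} < \<infinity>"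
    "measure lborel {x. s < \<bar>f x\<bar>} = measure lborel {x. s < ?f1 x} + measure lborel {x. s < ?f2 x}" if s: "0 < s" for s
  proof -
    have fm: "{x. s < \<bar>f x\<bar>} \<in> fmeasurable lborel" using fin[OF s] by (intro fmeasurableI) auto
    have fm12: "{x. s < ?f1 x} \<in> fmeasurable lborel" "{x. s < ?f2 x} \<in> fmeasurable lborel"
      using s by (auto intro!: fmeasurableI2[OF fm])
    then show "vol {x. s < ?f1 x} < \<infinity>" "vol {x. s < ?f2 x} < \<infinity>"
      by (auto simp: fmeasurable_def)
    have "{x. s < \<bar>f x\<bar>} = {x. s < ?f1 x} \<union> {x. s < ?f2 x}" using s by auto
    then show "measure lborel {x. s < \<bar>f x\<bar>} = measure lborel {x. s < ?f1 x} + measure lborel {x. s < ?f2 x}"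
      using fm12 s by (simp only:) (intro measure_Un_AE, auto)
  qed
  have hinge: "hinge_energy h fs ?B \<le> hinge_energy h f K" if h: "0 \<le> h" for h
  proof -
    have "hinge_energy h fs ?B = (LINT+ r. gap {x. r - h < fs x} ?B {x. r < fs x})"
      by (rule hinge_energy_layers) measurable
    also have "\<dots> \<le> (LINT+ r. gap {x. r - h < ?f1 x} K {x. r < ?f1 x} + gap {x. r - h < ?f2 x} K' {x. r < ?f2 x})"
    proof (rule nn_integral_mono_AE, use AE_lborel_singleton[of h] in eventually_elim)
      fix r assume "r \<noteq> h"
      show "gap {x. r - h < fs x} ?B {x. r < fs x} \<le> gap {x. r - h < ?f1 x} K {x. r < ?f1 x} + gap {x. r - h < ?f2 x} K' {x. r < ?f2 x}"
      proof (cases "h < r")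
        case True
        then show ?thesis unfolding K'_def
          using h fs[of "r - h"] fs[of r] fin12[of "r - h"] fin12[of r] K
          by (intro gap_rearrangement) auto
      next
        case False
        \<comment> \<open>A negative level is exceeded everywhere because \<open>fs\<close> is
          nonnegative; the complement is empty and the gap vanishes.\<close>
        then have "{x. r - h < fs x} = UNIV" using \<open>r \<noteq> h\<close> fs0 by (auto intro: less_le_trans[of _ 0])
        then show ?thesis by (simp add: gap_def)
      qed
    qed
    also have "\<dots> = hinge_energy h ?f1 K + hinge_energy h ?f2 K'"
    proof -
      have m: "(\<lambda>r. gap {x. r - h < g x} V {x. r < g x}) \<in> borel_measurable lborel"
        if [measurable]: "g \<in> borel_measurable borel" "V \<in> sets borel" for g :: "'a \<Rightarrow> real" and V
      proof -
        have "(\<lambda>r. gap {x. r - h < g x} V {x. r < g x}) = (\<lambda>r. LINT+ x. LINT+ u. (if g x \<le> r - h \<and> u \<in> V \<and> r < g (x + u) then 1 else 0))"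
          unfolding gap_def by (intro ext nn_integral_cong) (auto simp: indicator_def)
        also have "\<dots> \<in> borel_measurable lborel" by measurable
        finally show ?thesis .
      qed
      show ?thesis
        by (subst nn_integral_add[OF m m]) (simp_all add: hinge_energy_layers)
    qed
    also have "\<dots> \<le> hinge_energy h f K"
      unfolding K'_def using h by (intro hinge_energy_pos_neg) auto
    finally show ?thesis .
  qed
  obtain M where M: "sigma_finite_measure M" "sets M = sets borel" "AE h in M. 0 \<le> h"
    "\<And>t. ennreal (max 0 t powr p) = (\<integral>\<^sup>+h. ennreal (t - h) \<partial>M)"
    using powr_hinge_mixture[OF p] by blast
  have "nonlocal_energy p fs ?B = (\<integral>\<^sup>+h. hinge_energy h fs ?B \<partial>M)"
    by (rule nonlocal_energy_mixture) (use M in auto)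
  also have "\<dots> \<le> (\<integral>\<^sup>+h. hinge_energy h f K \<partial>M)"
    using M(3) hinge by (intro nn_integral_mono_AE) (auto elim: eventually_mono)
  also have "\<dots> = nonlocal_energy p f K"
    by (rule nonlocal_energy_mixture[symmetric]) (use M in auto)
  finally show ?thesis .
qed

lemma sgn_borel_measurable [measurable]: "(sgn :: 'a::euclidean_space \<Rightarrow> 'a) \<in> borel_measurable borel"
  unfolding sgn_div_norm[abs_def] by measurable

section \<open>Polar coordinates\<close>

text \<open>Push-forward to the Borel sets of the whole space, so that products with
  \<open>lborel\<close> carry the ordinary product sigma-algebra.\<close>

definition sphere_borel :: "((real, 'n::{finite,wellorder}) vec) measure" where
  "sphere_borel = distr sphere_haar borel (\<lambda>x. x)"

lemma sphere_borel_measurable: "(\<lambda>x. x) \<in> borel_measurable (sphere_haar :: ((real, 'n::{finite,wellorder}) vec) measure)"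
  by (rule sphere_haar_id[OF is_sphere_haar_sphere_haar])

lemma sets_sphere_borel [measurable_cong, simp]: "sets sphere_borel = sets borel"
  by (simp add: sphere_borel_def)

lemma prob_space_sphere_borel: "prob_space (sphere_borel :: ((real, 'n::{finite,wellorder}) vec) measure)"
  unfolding sphere_borel_def
  using is_sphere_haar_sphere_haar sphere_borel_measurable
  by (intro prob_space.prob_space_distr) (auto simp: is_sphere_haar_def)

lemma nn_integral_sphere_haar:
  fixes \<phi> :: "(real, 'n::{finite,wellorder}) vec \<Rightarrow> ennreal"
  assumes "\<phi> \<in> borel_measurable borel"
  shows "(\<integral>\<^sup>+u. \<phi> u \<partial>sphere_haar) = (\<integral>\<^sup>+u. \<phi> u \<partial>sphere_borel)"
  unfolding sphere_borel_def using assms sphere_borel_measurable by (subst nn_integral_distr) auto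

lemma AE_sphere_borel: "AE u in (sphere_borel :: ((real, 'n::{finite,wellorder}) vec) measure). norm u = 1"
proof -
  have "AE u in (sphere_haar :: ((real, 'n) vec) measure). norm u = 1"
    by (intro AE_I2) (simp add: sphere_haar_space[OF is_sphere_haar_sphere_haar])
  then show ?thesis unfolding sphere_borel_def using sphere_borel_measurable by (subst AE_distr_iff) auto
qed

text \<open>Haar measure is the radial projection of the uniform distribution on the ball, by
  \<open>sphere_haar_eq_cone_measure\<close>; here in a form free of restricted spaces.\<close>

lemma emeasure_sphere_borel:
  fixes A :: "((real, 'n::{finite,wellorder}) vec) set"
  assumes A [measurable]: "A \<in> sets borel"
  shows "ennreal (unit_ball_vol (real CARD('n))) * emeasure sphere_borel A = vol {x \<in> ball 0 1 - {0}. sgn x \<in> A}"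
proof -
  define B :: "((real, 'n) vec) set" where "B = ball 0 1 - {0}"
  define L where "L = restrict_space lborel B"
  define U where "U = uniform_measure L B"
  define R where "R = restrict_space borel (sphere (0::(real, 'n) vec) 1)"
  have B [measurable]: "B \<in> sets borel" by (simp add: B_def)
  have spL: "space L = B" by (simp add: L_def space_restrict_space)
  have spU: "space U = B" by (simp add: U_def spL)
  have BL: "B \<in> sets L" using sets.top[of L] spL by simp
  have emB: "vol B = ennreal (unit_ball_vol (real CARD('n)))"
  proof -
    have "vol B = vol (ball (0::(real, 'n) vec) 1)"
      unfolding B_def by (intro emeasure_Diff_null_set) (auto intro: finite_imp_null_set_lborel)
    then show ?thesis by (simp add: emeasure_ball)
  qed
  have emL: "emeasure L X = vol X" if "X \<subseteq> B" for X
    unfolding L_def by (rule emeasure_restrict_space) (use that in auto)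
  have sm: "sgn \<in> measurable U R"
    unfolding R_def
  proof (rule measurable_restrict_space2)
    show "sgn \<in> space U \<rightarrow> sphere 0 1" by (auto simp: spU B_def norm_sgn)
    have "sgn \<in> borel_measurable L" unfolding L_def by (intro measurable_restrict_space1) simp
    then show "sgn \<in> borel_measurable U" unfolding U_def by simp
  qed
  have cone: "(sphere_haar :: ((real, 'n) vec) measure) = distr U R sgn"
    unfolding sphere_haar_eq_cone_measure by (simp add: cone_measure_def U_def L_def R_def B_def)
  have mR: "(\<lambda>x. x) \<in> measurable R borel" unfolding R_def by (intro measurable_restrict_space1) simp
  have "emeasure sphere_borel A = emeasure (distr U borel sgn) A"
    unfolding sphere_borel_def cone using sm mR by (subst distr_distr) (auto simp: comp_def)
  also have "\<dots> = emeasure U {x \<in> B. sgn x \<in> A}"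
    using measurable_comp[OF sm mR] by (subst emeasure_distr) (auto simp: comp_def spU intro!: arg_cong[where f="emeasure U"])
  also have "\<dots> = emeasure L (B \<inter> {x \<in> B. sgn x \<in> A}) / emeasure L B"
    unfolding U_def
  proof (rule emeasure_uniform_measure[OF BL])
    have "{x \<in> B. sgn x \<in> A} \<in> sets borel" by measurable
    then show "{x \<in> B. sgn x \<in> A} \<in> sets L" unfolding L_def by (subst sets_restrict_space_iff) auto
  qed
  also have "B \<inter> {x \<in> B. sgn x \<in> A} = {x \<in> B. sgn x \<in> A}" by auto
  also have "emeasure L {x \<in> B. sgn x \<in> A} = vol {x \<in> B. sgn x \<in> A}" by (rule emL) auto
  also have "emeasure L B = ennreal (unit_ball_vol (real CARD('n)))" by (simp add: emL emB)
  finally have "ennreal (unit_ball_vol (real CARD('n))) * emeasure sphere_borel A =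
     ennreal (unit_ball_vol (real CARD('n))) * (vol {x \<in> B. sgn x \<in> A} / ennreal (unit_ball_vol (real CARD('n))))"
    by simp
  also have "\<dots> = vol {x \<in> B. sgn x \<in> A}"
  proof -
    have "ennreal (unit_ball_vol (real CARD('n))) \<noteq> 0" using unit_ball_vol_pos[of "real CARD('n)"] by (simp add: less_imp_neq[symmetric])
    then show ?thesis
      by (simp add: ennreal_times_divide ennreal_mult_divide_eq mult.commute[of "ennreal _"])
  qed
  finally show ?thesis by (simp add: B_def)
qed

lemma emeasure_cone_sector:
  fixes A :: "((real, 'n::{finite,wellorder}) vec) set"
  assumes A [measurable]: "A \<in> sets borel" and c: "0 < c"
  shows "vol {x. 0 < norm x ^ CARD('n) \<and> norm x ^ CARD('n) < c \<and> sgn x \<in> A} =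
    ennreal (c * unit_ball_vol (real CARD('n))) * emeasure sphere_borel A"
proof -
  have [simp]: "(0::real) ^ CARD('n) = 0" by (simp add: zero_power)
  define r where "r = root CARD('n) c"
  have r: "0 < r" "r ^ CARD('n) = c" using c by (auto simp: r_def real_root_pow_pos2 real_root_gt_zero)
  let ?P = "{x \<in> ball 0 1 - {0::(real, 'n) vec}. sgn x \<in> A}"
  have pow: "norm y ^ CARD('n) < c \<longleftrightarrow> norm y < r" for y :: "(real, 'n) vec"
    using r by (metis norm_ge_zero order_less_imp_le power_less_imp_less_base power_strict_mono zero_less_card_finite)
  have "vol {x. 0 < norm x ^ CARD('n) \<and> norm x ^ CARD('n) < c \<and> sgn x \<in> A} =
      (LINT+ x. indicator {x. 0 < norm x ^ CARD('n) \<and> norm x ^ CARD('n) < c \<and> sgn x \<in> A} x)"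
    by (subst nn_integral_indicator) auto
  also have "\<dots> = ennreal (\<bar>r\<bar> ^ DIM((real, 'n) vec)) *
      (LINT+ x. indicator {x. 0 < norm x ^ CARD('n) \<and> norm x ^ CARD('n) < c \<and> sgn x \<in> A} (0 + r *\<^sub>R x))"
    using r by (intro nn_integral_lborel_affine) auto
  also have "(LINT+ x. indicator {x. 0 < norm x ^ CARD('n) \<and> norm x ^ CARD('n) < c \<and> sgn x \<in> A} (0 + r *\<^sub>R x))
     = (LINT+ x. indicator ?P x)"
    using r by (intro nn_integral_cong) (simp add: indicator_def pow sgn_scaleR del: norm_scaleR, auto simp: zero_less_mult_iff)
  also have "\<dots> = vol ?P" by (subst nn_integral_indicator) auto
  also have "\<dots> = ennreal (unit_ball_vol (real CARD('n))) * emeasure sphere_borel A"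
    by (rule emeasure_sphere_borel[symmetric]) simp
  finally show ?thesis using r c by (simp add: ennreal_mult mult.assoc)
qed

text \<open>The volume of a cone sector is linear in the n-th power of its radius, so |x|^n has
  constant density on the points with direction in \<open>A\<close>.\<close>

lemma distr_radius:
  fixes A :: "((real, 'n::{finite,wellorder}) vec) set"
  assumes A [measurable]: "A \<in> sets borel" and T [measurable]: "T \<in> sets borel"
  shows "vol {x. x \<noteq> 0 \<and> norm x ^ CARD('n) \<in> T \<and> sgn x \<in> A} =
    ennreal (unit_ball_vol (real CARD('n))) * vol (T \<inter> {0<..}) * emeasure sphere_borel A"
proof -
  have [simp]: "(0::real) ^ CARD('n) = 0" by (simp add: zero_power)
  interpret S: prob_space "sphere_borel :: ((real, 'n) vec) measure" by (rule prob_space_sphere_borel)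
  define w where "w = unit_ball_vol (real CARD('n)) * measure sphere_borel A"
  have w: "ennreal w = ennreal (unit_ball_vol (real CARD('n))) * emeasure sphere_borel A" "0 \<le> w"
    by (simp_all add: w_def S.emeasure_eq_measure ennreal_mult)
  define M1 where "M1 = distr (density lborel (indicator {x::(real, 'n) vec. x \<noteq> 0 \<and> sgn x \<in> A})) borel (\<lambda>x. norm x ^ CARD('n))"
  define M2 where "M2 = density lborel (\<lambda>t::real. ennreal w * indicator {0<..} t)"
  have M1: "emeasure M1 T = vol {x. x \<noteq> 0 \<and> norm x ^ CARD('n) \<in> T \<and> sgn x \<in> A}" if [measurable]: "T \<in> sets borel" for T
  proof -
    have "emeasure M1 T = emeasure (density lborel (indicator {x::(real, 'n) vec. x \<noteq> 0 \<and> sgn x \<in> A})) ((\<lambda>x. norm x ^ CARD('n)) -` T)"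
      unfolding M1_def by (subst emeasure_distr) auto
    also have "\<dots> = (LINT+ x. indicator {x::(real, 'n) vec. x \<noteq> 0 \<and> sgn x \<in> A} x * indicator ((\<lambda>x. norm x ^ CARD('n)) -` T) x)"
      by (subst emeasure_density) (auto intro!: measurable_sets_borel[OF _ that])
    also have "\<dots> = (LINT+ x. indicator {x. x \<noteq> 0 \<and> norm x ^ CARD('n) \<in> T \<and> sgn x \<in> A} x)"
      by (intro nn_integral_cong) (auto simp: indicator_def)
    also have "\<dots> = vol {x. x \<noteq> 0 \<and> norm x ^ CARD('n) \<in> T \<and> sgn x \<in> A}"
      by (subst nn_integral_indicator) auto
    finally show ?thesis .
  qed
  have M2: "emeasure M2 T = ennreal w * vol (T \<inter> {0<..})" if [measurable]: "T \<in> sets borel" for T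
  proof -
    have "emeasure M2 T = (LINT+ t. ennreal w * indicator {0<..} t * indicator T t)"
      unfolding M2_def by (subst emeasure_density) auto
    also have "\<dots> = (LINT+ t. ennreal w * indicator (T \<inter> {0<..}) t)"
      by (intro nn_integral_cong) (auto simp: indicator_def)
    also have "\<dots> = ennreal w * vol (T \<inter> {0<..})" by (simp add: nn_integral_cmult_indicator)
    finally show ?thesis .
  qed
  have gen: "emeasure M1 {..<c} = emeasure M2 {..<c}" for c
  proof (cases "0 < c")
    case True
    have "emeasure M1 {..<c} = vol {x. 0 < norm x ^ CARD('n) \<and> norm x ^ CARD('n) < c \<and> sgn x \<in> A}"
      by (subst M1) (auto intro!: arg_cong[where f="vol"])
    also have "\<dots> = ennreal (c * unit_ball_vol (real CARD('n))) * emeasure sphere_borel A"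
      by (rule emeasure_cone_sector[OF A True])
    also have "\<dots> = ennreal c * ennreal w" using True by (simp add: ennreal_mult w mult.assoc)
    also have "\<dots> = emeasure M2 {..<c}"
    proof -
      have "{..<c} \<inter> {0<..} = {0<..<c}" by auto
      then show ?thesis using True by (simp add: M2 mult.commute)
    qed
    finally show ?thesis .
  next
    case False
    have e: "{x. x \<noteq> 0 \<and> norm x ^ CARD('n) \<in> {..<c} \<and> sgn x \<in> A} = ({} :: ((real, 'n) vec) set)"
      using False by (auto simp: not_less intro: order_trans)
    have e2: "{..<c} \<inter> {0<..} = {}" using False by auto
    have "emeasure M1 {..<c} = 0" unfolding M1[OF lessThan_borel] e by (simp only: emeasure_empty)
    moreover have "emeasure M2 {..<c} = 0" unfolding M2[OF lessThan_borel] e2 by simp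
    ultimately show ?thesis by simp
  qed
  have "M1 = M2"
  proof (rule measure_eqI_generator_eq[where E="range lessThan" and \<Omega>=UNIV and A="\<lambda>n. {..<real n}"])
    show "Int_stable (range (lessThan :: real \<Rightarrow> _))"
    proof (rule Int_stableI)
      fix a b :: "real set" assume "a \<in> range lessThan" "b \<in> range lessThan"
      then obtain x y where "a = {..<x}" "b = {..<y}" by auto
      then have "a \<inter> b = {..<min x y}" by auto
      then show "a \<inter> b \<in> range lessThan" by blast
    qed
    show "sets M1 = sigma_sets UNIV (range lessThan)" "sets M2 = sigma_sets UNIV (range lessThan)"
      by (simp_all add: M1_def M2_def borel_Iio)
    show "(\<Union>n. {..<real n}) = UNIV" using reals_Archimedean2 by auto
    show "emeasure M1 {..<real n} \<noteq> \<infinity>" for n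
    proof -
      have "emeasure M2 {..<real n} \<le> ennreal w * vol {0<..<real n}"
        unfolding M2[OF lessThan_borel] by (intro mult_left_mono emeasure_mono) auto
      also have "\<dots> < \<infinity>" by (simp add: ennreal_mult_less_top)
      finally show ?thesis by (simp add: gen)
    qed
    show "emeasure M1 X = emeasure M2 X" if "X \<in> range lessThan" for X
      using that gen by blast
  qed auto
  then have "emeasure M1 T = emeasure M2 T" by simp
  then show ?thesis unfolding M1[OF T] M2[OF T] w by (simp add: ac_simps)
qed

text \<open>The variable \<open>t = |x|^n\<close> is used instead of \<open>|x|\<close>, so that no density is needed.\<close>

theorem nn_integral_polar:
  fixes H :: "real \<Rightarrow> (real, 'n::{finite,wellorder}) vec \<Rightarrow> ennreal"
  assumes H [measurable]: "(\<lambda>(t, \<theta>). H t \<theta>) \<in> borel_measurable (borel \<Otimes>\<^sub>M borel)"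
  shows "(LINT+ x. H (norm x ^ CARD('n)) (sgn x)) =
    ennreal (unit_ball_vol (real CARD('n))) * (\<integral>\<^sup>+\<theta>. (LINT+ t. H t \<theta> * indicator {0<..} t) \<partial>sphere_borel)"
proof -
  interpret S: prob_space "sphere_borel :: ((real, 'n) vec) measure" by (rule prob_space_sphere_borel)
  define w where "w = unit_ball_vol (real CARD('n))"
  define M1 where "M1 = density lborel (\<lambda>t::real. ennreal w * indicator {0<..} t)"
  have sf: "sigma_finite_measure M1"
    unfolding M1_def
    by (rule sigma_finite_measure.sigma_finite_iff_density_finite[OF sigma_finite_lborel, THEN iffD2]) (auto simp: indicator_def)
  interpret M1: sigma_finite_measure M1 by (rule sf)
  interpret P: pair_sigma_finite M1 "sphere_borel :: ((real, 'n) vec) measure" by unfold_locales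
  have sM1 [measurable_cong]: "sets M1 = sets borel" by (simp add: M1_def)
  define D where "D = distr (density lborel (indicator {x::(real, 'n) vec. x \<noteq> 0})) (borel \<Otimes>\<^sub>M borel) (\<lambda>x. (norm x ^ CARD('n), sgn x))"
  have "M1 \<Otimes>\<^sub>M sphere_borel = D"
  proof (rule pair_measure_eqI[OF sf])
    show "sigma_finite_measure (sphere_borel :: ((real, 'n) vec) measure)" by unfold_locales
    show "sets (M1 \<Otimes>\<^sub>M sphere_borel) = sets D" by (simp add: D_def sM1 cong: sets_pair_measure_cong)
    fix T and A :: "((real, 'n) vec) set" assume "T \<in> sets M1" "A \<in> sets sphere_borel"
    then have [measurable]: "T \<in> sets borel" "A \<in> sets borel" by (simp_all add: sM1)
    have "emeasure M1 T = (LINT+ t. ennreal w * indicator {0<..} t * indicator T t)"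
      unfolding M1_def by (subst emeasure_density) auto
    also have "\<dots> = (LINT+ t. ennreal w * indicator (T \<inter> {0<..}) t)"
      by (intro nn_integral_cong) (auto simp: indicator_def)
    also have "\<dots> = ennreal w * vol (T \<inter> {0<..})" by (simp add: nn_integral_cmult_indicator)
    finally have 1: "emeasure M1 T = ennreal w * vol (T \<inter> {0<..})" .
    have m: "(\<lambda>x. (norm x ^ CARD('n), sgn x)) -` (T \<times> A) \<in> sets (borel :: ((real, 'n) vec) measure)"
      using measurable_sets[of "\<lambda>x::(real, 'n) vec. (norm x ^ CARD('n), sgn x)" borel "borel \<Otimes>\<^sub>M borel" "T \<times> A"] by simp
    have "emeasure D (T \<times> A) = emeasure (density lborel (indicator {x::(real, 'n) vec. x \<noteq> 0})) ((\<lambda>x. (norm x ^ CARD('n), sgn x)) -` (T \<times> A))"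
      unfolding D_def by (subst emeasure_distr) auto
    also have "\<dots> = (LINT+ x. indicator {x::(real, 'n) vec. x \<noteq> 0} x * indicator ((\<lambda>x. (norm x ^ CARD('n), sgn x)) -` (T \<times> A)) x)"
      using m by (subst emeasure_density) auto
    also have "\<dots> = (LINT+ x. indicator {x. x \<noteq> 0 \<and> norm x ^ CARD('n) \<in> T \<and> sgn x \<in> A} x)"
      by (intro nn_integral_cong) (auto simp: indicator_def)
    also have "\<dots> = vol {x. x \<noteq> 0 \<and> norm x ^ CARD('n) \<in> T \<and> sgn x \<in> A}"
      by (subst nn_integral_indicator) auto
    also have "\<dots> = ennreal w * vol (T \<inter> {0<..}) * emeasure sphere_borel A"
      unfolding w_def by (rule distr_radius) auto
    finally show "emeasure M1 T * emeasure sphere_borel A = emeasure D (T \<times> A)" by (simp add: 1)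
  qed
  have "(LINT+ x. H (norm x ^ CARD('n)) (sgn x)) = (LINT+ x. indicator {x::(real, 'n) vec. x \<noteq> 0} x * H (norm x ^ CARD('n)) (sgn x))"
    using AE_lborel_singleton[of "0::(real, 'n) vec"] by (intro nn_integral_cong_AE) (auto elim!: eventually_mono)
  also have "\<dots> = (\<integral>\<^sup>+x. H (norm x ^ CARD('n)) (sgn x) \<partial>density lborel (indicator {x::(real, 'n) vec. x \<noteq> 0}))"
    by (subst nn_integral_density) auto
  also have "\<dots> = (\<integral>\<^sup>+z. (\<lambda>(t, \<theta>). H t \<theta>) z \<partial>D)"
    unfolding D_def by (subst nn_integral_distr) auto
  also have "\<dots> = (\<integral>\<^sup>+z. (\<lambda>(t, \<theta>). H t \<theta>) z \<partial>(M1 \<Otimes>\<^sub>M sphere_borel))"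
    using \<open>M1 \<Otimes>\<^sub>M sphere_borel = D\<close> by simp
  also have "\<dots> = (\<integral>\<^sup>+\<theta>. \<integral>\<^sup>+t. H t \<theta> \<partial>M1 \<partial>sphere_borel)"
    by (subst P.nn_integral_snd[symmetric]) auto
  also have "\<dots> = (\<integral>\<^sup>+\<theta>. ennreal w * (LINT+ t. H t \<theta> * indicator {0<..} t) \<partial>sphere_borel)"
  proof (rule nn_integral_cong)
    fix \<theta> :: "(real, 'n) vec"
    have "(\<integral>\<^sup>+t. H t \<theta> \<partial>M1) = (LINT+ t. ennreal w * indicator {0<..} t * H t \<theta>)"
      unfolding M1_def by (subst nn_integral_density) auto
    then show "(\<integral>\<^sup>+t. H t \<theta> \<partial>M1) = ennreal w * (LINT+ t. H t \<theta> * indicator {0<..} t)"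
      by (simp add: nn_integral_cmult[symmetric] ac_simps)
  qed
  also have "\<dots> = ennreal w * (\<integral>\<^sup>+\<theta>. (LINT+ t. H t \<theta> * indicator {0<..} t) \<partial>sphere_borel)"
    by (rule nn_integral_cmult) measurable
  finally show ?thesis by (simp add: w_def)
qed

section \<open>Jensen's and Hardy's inequalities\<close>

lemma epowr_ennreal:
  assumes "0 < p" "0 \<le> x" shows "ennreal x epowr p = ennreal (x powr p)"
  using assms by (auto simp: epowr_def)

lemma epowr_infinity: "0 < p \<Longrightarrow> \<infinity> epowr p = \<infinity>"
  by (simp add: epowr_def)

lemma epowr_mono:
  assumes p: "0 < p" and xy: "x \<le> y" shows "x epowr p \<le> y epowr p"
proof (cases "y = \<infinity>")
  case True show ?thesis unfolding True epowr_infinity[OF p] by simp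
next
  case False
  then obtain b where b: "y = ennreal b" "0 \<le> b" by (cases y) auto
  then obtain a where a: "x = ennreal a" "0 \<le> a" using xy by (cases x) (auto simp: top_unique)
  show ?thesis using a b xy p by (auto simp: epowr_ennreal intro!: ennreal_leI powr_mono2)
qed

lemma epowr_epowr_inverse:
  assumes p: "0 < p" shows "(x epowr (1 / p)) epowr p = x"
proof (cases x)
  case (real r)
  then show ?thesis using p by (simp add: epowr_ennreal powr_powr)
next
  case top
  then show ?thesis using p epowr_infinity[of p] epowr_infinity[of "1/p"] by simp
qed

text \<open>A monotone map onto all of ennreal is continuous; it is onto because the power with
  reciprocal exponent is a right inverse.\<close>

lemma continuous_on_epowr:
  assumes p: "0 < p" shows "continuous_on UNIV (\<lambda>x. x epowr p)"
proof (rule continuous_onI_mono)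
  have "range (\<lambda>x. x epowr p) = UNIV" using epowr_epowr_inverse[OF p] by (metis surjI)
  then show "open ((\<lambda>x. x epowr p) ` UNIV)" by simp
qed (use p epowr_mono in auto)

lemma epowr_measurable [measurable]:
  assumes [measurable]: "f \<in> borel_measurable M" shows "(\<lambda>x. f x epowr a) \<in> borel_measurable M"
  unfolding epowr_def by measurable

lemma epowr_Liminf:
  assumes p: "0 < p" and le: "x \<le> Liminf F X" and F: "F \<noteq> bot"
  shows "x epowr p \<le> Liminf F (\<lambda>k. X k epowr p)"
proof -
  have "x epowr p \<le> Liminf F X epowr p" using p le by (rule epowr_mono)
  also have "\<dots> = Liminf F (\<lambda>k. X k epowr p)"
    using p F by (intro Liminf_compose_continuous_mono[symmetric] continuous_on_epowr monoI epowr_mono)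
  finally show ?thesis .
qed

lemma epowr_hinge_mixture:
  assumes p: "1 \<le> p" and M: "sets M = sets borel" "AE h in M. 0 \<le> h"
    and mix: "\<And>t. ennreal (max 0 t powr p) = (\<integral>\<^sup>+h. ennreal (t - h) \<partial>M)"
  shows "x epowr p = (\<integral>\<^sup>+h. (x - ennreal h) \<partial>M)"
proof (cases x)
  case (real t)
  have "x epowr p = ennreal (max 0 t powr p)" using real p by (simp add: epowr_ennreal max_def)
  also have "\<dots> = (\<integral>\<^sup>+h. ennreal (t - h) \<partial>M)" by (rule mix)
  also have "\<dots> = (\<integral>\<^sup>+h. (x - ennreal h) \<partial>M)"
    using M(2) by (intro nn_integral_cong_AE) (auto simp: real ennreal_minus elim!: eventually_mono)
  finally show ?thesis .
next
  case top
  \<comment> \<open>At the argument \<infinity> the integrand is constantly infinite, so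
    \<open>M\<close> only has to be nonzero; the mixture at t = 1 shows that.\<close>
  have "emeasure M (space M) \<noteq> 0"
  proof
    assume "emeasure M (space M) = 0"
    then have "AE h in M. False" by (simp add: AE_iff_null null_setsI)
    then have "(\<integral>\<^sup>+h. ennreal (1 - h) \<partial>M) = (\<integral>\<^sup>+h. 0 \<partial>M)" by (intro nn_integral_cong_AE) auto
    then show False using mix[of 1] by simp
  qed
  moreover have "(\<integral>\<^sup>+h. (x - ennreal h) \<partial>M) = \<infinity> * emeasure M (space M)"
    unfolding top by (simp add: ennreal_top_minus)
  ultimately show ?thesis using p top epowr_infinity[of p] by (simp add: ennreal_top_mult)
qed

text \<open>By the mixture only hinges need to be treated, and for them the claim follows by
  integrating g <= (g - h) + h against a probability measure. Truncated subtraction in ennreal is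
  the hinge itself, so infinite integrals are included.\<close>

lemma epowr_Jensen:
  assumes p: "1 \<le> p" and N: "prob_space N" and [measurable]: "g \<in> borel_measurable N"
  shows "(\<integral>\<^sup>+x. g x \<partial>N) epowr p \<le> (\<integral>\<^sup>+x. g x epowr p \<partial>N)"
proof -
  interpret N: prob_space N by fact
  obtain M :: "real measure" where M: "sigma_finite_measure M" "sets M = sets borel" "AE h in M. 0 \<le> h"
    "\<And>t. ennreal (max 0 t powr p) = (\<integral>\<^sup>+h. ennreal (t - h) \<partial>M)"
    using powr_hinge_mixture[OF p] by blast
  interpret M: sigma_finite_measure M by fact
  interpret P: pair_sigma_finite M N by unfold_locales
  note [measurable_cong] = M(2)
  note mix = epowr_hinge_mixture[OF p M(2,3,4)]
  have "(\<integral>\<^sup>+x. g x \<partial>N) epowr p = (\<integral>\<^sup>+h. ((\<integral>\<^sup>+x. g x \<partial>N) - ennreal h) \<partial>M)" by (rule mix)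
  also have "\<dots> \<le> (\<integral>\<^sup>+h. (\<integral>\<^sup>+x. g x - ennreal h \<partial>N) \<partial>M)"
  proof (rule nn_integral_mono)
    fix h :: real
    have "(\<integral>\<^sup>+x. g x \<partial>N) \<le> (\<integral>\<^sup>+x. (g x - ennreal h) + ennreal h \<partial>N)"
    proof (intro nn_integral_mono)
      fix x show "g x \<le> (g x - ennreal h) + ennreal h"
        using ennreal_minus_le_iff[of "g x" "ennreal h" "g x - ennreal h"] by (simp add: add.commute)
    qed
    also have "\<dots> = (\<integral>\<^sup>+x. g x - ennreal h \<partial>N) + ennreal h"
      by (simp add: nn_integral_add N.emeasure_space_1)
    finally show "(\<integral>\<^sup>+x. g x \<partial>N) - ennreal h \<le> (\<integral>\<^sup>+x. g x - ennreal h \<partial>N)"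
      by (simp add: ennreal_minus_le_iff add.commute)
  qed
  also have "\<dots> = (\<integral>\<^sup>+x. (\<integral>\<^sup>+h. g x - ennreal h \<partial>M) \<partial>N)"
    by (rule P.Fubini'[symmetric]) measurable
  also have "\<dots> = (\<integral>\<^sup>+x. g x epowr p \<partial>N)" by (simp add: mix)
  finally show ?thesis .
qed

lemma real_Jensen:
  assumes p: "1 \<le> p" and N: "prob_space N" and g: "integrable N g"
  shows "ennreal (max 0 (\<integral>x. g x \<partial>N) powr p) \<le> (\<integral>\<^sup>+x. ennreal (max 0 (g x) powr p) \<partial>N)"
proof -
  have [measurable]: "g \<in> borel_measurable N" using g by simp
  have "ennreal (max 0 (\<integral>x. g x \<partial>N)) \<le> (\<integral>\<^sup>+x. ennreal (max 0 (g x)) \<partial>N)"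
  proof -
    have i: "integrable N (\<lambda>x. max 0 (g x))" using g by simp
    have "(\<integral>x. g x \<partial>N) \<le> (\<integral>x. max 0 (g x) \<partial>N)" using g i by (intro integral_mono) auto
    moreover have "0 \<le> (\<integral>x. max 0 (g x) \<partial>N)" by (intro integral_nonneg_AE) auto
    ultimately have "ennreal (max 0 (\<integral>x. g x \<partial>N)) \<le> ennreal (\<integral>x. max 0 (g x) \<partial>N)"
      by (intro ennreal_leI) simp
    also have "\<dots> = (\<integral>\<^sup>+x. ennreal (max 0 (g x)) \<partial>N)"
      using i by (intro nn_integral_eq_integral[symmetric]) auto
    finally show ?thesis .
  qed
  then have "ennreal (max 0 (\<integral>x. g x \<partial>N)) epowr p \<le> (\<integral>\<^sup>+x. ennreal (max 0 (g x)) \<partial>N) epowr p"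
    using p by (intro epowr_mono) auto
  also have "\<dots> \<le> (\<integral>\<^sup>+x. ennreal (max 0 (g x)) epowr p \<partial>N)"
    by (rule epowr_Jensen[OF p N]) measurable
  finally have le: "ennreal (max 0 (\<integral>x. g x \<partial>N)) epowr p \<le> (\<integral>\<^sup>+x. ennreal (max 0 (g x)) epowr p \<partial>N)" .
  have "ennreal (max 0 b) epowr p = ennreal (max 0 b powr p)" for b
    by (rule epowr_ennreal) (use p in auto)
  with le show ?thesis by (simp only:)
qed

lemma nn_integral_real_scale:
  assumes [measurable]: "f \<in> borel_measurable borel" and c: "0 < (c::real)"
  shows "(LINT+ x. f x) = ennreal c * (LINT+ x. f (c * x))"
  using nn_integral_lborel_affine[of f c 0] c by simp

lemma nn_integral_powr_from_0:
  assumes a: "-1 < a" and b: "0 \<le> (b::real)"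
  shows "(LINT+ x. ennreal (x powr a) * indicator {0<..<b} x) = ennreal (b powr (a + 1) / (a + 1))"
proof -
  have "((\<lambda>x. x powr a) has_integral (b powr (a + 1) / (a + 1))) {0..b}"
    using has_integral_powr_from_0[OF a b] .
  then have "((\<lambda>x. if x \<in> {0..b} then x powr a else 0) has_integral (b powr (a + 1) / (a + 1))) UNIV"
    by (simp only: has_integral_restrict_UNIV)
  then have "(LINT+ x. ennreal (if x \<in> {0..b} then x powr a else 0)) = ennreal (b powr (a + 1) / (a + 1))"
    by (intro nn_integral_has_integral_lborel) auto
  moreover have "(LINT+ x. ennreal (x powr a) * indicator {0<..<b} x) = (LINT+ x. ennreal (if x \<in> {0..b} then x powr a else 0))"
    using AE_lborel_singleton[of 0] AE_lborel_singleton[of b]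
    by (intro nn_integral_cong_AE, eventually_elim) (auto simp: indicator_def)
  ultimately show ?thesis by simp
qed

text \<open>The weight \<open>\<gamma> \<lambda> powr (\<gamma> - 1)\<close> is the one for which Jensen's inequality becomes sharp on the extremal
  functions \<open>t powr (\<gamma> - 1)\<close>.\<close>

lemma hardy_inequality:
  fixes g :: "real \<Rightarrow> real"
  assumes p: "1 \<le> p" and [measurable]: "g \<in> borel_measurable borel" and g0: "\<And>t. 0 \<le> g t"
    and \<gamma>: "\<gamma> = 1 - 1 / p + a / p" "0 < \<gamma>"
  shows "ennreal (\<gamma> powr p) * (LINT+ t. (ennreal (1 / t) * (LINT+ s. ennreal (g s) * indicator {0<..<t} s)) epowr p * ennreal (t powr (- a)) * indicator {0<..} t)
    \<le> (LINT+ t. ennreal (g t powr p * t powr (- a)) * indicator {0<..} t)"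
proof -
  let ?m = "\<lambda>t. ennreal (1 / t) * (LINT+ s. ennreal (g s) * indicator {0<..<t} s)"
  let ?h = "\<lambda>t x. g (x * t) * x powr (1 - \<gamma>) / \<gamma>"
  let ?k = "\<lambda>x. ennreal (\<gamma> * x powr (\<gamma> - 1)) * indicator {0<..<1} x"
  define N where "N = density lborel (\<lambda>x. ennreal (\<gamma> * x powr (\<gamma> - 1)) * indicator {0<..<1} x)"
  have N: "prob_space N"
  proof (rule prob_spaceI)
    have "emeasure N (space N) = (LINT+ x. ennreal \<gamma> * (ennreal (x powr (\<gamma> - 1)) * indicator {0<..<1} x))"
      unfolding N_def using \<gamma> by (subst emeasure_density) (auto simp: ennreal_mult mult.assoc)
    also have "\<dots> = 1" using \<gamma> nn_integral_powr_from_0[of "\<gamma> - 1" 1]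
      by (simp add: nn_integral_cmult ennreal_mult[symmetric])
    finally show "emeasure N (space N) = 1" .
  qed
  have Nint: "(\<integral>\<^sup>+x. F x \<partial>N) = (LINT+ x. ?k x * F x)"
    if [measurable]: "F \<in> borel_measurable borel" for F
    unfolding N_def by (subst nn_integral_density) auto
  define W where "W = (LINT+ t. ennreal (g t powr p * t powr (- a)) * indicator {0<..} t)"
  \<comment> \<open>The Hardy mean as an average of dilates of \<open>g\<close> over
    \<open>N\<close>; the factor \<open>x powr (1 - \<gamma>) / \<gamma>\<close> compensates the
    density of \<open>N\<close>.\<close>
  have avg: "?m t =
      (\<integral>\<^sup>+x. ennreal (?h t x) \<partial>N)" if t: "0 < t" for t
  proof -
    have "(LINT+ s. ennreal (g s) * indicator {0<..<t} s) = ennreal t * (LINT+ x. ennreal (g (t * x)) * indicator {0<..<t} (t * x))"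
      using t by (intro nn_integral_real_scale) auto
    then have "?m t = (LINT+ x. ennreal (g (t * x)) * indicator {0<..<t} (t * x))"
      using t by (simp add: mult.assoc[symmetric] ennreal_mult[symmetric])
    also have "\<dots> = (LINT+ x. ?k x * ennreal (?h t x))"
    proof (rule nn_integral_cong)
      fix x :: real
      show "ennreal (g (t * x)) * indicator {0<..<t} (t * x) = ?k x * ennreal (?h t x)"
      proof (cases "0 < x \<and> x < 1")
        case True
        have "(\<gamma> * x powr (\<gamma> - 1)) * (?h t x) = g (x * t) * (x powr (\<gamma> - 1) * x powr (1 - \<gamma>))"
          using \<gamma>(2) by simp
        also have "x powr (\<gamma> - 1) * x powr (1 - \<gamma>) = 1" using True by (simp add: powr_add[symmetric])
        finally show ?thesis using True t \<gamma>(2) g0 by (simp add: ennreal_mult[symmetric] indicator_def mult.commute)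
      next
        case False
        then show ?thesis using t by (auto simp: indicator_def zero_less_mult_iff)
      qed
    qed
    also have "\<dots> = (\<integral>\<^sup>+x. ennreal (?h t x) \<partial>N)"
      by (rule Nint[symmetric]) measurable
    finally show ?thesis .
  qed
  have jen: "(?m t) epowr p
     \<le> (LINT+ x. ?k x * ennreal ((?h t x) powr p))" if t: "0 < t" for t
  proof -
    have "(?m t) epowr p
       \<le> (\<integral>\<^sup>+x. ennreal (?h t x) epowr p \<partial>N)"
      unfolding avg[OF t] by (rule epowr_Jensen[OF p N]) (simp add: N_def)
    also have "\<dots> = (\<integral>\<^sup>+x. ennreal ((?h t x) powr p) \<partial>N)"
      using p g0 \<gamma>(2) by (simp add: epowr_ennreal)
    also have "\<dots> = (LINT+ x. ?k x * ennreal ((?h t x) powr p))"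
      by (rule Nint) measurable
    finally show ?thesis .
  qed
  have "(LINT+ t. (?m t) epowr p * ennreal (t powr (- a)) * indicator {0<..} t)
     \<le> (LINT+ t. (LINT+ x. ?k x * ennreal ((?h t x) powr p) * ennreal (t powr (- a)) * indicator {0<..} t))"
  proof (rule nn_integral_mono)
    fix t :: real
    show "(?m t) epowr p * ennreal (t powr (- a)) * indicator {0<..} t
      \<le> (LINT+ x. ?k x * ennreal ((?h t x) powr p) * ennreal (t powr (- a)) * indicator {0<..} t)"
    proof (cases "0 < t")
      case True
      then show ?thesis using mult_right_mono[OF jen[OF True], of "ennreal (t powr (- a))"]
        by (simp add: nn_integral_multc)
    qed simp
  qed
  also have "\<dots> = (LINT+ x. (LINT+ t. ?k x * ennreal ((?h t x) powr p) * ennreal (t powr (- a)) * indicator {0<..} t))"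
    by (rule lborel_pair.Fubini') measurable
  also have "\<dots> = (LINT+ x. ?k x * (ennreal (\<gamma> powr (- p)) * W))"
  proof (rule nn_integral_cong)
    fix x :: real
    show "(LINT+ t. ?k x * ennreal ((?h t x) powr p) * ennreal (t powr (- a)) * indicator {0<..} t)
      = ?k x * (ennreal (\<gamma> powr (- p)) * W)"
    proof (cases "0 < x \<and> x < 1")
      case True
      then have x: "0 < x" by simp
      \<comment> \<open>Because of this relation the factor
        \<open>x powr (p * (1 - \<gamma>))\<close> from the dilate cancels against the substitution
        in the weighted integral, so every x yields the same multiple of \<open>W\<close>.\<close>
      have e: "p * (1 - \<gamma>) = 1 - a" using p \<gamma>(1) by (simp add: field_simps)
      have "W = ennreal x * (LINT+ t. ennreal (g (x * t) powr p * (x * t) powr (- a)) * indicator {0<..} (x * t))"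
        unfolding W_def using x by (intro nn_integral_real_scale) auto
      also have "\<dots> = (LINT+ t. ennreal x * (ennreal (g (x * t) powr p * (x * t) powr (- a)) * indicator {0<..} (x * t)))"
        by (rule nn_integral_cmult[symmetric]) measurable
      also have "\<dots> = (LINT+ t. ennreal (x powr (1 - a) * g (x * t) powr p * t powr (- a)) * indicator {0<..} t)"
      proof (rule nn_integral_cong)
        fix t :: real
        show "ennreal x * (ennreal (g (x * t) powr p * (x * t) powr (- a)) * indicator {0<..} (x * t)) = ennreal (x powr (1 - a) * g (x * t) powr p * t powr (- a)) * indicator {0<..} t"
        proof (cases "0 < t")
          case True
          have "x * (g (x * t) powr p * (x * t) powr (- a)) = (x * x powr (- a)) * g (x * t) powr p * t powr (- a)"
            using x True by (simp add: powr_mult)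
          also have "x * x powr (- a) = x powr (1 - a)" using x by (simp add: powr_mult_base)
          finally show ?thesis using x True by (simp add: ennreal_mult[symmetric] indicator_def)
        qed (use x in \<open>auto simp: indicator_def zero_less_mult_iff\<close>)
      qed
      finally have W: "W = (LINT+ t. ennreal (x powr (1 - a) * g (x * t) powr p * t powr (- a)) * indicator {0<..} t)" .
      have "(LINT+ t. ennreal ((?h t x) powr p) * ennreal (t powr (- a)) * indicator {0<..} t)
        = (LINT+ t. ennreal (\<gamma> powr (- p)) * (ennreal (x powr (1 - a) * g (x * t) powr p * t powr (- a)) * indicator {0<..} t))"
      proof (rule nn_integral_cong)
        fix t :: real
        have "(?h t x) powr p = \<gamma> powr (- p) * (x powr (1 - a) * g (x * t) powr p)"
          using x g0 \<gamma>(2) e by (simp add: powr_mult powr_divide powr_powr powr_minus inverse_powr divide_inverse ac_simps)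
        then show "ennreal ((?h t x) powr p) * ennreal (t powr (- a)) * indicator {0<..} t
          = ennreal (\<gamma> powr (- p)) * (ennreal (x powr (1 - a) * g (x * t) powr p * t powr (- a)) * indicator {0<..} t)"
          by (simp add: ennreal_mult mult.assoc)
      qed
      also have "\<dots> = ennreal (\<gamma> powr (- p)) * W" unfolding W by (rule nn_integral_cmult) measurable
      finally show ?thesis by (simp add: nn_integral_cmult mult.assoc)
    qed simp
  qed
  also have "\<dots> = (LINT+ x. ?k x) * (ennreal (\<gamma> powr (- p)) * W)"
    by (rule nn_integral_multc) measurable
  also have "(LINT+ x. ?k x) = 1"
    using Nint[of "\<lambda>_. 1"] prob_space.emeasure_space_1[OF N] by simp
  finally have "(LINT+ t. (?m t) epowr p * ennreal (t powr (- a)) * indicator {0<..} t)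
    \<le> ennreal (\<gamma> powr (- p)) * W" by simp
  then have "ennreal (\<gamma> powr p) * (LINT+ t. (?m t) epowr p * ennreal (t powr (- a)) * indicator {0<..} t)
    \<le> ennreal (\<gamma> powr p) * (ennreal (\<gamma> powr (- p)) * W)" by (rule mult_left_mono) simp
  also have "\<dots> = W" using \<gamma>(2) by (simp add: mult.assoc[symmetric] ennreal_mult[symmetric] powr_add[symmetric])
  finally show ?thesis by (simp add: W_def)
qed

section \<open>Nonlocal energies of radial functions on small balls\<close>

lemma nn_integral_sphere_orthogonal:
  fixes T :: "(real, 'n::{finite,wellorder}) vec \<Rightarrow> (real, 'n) vec"
  assumes T: "orthogonal_transformation T" and [measurable]: "\<phi> \<in> borel_measurable borel"
  shows "(\<integral>\<^sup>+u. \<phi> (T u) \<partial>sphere_borel) = (\<integral>\<^sup>+u. \<phi> u \<partial>sphere_borel)"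
proof -
  have h: "is_sphere_haar (sphere_haar :: ((real, 'n) vec) measure)" by (rule is_sphere_haar_sphere_haar)
  have Tb [measurable]: "T \<in> borel_measurable borel"
    by (intro borel_measurable_continuous_onI linear_continuous_on linear_linear[THEN iffD2])
      (simp add: T orthogonal_transformation_linear linear_linear)
  have m: "\<phi> \<in> borel_measurable sphere_haar"
    using measurable_compose[OF sphere_borel_measurable assms(2)] by simp
  have "(\<integral>\<^sup>+u. \<phi> u \<partial>sphere_haar) = (\<integral>\<^sup>+u. \<phi> u \<partial>distr sphere_haar sphere_haar T)"
    using h T by (simp add: is_sphere_haar_def)
  also have "\<dots> = (\<integral>\<^sup>+u. \<phi> (T u) \<partial>sphere_haar)"
    by (rule nn_integral_distr[OF sphere_haar_trans[OF h T]]) (simp add: m)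
  finally show ?thesis by (simp add: nn_integral_sphere_haar)
qed

definition sphere_moment :: "'n::{finite,wellorder} itself \<Rightarrow> real \<Rightarrow> real" where
  "sphere_moment _ p = (LINT u|(sphere_haar :: (real, 'n) vec measure). \<bar>u $ (LEAST i. True)\<bar> powr p)"

lemma I_const_eq: "I_const TYPE('n::{finite,wellorder}) p = sphere_moment TYPE('n) p powr (1 / p)"
  by (simp add: I_const_def sphere_moment_def)

lemma sphere_abs_moment:
  fixes e :: "(real, 'n::{finite,wellorder}) vec"
  assumes p: "0 < p" and e: "norm e = 1"
  shows "(\<integral>\<^sup>+u. ennreal (\<bar>u \<bullet> e\<bar> powr p) \<partial>sphere_borel) = ennreal (sphere_moment TYPE('n) p)"
proof -
  interpret S: prob_space "sphere_borel :: ((real, 'n) vec) measure" by (rule prob_space_sphere_borel)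
  define i0 :: 'n where "i0 = (LEAST i. True)"
  have "norm e = norm (axis i0 1 :: (real, 'n) vec)" using e by simp
  then obtain T where T: "orthogonal_transformation T" "T e = axis i0 (1::real)"
    by (rule orthogonal_transformation_exists)
  have "(\<integral>\<^sup>+u. ennreal (\<bar>u \<bullet> e\<bar> powr p) \<partial>sphere_borel) = (\<integral>\<^sup>+u. ennreal (\<bar>T u \<bullet> axis i0 1\<bar> powr p) \<partial>sphere_borel)"
  proof -
    have "u \<bullet> e = T u \<bullet> axis i0 1" for u
      using T(1) unfolding T(2)[symmetric] by (simp add: orthogonal_transformation_def)
    then show ?thesis by (simp only:)
  qed
  also have "\<dots> = (\<integral>\<^sup>+u. ennreal (\<bar>u \<bullet> axis i0 1\<bar> powr p) \<partial>(sphere_borel :: ((real, 'n) vec) measure))"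
    by (rule nn_integral_sphere_orthogonal[OF T(1)]) measurable
  also have "\<dots> = ennreal (LINT u|(sphere_borel :: ((real, 'n) vec) measure). \<bar>u $ i0\<bar> powr p)"
  proof -
    have "integrable (sphere_borel :: ((real, 'n) vec) measure) (\<lambda>u. \<bar>u $ i0\<bar> powr p)"
    proof (rule S.integrable_const_bound)
      show "AE u in (sphere_borel :: ((real, 'n) vec) measure). norm (\<bar>u $ i0\<bar> powr p) \<le> 1"
        using AE_sphere_borel
      proof eventually_elim
        case (elim u)
        have "\<bar>u $ i0\<bar> \<le> 1" using component_le_norm_cart[of u i0] elim by simp
        then have "\<bar>u $ i0\<bar> powr p \<le> 1 powr p" using p by (intro powr_mono2) auto
        then show ?case by simp
      qed
    qed measurable
    then show ?thesis by (simp add: nn_integral_eq_integral inner_axis)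
  qed
  also have "(LINT u|(sphere_borel :: ((real, 'n) vec) measure). \<bar>u $ i0\<bar> powr p) = sphere_moment TYPE('n) p"
    unfolding sphere_borel_def sphere_moment_def i0_def
    by (rule integral_distr[OF sphere_borel_measurable]) measurable
  finally show ?thesis .
qed

text \<open>The antipodal map exchanges the two halves of the absolute moment. This is where the
  factor \<open>2 powr (1 / p)\<close> of \<open>energy_plus\<close> comes from.\<close>

lemma sphere_pos_moment:
  fixes e :: "(real, 'n::{finite,wellorder}) vec"
  assumes p: "0 < p" and e: "norm e = 1"
  shows "(\<integral>\<^sup>+u. ennreal (max 0 (u \<bullet> e) powr p) \<partial>sphere_borel) = ennreal (sphere_moment TYPE('n) p / 2)"
proof -
  let ?J = "(\<integral>\<^sup>+u. ennreal (max 0 (u \<bullet> e) powr p) \<partial>sphere_borel)"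
  have "orthogonal_transformation (\<lambda>x::(real, 'n) vec. - x)"
    by (rule orthogonal_transformation_neg[THEN iffD2]) (rule orthogonal_transformation_id[unfolded id_def])
  then have neg: "(\<integral>\<^sup>+u. ennreal (max 0 ((- u) \<bullet> e) powr p) \<partial>sphere_borel) = ?J"
    by (rule nn_integral_sphere_orthogonal) measurable
  have "ennreal (sphere_moment TYPE('n) p) = (\<integral>\<^sup>+u. ennreal (\<bar>u \<bullet> e\<bar> powr p) \<partial>sphere_borel)"
    by (rule sphere_abs_moment[OF assms, symmetric])
  also have "\<dots> = (\<integral>\<^sup>+u. ennreal (max 0 (u \<bullet> e) powr p) + ennreal (max 0 ((- u) \<bullet> e) powr p) \<partial>sphere_borel)"
    using p by (intro nn_integral_cong) (auto simp: max_def abs_if)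
  also have "\<dots> = ?J + ?J" by (subst nn_integral_add) (measurable, simp only: neg)
  finally have eq: "ennreal (sphere_moment TYPE('n) p) = ?J + ?J" .
  have "0 \<le> sphere_moment TYPE('n) p" unfolding sphere_moment_def by (intro integral_nonneg_AE) auto
  moreover have "?J < \<infinity>" using eq by (metis ennreal_add_eq_top ennreal_neq_top infinity_ennreal_def less_top)
  then obtain j where j: "?J = ennreal j" "0 \<le> j" by (cases ?J) auto
  ultimately show ?thesis using eq unfolding j(1) by (simp add: ennreal_plus[symmetric] j(2) del: ennreal_plus)
qed

lemma sphere_moment_pos:
  assumes p: "0 < p" shows "0 < sphere_moment TYPE('n::{finite,wellorder}) p"
proof (rule ccontr)
  interpret S: prob_space "sphere_borel :: ((real, 'n) vec) measure" by (rule prob_space_sphere_borel)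
  assume "\<not> 0 < sphere_moment TYPE('n) p"
  then have z: "(\<integral>\<^sup>+u. ennreal (\<bar>u \<bullet> axis i 1\<bar> powr p) \<partial>sphere_borel) = 0" for i :: 'n
    using sphere_abs_moment[OF p, of "axis i 1 :: (real, 'n) vec"] by (simp add: ennreal_neg)
  have "AE u in (sphere_borel :: ((real, 'n) vec) measure). \<forall>i. u $ i = 0"
  proof (rule AE_all_countable[THEN iffD2], rule allI)
    fix i :: 'n
    show "AE u in (sphere_borel :: ((real, 'n) vec) measure). u $ i = 0"
      using z[of i] by (subst (asm) nn_integral_0_iff_AE) (auto simp: inner_axis ennreal_eq_0_iff)
  qed
  then have "AE u in (sphere_borel :: ((real, 'n) vec) measure). False"
    using AE_sphere_borel by eventually_elim (metis norm_zero vec_eq_iff zero_index zero_neq_one)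
  then show False by simp
qed

section \<open>Scaling, averaging and the passage to small balls\<close>

lemma nonlocal_energy_scale:
  fixes g :: "'a::euclidean_space \<Rightarrow> real"
  assumes [measurable]: "g \<in> borel_measurable borel" and c: "0 < c"
  shows "nonlocal_energy p g (ball 0 (c * \<rho>)) = ennreal (c ^ (2 * DIM('a))) * nonlocal_energy p (\<lambda>x. g (c *\<^sub>R x)) (ball 0 \<rho>)"
proof -
  have [measurable]: "ball (0::'a) r \<in> sets borel" for r by simp
  define \<phi> where "\<phi> x u = ennreal (max 0 (g (x + u) - g x) powr p) * indicator (ball 0 (c * \<rho>)) u" for x u
  have [measurable]: "(\<lambda>(x, u). \<phi> x u) \<in> borel_measurable (borel \<Otimes>\<^sub>M borel)" unfolding \<phi>_def by measurable
  have "nonlocal_energy p g (ball 0 (c * \<rho>)) = (LINT+ x. LINT+ u. \<phi> x u)"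
    by (simp add: nonlocal_energy_def \<phi>_def)
  also have "\<dots> = ennreal (\<bar>c\<bar> ^ DIM('a)) * (LINT+ x. LINT+ u. \<phi> (0 + c *\<^sub>R x) u)"
    using c by (intro nn_integral_lborel_affine) auto
  also have "\<dots> = ennreal (\<bar>c\<bar> ^ DIM('a)) * (LINT+ x. ennreal (\<bar>c\<bar> ^ DIM('a)) * (LINT+ u. \<phi> (0 + c *\<^sub>R x) (0 + c *\<^sub>R u)))"
    using c by (intro arg_cong2[where f="(*)"] refl nn_integral_cong nn_integral_lborel_affine) auto
  also have "\<dots> = ennreal (c ^ (2 * DIM('a))) * (LINT+ x. LINT+ u. \<phi> (0 + c *\<^sub>R x) (0 + c *\<^sub>R u))"
    using c by (simp add: nn_integral_cmult mult.assoc[symmetric] ennreal_mult[symmetric] mult_2 power_add)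
  also have "(LINT+ x. LINT+ u. \<phi> (0 + c *\<^sub>R x) (0 + c *\<^sub>R u)) = nonlocal_energy p (\<lambda>x. g (c *\<^sub>R x)) (ball 0 \<rho>)"
    unfolding nonlocal_energy_def \<phi>_def using c by (intro nn_integral_cong) (simp add: indicator_def scaleR_add_right)
  finally show ?thesis .
qed

text \<open>Convexity of the energy as a functional of the function, by Jensen's inequality in
  \<tau>. Integrability is asked only away from the origin, where a radial profile may blow
  up.\<close>

lemma nonlocal_energy_average:
  fixes g :: "real \<Rightarrow> 'a::euclidean_space \<Rightarrow> real"
  assumes p: "1 \<le> p" and U: "prob_space U" and sU [measurable_cong]: "sets U = sets borel"
    and [measurable]: "(\<lambda>(\<tau>, x). g \<tau> x) \<in> borel_measurable (borel \<Otimes>\<^sub>M borel)" "K \<in> sets borel"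
    and int: "\<And>x. x \<noteq> 0 \<Longrightarrow> integrable U (\<lambda>\<tau>. g \<tau> x)"
  shows "nonlocal_energy p (\<lambda>x. \<integral>\<tau>. g \<tau> x \<partial>U) K \<le> (\<integral>\<^sup>+\<tau>. nonlocal_energy p (g \<tau>) K \<partial>U)"
proof -
  let ?e = "\<lambda>x u \<tau>. ennreal (max 0 (g \<tau> (x + u) - g \<tau> x) powr p)"
  interpret U: prob_space U by fact
  interpret P: pair_sigma_finite "lborel :: 'a measure" U by unfold_locales
  have "nonlocal_energy p (\<lambda>x. \<integral>\<tau>. g \<tau> x \<partial>U) K \<le>
    (LINT+ x. LINT+ u. (\<integral>\<^sup>+\<tau>. ?e x u \<tau> * indicator K u \<partial>U))"
    unfolding nonlocal_energy_def
  proof (rule nn_integral_mono_AE, use AE_lborel_singleton[of "0::'a"] in eventually_elim)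
    fix x :: 'a assume x: "x \<noteq> 0"
    show "(LINT+ u. ennreal (max 0 ((\<integral>\<tau>. g \<tau> (x + u) \<partial>U) - (\<integral>\<tau>. g \<tau> x \<partial>U)) powr p) * indicator K u)
      \<le> (LINT+ u. (\<integral>\<^sup>+\<tau>. ?e x u \<tau> * indicator K u \<partial>U))"
    proof (rule nn_integral_mono_AE, use AE_lborel_singleton[of "- x"] in eventually_elim)
      fix u :: 'a assume "u \<noteq> - x"
      then have "x + u \<noteq> 0" by (metis add.commute add_eq_0_iff)
      then have i: "integrable U (\<lambda>\<tau>. g \<tau> (x + u))" "integrable U (\<lambda>\<tau>. g \<tau> x)" using x int by auto
      have "ennreal (max 0 ((\<integral>\<tau>. g \<tau> (x + u) \<partial>U) - (\<integral>\<tau>. g \<tau> x \<partial>U)) powr p) = ennreal (max 0 (\<integral>\<tau>. g \<tau> (x + u) - g \<tau> x \<partial>U) powr p)"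
        using i by simp
      also have "\<dots> \<le> (\<integral>\<^sup>+\<tau>. ?e x u \<tau> \<partial>U)"
        using i by (intro real_Jensen[OF p U]) auto
      finally show "ennreal (max 0 ((\<integral>\<tau>. g \<tau> (x + u) \<partial>U) - (\<integral>\<tau>. g \<tau> x \<partial>U)) powr p) * indicator K u
         \<le> (\<integral>\<^sup>+\<tau>. ?e x u \<tau> * indicator K u \<partial>U)"
        by (subst nn_integral_multc) (auto intro: mult_right_mono)
    qed
  qed
  also have "\<dots> = (LINT+ x. \<integral>\<^sup>+\<tau>. (LINT+ u. ?e x u \<tau> * indicator K u) \<partial>U)"
  proof (rule nn_integral_cong)
    fix x :: 'a
    show "(LINT+ u. (\<integral>\<^sup>+\<tau>. ?e x u \<tau> * indicator K u \<partial>U))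
      = (\<integral>\<^sup>+\<tau>. (LINT+ u. ?e x u \<tau> * indicator K u) \<partial>U)"
      by (rule P.Fubini'[symmetric]) measurable
  qed
  also have "\<dots> = (\<integral>\<^sup>+\<tau>. nonlocal_energy p (g \<tau>) K \<partial>U)"
    unfolding nonlocal_energy_def by (rule P.Fubini'[symmetric]) measurable
  finally show ?thesis .
qed

text \<open>Neighbouring windows differ only near their ends, so jumps of \<open>H\<close> in
  between are harmless. A decreasing function has at most countably many jumps, so the hypothesis
  holds for all but countably many \<open>y\<close>.\<close>

lemma DERIV_sliding_mean:
  fixes H :: "real \<Rightarrow> real"
  assumes anti: "antimono H" and d: "0 < d" and c: "isCont H y" "isCont H (y + d)"
    and G: "\<And>z. G z = (\<integral>\<tau>. H (\<tau> + z) \<partial>density lborel (\<lambda>\<tau>. ennreal (indicator {0..d} \<tau> / d)))"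
  shows "DERIV G y :> (H (y + d) - H y) / d"
proof -
  have [measurable]: "H \<in> borel_measurable borel"
  proof -
    have "mono (\<lambda>x. - H x)" using anti by (auto simp: mono_def antimono_def)
    then have "(\<lambda>x. - H x) \<in> borel_measurable borel" by (rule borel_measurable_mono)
    then show ?thesis by simp
  qed
  have Hint: "set_integrable lborel {a..b} H" for a b
  proof (cases "a \<le> b")
    case True
    have bd: "\<bar>indicator {a..b} x *\<^sub>R H x\<bar> \<le> (\<bar>H a\<bar> + \<bar>H b\<bar>) * indicator {a..b} x" for x
    proof (cases "x \<in> {a..b}")
      case True
      then have "H b \<le> H x" "H x \<le> H a" using antimonoD[OF anti] by auto
      then have "\<bar>H x\<bar> \<le> \<bar>H a\<bar> + \<bar>H b\<bar>" by linarith
      then show ?thesis using True by simp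
    qed simp
    show ?thesis unfolding set_integrable_def
    proof (rule Bochner_Integration.integrable_bound)
      show "integrable lborel (\<lambda>x. (\<bar>H a\<bar> + \<bar>H b\<bar>) * indicator {a..b} x)"
        by (intro integrable_mult_right integrable_real_indicator) (auto simp: emeasure_lborel_Icc_eq)
      show "AE x in lborel. norm (indicator {a..b} x *\<^sub>R H x) \<le> norm ((\<bar>H a\<bar> + \<bar>H b\<bar>) * indicator {a..b} x)"
      proof (rule AE_I2)
        fix x show "norm (indicator {a..b} x *\<^sub>R H x) \<le> norm ((\<bar>H a\<bar> + \<bar>H b\<bar>) * indicator {a..b} x)"
          using bd[of x] unfolding real_norm_def by linarith
      qed
    qed measurable
  qed (simp add: set_integrable_def)
  have Hio: "H integrable_on {a..b}" for a b using set_borel_integral_eq_integral(1)[OF Hint] .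
  \<comment> \<open>A base point strictly below \<open>y\<close>, so that the derivative of the
    integral at \<open>y\<close> is two-sided.\<close>
  define a where "a = y - 1"
  define \<Phi> where "\<Phi> z = integral {a..z} H" for z
  have D\<Phi>: "DERIV \<Phi> x :> H x" if x: "a < x" "isCont H x" for x
  proof -
    have "((\<lambda>u. integral {a..u} H) has_vector_derivative H x) (at x within ({a..x + 1} - {}))"
      using x by (intro integral_has_vector_derivative_continuous_at Hio) (auto intro: continuous_at_imp_continuous_at_within)
    moreover have "at x within ({a..x + 1} - {}) = at x" using x by (simp add: at_within_Icc_at)
    ultimately show ?thesis unfolding \<Phi>_def[abs_def] by (simp add: has_real_derivative_iff_has_vector_derivative)
  qed
  have Geq: "G z = (\<Phi> (z + d) - \<Phi> z) / d" if z: "a < z" for z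
  proof -
    have "G z = (\<integral>\<tau>. (indicator {0..d} \<tau> / d) *\<^sub>R H (\<tau> + z) \<partial>lborel)"
      unfolding G using d by (subst integral_density) auto
    also have "\<dots> = (\<integral>\<tau>. (indicator {z..z + d} (z + 1 * \<tau>) *\<^sub>R H (z + 1 * \<tau>)) / d \<partial>lborel)"
      by (intro Bochner_Integration.integral_cong) (auto simp: indicator_def add.commute)
    also have "\<dots> = (\<integral>\<tau>. indicator {z..z + d} (z + 1 * \<tau>) *\<^sub>R H (z + 1 * \<tau>) \<partial>lborel) / d" by simp
    also have "(\<integral>\<tau>. indicator {z..z + d} (z + 1 * \<tau>) *\<^sub>R H (z + 1 * \<tau>) \<partial>lborel) = (\<integral>\<tau>. indicator {z..z + d} \<tau> *\<^sub>R H \<tau> \<partial>lborel)"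
      using lborel_integral_real_affine[of 1 "\<lambda>\<tau>. indicator {z..z + d} \<tau> *\<^sub>R H \<tau>" z] by simp
    also have "\<dots> = integral {z..z + d} H"
      using set_borel_integral_eq_integral(2)[OF Hint[of z "z + d"]] by (simp add: set_lebesgue_integral_def)
    also have "\<dots> = \<Phi> (z + d) - \<Phi> z"
      using Henstock_Kurzweil_Integration.integral_combine[of a z "z + d" H] Hio d z by (simp add: \<Phi>_def)
    finally show ?thesis .
  qed
  have "DERIV (\<lambda>z. (\<Phi> (z + d) - \<Phi> z) / d) y :> (H (y + d) - H y) / d"
    using D\<Phi>[of y] D\<Phi>[of "y + d"] c d DERIV_shift[of \<Phi> "H (y + d)" y d]
    by (auto intro!: derivative_eq_intros simp: a_def)
  moreover have "eventually (\<lambda>z. G z = (\<Phi> (z + d) - \<Phi> z) / d) (nhds y)"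
    using Geq eventually_nhds_in_open[of "{a<..}" y] by (auto simp: a_def elim: eventually_mono)
  ultimately show ?thesis by (subst DERIV_cong_ev[OF refl _ refl]) assumption+
qed

lemma norm_power_powr:
  fixes x :: "'a::real_normed_vector" assumes "0 < n"
  shows "(norm x ^ n) powr (a / real n) = norm x powr a"
proof (cases "x = 0")
  case True then show ?thesis using assms by (simp add: zero_power)
next
  case False
  then have "norm x ^ n = norm x powr real n" by (simp add: powr_realpow)
  then show ?thesis using assms by (simp add: powr_powr)
qed

lemma norm_power_less_iff: "0 < n \<Longrightarrow> 0 \<le> r \<Longrightarrow> norm x ^ n < r ^ n \<longleftrightarrow> norm x < r"
  by (metis linorder_not_less norm_ge_zero power_mono power_strict_mono)

lemma inner_sgn: "x \<bullet> e = norm x * (sgn x \<bullet> e)"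
  by (cases "x = 0") (auto simp: sgn_div_norm)

lemma max_0_mult_left: "0 \<le> a \<Longrightarrow> max 0 (a * b) = a * max 0 (b::real)"
  by (cases "0 \<le> b") (simp_all add: max_def antisym mult_nonneg_nonpos)

text \<open>The factor n/(n+p) is the integral of t^(p/n) over (0,1); it returns in
  \<open>energy_gauge_ball_le\<close> and cancels.\<close>

lemma ball_pos_moment:
  fixes e :: "(real, 'n::{finite,wellorder}) vec" and p :: real
  assumes p: "0 < p" and e: "norm e = 1"
  shows "(LINT+ w. ennreal (max 0 (w \<bullet> e) powr p) * indicator (ball 0 1) w) =
    ennreal (unit_ball_vol (real CARD('n)) * (CARD('n) / (CARD('n) + p)) * (sphere_moment TYPE('n) p / 2))"
proof -
  let ?n = "CARD('n)"
  have n: "0 < ?n" by simp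
  define H where "H t \<theta> = ennreal (t powr (p / ?n)) * indicator {..<1} t * ennreal (max 0 (\<theta> \<bullet> e) powr p)" for t and \<theta> :: "(real, 'n) vec"
  have [measurable]: "(\<lambda>(t, \<theta>). H t \<theta>) \<in> borel_measurable (borel \<Otimes>\<^sub>M borel)" unfolding H_def by measurable
  have "(LINT+ w. ennreal (max 0 (w \<bullet> e) powr p) * indicator (ball 0 1) w) = (LINT+ x. H (norm x ^ ?n) (sgn x))"
  proof (rule nn_integral_cong)
    fix x :: "(real, 'n) vec"
    have "max 0 (x \<bullet> e) = norm x * max 0 (sgn x \<bullet> e)"
      by (subst inner_sgn) (simp add: max_0_mult_left)
    then have "max 0 (x \<bullet> e) powr p = (norm x ^ ?n) powr (p / ?n) * max 0 (sgn x \<bullet> e) powr p"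
      by (simp add: powr_mult norm_power_powr[OF n])
    moreover have "norm x ^ ?n < 1 \<longleftrightarrow> norm x < 1" using norm_power_less_iff[OF n, of 1 x] by simp
    ultimately show "ennreal (max 0 (x \<bullet> e) powr p) * indicator (ball 0 1) x = H (norm x ^ ?n) (sgn x)"
      by (simp add: H_def indicator_def ennreal_mult)
  qed
  also have "\<dots> = ennreal (unit_ball_vol (real ?n)) * (\<integral>\<^sup>+\<theta>. (LINT+ t. H t \<theta> * indicator {0<..} t) \<partial>sphere_borel)"
    by (rule nn_integral_polar) measurable
  also have "(\<integral>\<^sup>+\<theta>. (LINT+ t. H t \<theta> * indicator {0<..} t) \<partial>sphere_borel) =
     (\<integral>\<^sup>+\<theta>. ennreal (?n / (?n + p)) * ennreal (max 0 (\<theta> \<bullet> e) powr p) \<partial>sphere_borel)"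
  proof (rule nn_integral_cong)
    fix \<theta> :: "(real, 'n) vec"
    have "(LINT+ t. H t \<theta> * indicator {0<..} t) = (LINT+ t. (ennreal (t powr (p / ?n)) * indicator {0<..<1} t) * ennreal (max 0 (\<theta> \<bullet> e) powr p))"
      by (intro nn_integral_cong) (auto simp: H_def indicator_def)
    also have "\<dots> = (LINT+ t. ennreal (t powr (p / ?n)) * indicator {0<..<1} t) * ennreal (max 0 (\<theta> \<bullet> e) powr p)"
      by (rule nn_integral_multc) measurable
    also have "(LINT+ t. ennreal (t powr (p / ?n)) * indicator {0<..<1} t) = ennreal (1 / (p / ?n + 1))"
    proof -
      have "-1 < p / ?n" using p n by (meson divide_pos_pos le_less_trans less_le_trans neg_less_0_iff_less of_nat_0_less_iff zero_less_one less_trans)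
      then show ?thesis using nn_integral_powr_from_0[of "p / ?n" 1] by simp
    qed
    also have "1 / (p / ?n + 1) = ?n / (?n + p)" using n p by (simp add: field_simps)
    finally show "(LINT+ t. H t \<theta> * indicator {0<..} t) = ennreal (?n / (?n + p)) * ennreal (max 0 (\<theta> \<bullet> e) powr p)" .
  qed
  also have "\<dots> = ennreal (?n / (?n + p)) * (\<integral>\<^sup>+\<theta>. ennreal (max 0 (\<theta> \<bullet> e) powr p) \<partial>sphere_borel)"
    by (rule nn_integral_cmult) measurable
  also have "\<dots> = ennreal (?n / (?n + p)) * ennreal (sphere_moment TYPE('n) p / 2)"
    by (simp add: sphere_pos_moment[OF p e])
  finally show ?thesis using p sphere_moment_pos[OF p, where 'n='n] unit_ball_vol_pos[of "real ?n"]
    by (simp add: ennreal_mult[symmetric] mult.assoc)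
qed

text \<open>\<open>F\<close> may jump, so it is first averaged over the dilations by e^\<tau> with
  \<tau> between 0 and \<open>d\<close>. By convexity and scaling this costs at most the factor
  \<open>exp (d * p / n)\<close>, which tends to 1 with \<open>d\<close>, and it makes the function
  differentiable almost everywhere, with the quotient of \<open>F\<close> at step \<open>d\<close>
  as negative logarithmic derivative. Fatou's lemma for difference quotients at scales tending to 0
  then yields the integral of that derivative.\<close>

lemma radial_energy_limit:
  fixes F :: "real \<Rightarrow> real" and p d M :: real
  assumes p: "1 \<le> p" and F [measurable]: "F \<in> borel_measurable borel"
    and F0: "\<And>t. 0 < t \<Longrightarrow> 0 \<le> F t" and anti: "\<And>s t. 0 < s \<Longrightarrow> s \<le> t \<Longrightarrow> F t \<le> F s"
    and d: "0 < d" and M: "0 \<le> M"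
    and bound: "\<And>\<rho>. 0 < \<rho> \<Longrightarrow> nonlocal_energy p (\<lambda>x::(real, 'n::{finite,wellorder}) vec. F (unit_ball_vol (real CARD('n)) * norm x ^ CARD('n))) (ball 0 \<rho>)
       \<le> ennreal (M * \<rho> powr (CARD('n) + p))"
  shows "ennreal (unit_ball_vol (real CARD('n)) * (CARD('n) / (CARD('n) + p)) * (sphere_moment TYPE('n) p / 2)) *
     (LINT+ t. ennreal ((CARD('n) * ((F t - F (exp d * t)) / d) * (unit_ball_vol (real CARD('n)) / t) powr (1 / CARD('n))) powr p) * indicator {0<..} t)
    \<le> ennreal (M * exp (d * p / CARD('n)))"
proof -
  let ?n = "CARD('n)"
  let ?V = "TYPE((real, 'n) vec)"
  have n: "0 < ?n" by simp
  define \<omega> where "\<omega> = unit_ball_vol (real ?n)"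
  have \<omega>: "0 < \<omega>" unfolding \<omega>_def by (intro unit_ball_vol_pos) simp
  define c1 where "c1 = \<omega> * (?n / (?n + p)) * (sphere_moment TYPE('n) p / 2)"
  define T where "T x = \<omega> * norm x ^ ?n" for x :: "(real, 'n) vec"
  have T0: "0 < T x" if "x \<noteq> 0" for x using that \<omega> by (simp add: T_def)
  have [measurable]: "T \<in> borel_measurable borel" unfolding T_def[abs_def] by measurable
  define g where "g t = (F t - F (exp d * t)) / d" for t
  have [measurable]: "g \<in> borel_measurable borel" unfolding g_def[abs_def] by measurable
  have g0: "0 \<le> g t" if "0 < t" for t
    using anti[of t "exp d * t"] that d by (simp add: g_def)
  define U where "U = density lborel (\<lambda>\<tau>. ennreal (indicator {0..d} \<tau> / d))"
  have sU [measurable_cong]: "sets U = sets borel" by (simp add: U_def)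
  have U: "prob_space U"
  proof (rule prob_spaceI)
    have "emeasure U (space U) = (LINT+ \<tau>. ennreal (1 / d) * indicator {0..d} \<tau>)"
      unfolding U_def by (subst emeasure_density) (auto intro!: nn_integral_cong simp: indicator_def)
    also have "\<dots> = 1" using d by (simp add: nn_integral_cmult_indicator ennreal_mult[symmetric])
    finally show "emeasure U (space U) = 1" .
  qed
  interpret U: prob_space U by (rule U)
  have AEU: "AE \<tau> in U. \<tau> \<in> {0..d}"
    unfolding U_def by (subst AE_density) (auto simp: indicator_def)
  define fd where "fd x = (\<integral>\<tau>. F (exp \<tau> * T x) \<partial>U)" for x
  have fd_meas [measurable]: "fd \<in> borel_measurable borel"
    unfolding fd_def by measurable
  have [measurable]: "ball (0::(real, 'n) vec) r \<in> sets borel" for r by simp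
  define C where "C = M * exp (d * p / ?n)"
  have C0: "0 \<le> C" using M by (simp add: C_def)
  have en: "nonlocal_energy p fd (ball 0 \<rho>) \<le> ennreal (C * \<rho> powr (?n + p))" if \<rho>: "0 < \<rho>" for \<rho>
  proof -
    have "nonlocal_energy p fd (ball 0 \<rho>) \<le> (\<integral>\<^sup>+\<tau>. nonlocal_energy p (\<lambda>x. F (exp \<tau> * T x)) (ball 0 \<rho>) \<partial>U)"
      unfolding fd_def
    proof (rule nonlocal_energy_average[OF p U sU])
      fix x :: "(real, 'n) vec" assume x: "x \<noteq> 0"
      show "integrable U (\<lambda>\<tau>. F (exp \<tau> * T x))"
      proof (rule U.integrable_const_bound)
        show "AE \<tau> in U. norm (F (exp \<tau> * T x)) \<le> F (T x)"
          using AEU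
        proof eventually_elim
          case (elim \<tau>)
          then have "T x \<le> exp \<tau> * T x" using T0[OF x] by simp
          then show ?case using anti[of "T x" "exp \<tau> * T x"] F0[of "exp \<tau> * T x"] T0[OF x] by simp
        qed
      qed measurable
    qed measurable
    also have "\<dots> \<le> (\<integral>\<^sup>+\<tau>. ennreal (C * \<rho> powr (?n + p)) \<partial>U)"
    proof (rule nn_integral_mono_AE, use AEU in eventually_elim)
      fix \<tau> assume \<tau>: "\<tau> \<in> {0..d}"
      define c where "c = exp (\<tau> / ?n)"
      have c: "1 \<le> c" "0 < c" "c \<noteq> 0" using \<tau> by (auto simp: c_def)
      have cn: "c ^ ?n = exp \<tau>" unfolding c_def using n by (simp add: exp_of_nat_mult[symmetric])
      have Tc: "T (c *\<^sub>R x) = exp \<tau> * T x" for x using c by (simp add: T_def power_mult_distrib cn)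
      have "ennreal (c ^ (2 * ?n)) * nonlocal_energy p (\<lambda>x. F (exp \<tau> * T x)) (ball 0 \<rho>) = nonlocal_energy p (\<lambda>x. F (T x)) (ball 0 (c * \<rho>))"
        using nonlocal_energy_scale[of "\<lambda>x. F (T x)" c p \<rho>] c by (simp add: Tc)
      also have "\<dots> \<le> ennreal (M * (c * \<rho>) powr (?n + p))" unfolding T_def \<omega>_def using c \<rho> by (intro bound) simp
      finally have le: "ennreal (c ^ (2 * ?n)) * nonlocal_energy p (\<lambda>x. F (exp \<tau> * T x)) (ball 0 \<rho>) \<le> ennreal (M * (c * \<rho>) powr (?n + p))" .
      have "nonlocal_energy p (\<lambda>x. F (exp \<tau> * T x)) (ball 0 \<rho>) = ennreal (1 / c ^ (2 * ?n)) * (ennreal (c ^ (2 * ?n)) * nonlocal_energy p (\<lambda>x. F (exp \<tau> * T x)) (ball 0 \<rho>))"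
        using c by (simp add: mult.assoc[symmetric] ennreal_mult[symmetric])
      also have "\<dots> \<le> ennreal (1 / c ^ (2 * ?n)) * ennreal (M * (c * \<rho>) powr (?n + p))" by (intro mult_left_mono le) simp
      also have "\<dots> = ennreal (1 / c ^ (2 * ?n) * (M * (c * \<rho>) powr (?n + p)))"
        by (rule ennreal_mult[symmetric]) (use c M in auto)
      also have "1 / c ^ (2 * ?n) * (M * (c * \<rho>) powr (?n + p)) \<le> C * \<rho> powr (?n + p)"
      proof -
        \<comment> \<open>The scaled bound carries c^(n+p) / c^(2n), which is at most c^p since c >=
          1. Giving away c^(-n) is harmless, as the bound has to be sharp only for \<open>d\<close>
          tending to 0.\<close>
        have "c powr (?n + p) = c ^ ?n * c powr p" using c by (simp add: powr_add powr_realpow)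
        also have "\<dots> = c ^ ?n * exp (\<tau> * p / ?n)" by (simp add: c_def powr_def)
        also have "\<dots> \<le> c ^ (2 * ?n) * exp (d * p / ?n)"
        proof (intro mult_mono)
          show "c ^ ?n \<le> c ^ (2 * ?n)" using c by (intro power_increasing) auto
          show "exp (\<tau> * p / ?n) \<le> exp (d * p / ?n)" using \<tau> p by (simp add: divide_right_mono mult_right_mono)
        qed (use c in auto)
        finally have "1 / c ^ (2 * ?n) * c powr (?n + p) \<le> exp (d * p / ?n)" using c by (simp add: field_simps)
        then have "(M * \<rho> powr (?n + p)) * (1 / c ^ (2 * ?n) * c powr (?n + p)) \<le> (M * \<rho> powr (?n + p)) * exp (d * p / ?n)"
          using M by (intro mult_left_mono) auto
        then show ?thesis using c \<rho> by (simp add: C_def powr_mult ac_simps)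
      qed
      finally show "nonlocal_energy p (\<lambda>x. F (exp \<tau> * T x)) (ball 0 \<rho>) \<le> ennreal (C * \<rho> powr (?n + p))" by (simp add: ennreal_leI)
    qed
    also have "\<dots> = ennreal (C * \<rho> powr (?n + p))" by (simp add: U.emeasure_space_1)
    finally show ?thesis .
  qed
  define \<rho> where "\<rho> k = 1 / (real k + 1)" for k
  have \<rho>: "0 < \<rho> k" for k by (simp add: \<rho>_def)
  define Q where "Q k x w = ennreal (max 0 ((fd (x + \<rho> k *\<^sub>R w) - fd x) / \<rho> k) powr p) * indicator (ball 0 1) w" for k x w
  have [measurable]: "(\<lambda>(x, w). Q k x w) \<in> borel_measurable (borel \<Otimes>\<^sub>M borel)" for k unfolding Q_def by measurable
  \<comment> \<open>Substituting u = \<rho> w gives \<rho>^n and dividing the increments by \<rho>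
    gives \<rho>^p, together exactly the power in the bound on the energy.\<close>
  have Qbound: "(LINT+ x. LINT+ w. Q k x w) \<le> ennreal C" for k
  proof -
    let ?r = "\<rho> k"
    have "nonlocal_energy p fd (ball 0 ?r) = (LINT+ x. ennreal (?r powr (?n + p)) * (LINT+ w. Q k x w))"
      unfolding nonlocal_energy_def
    proof (rule nn_integral_cong)
      fix x :: "(real, 'n) vec"
      have "(LINT+ u. ennreal (max 0 (fd (x + u) - fd x) powr p) * indicator (ball 0 ?r) u) =
        ennreal (\<bar>?r\<bar> ^ DIM((real, 'n) vec)) * (LINT+ w. ennreal (max 0 (fd (x + (0 + ?r *\<^sub>R w)) - fd x) powr p) * indicator (ball 0 ?r) (0 + ?r *\<^sub>R w))"
        using \<rho>[of k] by (intro nn_integral_lborel_affine) auto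
      also have "(LINT+ w. ennreal (max 0 (fd (x + (0 + ?r *\<^sub>R w)) - fd x) powr p) * indicator (ball 0 ?r) (0 + ?r *\<^sub>R w)) = (LINT+ w. ennreal (?r powr p) * Q k x w)"
      proof (rule nn_integral_cong)
        fix w :: "(real, 'n) vec"
        have "max 0 (a / ?r) powr p * ?r powr p = max 0 a powr p" for a
        proof -
          have "max 0 a = max 0 (a / ?r) * ?r" using \<rho>[of k] by (auto simp: max_def field_simps)
          then show ?thesis using \<rho>[of k] by (simp add: powr_mult)
        qed
        then have "ennreal (max 0 (fd (x + ?r *\<^sub>R w) - fd x) powr p) = ennreal (?r powr p) * ennreal (max 0 ((fd (x + ?r *\<^sub>R w) - fd x) / ?r) powr p)"
          by (simp add: ennreal_mult[symmetric] mult.commute)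
        then show "ennreal (max 0 (fd (x + (0 + ?r *\<^sub>R w)) - fd x) powr p) * indicator (ball 0 ?r) (0 + ?r *\<^sub>R w) = ennreal (?r powr p) * Q k x w"
          using \<rho>[of k] by (simp add: Q_def indicator_def)
      qed
      also have "\<dots> = ennreal (?r powr p) * (LINT+ w. Q k x w)" by (rule nn_integral_cmult) measurable
      finally show "(LINT+ u. ennreal (max 0 (fd (x + u) - fd x) powr p) * indicator (ball 0 ?r) u) = ennreal (?r powr (?n + p)) * (LINT+ w. Q k x w)"
        using \<rho>[of k] by (simp add: mult.assoc[symmetric] ennreal_mult[symmetric] powr_add powr_realpow)
    qed
    also have "\<dots> = ennreal (?r powr (?n + p)) * (LINT+ x. LINT+ w. Q k x w)" by (rule nn_integral_cmult) measurable
    finally have eq: "nonlocal_energy p fd (ball 0 ?r) = ennreal (?r powr (?n + p)) * (LINT+ x. LINT+ w. Q k x w)" .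
    have "(LINT+ x. LINT+ w. Q k x w) = ennreal (1 / ?r powr (?n + p)) * (ennreal (?r powr (?n + p)) * (LINT+ x. LINT+ w. Q k x w))"
      using \<rho>[of k] by (simp add: mult.assoc[symmetric] ennreal_mult[symmetric])
    also have "\<dots> \<le> ennreal (1 / ?r powr (?n + p)) * ennreal (C * ?r powr (?n + p))"
      unfolding eq[symmetric] by (intro mult_left_mono en \<rho>) simp
    also have "\<dots> = ennreal C" using \<rho>[of k] C0 by (simp add: ennreal_mult[symmetric])
    finally show ?thesis .
  qed
  define H where "H s = F (exp s)" for s
  have antiH: "antimono H" by (rule antimonoI) (simp add: H_def anti)
  define G where "G z = (\<integral>\<tau>. H (\<tau> + z) \<partial>U)" for z
  have fdG: "fd x = G (ln (T x))" if "x \<noteq> 0" for x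
    using T0[OF that] by (simp add: fd_def G_def H_def exp_add)
  define D where "D = {s. \<not> isCont H s}"
  have D: "countable D"
  proof -
    have "mono (\<lambda>x. - H x)" using antiH by (auto simp: mono_def antimono_def)
    then have "countable {s. \<not> isCont (\<lambda>x. - H x) s}" by (rule mono_ctble_discont)
    moreover have "isCont (\<lambda>x. - H x) s \<longleftrightarrow> isCont H s" for s using continuous_minus[of "at s" "\<lambda>x. - H x"] continuous_minus[of "at s" H] by auto
    ultimately show ?thesis by (simp add: D_def)
  qed
  \<comment> \<open>The values of |x|^n at which \<open>DERIV_sliding_mean\<close> fails: there
    \<open>ln (T x)\<close> or \<open>ln (T x) + d\<close> is a jump of \<open>H\<close>.\<close>
  define N where "N = (\<lambda>s. exp s / \<omega>) ` (D \<union> (\<lambda>s. s - d) ` D)"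
  have N: "countable N" using D by (simp add: N_def)
  then have Nn: "N \<in> null_sets lborel" by (rule countable_imp_null_set_lborel)
  then have [measurable]: "N \<in> sets borel" by auto
  have good: "AE x in (lborel :: ((real, 'n) vec) measure). norm x ^ ?n \<notin> N"
  proof -
    have "(LINT+ x. indicator N (norm (x::(real, 'n) vec) ^ ?n)) = ennreal \<omega> * (\<integral>\<^sup>+(\<theta>::(real, 'n) vec). (LINT+ t. indicator N t * indicator {0<..} t) \<partial>sphere_borel)"
      unfolding \<omega>_def by (rule nn_integral_polar) measurable
    also have "(\<integral>\<^sup>+t. indicator N t * indicator {0<..} t \<partial>(lborel :: real measure)) = (0 :: ennreal)"
    proof -
      have "(\<integral>\<^sup>+t. indicator N t * indicator {0<..} t \<partial>(lborel :: real measure)) \<le> (\<integral>\<^sup>+t. indicator N t \<partial>(lborel :: real measure) :: ennreal)"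
        by (intro nn_integral_mono) (auto simp: indicator_def)
      also have "\<dots> = 0" using Nn by auto
      finally show ?thesis by simp
    qed
    finally have "(LINT+ x. indicator N (norm (x::(real, 'n) vec) ^ ?n)) = (0 :: ennreal)" by simp
    then have "AE x in (lborel :: ((real, 'n) vec) measure). indicator N (norm x ^ ?n) = (0 :: ennreal)"
      by (subst (asm) nn_integral_0_iff_AE) auto
    then show ?thesis by eventually_elim (auto simp: indicator_def split: if_splits)
  qed
  have lim: "(\<lambda>k. (fd (x + \<rho> k *\<^sub>R w) - fd x) / \<rho> k) \<longlonglongrightarrow> (?n * g (T x) / norm x) * (w \<bullet> (- sgn x))"
    if x: "x \<noteq> 0" "norm x ^ ?n \<notin> N" for x w :: "(real, 'n) vec"
  proof -
    define y where "y = ln (T x)"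
    have ey: "exp y = T x" using T0[OF x(1)] by (simp add: y_def)
    have cont: "isCont H y" "isCont H (y + d)"
    proof -
      have "exp y / \<omega> = norm x ^ ?n" using \<omega> by (simp add: ey T_def)
      then have "y \<notin> D \<union> (\<lambda>s. s - d) ` D" using x(2) unfolding N_def by (metis image_eqI)
      then have "y \<notin> D" "y + d \<notin> D" by (auto intro: image_eqI[of _ _ "y + d"])
      then show "isCont H y" "isCont H (y + d)" by (auto simp: D_def)
    qed
    have dG: "DERIV G y :> (H (y + d) - H y) / d"
      by (rule DERIV_sliding_mean[OF antiH d cont]) (simp add: G_def U_def)
    have Hg: "(H (y + d) - H y) / d = - g (T x)"
    proof -
      have "H (y + d) = F (exp d * T x)" "H y = F (T x)" by (simp_all add: H_def exp_add ey mult.commute)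
      then show ?thesis by (simp add: g_def diff_divide_distrib)
    qed
    \<comment> \<open>The squared norm along the line is a polynomial, so the derivative of
      \<open>ln (T z)\<close> needs no derivative of the norm.\<close>
    define q where "q r = x \<bullet> x + 2 * r * (x \<bullet> w) + r\<^sup>2 * (w \<bullet> w)" for r
    have q: "q r = (norm (x + r *\<^sub>R w))\<^sup>2" for r
      unfolding power2_norm_eq_inner q_def by (simp add: inner_add_left inner_add_right inner_commute power2_eq_square)
    have xx: "0 < x \<bullet> x" using x by simp
    have lnT: "ln (T z) = ln \<omega> + (?n / 2) * ln ((norm z)\<^sup>2)" if "z \<noteq> 0" for z :: "(real, 'n) vec"
      using that \<omega> n by (simp add: T_def ln_mult ln_realpow)
    have dq: "DERIV (\<lambda>r. ln \<omega> + (?n / 2) * ln (q r)) 0 :> ?n * (x \<bullet> w) / (x \<bullet> x)"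
      unfolding q_def using xx by (auto intro!: derivative_eq_intros simp: field_simps)
    have q0: "ln \<omega> + (?n / 2) * ln (q 0) = y" using lnT[OF x(1)] by (simp add: y_def q)
    have "DERIV (\<lambda>r. G (ln \<omega> + (?n / 2) * ln (q r))) 0 :> (- g (T x)) * (?n * (x \<bullet> w) / (x \<bullet> x))"
      by (rule DERIV_chain2[OF _ dq]) (use dG q0 Hg in simp)
    moreover have "eventually (\<lambda>r. fd (x + r *\<^sub>R w) = G (ln \<omega> + (?n / 2) * ln (q r))) (nhds 0)"
    proof -
      have "isCont (\<lambda>r. x + r *\<^sub>R w) 0" by (intro continuous_intros)
      then have "eventually (\<lambda>r. x + r *\<^sub>R w \<in> - {0}) (nhds 0)"
        using x unfolding continuous_within by (intro topological_tendstoD tendsto_nhds_iff[THEN iffD2]) auto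
      then show ?thesis by eventually_elim (simp add: fdG lnT q)
    qed
    ultimately have "DERIV (\<lambda>r. fd (x + r *\<^sub>R w)) 0 :> (- g (T x)) * (?n * (x \<bullet> w) / (x \<bullet> x))"
      by (subst DERIV_cong_ev[OF refl _ refl]) assumption+
    then have "((\<lambda>r. (fd (x + (0 + r) *\<^sub>R w) - fd (x + 0 *\<^sub>R w)) / r) \<longlongrightarrow> (- g (T x)) * (?n * (x \<bullet> w) / (x \<bullet> x))) (at 0)"
      by (simp only: DERIV_def)
    moreover have "filterlim \<rho> (at 0) sequentially"
    proof (rule filterlim_atI)
      show "\<rho> \<longlonglongrightarrow> 0" unfolding \<rho>_def[abs_def]
        using LIMSEQ_inverse_real_of_nat by (simp add: inverse_eq_divide add.commute)
      show "eventually (\<lambda>k. \<rho> k \<noteq> 0) sequentially" using \<rho> by (intro always_eventually) (metis less_irrefl)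
    qed
    ultimately have "(\<lambda>k. (fd (x + (0 + \<rho> k) *\<^sub>R w) - fd (x + 0 *\<^sub>R w)) / \<rho> k) \<longlonglongrightarrow> (- g (T x)) * (?n * (x \<bullet> w) / (x \<bullet> x))"
      by (rule filterlim_compose)
    moreover have "(- g (T x)) * (?n * (x \<bullet> w) / (x \<bullet> x)) = (?n * g (T x) / norm x) * (w \<bullet> (- sgn x))"
      using x by (simp add: sgn_div_norm inner_commute dot_square_norm power2_eq_square divide_inverse)
    ultimately show ?thesis by simp
  qed
  have "ennreal c1 * (\<integral>\<^sup>+x. ennreal ((?n * g (T x) / norm x) powr p) \<partial>(lborel :: ((real, 'n) vec) measure)) =
     (\<integral>\<^sup>+x. ennreal c1 * ennreal ((?n * g (T x) / norm x) powr p) \<partial>(lborel :: ((real, 'n) vec) measure))"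
    by (rule nn_integral_cmult[symmetric]) measurable
  also have "\<dots> \<le> (LINT+ x. liminf (\<lambda>k. LINT+ w. Q k x w))"
  proof (rule nn_integral_mono_AE, use good AE_lborel_singleton[of "0::(real, 'n) vec"] in eventually_elim)
    fix x :: "(real, 'n) vec" assume x: "norm x ^ ?n \<notin> N" "x \<noteq> 0"
    let ?a = "?n * g (T x) / norm x"
    have a0: "0 \<le> ?a" using g0[OF T0[OF x(2)]] by simp
    have "ennreal c1 * ennreal (?a powr p) = ennreal (?a powr p) * (LINT+ w. ennreal (max 0 (w \<bullet> (- sgn x)) powr p) * indicator (ball 0 1) w)"
      using x p by (subst ball_pos_moment) (auto simp: norm_sgn c1_def \<omega>_def mult.commute)
    also have "\<dots> = (LINT+ w. ennreal (?a powr p) * (ennreal (max 0 (w \<bullet> (- sgn x)) powr p) * indicator (ball 0 1) w))"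
      by (rule nn_integral_cmult[symmetric]) measurable
    also have "\<dots> \<le> (LINT+ w. liminf (\<lambda>k. Q k x w))"
    proof (rule nn_integral_mono)
      fix w :: "(real, 'n) vec"
      have conv: "(\<lambda>k. max 0 ((fd (x + \<rho> k *\<^sub>R w) - fd x) / \<rho> k) powr p) \<longlonglongrightarrow> max 0 (?a * (w \<bullet> (- sgn x))) powr p"
        using p by (intro tendsto_powr' tendsto_max tendsto_const lim x) auto
      have "(\<lambda>k. Q k x w) \<longlonglongrightarrow> ennreal (max 0 (?a * (w \<bullet> (- sgn x))) powr p) * indicator (ball 0 1) w"
      proof (cases "w \<in> ball 0 1")
        case True
        show ?thesis unfolding Q_def indicator_simps(1)[OF True] mult_1_right
          by (rule tendsto_ennrealI[OF conv])
      qed (simp add: Q_def)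
      then have "liminf (\<lambda>k. Q k x w) = ennreal (max 0 (?a * (w \<bullet> (- sgn x))) powr p) * indicator (ball 0 1) w"
        by (intro lim_imp_Liminf) auto
      moreover have "max 0 (?a * (w \<bullet> (- sgn x))) = ?a * max 0 (w \<bullet> (- sgn x))"
        using a0 by (rule max_0_mult_left)
      ultimately show "ennreal (?a powr p) * (ennreal (max 0 (w \<bullet> (- sgn x)) powr p) * indicator (ball 0 1) w) \<le> liminf (\<lambda>k. Q k x w)"
        using a0 by (simp only: powr_mult) (simp add: ennreal_mult mult.assoc)
    qed
    also have "\<dots> \<le> liminf (\<lambda>k. LINT+ w. Q k x w)" by (rule nn_integral_liminf) measurable
    finally show "ennreal c1 * ennreal (?a powr p) \<le> liminf (\<lambda>k. LINT+ w. Q k x w)" .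
  qed
  also have "\<dots> \<le> liminf (\<lambda>k. LINT+ x. LINT+ w. Q k x w)" by (rule nn_integral_liminf) measurable
  also have "\<dots> \<le> liminf (\<lambda>k. ennreal C)" by (intro Liminf_mono always_eventually allI Qbound)
  also have "\<dots> = ennreal C" by (simp add: Liminf_const)
  finally have main: "ennreal c1 * (\<integral>\<^sup>+x. ennreal ((?n * g (T x) / norm x) powr p) \<partial>(lborel :: ((real, 'n) vec) measure)) \<le> ennreal C" .
  have "(\<integral>\<^sup>+x. ennreal ((?n * g (T x) / norm x) powr p) \<partial>(lborel :: ((real, 'n) vec) measure)) =
     (LINT+ x. ennreal ((?n * g (\<omega> * (norm (x::(real, 'n) vec) ^ ?n)) / (norm x ^ ?n) powr (1 / ?n)) powr p))"
    by (simp add: T_def norm_power_powr[OF n])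
  also have "\<dots> = ennreal \<omega> * (\<integral>\<^sup>+(\<theta>::(real, 'n) vec). (LINT+ t. ennreal ((?n * g (\<omega> * t) / t powr (1 / ?n)) powr p) * indicator {0<..} t) \<partial>sphere_borel)"
    unfolding \<omega>_def by (rule nn_integral_polar) measurable
  also have "\<dots> = ennreal \<omega> * (LINT+ t. ennreal ((?n * g (\<omega> * t) / t powr (1 / ?n)) powr p) * indicator {0<..} t)"
    by (simp add: prob_space.emeasure_space_1[OF prob_space_sphere_borel])
  also have "\<dots> = ennreal \<omega> * (LINT+ t. ennreal ((?n * g (\<omega> * t) * (\<omega> / (\<omega> * t)) powr (1 / ?n)) powr p) * indicator {0<..} (\<omega> * t))"
  proof (rule arg_cong2[where f="(*)", OF refl], rule nn_integral_cong)
    fix t :: real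
    have "1 / t powr (1 / ?n) = (\<omega> / (\<omega> * t)) powr (1 / ?n)" if "0 < t"
      using that \<omega> by (simp add: powr_divide)
    then have "?n * g (\<omega> * t) / t powr (1 / ?n) = ?n * g (\<omega> * t) * (\<omega> / (\<omega> * t)) powr (1 / ?n)" if "0 < t"
      using that by (metis times_divide_eq_right mult.right_neutral)
    then show "ennreal ((?n * g (\<omega> * t) / t powr (1 / ?n)) powr p) * indicator {0<..} t =
        ennreal ((?n * g (\<omega> * t) * (\<omega> / (\<omega> * t)) powr (1 / ?n)) powr p) * indicator {0<..} (\<omega> * t)"
      using \<omega> by (simp add: indicator_def zero_less_mult_iff)
  qed
  also have "\<dots> = (LINT+ t. ennreal ((?n * g t * (\<omega> / t) powr (1 / ?n)) powr p) * indicator {0<..} t)"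
    using \<omega> by (intro nn_integral_real_scale[symmetric]) auto
  finally show ?thesis using main by (simp add: c1_def C_def g_def \<omega>_def)
qed

section \<open>The Hardy transform of a decreasing profile\<close>

lemma liminf_ennreal_cmult: "liminf (\<lambda>k. ennreal c * Y k) = ennreal c * liminf Y"
proof -
  have "continuous_on UNIV (\<lambda>y. ennreal c * y)"
    by (rule ennreal_continuous_on_cmult) auto
  then show ?thesis
    by (rule Liminf_compose_continuous_mono) (auto intro!: monoI mult_left_mono)
qed

lemma nn_integral_inverse:
  assumes "0 < a" "0 < d"
  shows "(LINT+ s. ennreal (1 / s) * indicator {a<..<exp d * a} s) = ennreal d"
proof -
  have "(LINT+ s. ennreal (1 / s) * indicator {a<..<exp d * a} s) = (LINT+ s. ennreal (1 / s) * indicator {a..exp d * a} s)"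
    using AE_lborel_singleton[of a] AE_lborel_singleton[of "exp d * a"]
    by (intro nn_integral_cong_AE, eventually_elim) (auto simp: indicator_def)
  also have "\<dots> = ennreal (ln (exp d * a) - ln a)"
    using assms by (intro nn_integral_FTC_Icc) (auto intro!: derivative_eq_intros)
  finally show ?thesis using assms by (simp add: ln_mult)
qed

text \<open>Right continuity is what recovers \<open>F s\<close> from the values
  \<open>F (exp d * s)\<close> as d decreases to 0, in \<open>mean_osc_le_liminf\<close>.\<close>

locale decreasing_profile =
  fixes F :: "real \<Rightarrow> real"
  assumes F_borel [measurable]: "F \<in> borel_measurable borel"
    and F_nonneg: "\<And>t. 0 < t \<Longrightarrow> 0 \<le> F t"
    and F_antimono: "\<And>s t. 0 < s \<Longrightarrow> s \<le> t \<Longrightarrow> F t \<le> F s"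
    and F_right: "\<And>s. 0 < s \<Longrightarrow> (F \<longlongrightarrow> F s) (at_right s)"
begin

text \<open>Minus the difference quotient of \<open>F\<close> in the variable ln t with step
  \<open>d\<close>. The value 0 off the positive axis serves \<open>hardy_inequality\<close>, which
  asks for a function that is nonnegative everywhere.\<close>

definition quotient :: "real \<Rightarrow> real \<Rightarrow> real" where
  "quotient d t = (if 0 < t then (F t - F (exp d * t)) / d else 0)"

lemma quotient_borel [measurable]: "quotient d \<in> borel_measurable borel"
  unfolding quotient_def[abs_def] by measurable

lemma quotient_nonneg: "0 < d \<Longrightarrow> 0 \<le> quotient d t"
  using F_antimono[of t "exp d * t"] by (simp add: quotient_def)

definition log_mass :: "real \<Rightarrow> real \<Rightarrow> ennreal" where
  "log_mass a b = (LINT+ s. ennreal (F s / s) * indicator {a<..<b} s)"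

lemma log_mass_ge:
  assumes "0 < a" "0 < d" shows "ennreal (d * F (exp d * a)) \<le> log_mass a (exp d * a)"
proof -
  have "ennreal (d * F (exp d * a)) = ennreal (F (exp d * a)) * (LINT+ s. ennreal (1 / s) * indicator {a<..<exp d * a} s)"
    unfolding nn_integral_inverse[OF assms]
    using assms F_nonneg[of "exp d * a"] by (simp add: ennreal_mult[symmetric] mult.commute)
  also have "\<dots> = (LINT+ s. ennreal (F (exp d * a)) * (ennreal (1 / s) * indicator {a<..<exp d * a} s))"
    by (rule nn_integral_cmult[symmetric]) measurable
  also have "\<dots> \<le> log_mass a (exp d * a)"
    unfolding log_mass_def
  proof (rule nn_integral_mono)
    fix s
    show "ennreal (F (exp d * a)) * (ennreal (1 / s) * indicator {a<..<exp d * a} s) \<le> ennreal (F s / s) * indicator {a<..<exp d * a} s"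
    proof (cases "s \<in> {a<..<exp d * a}")
      case True
      then have "F (exp d * a) * (1 / s) \<le> F s / s"
        using F_antimono[of s "exp d * a"] assms by (simp add: divide_right_mono)
      then show ?thesis using True F_nonneg[of "exp d * a"] assms by (simp add: ennreal_mult[symmetric] ennreal_leI)
    qed simp
  qed
  finally show ?thesis .
qed

lemma log_mass_le:
  assumes "0 < a" "0 < d" shows "log_mass a (exp d * a) \<le> ennreal (d * F a)"
proof -
  have "log_mass a (exp d * a) \<le> (LINT+ s. ennreal (F a) * (ennreal (1 / s) * indicator {a<..<exp d * a} s))"
    unfolding log_mass_def
  proof (rule nn_integral_mono)
    fix s
    show "ennreal (F s / s) * indicator {a<..<exp d * a} s \<le> ennreal (F a) * (ennreal (1 / s) * indicator {a<..<exp d * a} s)"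
    proof (cases "s \<in> {a<..<exp d * a}")
      case True
      then have "F s / s \<le> F a * (1 / s)"
        using F_antimono[of a s] assms by (simp add: divide_right_mono)
      then show ?thesis using True F_nonneg[of a] assms by (simp add: ennreal_mult[symmetric] ennreal_leI)
    qed simp
  qed
  also have "\<dots> = ennreal (F a) * (LINT+ s. ennreal (1 / s) * indicator {a<..<exp d * a} s)"
    by (rule nn_integral_cmult) measurable
  also have "\<dots> = ennreal (d * F a)"
    unfolding nn_integral_inverse[OF assms]
    using assms F_nonneg[of a] by (simp add: ennreal_mult[symmetric] mult.commute)
  finally show ?thesis .
qed

lemma log_mass_combine:
  assumes "a \<le> b" "b \<le> c" shows "log_mass a c = log_mass a b + log_mass b c"
proof -
  have "log_mass a c = (LINT+ s. ennreal (F s / s) * indicator {a<..<b} s + ennreal (F s / s) * indicator {b<..<c} s)"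
    unfolding log_mass_def
  proof (rule nn_integral_cong_AE, use AE_lborel_singleton[of b] in eventually_elim)
    fix s assume "s \<noteq> b"
    then show "ennreal (F s / s) * indicator {a<..<c} s = ennreal (F s / s) * indicator {a<..<b} s + ennreal (F s / s) * indicator {b<..<c} s"
      using assms by (cases "s < b") (auto simp: indicator_def)
  qed
  also have "\<dots> = log_mass a b + log_mass b c"
    unfolding log_mass_def by (rule nn_integral_add) measurable
  finally show ?thesis .
qed

lemma log_mass_finite: assumes "0 < a" shows "log_mass a b < \<infinity>"
proof (cases "a < b")
  case True
  then have "0 < ln (b / a)" "b = exp (ln (b / a)) * a" using assms by auto
  then show ?thesis using log_mass_le[of a "ln (b / a)"] assms by (metis ennreal_less_top infinity_ennreal_def le_less_trans)
next
  case False
  then have "{a<..<b} = {}" by auto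
  then show ?thesis by (simp add: log_mass_def)
qed

text \<open>The logarithmic measure is invariant under dilations, so the integral of the difference
  quotient telescopes to two short windows.\<close>

lemma quotient_integral_ge:
  assumes st: "0 < s" "s < t" and d: "0 < d"
  shows "ennreal (F (exp d * s) - F t) \<le> (LINT+ \<sigma>. ennreal (quotient d \<sigma> / \<sigma>) * indicator {s<..<t} \<sigma>)" (is "_ \<le> ?X")
proof -
  let ?e = "exp d"
  have e1: "1 < ?e" using d by simp
  have t0: "0 < t" using st by simp
  have shift: "log_mass (?e * s) (?e * t) = (LINT+ \<sigma>. ennreal (F (?e * \<sigma>) / \<sigma>) * indicator {s<..<t} \<sigma>)"
  proof -
    have "log_mass (?e * s) (?e * t) = ennreal ?e * (LINT+ \<sigma>. ennreal (F (?e * \<sigma>) / (?e * \<sigma>)) * indicator {?e * s<..<?e * t} (?e * \<sigma>))"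
      unfolding log_mass_def by (rule nn_integral_real_scale) auto
    also have "\<dots> = (LINT+ \<sigma>. ennreal ?e * (ennreal (F (?e * \<sigma>) / (?e * \<sigma>)) * indicator {?e * s<..<?e * t} (?e * \<sigma>)))"
      by (rule nn_integral_cmult[symmetric]) measurable
    also have "\<dots> = (LINT+ \<sigma>. ennreal (F (?e * \<sigma>) / \<sigma>) * indicator {s<..<t} \<sigma>)"
    proof (rule nn_integral_cong)
      fix \<sigma> :: real
      have "ennreal ?e * ennreal (F (?e * \<sigma>) / (?e * \<sigma>)) = ennreal (F (?e * \<sigma>) / \<sigma>)" if "0 < \<sigma>"
        using that F_nonneg[of "?e * \<sigma>"] by (simp add: ennreal_mult[symmetric])
      then show "ennreal ?e * (ennreal (F (?e * \<sigma>) / (?e * \<sigma>)) * indicator {?e * s<..<?e * t} (?e * \<sigma>)) = ennreal (F (?e * \<sigma>) / \<sigma>) * indicator {s<..<t} \<sigma>"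
        using st by (auto simp: indicator_def)
    qed
    finally show ?thesis .
  qed
  have split: "log_mass s t = ennreal d * ?X + log_mass (?e * s) (?e * t)"
  proof -
    have "log_mass s t = (LINT+ \<sigma>. ennreal d * (ennreal (quotient d \<sigma> / \<sigma>) * indicator {s<..<t} \<sigma>) + ennreal (F (?e * \<sigma>) / \<sigma>) * indicator {s<..<t} \<sigma>)"
      unfolding log_mass_def
    proof (rule nn_integral_cong)
      fix \<sigma> :: real
      show "ennreal (F \<sigma> / \<sigma>) * indicator {s<..<t} \<sigma> = ennreal d * (ennreal (quotient d \<sigma> / \<sigma>) * indicator {s<..<t} \<sigma>) + ennreal (F (?e * \<sigma>) / \<sigma>) * indicator {s<..<t} \<sigma>"
      proof (cases "\<sigma> \<in> {s<..<t}")
        case True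
        then have \<sigma>: "0 < \<sigma>" using st by auto
        have "F \<sigma> / \<sigma> = d * (quotient d \<sigma> / \<sigma>) + F (?e * \<sigma>) / \<sigma>"
          using \<sigma> d by (simp add: quotient_def field_simps)
        moreover have "0 \<le> d * (quotient d \<sigma> / \<sigma>)" "0 \<le> F (?e * \<sigma>) / \<sigma>" using \<sigma> d quotient_nonneg[OF d, of \<sigma>] F_nonneg[of "?e * \<sigma>"] by auto
        ultimately have "ennreal (F \<sigma> / \<sigma>) = ennreal (d * (quotient d \<sigma> / \<sigma>)) + ennreal (F (?e * \<sigma>) / \<sigma>)"
          by (simp only: ennreal_plus)
        then show ?thesis using True d \<sigma> quotient_nonneg[OF d, of \<sigma>] by (simp add: ennreal_mult[symmetric])
      qed simp
    qed
    also have "\<dots> = ennreal d * ?X + log_mass (?e * s) (?e * t)"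
      unfolding shift by (subst nn_integral_add) (measurable, subst nn_integral_cmult, measurable)
    finally show ?thesis .
  qed
  have c1: "log_mass s (?e * t) = log_mass s t + log_mass t (?e * t)"
    using st e1 t0 by (intro log_mass_combine) auto
  have c2: "log_mass s (?e * t) = log_mass s (?e * s) + log_mass (?e * s) (?e * t)"
    using st e1 t0 by (intro log_mass_combine) auto
  have "log_mass (?e * s) (?e * t) + (ennreal d * ?X + log_mass t (?e * t)) = log_mass (?e * s) (?e * t) + log_mass s (?e * s)"
    using c1 c2 split by (simp add: ac_simps)
  then have eq: "ennreal d * ?X + log_mass t (?e * t) = log_mass s (?e * s)"
    using log_mass_finite[of "?e * s" "?e * t"] st by (auto simp: ennreal_add_left_cancel)
  have "ennreal (d * F (?e * s)) \<le> ennreal d * ?X + ennreal (d * F t)"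
    using log_mass_ge[OF st(1) d] unfolding eq[symmetric]
    by (rule order_trans) (intro add_left_mono log_mass_le t0 d)
  then have "ennreal (d * F (?e * s)) - ennreal (d * F t) \<le> ennreal d * ?X"
    by (simp add: ennreal_minus_le_iff add.commute)
  then have le: "ennreal (d * (F (?e * s) - F t)) \<le> ennreal d * ?X"
    using F_nonneg[OF t0] d by (simp add: ennreal_minus right_diff_distrib)
  have "ennreal (F (?e * s) - F t) = ennreal (1 / d) * ennreal (d * (F (?e * s) - F t))"
    using d by (simp add: ennreal_mult'[symmetric])
  also have "\<dots> \<le> ennreal (1 / d) * (ennreal d * ?X)" by (intro mult_left_mono le) simp
  also have "\<dots> = ?X" using d by (simp add: mult.assoc[symmetric] ennreal_mult[symmetric])
  finally show ?thesis .
qed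

text \<open>For the profile of \<open>f\<close> this is the Hardy transform minus the rearrangement,
  see \<open>hardy_minus_rearrangement\<close>, in a form without a difference of averages.\<close>

definition mean_osc :: "real \<Rightarrow> ennreal" where
  "mean_osc t = ennreal (1 / t) * (LINT+ s. ennreal (F s - F t) * indicator {0<..<t} s)"

text \<open>\<open>quotient_integral_ge\<close> is averaged over s between 0 and t. After the
  exchange of integrals the range of s has length \<sigma>, which cancels the weight 1/\<sigma>, so
  a Hardy mean of \<open>quotient\<close> remains.\<close>

lemma mean_osc_le_liminf:
  assumes t: "0 < t"
  shows "mean_osc t \<le> liminf (\<lambda>k. ennreal (1 / t) * (LINT+ \<sigma>. ennreal (quotient (1 / (real k + 1)) \<sigma>) * indicator {0<..<t} \<sigma>))"
proof -
  define d where "d k = 1 / (real k + 1)" for k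
  have d: "0 < d k" for k by (simp add: d_def)
  let ?q = "\<lambda>k s \<sigma>. if 0 < s \<and> s < \<sigma> \<and> \<sigma> < t then ennreal (quotient (d k) \<sigma> / \<sigma>) else 0"
  have d0: "d \<longlonglongrightarrow> 0" unfolding d_def[abs_def]
    using LIMSEQ_inverse_real_of_nat by (simp add: inverse_eq_divide add.commute)
  define X where "X k s = (LINT+ \<sigma>. ennreal (quotient (d k) \<sigma> / \<sigma>) * indicator {s<..<t} \<sigma>)" for k s
  have Xalt: "X k s = (LINT+ \<sigma>. (if s < \<sigma> \<and> \<sigma> < t then ennreal (quotient (d k) \<sigma> / \<sigma>) else 0))" for k s
    unfolding X_def by (intro nn_integral_cong) (auto simp: indicator_def)
  have [measurable]: "X k \<in> borel_measurable borel" for k unfolding Xalt[abs_def] by measurable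
  have osc: "ennreal (F s - F t) \<le> liminf (\<lambda>k. X k s)" if s: "0 < s" "s < t" for s
  proof -
    have "filterlim (\<lambda>k. exp (d k) * s) (at_right s) sequentially"
    proof (rule tendsto_imp_filterlim_at_right)
      show "(\<lambda>k. exp (d k) * s) \<longlonglongrightarrow> s" using tendsto_mult[OF tendsto_exp[OF d0] tendsto_const[of s]] by simp
      show "eventually (\<lambda>k. s < exp (d k) * s) sequentially" using d s by simp
    qed
    then have "(\<lambda>k. F (exp (d k) * s)) \<longlonglongrightarrow> F s" by (rule filterlim_compose[OF F_right[OF s(1)]])
    then have "(\<lambda>k. ennreal (F (exp (d k) * s) - F t)) \<longlonglongrightarrow> ennreal (F s - F t)"
      by (intro tendsto_ennrealI tendsto_diff tendsto_const)
    then have "liminf (\<lambda>k. ennreal (F (exp (d k) * s) - F t)) = ennreal (F s - F t)"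
      by (intro lim_imp_Liminf) auto
    moreover have "liminf (\<lambda>k. ennreal (F (exp (d k) * s) - F t)) \<le> liminf (\<lambda>k. X k s)"
      unfolding X_def by (intro Liminf_mono always_eventually allI quotient_integral_ge s d)
    ultimately show ?thesis by simp
  qed
  have fub: "(LINT+ s. X k s * indicator {0<..<t} s) = (LINT+ \<sigma>. ennreal (quotient (d k) \<sigma>) * indicator {0<..<t} \<sigma>)" for k
  proof -
    have "(LINT+ s. X k s * indicator {0<..<t} s) = (LINT+ s. LINT+ \<sigma>. ?q k s \<sigma>)"
      unfolding Xalt by (subst nn_integral_multc[symmetric], measurable) (intro nn_integral_cong, auto simp: indicator_def)
    also have "\<dots> = (LINT+ \<sigma>. LINT+ s. ?q k s \<sigma>)"
      by (rule lborel_pair.Fubini') measurable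
    also have "\<dots> = (LINT+ \<sigma>. ennreal (quotient (d k) \<sigma>) * indicator {0<..<t} \<sigma>)"
    proof (rule nn_integral_cong)
      fix \<sigma> :: real
      show "(LINT+ s. ?q k s \<sigma>) = ennreal (quotient (d k) \<sigma>) * indicator {0<..<t} \<sigma>"
      proof (cases "0 < \<sigma> \<and> \<sigma> < t")
        case True
        have "(LINT+ s. ?q k s \<sigma>) = (LINT+ s. ennreal (quotient (d k) \<sigma> / \<sigma>) * indicator {0<..<\<sigma>} s)"
          using True by (intro nn_integral_cong) (auto simp: indicator_def)
        also have "\<dots> = ennreal (quotient (d k) \<sigma> / \<sigma>) * ennreal \<sigma>" using True by (subst nn_integral_cmult_indicator) auto
        also have "\<dots> = ennreal (quotient (d k) \<sigma>)" using True quotient_nonneg[OF d, of k \<sigma>] by (simp add: ennreal_mult[symmetric])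
        finally show ?thesis using True by simp
      next
        case False
        then have "(\<lambda>s. if 0 < s \<and> s < \<sigma> \<and> \<sigma> < t then ennreal (quotient (d k) \<sigma> / \<sigma>) else 0) = (\<lambda>s. 0)" by auto
        then have "(LINT+ s. ?q k s \<sigma>) = 0" by simp
        then show ?thesis using False by (auto simp: indicator_def)
      qed
    qed
    finally show ?thesis .
  qed
  have "mean_osc t = (LINT+ s. ennreal (1 / t) * (ennreal (F s - F t) * indicator {0<..<t} s))"
    unfolding mean_osc_def by (rule nn_integral_cmult[symmetric]) measurable
  also have "\<dots> \<le> (LINT+ s. liminf (\<lambda>k. ennreal (1 / t) * (X k s * indicator {0<..<t} s)))"
  proof (rule nn_integral_mono)
    fix s
    show "ennreal (1 / t) * (ennreal (F s - F t) * indicator {0<..<t} s) \<le> liminf (\<lambda>k. ennreal (1 / t) * (X k s * indicator {0<..<t} s))"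
    proof (cases "s \<in> {0<..<t}")
      case True
      have "liminf (\<lambda>k. ennreal (1 / t) * X k s) = ennreal (1 / t) * liminf (\<lambda>k. X k s)"
        by (rule liminf_ennreal_cmult)
      then show ?thesis using True osc[of s] by (simp add: mult_left_mono)
    qed simp
  qed
  also have "\<dots> \<le> liminf (\<lambda>k. LINT+ s. ennreal (1 / t) * (X k s * indicator {0<..<t} s))"
    by (rule nn_integral_liminf) measurable
  also have "\<dots> = liminf (\<lambda>k. ennreal (1 / t) * (LINT+ \<sigma>. ennreal (quotient (d k) \<sigma>) * indicator {0<..<t} \<sigma>))"
    unfolding fub[symmetric] by (subst nn_integral_cmult) auto
  finally show ?thesis by (simp add: d_def)
qed

text \<open>Hardy's inequality holds for all steps with the same constant. Fatou's lemma lets the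
  step tend to 0, where the factor \<open>exp (d * a)\<close> disappears.\<close>

lemma mean_osc_bound:
  assumes p: "1 \<le> p" and \<gamma>: "\<gamma> = 1 - 1 / p + a / p" "0 < \<gamma>" and a: "0 \<le> a"
    and K: "0 \<le> K" and bound: "\<And>d. 0 < d \<Longrightarrow> (LINT+ t. ennreal (quotient d t powr p * t powr (- a)) * indicator {0<..} t) \<le> ennreal (K * exp (d * a))"
  shows "ennreal (\<gamma> powr p) * (LINT+ t. mean_osc t epowr p * ennreal (t powr (- a)) * indicator {0<..} t) \<le> ennreal K"
proof -
  let ?w = "\<lambda>X t. X epowr p * ennreal (t powr (- a)) * indicator {0<..} t"
  define d where "d k = 1 / (real k + 1)" for k
  have d: "0 < d k" for k by (simp add: d_def)
  have d0: "d \<longlonglongrightarrow> 0" unfolding d_def[abs_def]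
    using LIMSEQ_inverse_real_of_nat by (simp add: inverse_eq_divide add.commute)
  define A where "A k t = ennreal (1 / t) * (LINT+ s. ennreal (quotient (d k) s) * indicator {0<..<t} s)" for k t
  have Aalt: "A k t = ennreal (1 / t) * (LINT+ s. (if 0 < s \<and> s < t then ennreal (quotient (d k) s) else 0))" for k t
    unfolding A_def by (intro arg_cong2[where f="(*)"] refl nn_integral_cong) (auto simp: indicator_def)
  have [measurable]: "A k \<in> borel_measurable borel" for k unfolding Aalt[abs_def] by measurable
  have p0: "0 < p" using p by simp
  have [measurable]: "(\<lambda>t. A k t epowr p) \<in> borel_measurable borel" for k using p0 by measurable
  have "(LINT+ t. ?w (mean_osc t) t)
    \<le> (LINT+ t. liminf (\<lambda>k. ?w (A k t) t))"
  proof (rule nn_integral_mono)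
    fix t
    show "?w (mean_osc t) t \<le> liminf (\<lambda>k. ?w (A k t) t)"
    proof (cases "0 < t")
      case True
      have "mean_osc t epowr p \<le> liminf (\<lambda>k. A k t epowr p)"
        using mean_osc_le_liminf[OF True] p0 by (intro epowr_Liminf) (auto simp: A_def d_def)
      then have "mean_osc t epowr p * ennreal (t powr (- a)) \<le> liminf (\<lambda>k. A k t epowr p) * ennreal (t powr (- a))"
        by (rule mult_right_mono) simp
      also have "\<dots> = liminf (\<lambda>k. A k t epowr p * ennreal (t powr (- a)))"
        unfolding mult.commute[of _ "ennreal (t powr (- a))"] by (rule liminf_ennreal_cmult[symmetric])
      finally show ?thesis using True by simp
    qed simp
  qed
  also have "\<dots> \<le> liminf (\<lambda>k. LINT+ t. ?w (A k t) t)"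
    by (rule nn_integral_liminf) measurable
  finally have "ennreal (\<gamma> powr p) * (LINT+ t. ?w (mean_osc t) t)
    \<le> ennreal (\<gamma> powr p) * liminf (\<lambda>k. LINT+ t. ?w (A k t) t)"
    by (rule mult_left_mono) simp
  also have "\<dots> = liminf (\<lambda>k. ennreal (\<gamma> powr p) * (LINT+ t. ?w (A k t) t))"
    by (rule liminf_ennreal_cmult[symmetric])
  also have "\<dots> \<le> liminf (\<lambda>k. ennreal (K * exp (d k * a)))"
  proof (intro Liminf_mono always_eventually allI)
    fix k
    have "ennreal (\<gamma> powr p) * (LINT+ t. ?w (A k t) t)
      \<le> (LINT+ t. ennreal (quotient (d k) t powr p * t powr (- a)) * indicator {0<..} t)"
      unfolding A_def by (rule hardy_inequality[OF p _ quotient_nonneg[OF d] \<gamma>]) measurable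
    also have "\<dots> \<le> ennreal (K * exp (d k * a))" by (rule bound[OF d])
    finally show "ennreal (\<gamma> powr p) * (LINT+ t. ?w (A k t) t) \<le> ennreal (K * exp (d k * a))" .
  qed
  also have "\<dots> = ennreal K"
  proof (rule lim_imp_Liminf)
    have "(\<lambda>k. K * exp (d k * a)) \<longlonglongrightarrow> K * exp (0 * a)" by (intro tendsto_intros d0)
    then show "(\<lambda>k. ennreal (K * exp (d k * a))) \<longlonglongrightarrow> ennreal K" by (intro tendsto_ennrealI) simp
  qed simp
  finally show ?thesis .
qed

end

section \<open>The decreasing rearrangement and its radial counterpart\<close>

lemma decreasing_rearrangement_le_iff:
  fixes f :: "real^'n \<Rightarrow> real"
  assumes f [measurable]: "f \<in> borel_measurable lebesgue" and r: "0 \<le> r"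
  shows "decreasing_rearrangement f t \<le> ennreal r \<longleftrightarrow> emeasure lebesgue {x. r < \<bar>f x\<bar>} \<le> ennreal t"
proof
  have m [measurable]: "{x. l < \<bar>f x\<bar>} \<in> sets lebesgue" for l
  proof -
    have "{x \<in> space lebesgue. l < \<bar>f x\<bar>} \<in> sets lebesgue" by measurable
    then show ?thesis by simp
  qed
  assume le: "emeasure lebesgue {x. r < \<bar>f x\<bar>} \<le> ennreal t"
  have "decreasing_rearrangement f t \<le> ennreal l" if l: "r < l" for l
    unfolding decreasing_rearrangement_def
  proof (intro Inf_lower CollectI exI[of _ l] conjI refl)
    have "emeasure lebesgue {x. l < \<bar>f x\<bar>} \<le> emeasure lebesgue {x. r < \<bar>f x\<bar>}" using l by (intro emeasure_mono m) auto
    then show "emeasure lebesgue {x. l < \<bar>f x\<bar>} \<le> ennreal t" using le by (rule order_trans)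
  qed (use l r in auto)
  note gt = this
  show "decreasing_rearrangement f t \<le> ennreal r"
  proof (rule ennreal_le_epsilon)
    fix e :: real assume "0 < e"
    then show "decreasing_rearrangement f t \<le> ennreal r + ennreal e"
      using gt[of "r + e"] r by (simp add: ennreal_plus)
  qed
next
  assume le: "decreasing_rearrangement f t \<le> ennreal r"
  have m [measurable]: "{x. l < \<bar>f x\<bar>} \<in> sets lebesgue" for l
  proof -
    have "{x \<in> space lebesgue. l < \<bar>f x\<bar>} \<in> sets lebesgue" by measurable
    then show ?thesis by simp
  qed
  \<comment> \<open>The defining infimum need not be attained at \<open>r\<close>. The levels
    \<open>r + 1 / (k + 1)\<close> lie above it, their sets increase to the set at level
    \<open>r\<close>, and continuity from below transfers the bound.\<close>
  define A where "A k = {x. r + 1 / (real k + 1) < \<bar>f x\<bar>}" for k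
  have Un: "(\<Union>k. A k) = {x. r < \<bar>f x\<bar>}"
  proof (intro set_eqI iffI)
    fix x assume "x \<in> (\<Union>k. A k)"
    then obtain k where "r + 1 / (real k + 1) < \<bar>f x\<bar>" by (auto simp: A_def)
    moreover have "0 < 1 / (real k + 1)" by simp
    ultimately show "x \<in> {x. r < \<bar>f x\<bar>}" unfolding mem_Collect_eq by linarith
  next
    fix x assume "x \<in> {x. r < \<bar>f x\<bar>}"
    then obtain k where "inverse (real (Suc k)) < \<bar>f x\<bar> - r" using reals_Archimedean[of "\<bar>f x\<bar> - r"] by auto
    then have "x \<in> A k" by (simp add: A_def inverse_eq_divide algebra_simps)
    then show "x \<in> (\<Union>k. A k)" by blast
  qed
  have "emeasure lebesgue {x. r < \<bar>f x\<bar>} = (SUP k. emeasure lebesgue (A k))"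
    unfolding Un[symmetric]
  proof (rule SUP_emeasure_incseq[symmetric])
    show "range A \<subseteq> sets lebesgue" using m by (auto simp: A_def)
    show "incseq A"
    proof (rule incseq_SucI)
      fix k :: nat
      have "1 / (real (Suc k) + 1) \<le> 1 / (real k + 1)" by (simp add: frac_le)
      then show "A k \<subseteq> A (Suc k)" unfolding A_def by (auto intro: le_less_trans)
    qed
  qed
  also have "\<dots> \<le> ennreal t"
  proof (rule SUP_least)
    fix k :: nat
    have "ennreal r < ennreal (r + 1 / (real k + 1))" using r by (intro ennreal_lessI) (auto intro: add_nonneg_pos)
    then have "decreasing_rearrangement f t < ennreal (r + 1 / (real k + 1))" using le by (rule le_less_trans[rotated])
    then obtain l where l: "l > 0" "emeasure lebesgue {x. l < \<bar>f x\<bar>} \<le> ennreal t" "ennreal l < ennreal (r + 1 / (real k + 1))"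
      unfolding decreasing_rearrangement_def Inf_less_iff by blast
    have "l < r + 1 / (real k + 1)" using l(1,3) by (simp add: ennreal_less_iff)
    then have "emeasure lebesgue (A k) \<le> emeasure lebesgue {x. l < \<bar>f x\<bar>}"
      unfolding A_def by (intro emeasure_mono m) auto
    then show "emeasure lebesgue (A k) \<le> ennreal t" using l(2) by (rule order_trans)
  qed
  finally show "emeasure lebesgue {x. r < \<bar>f x\<bar>} \<le> ennreal t" .
qed

locale finite_levels =
  fixes f :: "(real, 'n::{finite,wellorder}) vec \<Rightarrow> real"
  assumes f_borel [measurable]: "f \<in> borel_measurable borel"
    and fin: "\<And>s. 0 < s \<Longrightarrow> vol {x. s < \<bar>f x\<bar>} < \<infinity>"
begin

text \<open>Real-valued by \<open>rearrangement_eq_profile\<close> for t > 0. At t = 0 an infinite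
  value would become 0, hence the removal of the origin in statements on level sets.\<close>

definition profile :: "real \<Rightarrow> real" where
  "profile t = enn2real (decreasing_rearrangement f t)"

lemma rearrangement_le_iff:
  "0 \<le> r \<Longrightarrow> decreasing_rearrangement f t \<le> ennreal r \<longleftrightarrow> vol {x. r < \<bar>f x\<bar>} \<le> ennreal t"
  by (subst decreasing_rearrangement_le_iff) (auto simp: measurable_completion)

lemma rearrangement_eq_profile:
  assumes t: "0 < t" shows "decreasing_rearrangement f t = ennreal (profile t)"
proof -
  define A where "A k = {x. real k + 1 < \<bar>f x\<bar>}" for k
  have "(\<lambda>k. vol (A k)) \<longlonglongrightarrow> vol (\<Inter>k. A k)"
  proof (rule Lim_emeasure_decseq)
    show "range A \<subseteq> sets lborel" by (auto simp: A_def)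
    show "decseq A" by (auto simp: decseq_def A_def)
    show "vol (A k) \<noteq> \<infinity>" for k using fin[of "real k + 1"] by (simp add: A_def)
  qed
  also have "(\<Inter>k. A k) = {}"
  proof -
    have "x \<notin> (\<Inter>k. A k)" for x
    proof -
      obtain k where "\<bar>f x\<bar> < real k" using reals_Archimedean2 by blast
      then have "x \<notin> A k" by (simp add: A_def)
      then show ?thesis by blast
    qed
    then show ?thesis by blast
  qed
  finally have "(\<lambda>k. vol (A k)) \<longlonglongrightarrow> 0" by simp
  then have "eventually (\<lambda>k. vol (A k) < ennreal t) sequentially" using t by (intro order_tendstoD) auto
  then obtain k where "vol (A k) < ennreal t" by (auto simp: eventually_sequentially)
  then have "decreasing_rearrangement f t \<le> ennreal (real k + 1)"
    by (subst rearrangement_le_iff) (auto simp: A_def intro: less_imp_le)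
  then have "decreasing_rearrangement f t < \<top>" by (rule le_less_trans) simp
  then show ?thesis by (simp add: profile_def)
qed

lemma profile_le_iff:
  assumes "0 < t" "0 \<le> r" shows "profile t \<le> r \<longleftrightarrow> vol {x. r < \<bar>f x\<bar>} \<le> ennreal t"
  using rearrangement_le_iff[OF assms(2), of t] assms by (simp add: rearrangement_eq_profile ennreal_le_iff)

lemma profile_nonneg: "0 \<le> profile t"
  by (simp add: profile_def)

lemma rearrangement_measurable [measurable]: "decreasing_rearrangement f \<in> borel_measurable borel"
proof (rule borel_measurableI_le)
  fix y :: ennreal
  show "{t \<in> space borel. decreasing_rearrangement f t \<le> y} \<in> sets borel"
  proof (cases y)
    case (real r)
    have "{t \<in> space borel. decreasing_rearrangement f t \<le> y} = {t \<in> space borel. vol {x. r < \<bar>f x\<bar>} \<le> ennreal t}"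
      using real by (simp add: rearrangement_le_iff)
    also have "\<dots> \<in> sets borel" by measurable
    finally show ?thesis .
  next
    case top
    then have "{t \<in> space borel. decreasing_rearrangement f t \<le> y} = UNIV" by simp
    then show ?thesis by simp
  qed
qed

lemma decreasing_profile: "decreasing_profile profile"
proof
  show "profile \<in> borel_measurable borel" unfolding profile_def[abs_def] by measurable
  show "0 \<le> profile t" for t by (rule profile_nonneg)
  show anti: "profile t \<le> profile s" if "0 < s" "s \<le> t" for s t
  proof -
    have "vol {x. profile s < \<bar>f x\<bar>} \<le> ennreal s" using profile_le_iff[OF that(1) profile_nonneg] by blast
    also have "\<dots> \<le> ennreal t" using that by (intro ennreal_leI)
    finally show ?thesis using that profile_nonneg by (subst profile_le_iff) auto
  qed
  show "(profile \<longlongrightarrow> profile s) (at_right s)" if s: "0 < s" for s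
  proof (rule order_tendstoI)
    fix a assume "profile s < a"
    then have "profile t < a" if "s < t" for t using anti[of s t] s that by simp
    then show "eventually (\<lambda>t. profile t < a) (at_right s)"
      by (intro eventually_at_right_less[THEN eventually_mono]) auto
  next
    fix a assume a: "a < profile s"
    show "eventually (\<lambda>t. a < profile t) (at_right s)"
    proof (cases "0 \<le> a")
      case True
      \<comment> \<open>Strictness leaves room: the level set at \<open>a\<close> is larger than
        some b > s, so the profile stays above \<open>a\<close> up to b.\<close>
      then have "ennreal s < vol {x. a < \<bar>f x\<bar>}" using a profile_le_iff[OF s True] by (simp add: not_le[symmetric])
      then obtain y where y: "ennreal s < y" "y < vol {x. a < \<bar>f x\<bar>}" using dense by blast
      then obtain b where b: "y = ennreal b" "0 \<le> b" by (cases y) auto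
      then have sb: "s < b" using y(1) s by (simp add: ennreal_less_iff)
      have "a < profile t" if "s < t" "t < b" for t
      proof -
        have "ennreal t < vol {x. a < \<bar>f x\<bar>}" using that s y(2) b by (intro less_trans[OF ennreal_lessI y(2)[unfolded b(1)]]) auto
        then show ?thesis using profile_le_iff[of t a] that s True by (simp add: not_le[symmetric])
      qed
      then show ?thesis using sb by (auto simp: eventually_at_right)
    next
      case False
      then have "a < profile t" for t using profile_nonneg[of t] by simp
      then show ?thesis by simp
    qed
  qed
qed

sublocale P: decreasing_profile profile by (rule decreasing_profile)

text \<open>The symmetric decreasing rearrangement of \<open>f\<close>, up to its value at the
  origin.\<close>

definition radial :: "(real, 'n) vec \<Rightarrow> real" where
  "radial x = profile (unit_ball_vol (real CARD('n)) * norm x ^ CARD('n))"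

lemma radial_levels:
  assumes s: "0 < s"
  shows "{x. s < radial x} - {0} = centred_ball (measure lborel {x. s < \<bar>f x\<bar>}) - {0}"
proof -
  let ?n = "CARD('n)" and ?\<mu> = "measure lborel {x. s < \<bar>f x\<bar>}"
  have \<omega>: "0 < unit_ball_vol (real ?n)" by (intro unit_ball_vol_pos) simp
  have n: "0 < ?n" by simp
  have e: "vol {x. s < \<bar>f x\<bar>} = ennreal ?\<mu>" using fin[OF s] by (intro emeasure_eq_ennreal_measure) auto
  have "s < radial x \<longleftrightarrow> x \<in> centred_ball ?\<mu>" if x: "x \<noteq> 0" for x
  proof -
    have T: "0 < unit_ball_vol (real ?n) * norm x ^ ?n" using x \<omega> by simp
    have "s < radial x \<longleftrightarrow> unit_ball_vol (real ?n) * norm x ^ ?n < ?\<mu>"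
    proof -
      have "profile (unit_ball_vol (real ?n) * norm x ^ ?n) \<le> s \<longleftrightarrow> ?\<mu> \<le> unit_ball_vol (real ?n) * norm x ^ ?n"
        using profile_le_iff[OF T, of s] s T unfolding e by (simp add: ennreal_le_iff)
      then show ?thesis by (auto simp: radial_def)
    qed
    also have "\<dots> \<longleftrightarrow> norm x ^ ?n < ?\<mu> / unit_ball_vol (real ?n)" using \<omega> by (simp add: pos_less_divide_eq mult.commute)
    also have "\<dots> \<longleftrightarrow> norm x ^ ?n < root ?n (?\<mu> / unit_ball_vol (real ?n)) ^ ?n"
      using \<omega> n by (simp add: real_root_pow_pos2)
    also have "\<dots> \<longleftrightarrow> norm x < root ?n (?\<mu> / unit_ball_vol (real ?n))"
      using \<omega> n by (intro norm_power_less_iff) auto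
    finally show ?thesis by (simp add: centred_ball_def)
  qed
  then show ?thesis by blast
qed

lemma radial_borel [measurable]: "radial \<in> borel_measurable borel"
  unfolding radial_def[abs_def] by measurable

lemma nonlocal_energy_radial_le:
  assumes "1 \<le> p" "K \<in> sets borel" "vol K < \<infinity>"
  shows "nonlocal_energy p radial (centred_ball (measure lborel K)) \<le> nonlocal_energy p f K"
  using assms radial_levels fin profile_nonneg
  by (intro nonlocal_energy_rearrangement) (auto simp: radial_def)

lemma hardy_minus_rearrangement:
  assumes t: "0 < t"
  shows "hardy_transform f t - decreasing_rearrangement f t = P.mean_osc t"
proof -
  have "(\<integral>\<^sup>+s\<in>{0..t}. decreasing_rearrangement f s \<partial>lborel) = (LINT+ s. ennreal (profile s - profile t) * indicator {0<..<t} s + ennreal (profile t) * indicator {0<..<t} s)"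
  proof (rule nn_integral_cong_AE, use AE_lborel_singleton[of 0] AE_lborel_singleton[of t] in eventually_elim)
    fix s :: real assume s: "s \<noteq> 0" "s \<noteq> t"
    show "decreasing_rearrangement f s * indicator {0..t} s = ennreal (profile s - profile t) * indicator {0<..<t} s + ennreal (profile t) * indicator {0<..<t} s"
    proof (cases "s \<in> {0<..<t}")
      case True
      then have "profile t \<le> profile s" by (intro P.F_antimono) auto
      then have "ennreal (profile s) = ennreal (profile s - profile t) + ennreal (profile t)"
        using profile_nonneg[of t] by (simp add: ennreal_plus[symmetric] del: ennreal_plus)
      then show ?thesis using True by (simp add: rearrangement_eq_profile)
    next
      case False
      then show ?thesis using s by (auto simp: indicator_def)
    qed
  qed
  also have "\<dots> = (LINT+ s. ennreal (profile s - profile t) * indicator {0<..<t} s) + ennreal (profile t) * ennreal t"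
    using t by (subst nn_integral_add) (auto simp: nn_integral_cmult_indicator)
  finally have "hardy_transform f t = P.mean_osc t + ennreal (1 / t) * (ennreal (profile t) * ennreal t)"
    by (simp add: hardy_transform_def P.mean_osc_def distrib_left)
  also have "ennreal (1 / t) * (ennreal (profile t) * ennreal t) = ennreal (profile t)"
    using t profile_nonneg[of t] by (simp add: ennreal_mult[symmetric])
  finally show ?thesis using t by (simp add: rearrangement_eq_profile)
qed

lemma norm_inf_p_epowr:
  assumes p: "0 < p"
  shows "norm_inf_p p f epowr p = (LINT+ t. P.mean_osc t epowr p * ennreal (t powr (- (p / CARD('n)))) * indicator {0<..} t)"
proof -
  have "norm_inf_p p f epowr p = (\<integral>\<^sup>+t\<in>{0<..}. ((hardy_transform f t - decreasing_rearrangement f t) epowr p * ennreal (1 / t powr (p / real CARD('n)))) \<partial>lborel)"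
    unfolding norm_inf_p_def by (rule epowr_epowr_inverse[OF p])
  also have "\<dots> = (LINT+ t. P.mean_osc t epowr p * ennreal (t powr (- (p / CARD('n)))) * indicator {0<..} t)"
  proof (rule nn_integral_cong)
    fix t :: real
    show "((hardy_transform f t - decreasing_rearrangement f t) epowr p * ennreal (1 / t powr (p / real CARD('n)))) * indicator {0<..} t =
      P.mean_osc t epowr p * ennreal (t powr (- (p / CARD('n)))) * indicator {0<..} t"
      by (cases "0 < t") (simp_all add: hardy_minus_rearrangement powr_minus_divide)
  qed
  finally show ?thesis .
qed

text \<open>\<open>mean_osc_bound\<close> with the weight exponent p/n converts the limit of small
  balls into the norm. For this weight Hardy's exponent is \<open>\<gamma>\<close>, which equals 1 -
  1/q.\<close>

lemma norm_inf_p_bound: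
  fixes p M \<gamma> :: real
  assumes p: "1 \<le> p" and M: "0 \<le> M"
    and \<gamma>: "\<gamma> = 1 - 1 / p + 1 / CARD('n)" "0 < \<gamma>"
    and bound: "\<And>\<rho>. 0 < \<rho> \<Longrightarrow> nonlocal_energy p radial (ball 0 \<rho>) \<le> ennreal (M * \<rho> powr (CARD('n) + p))"
  shows "ennreal (unit_ball_vol (real CARD('n)) * (CARD('n) / (CARD('n) + p)) * (sphere_moment TYPE('n) p / 2) *
      (\<gamma> * CARD('n) * unit_ball_vol (real CARD('n)) powr (1 / CARD('n))) powr p) * norm_inf_p p f epowr p \<le> ennreal M"
proof -
  let ?n = "CARD('n)" and ?\<omega> = "unit_ball_vol (real CARD('n))"
  have \<omega>: "0 < ?\<omega>" by (intro unit_ball_vol_pos) simp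
  have n: "0 < ?n" by simp
  have p0: "0 < p" using p by simp
  define c1 where "c1 = ?\<omega> * (?n / (?n + p)) * (sphere_moment TYPE('n) p / 2)"
  have c1: "0 < c1" unfolding c1_def using \<omega> n p sphere_moment_pos[OF p0, where 'n='n] by (intro mult_pos_pos divide_pos_pos) auto
  define c2 where "c2 = c1 * (?n * ?\<omega> powr (1 / ?n)) powr p"
  have c2: "0 < c2"   proof -
    have "0 < ?n * ?\<omega> powr (1 / ?n)" using n less_imp_neq[OF \<omega>] by (intro mult_pos_pos) auto
    then show ?thesis using c1 unfolding c2_def by (intro mult_pos_pos) auto
  qed
  have "ennreal (\<gamma> powr p) * (LINT+ t. P.mean_osc t epowr p * ennreal (t powr (- (p / ?n))) * indicator {0<..} t) \<le> ennreal (M / c2)"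
  proof (rule P.mean_osc_bound[OF p])
    show "\<gamma> = 1 - 1 / p + (p / ?n) / p" using \<gamma> p by simp
    show "0 < \<gamma>" "0 \<le> p / ?n" "0 \<le> M / c2" using \<gamma> p M c2 by auto
    fix d :: real assume d: "0 < d"
    let ?I = "LINT+ t. ennreal (P.quotient d t powr p * t powr (- (p / ?n))) * indicator {0<..} t"
    have "ennreal c1 * (LINT+ t. ennreal ((?n * ((profile t - profile (exp d * t)) / d) * (?\<omega> / t) powr (1 / ?n)) powr p) * indicator {0<..} t)
      \<le> ennreal (M * exp (d * p / ?n))"
      unfolding c1_def
      by (rule radial_energy_limit[OF p P.F_borel P.F_nonneg P.F_antimono d M]) (use bound in \<open>auto simp: radial_def[abs_def]\<close>)
    also have "(LINT+ t. ennreal ((?n * ((profile t - profile (exp d * t)) / d) * (?\<omega> / t) powr (1 / ?n)) powr p) * indicator {0<..} t)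
       = (LINT+ t. ennreal ((?n * ?\<omega> powr (1 / ?n)) powr p) * (ennreal (P.quotient d t powr p * t powr (- (p / ?n))) * indicator {0<..} t))"
    proof (rule nn_integral_cong)
      fix t :: real
      show "ennreal ((?n * ((profile t - profile (exp d * t)) / d) * (?\<omega> / t) powr (1 / ?n)) powr p) * indicator {0<..} t =
        ennreal ((?n * ?\<omega> powr (1 / ?n)) powr p) * (ennreal (P.quotient d t powr p * t powr (- (p / ?n))) * indicator {0<..} t)"
      proof (cases "0 < t")
        case True
        have q: "(profile t - profile (exp d * t)) / d = P.quotient d t" using True by (simp add: P.quotient_def)
        have "?n * P.quotient d t * (?\<omega> / t) powr (1 / ?n) = (?n * ?\<omega> powr (1 / ?n)) * P.quotient d t * t powr (- (1 / ?n))"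
          using True \<omega> by (simp add: powr_divide powr_minus_divide)
        also have "\<dots> powr p = (?n * ?\<omega> powr (1 / ?n)) powr p * P.quotient d t powr p * (t powr (- (1 / ?n))) powr p"
          using P.quotient_nonneg[OF d, of t] \<omega> by (simp add: powr_mult)
        also have "(t powr (- (1 / ?n))) powr p = t powr (- (p / ?n))" by (simp add: powr_powr)
        finally show ?thesis using True unfolding q by (simp add: ennreal_mult[symmetric] mult.assoc)
      qed simp
    qed
    also have "\<dots> = ennreal ((?n * ?\<omega> powr (1 / ?n)) powr p) * ?I" by (rule nn_integral_cmult) measurable
    finally have le: "ennreal c2 * ?I \<le> ennreal (M * exp (d * p / ?n))"
      using c1 by (simp add: c2_def ennreal_mult mult.assoc)
    have "?I = ennreal (1 / c2) * (ennreal c2 * ?I)" using c2 by (simp add: mult.assoc[symmetric] ennreal_mult[symmetric])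
    also have "\<dots> \<le> ennreal (1 / c2) * ennreal (M * exp (d * p / ?n))" by (intro mult_left_mono le) simp
    also have "\<dots> = ennreal (M / c2 * exp (d * (p / ?n)))" using c2 M by (simp add: ennreal_mult[symmetric])
    finally show "?I \<le> ennreal (M / c2 * exp (d * (p / ?n)))" .
  qed
  then have le: "ennreal (\<gamma> powr p) * norm_inf_p p f epowr p \<le> ennreal (M / c2)" by (simp add: norm_inf_p_epowr[OF p0])
  have "ennreal (c2 * \<gamma> powr p) * norm_inf_p p f epowr p = ennreal c2 * (ennreal (\<gamma> powr p) * norm_inf_p p f epowr p)"
    using c2 by (simp add: ennreal_mult mult.assoc)
  also have "\<dots> \<le> ennreal c2 * ennreal (M / c2)" by (intro mult_left_mono le) simp
  also have "\<dots> = ennreal M" using c2 M by (simp add: ennreal_mult[symmetric])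
  also have "c2 * \<gamma> powr p = c1 * (\<gamma> * ?n * ?\<omega> powr (1 / ?n)) powr p"
    using \<gamma>(2) \<omega> by (simp add: c2_def powr_mult mult.assoc mult.left_commute)
  finally show ?thesis by (simp add: c1_def)
qed

end

section \<open>Test functions and weak gradients\<close>

text \<open>The function exp(-1/t), extended by 0, together with its multiples by powers of 1/t: a
  family whose span is closed under differentiation.\<close>

definition flat_exp :: "nat \<Rightarrow> real \<Rightarrow> real" where
  "flat_exp m t = (if 0 < t then inverse t ^ m * exp (- inverse t) else 0)"

lemma flat_exp_lim0: "(flat_exp m \<longlongrightarrow> 0) (at 0)"
proof (rule filterlim_split_at)
  have "eventually (\<lambda>t::real. flat_exp m t = 0) (at_left 0)"
    by (auto simp: flat_exp_def eventually_at_filter)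
  then show "(flat_exp m \<longlongrightarrow> 0) (at_left 0)" by (rule tendsto_eventually)
  have "((\<lambda>t::real. inverse t ^ m / exp (inverse t)) \<longlongrightarrow> 0) (at_right 0)"
    by (rule filterlim_compose[OF tendsto_power_div_exp_0 filterlim_inverse_at_top_right])
  moreover have "eventually (\<lambda>t::real. flat_exp m t = inverse t ^ m / exp (inverse t)) (at_right 0)"
    by (auto simp: flat_exp_def eventually_at_filter exp_minus divide_inverse)
  ultimately show "(flat_exp m \<longlongrightarrow> 0) (at_right 0)" by (simp add: tendsto_cong)
qed

lemma DERIV_flat_exp: "DERIV (flat_exp m) t :> flat_exp (m + 2) t - real m * flat_exp (m + 1) t"
proof -
  consider "0 < t" | "t < 0" | "t = 0" by linarith
  then show ?thesis
  proof cases
    case 1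
    have "DERIV (\<lambda>t. inverse t ^ m * exp (- inverse t)) t :> inverse t ^ (m + 2) * exp (- inverse t) - real m * (inverse t ^ (m + 1) * exp (- inverse t))"
    proof -
      have "DERIV (\<lambda>t. inverse t ^ m) t :> - real m * inverse t ^ (m + 1)"
      proof (cases m)
        case (Suc j)
        have "DERIV inverse t :> - (inverse t ^ Suc (Suc 0))" using 1 by (intro DERIV_inverse) simp
        from DERIV_power_Suc[OF this, of j] show ?thesis unfolding Suc
          by (rule DERIV_cong) (simp add: algebra_simps)
      qed simp
      moreover have "DERIV (\<lambda>t. exp (- inverse t)) t :> exp (- inverse t) * (inverse t * inverse t)"
        using 1 by (auto intro!: derivative_eq_intros)
      ultimately show ?thesis
        by (rule DERIV_cong[OF DERIV_mult]) (simp add: algebra_simps)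
    qed
    moreover have "eventually (\<lambda>s. flat_exp m s = inverse s ^ m * exp (- inverse s)) (nhds t)"
      using eventually_nhds_in_open[of "{0<..}" t] 1 by (auto simp: flat_exp_def elim: eventually_mono)
    ultimately show ?thesis using 1 by (subst DERIV_cong_ev[OF refl _ refl]) (auto simp: flat_exp_def)
  next
    case 2
    have "eventually (\<lambda>s. flat_exp m s = 0) (nhds t)"
      using eventually_nhds_in_open[of "{..<0}" t] 2 by (auto simp: flat_exp_def elim: eventually_mono)
    then show ?thesis using 2 by (subst DERIV_cong_ev[OF refl _ refl]) (auto simp: flat_exp_def)
  next
    case 3
    \<comment> \<open>At 0 the difference quotient of \<open>flat_exp m\<close> is
      \<open>flat_exp (m + 1)\<close>, again a function with limit 0.\<close>
    have "((\<lambda>h. (flat_exp m (0 + h) - flat_exp m 0) / h) \<longlongrightarrow> 0) (at 0)"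
    proof (rule Lim_transform_eventually[OF flat_exp_lim0[of "m + 1"]])
      show "eventually (\<lambda>h. flat_exp (m + 1) h = (flat_exp m (0 + h) - flat_exp m 0) / h) (at 0)"
        by (auto simp: flat_exp_def eventually_at_filter divide_inverse)
    qed
    then show ?thesis using 3 by (simp add: DERIV_def flat_exp_def)
  qed
qed

lemma flat_exp_nonneg: "0 \<le> flat_exp m t" by (simp add: flat_exp_def)

lemma flat_exp_0_le_1: "flat_exp 0 t \<le> 1" by (simp add: flat_exp_def)

section \<open>Smooth functions with compact support\<close>

lemma Ck_const: "Ck k (\<lambda>x. c)"
  by (induction k arbitrary: c) auto

lemma frechet_derivative_at': "(f has_derivative f') (at x) \<Longrightarrow> frechet_derivative f (at x) = f'"
  by (simp add: frechet_derivative_at[symmetric])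

lemma Ck_SucD: "Ck (Suc k) f \<Longrightarrow> Ck k f"
proof (induction k arbitrary: f)
  case 0
  then show ?case by (auto simp: continuous_on_eq_continuous_within intro: differentiable_imp_continuous_within)
next
  case (Suc k)
  then show ?case by (metis Ck.simps(2))
qed

lemma Ck_add: "Ck k f \<Longrightarrow> Ck k g \<Longrightarrow> Ck k (\<lambda>x. f x + g x)"
proof (induction k arbitrary: f g)
  case 0 then show ?case by (auto intro: continuous_intros)
next
  case (Suc k)
  have "frechet_derivative (\<lambda>x. f x + g x) (at x) (axis i 1) = frechet_derivative f (at x) (axis i 1) + frechet_derivative g (at x) (axis i 1)" for x i
  proof -
    have "((\<lambda>x. f x + g x) has_derivative (\<lambda>h. frechet_derivative f (at x) h + frechet_derivative g (at x) h)) (at x)"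
      using Suc.prems by (intro has_derivative_add) (auto simp: frechet_derivative_works)
    then show ?thesis by (simp add: frechet_derivative_at')
  qed
  then show ?case using Suc by simp
qed

lemma Ck_mult: "Ck k f \<Longrightarrow> Ck k g \<Longrightarrow> Ck k (\<lambda>x. f x * g x)"
proof (induction k arbitrary: f g)
  case 0 then show ?case by (auto intro: continuous_intros)
next
  case (Suc k)
  have "frechet_derivative (\<lambda>x. f x * g x) (at x) (axis i 1) = f x * frechet_derivative g (at x) (axis i 1) + frechet_derivative f (at x) (axis i 1) * g x" for x i
  proof -
    have "((\<lambda>x. f x * g x) has_derivative (\<lambda>h. f x * frechet_derivative g (at x) h + frechet_derivative f (at x) h * g x)) (at x)"
      using Suc.prems by (intro has_derivative_mult) (auto simp: frechet_derivative_works)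
    then show ?thesis by (simp add: frechet_derivative_at')
  qed
  moreover have "Ck k (\<lambda>x. f x * frechet_derivative g (at x) (axis i 1) + frechet_derivative f (at x) (axis i 1) * g x)" for i
    using Suc.prems Ck_SucD[OF Suc.prems(1)] Ck_SucD[OF Suc.prems(2)] by (intro Ck_add Suc.IH) auto
  ultimately show ?case using Suc.prems by simp
qed

lemma Ck_prod: "finite S \<Longrightarrow> (\<And>i. i \<in> S \<Longrightarrow> Ck k (f i)) \<Longrightarrow> Ck k (\<lambda>x. \<Prod>i\<in>S. f i x)"
  by (induction S rule: finite_induct) (auto intro: Ck_const Ck_mult)

lemma Ck_flat_exp: "Ck k (\<lambda>x::real^'n. flat_exp m (c * x $ i + b))"
proof (induction k arbitrary: m)
  case 0
  have "continuous_on UNIV (flat_exp m)"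
    using DERIV_flat_exp by (auto simp: continuous_on_eq_continuous_at intro: DERIV_isCont)
  then show ?case by (auto intro!: continuous_on_compose2[of UNIV "flat_exp m"] continuous_intros)
next
  case (Suc k)
  let ?d = "\<lambda>x::real^'n. flat_exp (m + 2) (c * x $ i + b) - real m * flat_exp (m + 1) (c * x $ i + b)"
  have D: "((\<lambda>x::real^'n. flat_exp m (c * x $ i + b)) has_derivative (\<lambda>h. ?d x * (c * h $ i))) (at x)" for x
  proof -
    have "((\<lambda>x::real^'n. c * x $ i + b) has_derivative (\<lambda>h. c * h $ i)) (at x)"
      by (auto intro!: derivative_eq_intros bounded_linear.has_derivative[OF bounded_linear_vec_nth] has_derivative_ident)
    then have "(flat_exp m \<circ> (\<lambda>x::real^'n. c * x $ i + b) has_derivative (\<lambda>h. ?d x * h) \<circ> (\<lambda>h. c * h $ i)) (at x)"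
      using DERIV_flat_exp[of m "c * x $ i + b"] unfolding has_field_derivative_def by (rule diff_chain_at)
    then show ?thesis by (simp add: comp_def)
  qed
  have "frechet_derivative (\<lambda>x::real^'n. flat_exp m (c * x $ i + b)) (at x) (axis j 1) =
      flat_exp (m + 2) (c * x $ i + b) * (c * axis j 1 $ i) + (flat_exp (m + 1) (c * x $ i + b) * (- real m * (c * axis j 1 $ i)))" for x j
    unfolding frechet_derivative_at'[OF D] by (simp add: algebra_simps)
  moreover have "Ck k (\<lambda>x::real^'n. flat_exp (m + 2) (c * x $ i + b) * (c * axis j 1 $ i) + (flat_exp (m + 1) (c * x $ i + b) * (- real m * (c * axis j 1 $ i))))" for j
    by (intro Ck_add Ck_mult Ck_const Suc.IH)
  moreover have "(\<lambda>x::real^'n. flat_exp m (c * x $ i + b)) differentiable (at x)" for x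
    using D by (rule differentiableI)
  ultimately show ?case by (simp only: Ck.simps simp_thms)
qed

text \<open>Each factor is exp(-1/(k s)) with s the signed distance to a face, or 0 when s is not
  positive. Inside the box all factors tend to 1 as \<open>k\<close> grows, so the functions
  approximate its indicator.\<close>

definition box_bump :: "real^'n \<Rightarrow> real^'n \<Rightarrow> nat \<Rightarrow> real^'n \<Rightarrow> real" where
  "box_bump a b k x = (\<Prod>i\<in>UNIV. flat_exp 0 (real k * x $ i + (- real k * a $ i)) * flat_exp 0 (- real k * x $ i + real k * b $ i))"

lemma box_bump_zero: "x \<notin> box a b \<Longrightarrow> box_bump a b k x = 0"
proof -
  assume "x \<notin> box a b"
  then obtain i where "x $ i \<le> a $ i \<or> b $ i \<le> x $ i" by (auto simp: mem_box_cart not_less)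
  then have "real k * x $ i \<le> real k * a $ i \<or> real k * b $ i \<le> real k * x $ i"
    by (metis mult_left_mono of_nat_0_le_iff)
  then have "flat_exp 0 (real k * x $ i + (- real k * a $ i)) * flat_exp 0 (- real k * x $ i + real k * b $ i) = 0"
    by (auto simp: flat_exp_def)
  then show ?thesis unfolding box_bump_def by (intro prod_zero) auto
qed

lemma box_bump_range: "0 \<le> box_bump a b k x" "box_bump a b k x \<le> 1"
  unfolding box_bump_def
  by (auto intro!: prod_nonneg prod_le_1 mult_nonneg_nonneg mult_le_one simp: flat_exp_nonneg flat_exp_0_le_1)

lemma test_function_box_bump: "test_function (box_bump a b k)"
proof -
  have "Ck j (box_bump a b k)" for j
    unfolding box_bump_def by (intro Ck_prod Ck_mult Ck_flat_exp) auto
  moreover have "compact (closure {x. box_bump a b k x \<noteq> 0})"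
  proof -
    have "{x. box_bump a b k x \<noteq> 0} \<subseteq> box a b" using box_bump_zero by blast
    then have "bounded {x. box_bump a b k x \<noteq> 0}" using bounded_box bounded_subset by blast
    then show ?thesis by simp
  qed
  ultimately show ?thesis by (simp add: test_function_def)
qed

lemma box_bump_tendsto: "(\<lambda>k. box_bump a b k x) \<longlonglongrightarrow> indicator (box a b) x"
proof (cases "x \<in> box a b")
  case True
  have one: "(\<lambda>k. flat_exp 0 (real k * s)) \<longlonglongrightarrow> 1" if s: "0 < s" for s
  proof -
    have "filterlim (\<lambda>k. real k * s) at_top sequentially"
      using s by (intro filterlim_at_top_mult_tendsto_pos[OF tendsto_const]) (auto simp: filterlim_real_sequentially)
    then have "(\<lambda>k. exp (- inverse (real k * s))) \<longlonglongrightarrow> exp (- 0)"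
      by (intro tendsto_exp tendsto_minus filterlim_compose[OF tendsto_inverse_0_at_top[OF filterlim_ident]])
    moreover have "eventually (\<lambda>k. exp (- inverse (real k * s)) = flat_exp 0 (real k * s)) sequentially"
      by (rule eventually_mono[OF eventually_gt_at_top[of 0]]) (use s in \<open>simp add: flat_exp_def\<close>)
    ultimately show ?thesis by (simp add: tendsto_cong)
  qed
  have "(\<lambda>k. box_bump a b k x) \<longlonglongrightarrow> (\<Prod>i\<in>(UNIV :: 'a set). 1 * 1)"
    unfolding box_bump_def
  proof (intro tendsto_prod tendsto_mult)
    fix i
    have "0 < x $ i - a $ i" "0 < b $ i - x $ i" using True by (auto simp: mem_box_cart)
    from this[THEN one] show "(\<lambda>k. flat_exp 0 (real k * x $ i + (- real k * a $ i))) \<longlonglongrightarrow> 1"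
      "(\<lambda>k. flat_exp 0 (- real k * x $ i + real k * b $ i)) \<longlonglongrightarrow> 1"
      by (simp_all add: algebra_simps)
  qed
  then show ?thesis using True by simp
next
  case False
  then show ?thesis by (simp add: box_bump_zero)
qed

lemma Ck_differentiable: "Ck (Suc k) \<phi> \<Longrightarrow> (\<phi> has_derivative frechet_derivative \<phi> (at x)) (at x)"
  by (auto simp: frechet_derivative_works)

lemma Ck_translate: "Ck k \<phi> \<Longrightarrow> Ck k (\<lambda>x::real^'n. \<phi> (x - c))"
proof (induction k arbitrary: \<phi>)
  case 0
  then show ?case by (auto intro!: continuous_on_compose2[of UNIV \<phi>] continuous_intros)
next
  case (Suc k)
  have D: "((\<lambda>x. \<phi> (x - c)) has_derivative frechet_derivative \<phi> (at (x - c))) (at x)" for x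
  proof -
    have "((\<lambda>x. x - c) has_derivative (\<lambda>h. h)) (at x)" by (auto intro!: derivative_eq_intros)
    then have "(\<phi> \<circ> (\<lambda>x. x - c) has_derivative frechet_derivative \<phi> (at (x - c)) \<circ> (\<lambda>h. h)) (at x)"
      by (rule diff_chain_at) (rule Ck_differentiable[OF Suc.prems])
    then show ?thesis by (simp add: comp_def)
  qed
  have "(\<lambda>x. \<phi> (x - c)) differentiable (at x)" for x using D by (rule differentiableI)
  moreover have "Ck k (\<lambda>x. frechet_derivative (\<lambda>x. \<phi> (x - c)) (at x) (axis i 1))" for i
    using Suc.IH[of "\<lambda>x. frechet_derivative \<phi> (at x) (axis i 1)"] Suc.prems unfolding frechet_derivative_at'[OF D] by simp
  ultimately show ?case by simp
qed

lemma frechet_derivative_translate: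
  assumes "Ck 1 \<phi>"
  shows "frechet_derivative (\<lambda>x::real^'n. \<phi> (x - c)) (at x) = frechet_derivative \<phi> (at (x - c))"
proof (rule frechet_derivative_at')
  have "((\<lambda>x. x - c) has_derivative (\<lambda>h. h)) (at x)" by (auto intro!: derivative_eq_intros)
  then have "(\<phi> \<circ> (\<lambda>x. x - c) has_derivative frechet_derivative \<phi> (at (x - c)) \<circ> (\<lambda>h. h)) (at x)"
    by (rule diff_chain_at) (rule Ck_differentiable[of 0], use assms in simp)
  then show "((\<lambda>x. \<phi> (x - c)) has_derivative frechet_derivative \<phi> (at (x - c))) (at x)" by (simp add: comp_def)
qed

lemma test_function_CkD: "test_function \<phi> \<Longrightarrow> Ck k \<phi>"
  by (simp add: test_function_def)

lemma test_function_continuous: "test_function \<phi> \<Longrightarrow> continuous_on UNIV \<phi>"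
  using test_function_CkD[of \<phi> 0] by simp

lemma test_function_bounded_support:
  fixes \<phi> :: "real^'n \<Rightarrow> real"
  assumes "test_function \<phi>"
  obtains r where "0 \<le> r" "\<And>x. r < norm x \<Longrightarrow> \<phi> x = 0"
proof -
  have "bounded {x. \<phi> x \<noteq> 0}"
    using assms compact_imp_bounded bounded_subset[OF _ closure_subset] unfolding test_function_def by blast
  then obtain r where r: "\<And>x. \<phi> x \<noteq> 0 \<Longrightarrow> norm x \<le> r" unfolding bounded_iff by auto
  show ?thesis
  proof (rule that[of "\<bar>r\<bar>"])
    fix x :: "real^'n" assume "\<bar>r\<bar> < norm x"
    then show "\<phi> x = 0" using r[of x] by (cases "\<phi> x = 0") auto
  qed simp
qed

lemma test_function_translate: 
  assumes "test_function \<phi>" shows "test_function (\<lambda>x. \<phi> (x - c))"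
proof -
  obtain r where r: "0 \<le> r" "\<And>x. r < norm x \<Longrightarrow> \<phi> x = 0" using test_function_bounded_support[OF assms] by blast
  have "bounded {x. \<phi> (x - c) \<noteq> 0}"
  proof (rule boundedI[of _ "r + norm c"])
    fix x assume "x \<in> {x. \<phi> (x - c) \<noteq> 0}"
    then have "norm (x - c) \<le> r" using r(2)[of "x - c"] by (auto simp: not_less[symmetric])
    then show "norm x \<le> r + norm c" using norm_triangle_ineq[of "x - c" c] by simp
  qed
  then show ?thesis using assms by (auto simp: test_function_def intro: Ck_translate)
qed

lemma test_function_partial:
  assumes \<phi>: "test_function \<phi>" shows "test_function (\<lambda>x. frechet_derivative \<phi> (at x) (axis i 1))"
proof -
  obtain r where r: "0 \<le> r" "\<And>x. r < norm x \<Longrightarrow> \<phi> x = 0" using test_function_bounded_support[OF \<phi>] by blast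
  have z: "frechet_derivative \<phi> (at x) = (\<lambda>h. 0)" if x: "r < norm x" for x
  proof (rule frechet_derivative_at')
    have "eventually (\<lambda>y. \<phi> y = 0) (nhds x)"
    proof -
      have "open {y. r < norm y}" by (intro open_Collect_less continuous_intros)
      then have "eventually (\<lambda>y. y \<in> {y. r < norm y}) (nhds x)" using x by (intro eventually_nhds_in_open) auto
      then show ?thesis by eventually_elim (simp add: r(2))
    qed
    then show "(\<phi> has_derivative (\<lambda>h. 0)) (at x)"
      using has_derivative_transform_eventually[of "\<lambda>_. 0" "\<lambda>h. 0" x UNIV \<phi>] r(2)[OF x]
      by (auto simp: eventually_nhds_conv_at elim: eventually_mono)
  qed
  have "bounded {x. frechet_derivative \<phi> (at x) (axis i 1) \<noteq> 0}"
  proof (rule boundedI[of _ r])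
    fix x assume "x \<in> {x. frechet_derivative \<phi> (at x) (axis i 1) \<noteq> 0}"
    then show "norm x \<le> r" using z[of x] by (cases "norm x \<le> r") auto
  qed
  moreover have "Ck k (\<lambda>x. frechet_derivative \<phi> (at x) (axis i 1))" for k
    using test_function_CkD[OF \<phi>, of "Suc k"] by simp
  ultimately show ?thesis by (simp add: test_function_def)
qed

lemma test_function_bounded:
  assumes \<phi>: "test_function \<phi>" obtains B where "0 \<le> B" "\<And>x. \<bar>\<phi> x\<bar> \<le> B"
proof -
  obtain r where r: "0 \<le> r" "\<And>x. r < norm x \<Longrightarrow> \<phi> x = 0" using test_function_bounded_support[OF \<phi>] by blast
  have "compact (\<phi> ` cball 0 r)"
    by (intro compact_continuous_image continuous_on_subset[OF test_function_continuous[OF \<phi>]]) auto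
  then have "bounded (\<phi> ` cball 0 r)" by (rule compact_imp_bounded)
  then obtain B where "\<forall>y\<in>\<phi> ` cball 0 r. norm y \<le> B" unfolding bounded_iff by blast
  then have B: "\<bar>\<phi> x\<bar> \<le> B" if "norm x \<le> r" for x using that by auto
  show ?thesis
  proof (rule that[of "\<bar>B\<bar>"])
    fix x show "\<bar>\<phi> x\<bar> \<le> \<bar>B\<bar>" using B[of x] r(2)[of x] by (cases "norm x \<le> r") auto
  qed simp
qed

definition dir_deriv :: "(real^'n \<Rightarrow> real) \<Rightarrow> real^'n \<Rightarrow> real^'n \<Rightarrow> real" where
  "dir_deriv \<phi> u x = (\<Sum>i\<in>UNIV. u $ i * frechet_derivative \<phi> (at x) (axis i 1))"

lemma dir_deriv_eq:
  assumes "Ck 1 \<phi>" shows "dir_deriv \<phi> u x = frechet_derivative \<phi> (at x) u"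
proof -
  have "linear (frechet_derivative \<phi> (at x))"
    using Ck_differentiable[of 0 \<phi> x] assms by (auto intro: has_derivative_linear)
  then have "frechet_derivative \<phi> (at x) (\<Sum>i\<in>UNIV. u $ i *\<^sub>R axis i 1) = dir_deriv \<phi> u x"
    by (simp add: dir_deriv_def linear_sum linear_scale)
  moreover have "(\<Sum>i\<in>UNIV. u $ i *\<^sub>R axis i 1) = u"
    using basis_expansion[of u] by (simp add: scalar_mult_eq_scaleR)
  ultimately show ?thesis by simp
qed

lemma dir_deriv_bounded:
  assumes \<phi>: "test_function \<phi>" obtains B where "0 \<le> B" "\<And>x. \<bar>dir_deriv \<phi> u x\<bar> \<le> B"
proof -
  have "\<exists>B. 0 \<le> B \<and> (\<forall>x. \<bar>frechet_derivative \<phi> (at x) (axis i 1)\<bar> \<le> B)" for i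
    using test_function_bounded[OF test_function_partial[OF \<phi>, of i]] by metis
  then obtain B where B: "\<And>i. 0 \<le> B i" "\<And>i x. \<bar>frechet_derivative \<phi> (at x) (axis i 1)\<bar> \<le> B i" by metis
  show ?thesis
  proof (rule that[of "\<Sum>i\<in>UNIV. \<bar>u $ i\<bar> * B i"])
    show "0 \<le> (\<Sum>i\<in>UNIV. \<bar>u $ i\<bar> * B i)" by (intro sum_nonneg mult_nonneg_nonneg B) auto
    fix x
    have "\<bar>dir_deriv \<phi> u x\<bar> \<le> (\<Sum>i\<in>UNIV. \<bar>u $ i * frechet_derivative \<phi> (at x) (axis i 1)\<bar>)"
      unfolding dir_deriv_def by (rule sum_abs)
    also have "\<dots> \<le> (\<Sum>i\<in>UNIV. \<bar>u $ i\<bar> * B i)" using B by (intro sum_mono) (simp add: abs_mult mult_left_mono)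
    finally show "\<bar>dir_deriv \<phi> u x\<bar> \<le> (\<Sum>i\<in>UNIV. \<bar>u $ i\<bar> * B i)" .
  qed
qed

lemma dir_deriv_continuous:
  assumes \<phi>: "test_function \<phi>" shows "continuous_on UNIV (dir_deriv \<phi> u)"
  unfolding dir_deriv_def
  by (intro continuous_intros test_function_continuous test_function_partial \<phi>)

lemma dir_deriv_support:
  assumes \<phi>: "test_function \<phi>" obtains r where "0 \<le> r" "\<And>x. r < norm x \<Longrightarrow> dir_deriv \<phi> u x = 0"
proof -
  have "\<exists>r\<ge>0. \<forall>x. r < norm x \<longrightarrow> frechet_derivative \<phi> (at x) (axis i 1) = 0" for i
    using test_function_bounded_support[OF test_function_partial[OF \<phi>, of i]] by metis
  then obtain r where r: "\<And>i. 0 \<le> r i" "\<And>i x. r i < norm x \<Longrightarrow> frechet_derivative \<phi> (at x) (axis i 1) = 0" by metis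
  show ?thesis
  proof (rule that[of "\<Sum>i\<in>UNIV. r i"])
    show "0 \<le> (\<Sum>i\<in>UNIV. r i)" by (intro sum_nonneg r)
    fix x :: "real^'a" assume x: "(\<Sum>i\<in>UNIV. r i) < norm x"
    have "r i \<le> (\<Sum>i\<in>UNIV. r i)" for i by (rule member_le_sum) (use r in auto)
    then show "dir_deriv \<phi> u x = 0" using x r(2) unfolding dir_deriv_def by (intro sum.neutral) (auto intro: le_less_trans)
  qed
qed

lemma test_function_FTC:
  assumes \<phi>: "test_function \<phi>"
  shows "(LINT s|lborel. dir_deriv \<phi> u (y - s *\<^sub>R u) * indicator {0..1} s) = \<phi> y - \<phi> (y - u)"
proof -
  have C1: "Ck 1 \<phi>" by (rule test_function_CkD[OF \<phi>])
  have D: "DERIV (\<lambda>s. - \<phi> (y - s *\<^sub>R u)) s :> dir_deriv \<phi> u (y - s *\<^sub>R u)" for s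
  proof -
    have lin: "linear (frechet_derivative \<phi> (at (y - s *\<^sub>R u)))"
      using Ck_differentiable[of 0 \<phi>] C1 by (auto intro: has_derivative_linear)
    have "((\<lambda>s. y - s *\<^sub>R u) has_derivative (\<lambda>h. - (h *\<^sub>R u))) (at s)" by (auto intro!: derivative_eq_intros)
    then have "(\<phi> \<circ> (\<lambda>s. y - s *\<^sub>R u) has_derivative frechet_derivative \<phi> (at (y - s *\<^sub>R u)) \<circ> (\<lambda>h. - (h *\<^sub>R u))) (at s)"
      by (rule diff_chain_at) (rule Ck_differentiable[of 0], use C1 in simp)
    then have "((\<lambda>s. - \<phi> (y - s *\<^sub>R u)) has_derivative (\<lambda>h. - frechet_derivative \<phi> (at (y - s *\<^sub>R u)) (- (h *\<^sub>R u)))) (at s)"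
      by (intro has_derivative_minus) (simp add: comp_def)
    moreover have "(\<lambda>h. - frechet_derivative \<phi> (at (y - s *\<^sub>R u)) (- (h *\<^sub>R u))) = (*) (dir_deriv \<phi> u (y - s *\<^sub>R u))"
      using linear_neg[OF lin] linear_scale[OF lin] by (auto simp: fun_eq_iff dir_deriv_eq[OF C1])
    ultimately show ?thesis by (simp add: has_field_derivative_def)
  qed
  have "isCont (\<lambda>s. dir_deriv \<phi> u (y - s *\<^sub>R u)) s" for s
  proof -
    have "continuous_on UNIV (\<lambda>s. dir_deriv \<phi> u (y - s *\<^sub>R u))"
      by (intro continuous_on_compose2[OF dir_deriv_continuous[OF \<phi>]] continuous_intros) auto
    then show ?thesis by (simp add: continuous_on_eq_continuous_at)
  qed
  then have "(LINT s|lborel. dir_deriv \<phi> u (y - s *\<^sub>R u) * indicator {0..1} s) = (- \<phi> (y - 1 *\<^sub>R u)) - (- \<phi> (y - 0 *\<^sub>R u))"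
    using D by (intro integral_FTC_Icc_real) auto
  then show ?thesis by simp
qed

section \<open>Local integrability and the fundamental lemma of the calculus of variations\<close>

lemma integrable_lborel_pairI:
  fixes g :: "'a::euclidean_space \<Rightarrow> 'b::euclidean_space \<Rightarrow> real"
  assumes [measurable]: "(\<lambda>(x, s). g x s) \<in> borel_measurable (borel \<Otimes>\<^sub>M borel)"
    and fin: "(LINT+ x. LINT+ s. ennreal \<bar>g x s\<bar>) < \<infinity>"
  shows "integrable (lborel \<Otimes>\<^sub>M lborel) (\<lambda>(x, s). g x s)"
proof (rule integrableI_bounded)
  show "(\<lambda>(x, s). g x s) \<in> borel_measurable (lborel \<Otimes>\<^sub>M lborel)" by measurable
  have "(\<integral>\<^sup>+z. ennreal (norm ((\<lambda>(x, s). g x s) z)) \<partial>(lborel \<Otimes>\<^sub>M lborel)) = (LINT+ x. LINT+ s. ennreal (norm ((\<lambda>(x, s). g x s) (x, s))))"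
    by (rule lborel.nn_integral_fst[symmetric]) measurable
  then show "(\<integral>\<^sup>+z. ennreal (norm ((\<lambda>(x, s). g x s) z)) \<partial>(lborel \<Otimes>\<^sub>M lborel)) < \<infinity>" using fin by simp
qed

text \<open>Local integrability of a Borel representative. Closed balls about 0 exhaust the compact
  sets, and with \<open>lborel\<close> instead of its completion Fubini's theorem applies
  directly.\<close>

definition loc_int :: "('a::euclidean_space \<Rightarrow> real) \<Rightarrow> bool" where
  "loc_int g \<longleftrightarrow> g \<in> borel_measurable borel \<and> (\<forall>r. (LINT+ x. ennreal \<bar>g x\<bar> * indicator (cball 0 r) x) < \<infinity>)"

lemma locally_integrable_imp_loc_int:
  fixes f f' :: "real^'n \<Rightarrow> real"
  assumes f: "locally_integrable f" and f' [measurable]: "f' \<in> borel_measurable borel" and ae: "AE x in lebesgue. f x = f' x"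
  shows "loc_int f'"
  unfolding loc_int_def
proof (intro conjI allI f')
  fix r
  have i: "integrable lebesgue (\<lambda>x. indicator (cball 0 r) x *\<^sub>R f x)"
    using f by (simp add: locally_integrable_def set_integrable_def)
  have "(LINT+ x. ennreal \<bar>f' x\<bar> * indicator (cball 0 r) x) = (\<integral>\<^sup>+x. ennreal \<bar>f' x\<bar> * indicator (cball 0 r) x \<partial>lebesgue)"
    by (rule nn_integral_completion[symmetric])
  also have "\<dots> = (\<integral>\<^sup>+x. ennreal (norm (indicator (cball 0 r) x *\<^sub>R f x)) \<partial>lebesgue)"
    using ae by (intro nn_integral_cong_AE, eventually_elim) (auto simp: indicator_def)
  also have "\<dots> < \<infinity>" using i by (simp add: integrable_iff_bounded)
  finally show "(LINT+ x. ennreal \<bar>f' x\<bar> * indicator (cball 0 r) x) < \<infinity>" .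
qed

lemma locally_integrable_measurable:
  assumes w: "locally_integrable w" shows "w \<in> borel_measurable lebesgue"
proof (rule borel_measurable_LIMSEQ_metric)
  show "(\<lambda>x. indicator (cball 0 (real k)) x *\<^sub>R w x) \<in> borel_measurable lebesgue" for k
  proof -
    have "set_integrable lebesgue (cball 0 (real k)) w" using w by (simp add: locally_integrable_def)
    then show ?thesis unfolding set_integrable_def by (rule borel_measurable_integrable)
  qed
  show "(\<lambda>k. indicator (cball 0 (real k)) x *\<^sub>R w x) \<longlonglongrightarrow> w x" for x
  proof (rule tendsto_eventually)
    obtain k0 where "norm x \<le> real k0" using real_arch_simple by blast
    then show "eventually (\<lambda>k. indicator (cball 0 (real k)) x *\<^sub>R w x = w x) sequentially"
      by (intro eventually_sequentiallyI[of k0]) (auto simp: indicator_def)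
  qed
qed

lemma loc_int_test_integrable:
  fixes g \<psi> :: "real^'n \<Rightarrow> real"
  assumes g: "loc_int g" and \<psi>: "test_function \<psi>" shows "integrable lborel (\<lambda>y. g y * \<psi> y)"
proof -
  obtain r where r: "0 \<le> r" "\<And>x. r < norm x \<Longrightarrow> \<psi> x = 0" using test_function_bounded_support[OF \<psi>] by blast
  obtain B where B: "0 \<le> B" "\<And>x. \<bar>\<psi> x\<bar> \<le> B" using test_function_bounded[OF \<psi>] by blast
  have [measurable]: "\<psi> \<in> borel_measurable borel" "g \<in> borel_measurable borel"
    using g test_function_continuous[OF \<psi>] by (auto simp: loc_int_def borel_measurable_continuous_onI)
  have [measurable]: "cball (0::real^'n) r \<in> sets borel" by simp
  show ?thesis
  proof (rule integrableI_bounded)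
    have "(LINT+ y. ennreal (norm (g y * \<psi> y))) \<le> (LINT+ y. ennreal B * (ennreal \<bar>g y\<bar> * indicator (cball 0 r) y))"
    proof (rule nn_integral_mono)
      fix y
      show "ennreal (norm (g y * \<psi> y)) \<le> ennreal B * (ennreal \<bar>g y\<bar> * indicator (cball 0 r) y)"
      proof (cases "norm y \<le> r")
        case True
        have "\<bar>g y * \<psi> y\<bar> \<le> B * \<bar>g y\<bar>" using mult_right_mono[OF B(2)[of y], of "\<bar>g y\<bar>"] by (simp add: abs_mult mult.commute)
        then show ?thesis using True B(1) by (simp add: ennreal_mult[symmetric] ennreal_leI)
      qed (simp add: r(2))
    qed
    also have "\<dots> = ennreal B * (LINT+ y. ennreal \<bar>g y\<bar> * indicator (cball 0 r) y)" by (rule nn_integral_cmult) measurable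
    also have "\<dots> < \<infinity>" using g by (simp add: loc_int_def ennreal_mult_less_top)
    finally show "(LINT+ y. ennreal (norm (g y * \<psi> y))) < \<infinity>" .
  qed measurable
qed

lemma loc_int_translate:
  fixes g :: "'a::euclidean_space \<Rightarrow> real"
  assumes g: "loc_int g" shows "loc_int (\<lambda>x. g (x + c))"
  unfolding loc_int_def
proof (intro conjI allI)
  have [measurable]: "g \<in> borel_measurable borel" "cball (0::'a) r \<in> sets borel" for r using g by (simp_all add: loc_int_def)
  show "(\<lambda>x. g (x + c)) \<in> borel_measurable borel" by measurable
  fix r
  have "(LINT+ x. ennreal \<bar>g (x + c)\<bar> * indicator (cball 0 r) x) \<le> (LINT+ x. ennreal \<bar>g (c + x)\<bar> * indicator (cball 0 (r + norm c)) (c + x))"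
  proof (rule nn_integral_mono)
    fix x
    have "norm (c + x) \<le> r + norm c" if "norm x \<le> r" using that norm_triangle_ineq[of c x] by linarith
    then show "ennreal \<bar>g (x + c)\<bar> * indicator (cball 0 r) x \<le> ennreal \<bar>g (c + x)\<bar> * indicator (cball 0 (r + norm c)) (c + x)"
      by (auto simp: indicator_def add.commute)
  qed
  also have "\<dots> = (LINT+ x. ennreal \<bar>g x\<bar> * indicator (cball 0 (r + norm c)) x)"
    by (rule nn_integral_lborel_translate) measurable
  also have "\<dots> < \<infinity>" using g by (simp add: loc_int_def)
  finally show "(LINT+ x. ennreal \<bar>g (x + c)\<bar> * indicator (cball 0 r) x) < \<infinity>" .
qed

lemma loc_int_add:
  fixes g h :: "'a::euclidean_space \<Rightarrow> real"
  assumes g: "loc_int g" and h: "loc_int h" shows "loc_int (\<lambda>x. g x + c * h x)"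
  unfolding loc_int_def
proof (intro conjI allI)
  have [measurable]: "g \<in> borel_measurable borel" "h \<in> borel_measurable borel" "cball (0::'a) r \<in> sets borel" for r
    using g h by (simp_all add: loc_int_def)
  show "(\<lambda>x. g x + c * h x) \<in> borel_measurable borel" by measurable
  fix r
  have "(LINT+ x. ennreal \<bar>g x + c * h x\<bar> * indicator (cball 0 r) x) \<le>
      (LINT+ x. ennreal \<bar>g x\<bar> * indicator (cball 0 r) x + ennreal \<bar>c\<bar> * (ennreal \<bar>h x\<bar> * indicator (cball 0 r) x))"
    using abs_triangle_ineq[of "g _" "c * h _"]
    by (intro nn_integral_mono) (auto simp: indicator_def abs_mult ennreal_mult[symmetric] ennreal_plus[symmetric] simp del: ennreal_plus intro!: ennreal_leI)
  also have "\<dots> = (LINT+ x. ennreal \<bar>g x\<bar> * indicator (cball 0 r) x) + ennreal \<bar>c\<bar> * (LINT+ x. ennreal \<bar>h x\<bar> * indicator (cball 0 r) x)"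
    by (subst nn_integral_add) (simp_all add: nn_integral_cmult)
  also have "\<dots> < \<infinity>" using g h by (simp add: loc_int_def ennreal_mult_less_top)
  finally show "(LINT+ x. ennreal \<bar>g x + c * h x\<bar> * indicator (cball 0 r) x) < \<infinity>" .
qed

lemma loc_int_diff: "loc_int g \<Longrightarrow> loc_int h \<Longrightarrow> loc_int (\<lambda>x. g x - h x)"
  using loc_int_add[of g h "- 1"] by simp

lemma loc_int_sum: "finite I \<Longrightarrow> (\<And>i. i \<in> I \<Longrightarrow> loc_int (g i)) \<Longrightarrow> loc_int (\<lambda>x. \<Sum>i\<in>I. c i * g i x)"
proof (induction I rule: finite_induct)
  case (insert i I)
  then show ?case using loc_int_add[of "\<lambda>x. \<Sum>i\<in>I. c i * g i x" "g i" "c i"] by (simp add: add.commute)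
qed (simp add: loc_int_def)

text \<open>Supplies the absolute convergence behind the exchange of integrals in
  \<open>increment_test\<close>; the support of the kernel is bounded uniformly in the
  parameter.\<close>

lemma loc_int_kernel_integrable:
  fixes g :: "'a::euclidean_space \<Rightarrow> real" and k :: "'a \<Rightarrow> real \<Rightarrow> real"
  assumes g: "loc_int g" and [measurable]: "(\<lambda>(x, s). k x s) \<in> borel_measurable (borel \<Otimes>\<^sub>M borel)"
    and B: "\<And>x s. \<bar>k x s\<bar> \<le> B" and r: "\<And>x s. s \<in> {0..1} \<Longrightarrow> r < norm x \<Longrightarrow> k x s = 0"
  shows "integrable (lborel \<Otimes>\<^sub>M lborel) (\<lambda>(x, s). g x * k x s * indicator {0..1} s)"
proof (rule integrable_lborel_pairI)
  have [measurable]: "g \<in> borel_measurable borel" "cball (0::'a) r \<in> sets borel" using g by (simp_all add: loc_int_def)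
  show "(\<lambda>(x, s). g x * k x s * indicator {0..1} s) \<in> borel_measurable (borel \<Otimes>\<^sub>M borel)" by measurable
  have B0: "0 \<le> B" using B[of 0 0] by (meson abs_ge_zero order_trans)
  have "(LINT+ x. LINT+ s. ennreal \<bar>g x * k x s * indicator {0..1} s\<bar>)
     \<le> (LINT+ x. LINT+ s. (ennreal B * (ennreal \<bar>g x\<bar> * indicator (cball 0 r) x)) * indicator {0..1} (s::real))"
  proof (intro nn_integral_mono)
    fix x :: 'a and s :: real
    show "ennreal \<bar>g x * k x s * indicator {0..1} s\<bar> \<le> (ennreal B * (ennreal \<bar>g x\<bar> * indicator (cball 0 r) x)) * indicator {0..1} s"
    proof (cases "s \<in> {0..1} \<and> norm x \<le> r")
      case True
      have "\<bar>g x * k x s\<bar> \<le> B * \<bar>g x\<bar>" using mult_right_mono[OF B[of x s], of "\<bar>g x\<bar>"] by (simp add: abs_mult mult.commute)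
      then show ?thesis using True B0 by (simp add: ennreal_mult[symmetric] ennreal_leI)
    next
      case False
      then show ?thesis using r[of s x] by (cases "s \<in> {0..1}") auto
    qed
  qed
  also have "\<dots> = (LINT+ x. ennreal B * (ennreal \<bar>g x\<bar> * indicator (cball 0 r) x))"
    by (simp add: nn_integral_cmult)
  also have "\<dots> = ennreal B * (LINT+ x. ennreal \<bar>g x\<bar> * indicator (cball 0 r) x)"
    by (rule nn_integral_cmult) measurable
  also have "\<dots> < \<infinity>" using g by (simp add: loc_int_def ennreal_mult_less_top)
  finally show "(LINT+ x. LINT+ s. ennreal \<bar>g x * k x s * indicator {0..1} s\<bar>) < \<infinity>" .
qed

text \<open>Box indicators are bounded limits of test functions, so the measures with the positive
  and negative parts of \<open>h\<close> as densities agree on boxes, a generator closed under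
  intersection.\<close>

lemma fundamental_lemma_calculus_of_variations:
  fixes h :: "real^'n \<Rightarrow> real"
  assumes h: "loc_int h" and test: "\<And>\<phi>. test_function \<phi> \<Longrightarrow> (LINT x|lborel. h x * \<phi> x) = 0"
  shows "AE x in lborel. h x = 0"
proof -
  have [measurable]: "h \<in> borel_measurable borel" using h by (simp add: loc_int_def)
  let ?P = "density lborel (\<lambda>x. ennreal (h x))" and ?N = "density lborel (\<lambda>x. ennreal (- h x))"
  have i: "integrable lborel (\<lambda>x. indicator (box a b) x * h x)" for a b
  proof (rule integrableI_bounded)
    obtain r where "\<forall>x\<in>box a b. norm x \<le> r" using bounded_box unfolding bounded_iff by blast
    then have "(LINT+ x. ennreal (norm (indicator (box a b) x * h x))) \<le> (LINT+ x. ennreal \<bar>h x\<bar> * indicator (cball 0 r) x)"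
      by (intro nn_integral_mono) (auto simp: indicator_def)
    also have "\<dots> < \<infinity>" using h by (simp add: loc_int_def)
    finally show "(LINT+ x. ennreal (norm (indicator (box a b) x * h x))) < \<infinity>" .
  qed measurable
  have box0: "(LINT x|lborel. indicator (box a b) x * h x) = 0" for a b
  proof -
    have [measurable]: "box_bump a b k \<in> borel_measurable borel" for k
      by (intro borel_measurable_continuous_onI test_function_continuous test_function_box_bump)
    have "(\<lambda>k. LINT x|lborel. h x * box_bump a b k x) \<longlonglongrightarrow> (LINT x|lborel. indicator (box a b) x * h x)"
    proof (rule integral_dominated_convergence[OF _ _ integrable_norm[OF i]])
      show "AE x in lborel. (\<lambda>k. h x * box_bump a b k x) \<longlonglongrightarrow> indicator (box a b) x * h x"
        using tendsto_mult[OF tendsto_const box_bump_tendsto] by (intro AE_I2) (simp add: mult.commute)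
      show "AE x in lborel. norm (h x * box_bump a b k x) \<le> norm (indicator (box a b) x * h x)" for k
      proof (rule AE_I2)
        fix x
        show "norm (h x * box_bump a b k x) \<le> norm (indicator (box a b) x * h x)"
          using box_bump_range[of a b k x] box_bump_zero[of x a b k]
          by (cases "x \<in> box a b") (auto simp: abs_mult intro: mult_left_le)
      qed
    qed measurable
    then show ?thesis by (simp add: test[OF test_function_box_bump] LIMSEQ_const_iff)
  qed
  have em: "emeasure ?P (box a b) = (LINT+ x. ennreal (indicator (box a b) x * h x))"
      "emeasure ?N (box a b) = (LINT+ x. ennreal (- (indicator (box a b) x * h x)))" for a b
    by (subst emeasure_density; auto intro!: nn_integral_cong simp: indicator_def)+
  have fin: "emeasure ?P (box a b) \<noteq> \<infinity>" "emeasure ?N (box a b) \<noteq> \<infinity>" for a b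
    using i[of a b] unfolding em real_integrable_def by auto
  have eqb: "emeasure ?P (box a b) = emeasure ?N (box a b)" for a b
  proof -
    have "enn2real (emeasure ?P (box a b)) - enn2real (emeasure ?N (box a b)) = 0"
      using real_lebesgue_integral_def[OF i[of a b]] box0[of a b] unfolding em by linarith
    then show ?thesis using fin[of a b] by (cases "emeasure ?P (box a b)"; cases "emeasure ?N (box a b)") auto
  qed
  have "?P = ?N"
  proof (rule measure_eqI_generator_eq[where E="range (\<lambda>(a, b). box a b)" and \<Omega>=UNIV and A="\<lambda>n::nat. box (- (real n *\<^sub>R One)) (real n *\<^sub>R One)"])
    show "Int_stable (range (\<lambda>(a, b). box a b :: (real^'n) set))"
    proof (rule Int_stableI)
      fix X Y :: "(real^'n) set" assume "X \<in> range (\<lambda>(a, b). box a b)" "Y \<in> range (\<lambda>(a, b). box a b)"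
      then obtain a b c d where "X = box a b" "Y = box c d" by auto
      moreover obtain p q where "box a b \<inter> box c d = box p q" using box_Int_box by blast
      ultimately show "X \<inter> Y \<in> range (\<lambda>(a, b). box a b)" by (auto intro!: image_eqI[of _ _ "(p, q)"])
    qed
    show "sets ?P = sigma_sets UNIV (range (\<lambda>(a, b). box a b))" "sets ?N = sigma_sets UNIV (range (\<lambda>(a, b). box a b))"
      by (simp_all add: borel_eq_box)
    show "(\<Union>n::nat. box (- (real n *\<^sub>R One)) (real n *\<^sub>R One)) = (UNIV :: (real^'n) set)"
      by (rule UN_box_eq_UNIV)
  qed (use eqb fin in auto)
  then have "AE x in lborel. ennreal (h x) = ennreal (- h x)"
    by (intro sigma_finite_measure.density_unique[OF lborel.sigma_finite_measure_axioms]) auto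
  then show ?thesis
  proof eventually_elim
    case (elim x)
    then show ?case by (cases "0 \<le> h x") (auto simp: ennreal_neg)
  qed
qed

lemma lebesgue_borel_vec:
  fixes g :: "'a::euclidean_space \<Rightarrow> real^'n"
  assumes g: "g \<in> borel_measurable lebesgue"
  obtains g' where "g' \<in> borel_measurable borel" "AE x in lebesgue. g x = g' x"
proof -
  have "\<exists>h. h \<in> borel_measurable borel \<and> (AE x in lborel. g x $ i = h x)" for i
  proof -
    have "(\<lambda>x. g x $ i) \<in> borel_measurable lebesgue"
      by (rule measurable_compose[OF g borel_measurable_continuous_onI]) (intro continuous_intros)
    then show ?thesis using completion_ex_borel_measurable_real[of "\<lambda>x. g x $ i" lborel] by auto
  qed
  then obtain h where h: "\<And>i. h i \<in> borel_measurable borel" "\<And>i. AE x in lborel. g x $ i = h i x" by metis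
  have "AE x in lborel. \<forall>i. g x $ i = h i x" by (subst AE_all_countable) (use h in auto)
  then have "AE x in lebesgue. g x = (\<chi> i. h i x)"
    by (intro AE_completion) (auto simp: vec_eq_iff)
  moreover have "(\<lambda>x. \<chi> i. h i x) \<in> borel_measurable borel"
    by (rule borel_measurable_euclidean_space[THEN iffD2])
      (auto simp: Basis_vec_def inner_axis intro: h)
  ultimately show ?thesis using that by blast
qed

text \<open>The weak gradient identity for Borel representatives over \<open>lborel\<close>, in
  which translates and segments can be integrated by Fubini's theorem.\<close>

locale borel_gradient =
  fixes f :: "real^'n \<Rightarrow> real" and w :: "real^'n \<Rightarrow> real^'n"
  assumes loc_f: "loc_int f" and loc_w: "\<And>i. loc_int (\<lambda>x. w x $ i)"
    and weak: "\<And>\<phi> i. test_function \<phi> \<Longrightarrow>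
      (LINT x|lborel. f x * frechet_derivative \<phi> (at x) (axis i 1)) = - (LINT x|lborel. w x $ i * \<phi> x)"

lemma borel_gradientI:
  assumes wg: "has_weak_gradient f g"
    and f' [measurable]: "f' \<in> borel_measurable borel" and ae_f: "AE x in lebesgue. f x = f' x"
    and w: "w \<in> borel_measurable borel" and ae_w: "AE x in lebesgue. g x = w x"
  shows "borel_gradient f' w"
proof
  have wi [measurable]: "(\<lambda>x. w x $ i) \<in> borel_measurable borel" for i
    by (rule measurable_compose[OF w borel_measurable_continuous_onI]) (intro continuous_intros)
  have fm: "f \<in> borel_measurable lebesgue" and gm: "g \<in> borel_measurable lebesgue"
    using wg by (simp_all add: has_weak_gradient_def locally_integrable_measurable)
  have gi: "(\<lambda>x. g x $ i) \<in> borel_measurable lebesgue" for i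
    by (rule measurable_compose[OF gm borel_measurable_continuous_onI]) (intro continuous_intros)
  show "loc_int f'"
    using wg ae_f by (intro locally_integrable_imp_loc_int[OF _ f']) (auto simp: has_weak_gradient_def)
  show "loc_int (\<lambda>x. w x $ i)" for i
  proof (rule locally_integrable_imp_loc_int[OF _ wi])
    show "locally_integrable (\<lambda>x. g x $ i)"
      unfolding locally_integrable_def set_integrable_def
    proof (intro allI impI)
      fix K :: "(real^'a) set" assume "compact K"
      then have "integrable lebesgue (\<lambda>x. (indicator K x *\<^sub>R g x) $ i)"
        using wg by (intro integrable_bounded_linear[OF bounded_linear_vec_nth]) (auto simp: has_weak_gradient_def locally_integrable_def set_integrable_def)
      then show "integrable lebesgue (\<lambda>x. indicator K x *\<^sub>R g x $ i)" by simp
    qed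
    show "AE x in lebesgue. g x $ i = w x $ i" using ae_w by eventually_elim simp
  qed
  fix \<phi> :: "real^'a \<Rightarrow> real" and i assume \<phi>: "test_function \<phi>"
  let ?d = "\<lambda>x. frechet_derivative \<phi> (at x) (axis i 1)"
  have [measurable]: "\<phi> \<in> borel_measurable borel" "?d \<in> borel_measurable borel"
    by (intro borel_measurable_continuous_onI test_function_continuous test_function_partial \<phi>)+
  have cong: "(LINT x|lborel. h' x * \<psi> x) = (LINT x|lebesgue. h x * \<psi> x)"
    if [measurable]: "h' \<in> borel_measurable borel" "\<psi> \<in> borel_measurable borel" and h: "h \<in> borel_measurable lebesgue" and ae: "AE x in lebesgue. h x = h' x"
    for h h' \<psi> :: "real^'a \<Rightarrow> real"
  proof -
    have "(LINT x|lborel. h' x * \<psi> x) = (LINT x|lebesgue. h' x * \<psi> x)" by (rule integral_completion[symmetric]) measurable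
    also have "\<dots> = (LINT x|lebesgue. h x * \<psi> x)"
    proof (rule integral_cong_AE)
      show "(\<lambda>x. h' x * \<psi> x) \<in> borel_measurable lebesgue" by (rule measurable_completion) measurable
      show "(\<lambda>x. h x * \<psi> x) \<in> borel_measurable lebesgue"
        by (intro borel_measurable_times h measurable_completion) measurable
      show "AE x in lebesgue. h' x * \<psi> x = h x * \<psi> x" using ae by eventually_elim simp
    qed
    finally show ?thesis .
  qed
  have "AE x in lebesgue. g x $ i = w x $ i" using ae_w by eventually_elim simp
  then show "(LINT x|lborel. f' x * ?d x) = - (LINT x|lborel. w x $ i * \<phi> x)"
    using cong[OF f' _ fm ae_f, of ?d] cong[OF wi _ gi, of \<phi> i] wg \<phi> by (simp add: has_weak_gradient_def)
qed

text \<open>\<open>weak_gradient\<close> is an arbitrary choice; this lets any known weak gradient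
  stand in for it under integrals.\<close>

lemma has_weak_gradient_unique:
  fixes f :: "real^'n \<Rightarrow> real"
  assumes g: "has_weak_gradient f g" "has_weak_gradient f g'"
  shows "AE x in lebesgue. g x = g' x"
proof -
  have m: "f \<in> borel_measurable lebesgue" "g \<in> borel_measurable lebesgue" "g' \<in> borel_measurable lebesgue"
    using g by (simp_all add: has_weak_gradient_def locally_integrable_measurable)
  obtain f' where f': "f' \<in> borel_measurable borel" "AE x in lborel. f x = f' x"
    using completion_ex_borel_measurable_real[OF m(1)] by auto
  obtain w where w: "w \<in> borel_measurable borel" "AE x in lebesgue. g x = w x" using lebesgue_borel_vec[OF m(2)] .
  obtain w' where w': "w' \<in> borel_measurable borel" "AE x in lebesgue. g' x = w' x" using lebesgue_borel_vec[OF m(3)] .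
  interpret G: borel_gradient f' w by (rule borel_gradientI[OF g(1) f'(1) AE_completion[OF f'(2)] w])
  interpret G': borel_gradient f' w' by (rule borel_gradientI[OF g(2) f'(1) AE_completion[OF f'(2)] w'])
  have "AE x in lborel. w x $ i - w' x $ i = 0" for i
  proof (rule fundamental_lemma_calculus_of_variations)
    show "loc_int (\<lambda>x. w x $ i - w' x $ i)" by (intro loc_int_diff G.loc_w G'.loc_w)
    fix \<phi> :: "real^'n \<Rightarrow> real" assume \<phi>: "test_function \<phi>"
    have "(LINT x|lborel. (w x $ i - w' x $ i) * \<phi> x) = (LINT x|lborel. w x $ i * \<phi> x) - (LINT x|lborel. w' x $ i * \<phi> x)"
      unfolding left_diff_distrib by (intro Bochner_Integration.integral_diff loc_int_test_integrable G.loc_w G'.loc_w \<phi>)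
    then show "(LINT x|lborel. (w x $ i - w' x $ i) * \<phi> x) = 0" using G.weak[OF \<phi>, of i] G'.weak[OF \<phi>, of i] by simp
  qed
  then have "AE x in lborel. \<forall>i. w x $ i - w' x $ i = 0" by (simp add: AE_all_countable)
  then have "AE x in lebesgue. \<forall>i. w x $ i - w' x $ i = 0" by (rule AE_completion)
  with w(2) w'(2) show ?thesis by eventually_elim (simp add: vec_eq_iff)
qed

section \<open>Increments of a Sobolev function in a fixed direction\<close>

locale weak_gradient_direction = borel_gradient f w
  for f :: "real^'n \<Rightarrow> real" and w :: "real^'n \<Rightarrow> real^'n" +
  fixes u :: "real^'n"
begin

abbreviation "W x \<equiv> w x \<bullet> u"

lemma loc_W: "loc_int W"
  unfolding inner_vec_def using loc_int_sum[where I=UNIV and c="\<lambda>i. u $ i", OF finite loc_w] by (simp add: mult.commute)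

lemma W_borel [measurable]: "W \<in> borel_measurable borel"
  using loc_W by (simp add: loc_int_def)

lemma f_borel [measurable]: "f \<in> borel_measurable borel"
  using loc_f by (simp add: loc_int_def)

lemma weak_dir_deriv:
  assumes \<phi>: "test_function \<phi>"
  shows "(LINT y|lborel. f y * dir_deriv \<phi> u y) = - (LINT y|lborel. W y * \<phi> y)"
proof -
  have "(LINT y|lborel. f y * dir_deriv \<phi> u y) = (LINT y|lborel. (\<Sum>i\<in>UNIV. u $ i * (f y * frechet_derivative \<phi> (at y) (axis i 1))))"
    by (intro Bochner_Integration.integral_cong) (auto simp: dir_deriv_def sum_distrib_left mult_ac)
  also have "\<dots> = (\<Sum>i\<in>UNIV. u $ i * (LINT y|lborel. f y * frechet_derivative \<phi> (at y) (axis i 1)))"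
    by (subst Bochner_Integration.integral_sum) (auto intro!: integrable_mult_right loc_int_test_integrable loc_f test_function_partial \<phi>)
  also have "\<dots> = - (\<Sum>i\<in>UNIV. u $ i * (LINT y|lborel. w y $ i * \<phi> y))"
    by (simp add: weak[OF \<phi>] sum_negf)
  also have "(\<Sum>i\<in>UNIV. u $ i * (LINT y|lborel. w y $ i * \<phi> y)) = (LINT y|lborel. (\<Sum>i\<in>UNIV. u $ i * (w y $ i * \<phi> y)))"
    by (subst Bochner_Integration.integral_sum) (auto intro!: integrable_mult_right loc_int_test_integrable loc_w \<phi>)
  also have "(\<lambda>y. \<Sum>i\<in>UNIV. u $ i * (w y $ i * \<phi> y)) = (\<lambda>y. W y * \<phi> y)"
    by (simp add: fun_eq_iff inner_vec_def sum_distrib_left sum_distrib_right mult_ac)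
  finally show ?thesis .
qed

definition mean_W :: "real^'n \<Rightarrow> real" where
  "mean_W x = (LINT s|lborel. W (x + s *\<^sub>R u) * indicator {0..1} s)"

lemma mean_W_borel [measurable]: "mean_W \<in> borel_measurable borel"
  unfolding mean_W_def[abs_def] by measurable

text \<open>Translating by \<open>s *\<^sub>R u\<close> with s between 0 and 1 enlarges the ball by
  at most the norm of \<open>u\<close>, so local integrability bounds all these integrals at
  once.\<close>

lemma segment_finite:
  "(LINT+ x. LINT+ s. ennreal \<bar>W (x + s *\<^sub>R u)\<bar> * indicator {0..1} s * indicator (cball 0 r) x) < \<infinity>"
proof -
  have [measurable]: "cball (0::real^'n) r \<in> sets borel" for r by simp
  let ?C = "LINT+ y. ennreal \<bar>W y\<bar> * indicator (cball 0 (r + norm u)) y"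
  have "(LINT+ x. LINT+ s. ennreal \<bar>W (x + s *\<^sub>R u)\<bar> * indicator {0..1} s * indicator (cball 0 r) x) =
     (LINT+ s. LINT+ x. ennreal \<bar>W (x + s *\<^sub>R u)\<bar> * indicator {0..1} s * indicator (cball 0 r) x)"
    by (rule lborel_pair.Fubini') measurable
  also have "\<dots> \<le> (\<integral>\<^sup>+s. ?C * indicator {0..1} s \<partial>(lborel :: real measure))"
  proof (rule nn_integral_mono)
    fix s :: real
    show "(LINT+ x. ennreal \<bar>W (x + s *\<^sub>R u)\<bar> * indicator {0..1} s * indicator (cball 0 r) x) \<le> ?C * indicator {0..1} s"
    proof (cases "s \<in> {0..1}")
      case True
      have "(LINT+ x. ennreal \<bar>W (x + s *\<^sub>R u)\<bar> * indicator {0..1} s * indicator (cball 0 r) x)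
          \<le> (LINT+ x. ennreal \<bar>W (s *\<^sub>R u + x)\<bar> * indicator (cball 0 (r + norm u)) (s *\<^sub>R u + x))"
      proof (rule nn_integral_mono)
        fix x
        have "norm (s *\<^sub>R u + x) \<le> r + norm u" if "norm x \<le> r"
        proof -
          have "norm (s *\<^sub>R u) \<le> norm u" using True by (simp add: mult_left_le_one_le)
          then show ?thesis using that norm_triangle_ineq[of "s *\<^sub>R u" x] by linarith
        qed
        then show "ennreal \<bar>W (x + s *\<^sub>R u)\<bar> * indicator {0..1} s * indicator (cball 0 r) x \<le> ennreal \<bar>W (s *\<^sub>R u + x)\<bar> * indicator (cball 0 (r + norm u)) (s *\<^sub>R u + x)"
          using True by (auto simp: indicator_def add.commute)
      qed
      also have "\<dots> = ?C" by (rule nn_integral_lborel_translate) measurable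
      finally show ?thesis using True by simp
    qed simp
  qed
  also have "\<dots> = ?C" by (simp add: nn_integral_cmult)
  also have "\<dots> < \<infinity>" using loc_W by (simp add: loc_int_def)
  finally show ?thesis .
qed

lemma AE_segment_integrable: "AE x in lborel. integrable lborel (\<lambda>s. W (x + s *\<^sub>R u) * indicator {0..1} s)"
proof -
  have [measurable]: "cball (0::real^'n) r \<in> sets borel" for r by simp
  have "AE x in lborel. (LINT+ s. ennreal \<bar>W (x + s *\<^sub>R u)\<bar> * indicator {0..1} s * indicator (cball 0 (real k)) x) \<noteq> \<infinity>" for k
    by (rule nn_integral_noteq_infinite) (use segment_finite[of "real k"] in \<open>auto simp: less_top\<close>)
  then have "AE x in lborel. \<forall>k::nat. (LINT+ s. ennreal \<bar>W (x + s *\<^sub>R u)\<bar> * indicator {0..1} s * indicator (cball 0 (real k)) x) \<noteq> \<infinity>"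
    by (simp only: AE_all_countable) blast
  then show ?thesis
  proof eventually_elim
    case (elim x)
    obtain k where k: "norm x \<le> real k" using real_arch_simple by blast
    show ?case
    proof (rule integrableI_bounded)
      have "(LINT+ s. ennreal (norm (W (x + s *\<^sub>R u) * indicator {0..1} s))) =
          (LINT+ s. ennreal \<bar>W (x + s *\<^sub>R u)\<bar> * indicator {0..1} s * indicator (cball 0 (real k)) x)"
        using k by (intro nn_integral_cong) (auto simp: indicator_def)
      then show "(LINT+ s. ennreal (norm (W (x + s *\<^sub>R u) * indicator {0..1} s))) < \<infinity>"
        using elim[rule_format, of k] by (simp add: less_top)
    qed measurable
  qed
qed

lemma loc_mean_W: "loc_int mean_W"
  unfolding loc_int_def
proof (intro conjI allI)
  fix r
  have "(LINT+ x. ennreal \<bar>mean_W x\<bar> * indicator (cball 0 r) x) \<le>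
     (LINT+ x. LINT+ s. ennreal \<bar>W (x + s *\<^sub>R u)\<bar> * indicator {0..1} s * indicator (cball 0 r) x)"
  proof (rule nn_integral_mono)
    fix x
    \<comment> \<open>Where the integral over the segment does not exist, its value is 0 by
      convention and the bound is trivial.\<close>
    have "ennreal \<bar>mean_W x\<bar> \<le> (LINT+ s. ennreal \<bar>W (x + s *\<^sub>R u) * indicator {0..1} s\<bar>)"
      unfolding mean_W_def using integral_norm_bound_ennreal[of lborel "\<lambda>s. W (x + s *\<^sub>R u) * indicator {0..1} s"]
      by (cases "integrable lborel (\<lambda>s. W (x + s *\<^sub>R u) * indicator {0..1} s)") (auto simp: not_integrable_integral_eq)
    also have "\<dots> = (LINT+ s. ennreal \<bar>W (x + s *\<^sub>R u)\<bar> * indicator {0..1} s)"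
      by (intro nn_integral_cong) (auto simp: indicator_def)
    finally show "ennreal \<bar>mean_W x\<bar> * indicator (cball 0 r) x \<le> (LINT+ s. ennreal \<bar>W (x + s *\<^sub>R u)\<bar> * indicator {0..1} s * indicator (cball 0 r) x)"
      by (subst nn_integral_multc) (auto intro: mult_right_mono)
  qed
  then show "(LINT+ x. ennreal \<bar>mean_W x\<bar> * indicator (cball 0 r) x) < \<infinity>"
    using segment_finite by (rule le_less_trans)
qed measurable

lemma segment_pair_integrable:
  assumes \<phi>: "test_function \<phi>"
  shows "integrable (lborel \<Otimes>\<^sub>M lborel) (\<lambda>(x, s). W (x + s *\<^sub>R u) * \<phi> x * indicator {0..1} s)"
proof (rule integrable_lborel_pairI)
  obtain r where r: "0 \<le> r" "\<And>x. r < norm x \<Longrightarrow> \<phi> x = 0" using test_function_bounded_support[OF \<phi>] by blast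
  obtain B where B: "0 \<le> B" "\<And>x. \<bar>\<phi> x\<bar> \<le> B" using test_function_bounded[OF \<phi>] by blast
  have [measurable]: "\<phi> \<in> borel_measurable borel" "cball (0::real^'n) r \<in> sets borel"
    using test_function_continuous[OF \<phi>] by (auto intro: borel_measurable_continuous_onI)
  show "(\<lambda>(x, s). W (x + s *\<^sub>R u) * \<phi> x * indicator {0..1} s) \<in> borel_measurable (borel \<Otimes>\<^sub>M borel)" by measurable
  have "(LINT+ x. LINT+ s. ennreal \<bar>W (x + s *\<^sub>R u) * \<phi> x * indicator {0..1} s\<bar>) \<le>
    (LINT+ x. LINT+ s. ennreal B * (ennreal \<bar>W (x + s *\<^sub>R u)\<bar> * indicator {0..1} s * indicator (cball 0 r) x))"
  proof (intro nn_integral_mono)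
    fix x :: "real^'n" and s :: real
    show "ennreal \<bar>W (x + s *\<^sub>R u) * \<phi> x * indicator {0..1} s\<bar> \<le> ennreal B * (ennreal \<bar>W (x + s *\<^sub>R u)\<bar> * indicator {0..1} s * indicator (cball 0 r) x)"
    proof (cases "s \<in> {0..1} \<and> norm x \<le> r")
      case True
      have "\<bar>W (x + s *\<^sub>R u) * \<phi> x\<bar> \<le> B * \<bar>W (x + s *\<^sub>R u)\<bar>"
        using mult_right_mono[OF B(2)[of x], of "\<bar>W (x + s *\<^sub>R u)\<bar>"] by (simp add: abs_mult mult.commute)
      then show ?thesis using True B(1) by (simp add: ennreal_mult[symmetric] ennreal_leI)
    qed (auto simp: r(2))
  qed
  also have "\<dots> = ennreal B * (LINT+ x. LINT+ s. ennreal \<bar>W (x + s *\<^sub>R u)\<bar> * indicator {0..1} s * indicator (cball 0 r) x)"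
    by (simp add: nn_integral_cmult)
  also have "\<dots> < \<infinity>" using segment_finite[of r] by (simp add: ennreal_mult_less_top)
  finally show "(LINT+ x. LINT+ s. ennreal \<bar>W (x + s *\<^sub>R u) * \<phi> x * indicator {0..1} s\<bar>) < \<infinity>" .
qed

text \<open>The increment of \<open>f\<close> is moved to the test function, where the classical fundamental theorem
  of calculus applies.\<close>

lemma increment_test:
  assumes \<phi>: "test_function \<phi>"
  shows "(LINT x|lborel. (f (x + u) - f x) * \<phi> x) = (LINT x|lborel. mean_W x * \<phi> x)"
proof -
  have C1: "Ck 1 \<phi>" by (rule test_function_CkD[OF \<phi>])
  have \<phi>t: "test_function (\<lambda>x. \<phi> (x - c))" for c by (rule test_function_translate[OF \<phi>])
  have ddt: "dir_deriv (\<lambda>x. \<phi> (x - c)) u y = dir_deriv \<phi> u (y - c)" for c y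
    by (simp add: dir_deriv_def frechet_derivative_translate[OF C1])
  have ddc: "dir_deriv \<phi> u \<in> borel_measurable borel"
    by (intro borel_measurable_continuous_onI dir_deriv_continuous \<phi>)
  have [measurable]: "\<phi> \<in> borel_measurable borel"
    using test_function_continuous[OF \<phi>] by (rule borel_measurable_continuous_onI)
  obtain r where r: "0 \<le> r" "\<And>x. r < norm x \<Longrightarrow> dir_deriv \<phi> u x = 0" using dir_deriv_support[OF \<phi>] by blast
  obtain B where B: "0 \<le> B" "\<And>x. \<bar>dir_deriv \<phi> u x\<bar> \<le> B" using dir_deriv_bounded[OF \<phi>] by blast
  have kint: "integrable (lborel \<Otimes>\<^sub>M lborel) (\<lambda>(y, s). f y * dir_deriv \<phi> u (y - s *\<^sub>R u) * indicator {0..1} s)"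
  proof (rule loc_int_kernel_integrable[OF loc_f _ B(2)])
    show "(\<lambda>(x, s). dir_deriv \<phi> u (x - s *\<^sub>R u)) \<in> borel_measurable (borel \<Otimes>\<^sub>M borel)"
      unfolding split_beta by (rule measurable_compose[OF _ ddc]) measurable
    fix x :: "real^'n" and s :: real assume s: "s \<in> {0..1}" and x: "r + norm u < norm x"
    have "norm (s *\<^sub>R u) \<le> norm u" using s by (simp add: mult_left_le_one_le)
    then have "r < norm (x - s *\<^sub>R u)" using x norm_triangle_ineq2[of x "s *\<^sub>R u"] by linarith
    then show "dir_deriv \<phi> u (x - s *\<^sub>R u) = 0" by (rule r(2))
  qed
  have trans: "(LINT x|lborel. g (x + c)) = (LINT x|lborel. g x)" if "g \<in> borel_measurable borel" for g :: "real^'n \<Rightarrow> real" and c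
  proof -
    have "(LINT x|lborel. g x) = (LINT x|distr lborel borel ((+) c). g x)" by (simp only: lborel_distr_plus)
    also have "\<dots> = (LINT x|lborel. g (c + x))" using that by (subst integral_distr) auto
    finally show ?thesis by (simp add: add.commute)
  qed
  have "(LINT x|lborel. (f (x + u) - f x) * \<phi> x) = (LINT x|lborel. f (x + u) * \<phi> x) - (LINT x|lborel. f x * \<phi> x)"
    unfolding left_diff_distrib
    by (intro Bochner_Integration.integral_diff loc_int_test_integrable loc_int_translate loc_f \<phi>)
  also have "(LINT x|lborel. f (x + u) * \<phi> x) = (LINT y|lborel. f y * \<phi> (y - u))"
    using trans[of "\<lambda>y. f y * \<phi> (y - u)" u] by simp
  also have "(LINT y|lborel. f y * \<phi> (y - u)) - (LINT x|lborel. f x * \<phi> x) = - (LINT y|lborel. f y * (\<phi> y - \<phi> (y - u)))"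
    unfolding right_diff_distrib
    by (subst Bochner_Integration.integral_diff) (auto intro!: loc_int_test_integrable loc_f \<phi> \<phi>t)
  also have "(LINT y|lborel. f y * (\<phi> y - \<phi> (y - u))) = (LINT y|lborel. LINT s|lborel. f y * dir_deriv \<phi> u (y - s *\<^sub>R u) * indicator {0..1} s)"
    unfolding test_function_FTC[OF \<phi>, symmetric] by (simp add: mult.assoc)
  also have "\<dots> = (LINT s|lborel. LINT y|lborel. f y * dir_deriv \<phi> u (y - s *\<^sub>R u) * indicator {0..1} s)"
    by (rule lborel_pair.Fubini_integral[OF kint, symmetric])
  also have "\<dots> = (LINT s|lborel. - (LINT x|lborel. W (x + s *\<^sub>R u) * \<phi> x * indicator {0..1} s))"
  proof (rule Bochner_Integration.integral_cong[OF refl])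
    fix s :: real
    have "(LINT y|lborel. f y * dir_deriv \<phi> u (y - s *\<^sub>R u)) = - (LINT y|lborel. W y * \<phi> (y - s *\<^sub>R u))"
      using weak_dir_deriv[OF \<phi>t[of "s *\<^sub>R u"]] by (simp add: ddt)
    also have "(LINT y|lborel. W y * \<phi> (y - s *\<^sub>R u)) = (LINT x|lborel. W (x + s *\<^sub>R u) * \<phi> x)"
      using trans[of "\<lambda>y. W y * \<phi> (y - s *\<^sub>R u)" "s *\<^sub>R u"] by simp
    finally show "(LINT y|lborel. f y * dir_deriv \<phi> u (y - s *\<^sub>R u) * indicator {0..1} s) = - (LINT x|lborel. W (x + s *\<^sub>R u) * \<phi> x * indicator {0..1} s)"
      by simp
  qed
  also have "\<dots> = - (LINT x|lborel. LINT s|lborel. W (x + s *\<^sub>R u) * \<phi> x * indicator {0..1} s)"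
    using lborel_pair.Fubini_integral[OF segment_pair_integrable[OF \<phi>]] by simp
  also have "(LINT x|lborel. LINT s|lborel. W (x + s *\<^sub>R u) * \<phi> x * indicator {0..1} s) = (LINT x|lborel. mean_W x * \<phi> x)"
    unfolding mean_W_def by (simp add: mult.assoc mult.commute[of "\<phi> _"] flip: integral_mult_left_zero)
  finally show ?thesis by simp
qed

lemma AE_increment: "AE x in lborel. f (x + u) - f x = mean_W x"
proof -
  have l: "loc_int (\<lambda>x. f (x + u) - f x - mean_W x)"
    by (intro loc_int_diff loc_int_translate loc_f loc_mean_W)
  have "AE x in lborel. f (x + u) - f x - mean_W x = 0"
  proof (rule fundamental_lemma_calculus_of_variations[OF l])
    fix \<phi> :: "real^'n \<Rightarrow> real" assume \<phi>: "test_function \<phi>"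
    have "(LINT x|lborel. (f (x + u) - f x - mean_W x) * \<phi> x) = (LINT x|lborel. (f (x + u) - f x) * \<phi> x) - (LINT x|lborel. mean_W x * \<phi> x)"
      unfolding left_diff_distrib[of "f (_ + u) - f _" "mean_W _"]
      by (intro Bochner_Integration.integral_diff loc_int_test_integrable loc_int_diff loc_int_translate loc_f loc_mean_W \<phi>)
    then show "(LINT x|lborel. (f (x + u) - f x - mean_W x) * \<phi> x) = 0" by (simp add: increment_test[OF \<phi>])
  qed
  then show ?thesis by eventually_elim simp
qed

lemma increment_bound:
  assumes p: "1 \<le> p"
  shows "(LINT+ x. ennreal (max 0 (f (x + u) - f x) powr p)) \<le> (LINT+ x. ennreal (max 0 (W x) powr p))"
proof -
  let ?U = "restrict_space lborel {0..1::real}"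
  have U: "prob_space ?U"
    by (rule prob_spaceI) (simp add: space_restrict_space emeasure_restrict_space)
  have "(LINT+ x. ennreal (max 0 (f (x + u) - f x) powr p))
      \<le> (LINT+ x. LINT+ s. ennreal (max 0 (W (x + s *\<^sub>R u)) powr p) * indicator {0..1} s)"
  proof (rule nn_integral_mono_AE, use AE_increment AE_segment_integrable in eventually_elim)
    case (elim x)
    have i: "integrable ?U (\<lambda>s. W (x + s *\<^sub>R u))"
      using elim(2) by (subst integrable_restrict_space) (simp_all add: mult.commute)
    have "mean_W x = (\<integral>s. W (x + s *\<^sub>R u) \<partial>?U)"
      unfolding mean_W_def by (subst integral_restrict_space) (simp_all add: mult.commute)
    then have "ennreal (max 0 (f (x + u) - f x) powr p) \<le> (\<integral>\<^sup>+s. ennreal (max 0 (W (x + s *\<^sub>R u)) powr p) \<partial>?U)"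
      using real_Jensen[OF p U i] elim(1) by simp
    also have "\<dots> = (LINT+ s. ennreal (max 0 (W (x + s *\<^sub>R u)) powr p) * indicator {0..1} s)"
      by (subst nn_integral_restrict_space) simp_all
    finally show ?case .
  qed
  also have "\<dots> = (LINT+ s. LINT+ x. ennreal (max 0 (W (x + s *\<^sub>R u)) powr p) * indicator {0..1} s)"
    by (rule lborel_pair.Fubini') measurable
  also have "\<dots> = (\<integral>\<^sup>+s. (LINT+ x. ennreal (max 0 (W x) powr p)) * indicator {0..1} s \<partial>(lborel :: real measure))"
  proof (rule nn_integral_cong)
    fix s :: real
    have "(LINT+ x. ennreal (max 0 (W (s *\<^sub>R u + x)) powr p)) = (LINT+ x. ennreal (max 0 (W x) powr p))"
      by (rule nn_integral_lborel_translate) measurable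
    then show "(LINT+ x. ennreal (max 0 (W (x + s *\<^sub>R u)) powr p) * indicator {0..1} s) = (LINT+ x. ennreal (max 0 (W x) powr p)) * indicator {0..1} s"
      by (subst nn_integral_multc) (simp_all add: add.commute)
  qed
  also have "\<dots> = (LINT+ x. ennreal (max 0 (W x) powr p))" by (simp add: nn_integral_cmult)
  finally show ?thesis .
qed

end

section \<open>The inequality\<close>

text \<open>The expression is 1 - 1/q; at p = 1 it still has the value 1/n.\<close>

lemma affine_exponent_pos:
  assumes "1 \<le> p" shows "0 < 1 - 1 / p + 1 / real CARD('n::finite)"
proof -
  have "1 / p \<le> 1" using assms by simp
  moreover have "0 < 1 / real CARD('n)" by simp
  ultimately show ?thesis by linarith
qed

lemma norm_inf_p_cong_AE:
  assumes "AE x in lebesgue. f x = f' x" and m: "f \<in> borel_measurable lebesgue" "f' \<in> borel_measurable lebesgue"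
  shows "norm_inf_p p f = norm_inf_p p f'"
proof -
  have "emeasure lebesgue {x. l < \<bar>f x\<bar>} = emeasure lebesgue {x. l < \<bar>f' x\<bar>}" for l
  proof (rule emeasure_eq_AE)
    show "AE x in lebesgue. (x \<in> {x. l < \<bar>f x\<bar>}) = (x \<in> {x. l < \<bar>f' x\<bar>})" using assms(1) by eventually_elim simp
    show "{x. l < \<bar>f x\<bar>} \<in> sets lebesgue" "{x. l < \<bar>f' x\<bar>} \<in> sets lebesgue"
      using m by (auto intro!: borel_measurable_less[of _ lebesgue, simplified])
  qed
  then have "decreasing_rearrangement f = decreasing_rearrangement f'"
    by (simp add: decreasing_rearrangement_def fun_eq_iff)
  then show ?thesis by (simp add: norm_inf_p_def hardy_transform_def)
qed

text \<open>\<open>weak_gradient f\<close> is a choice known to be measurable only for the completed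
  measure. \<open>f'\<close> and \<open>w\<close> are Borel functions that agree almost everywhere
  with \<open>f\<close> and with that choice.\<close>

locale sobolev_representative =
  fixes p :: real and f f' :: "(real, 'n::{finite,wellorder}) vec \<Rightarrow> real" and w :: "(real, 'n) vec \<Rightarrow> (real, 'n) vec"
  assumes p: "1 \<le> p"
    and fm: "f \<in> borel_measurable lebesgue" and bg: "borel_gradient f' w"
    and f' [measurable]: "f' \<in> borel_measurable borel" and ae_f: "AE x in lebesgue. f x = f' x"
    and w [measurable]: "w \<in> borel_measurable borel" and ae_w: "AE x in lebesgue. weak_gradient f x = w x"
    and fin_f: "(LINT+ x. ennreal (\<bar>f' x\<bar> powr p)) < \<infinity>"
    and fin_w: "(LINT+ x. ennreal (norm (w x) powr p)) < \<infinity>"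

lemma sobolev_representative_exists:
  fixes f :: "(real, 'n::{finite,wellorder}) vec \<Rightarrow> real"
  assumes p: "1 \<le> p" and f: "f \<in> sobolev_W1 p"
  obtains f' w where "sobolev_representative p f f' w"
proof -
  have fm: "f \<in> borel_measurable lebesgue" and fi: "integrable lebesgue (\<lambda>x. norm (f x) powr p)"
    using f by (auto simp: sobolev_W1_def Lp_functions_def)
  obtain g where g: "has_weak_gradient f g" "g \<in> borel_measurable lebesgue" "integrable lebesgue (\<lambda>x. norm (g x) powr p)"
    using f by (auto simp: sobolev_W1_def Lp_functions_def)
  have wg: "has_weak_gradient f (weak_gradient f)" unfolding weak_gradient_def by (rule someI[of "has_weak_gradient f", OF g(1)])
  obtain f' where f': "f' \<in> borel_measurable borel" "AE x in lborel. f x = f' x"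
    using completion_ex_borel_measurable_real[OF fm] by auto
  obtain w where w: "w \<in> borel_measurable borel" "AE x in lebesgue. g x = w x" using lebesgue_borel_vec[OF g(2)] by blast
  have ae_f: "AE x in lebesgue. f x = f' x" using f'(2) by (rule AE_completion)
  have ae_w: "AE x in lebesgue. weak_gradient f x = w x"
    using has_weak_gradient_unique[OF wg g(1)] w(2) by eventually_elim simp
  moreover have "borel_gradient f' w" by (rule borel_gradientI[OF wg f'(1) ae_f w(1) ae_w])
  moreover have "(LINT+ x. ennreal (\<bar>f' x\<bar> powr p)) < \<infinity>"
  proof -
    have "(LINT+ x. ennreal (\<bar>f' x\<bar> powr p)) = (\<integral>\<^sup>+x. ennreal (\<bar>f' x\<bar> powr p) \<partial>lebesgue)" by (rule nn_integral_completion[symmetric])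
    also have "\<dots> = (\<integral>\<^sup>+x. ennreal (norm (norm (f x) powr p)) \<partial>lebesgue)"
      using ae_f by (intro nn_integral_cong_AE, eventually_elim) simp
    also have "\<dots> < \<infinity>" using fi by (simp add: integrable_iff_bounded)
    finally show ?thesis .
  qed
  moreover have "(LINT+ x. ennreal (norm (w x) powr p)) < \<infinity>"
  proof -
    have "(LINT+ x. ennreal (norm (w x) powr p)) = (\<integral>\<^sup>+x. ennreal (norm (w x) powr p) \<partial>lebesgue)" by (rule nn_integral_completion[symmetric])
    also have "\<dots> = (\<integral>\<^sup>+x. ennreal (norm (norm (g x) powr p)) \<partial>lebesgue)"
      using w(2) by (intro nn_integral_cong_AE, eventually_elim) simp
    also have "\<dots> < \<infinity>" using g(3) by (simp add: integrable_iff_bounded)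
    finally show ?thesis .
  qed
  ultimately show ?thesis using p fm f' w ae_f by (intro that[of f' w]) (simp add: sobolev_representative_def)
qed

context sobolev_representative begin

definition energy :: "(real, 'n) vec \<Rightarrow> ennreal" where
  "energy u = (LINT+ x. ennreal (max 0 (w x \<bullet> u) powr p))"

lemma energy_measurable [measurable]: "energy \<in> borel_measurable borel"
  unfolding energy_def[abs_def] by measurable

lemma Lp_norm_D_plus: "Lp_norm p (D_plus u f) = energy u epowr (1 / p)"
proof -
  have "(\<integral>\<^sup>+x. ennreal (\<bar>D_plus u f x\<bar> powr p) \<partial>lebesgue) = (\<integral>\<^sup>+x. ennreal (max 0 (w x \<bullet> u) powr p) \<partial>lebesgue)"
    using ae_w by (intro nn_integral_cong_AE, eventually_elim) (simp add: D_plus_def max.commute)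
  then show ?thesis unfolding Lp_norm_def energy_def nn_integral_completion by simp
qed

lemma energy_scale: "0 \<le> c \<Longrightarrow> energy (c *\<^sub>R u) = ennreal (c powr p) * energy u"
proof -
  assume c: "0 \<le> c"
  have "energy (c *\<^sub>R u) = (LINT+ x. ennreal (c powr p) * ennreal (max 0 (w x \<bullet> u) powr p))"
    unfolding energy_def using c by (intro nn_integral_cong) (simp add: max_0_mult_left powr_mult ennreal_mult')
  then show ?thesis unfolding energy_def by (simp add: nn_integral_cmult)
qed

definition G :: real where "G = enn2real (LINT+ x. ennreal (norm (w x) powr p))"

lemma G_nonneg: "0 \<le> G" by (simp add: G_def)

lemma energy_le: "energy u \<le> ennreal (G * norm u powr p)"
proof -
  have "energy u \<le> (LINT+ x. ennreal (norm u powr p) * ennreal (norm (w x) powr p))"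
    unfolding energy_def
  proof (rule nn_integral_mono)
    fix x
    have "max 0 (w x \<bullet> u) \<le> norm u * norm (w x)" using norm_cauchy_schwarz[of "w x" u] by (simp add: mult.commute)
    then have "max 0 (w x \<bullet> u) powr p \<le> (norm u * norm (w x)) powr p" using p by (intro powr_mono2) auto
    then show "ennreal (max 0 (w x \<bullet> u) powr p) \<le> ennreal (norm u powr p) * ennreal (norm (w x) powr p)"
      by (simp add: powr_mult ennreal_mult[symmetric] ennreal_leI)
  qed
  also have "\<dots> = ennreal (norm u powr p) * ennreal G" using fin_w unfolding G_def by (simp add: nn_integral_cmult)
  finally show ?thesis using G_nonneg by (simp add: ennreal_mult mult.commute)
qed

lemma energy_eq_real: "energy u = ennreal (enn2real (energy u))"
  using energy_le[of u] by (simp add: ennreal_enn2real_if) (metis ennreal_neq_top top.extremum_unique)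

lemma increment_energy:
  "(LINT+ x. ennreal (max 0 (f' (x + u) - f' x) powr p)) \<le> energy u"
proof -
  interpret weak_gradient_direction f' w u using bg by (simp add: weak_gradient_direction_def)
  show ?thesis unfolding energy_def by (rule increment_bound[OF p])
qed

lemma nonlocal_energy_le:
  assumes [measurable]: "K \<in> sets borel"
  shows "nonlocal_energy p f' K \<le> (LINT+ u. energy u * indicator K u)"
proof -
  have "nonlocal_energy p f' K = (LINT+ u. LINT+ x. ennreal (max 0 (f' (x + u) - f' x) powr p) * indicator K u)"
    unfolding nonlocal_energy_def by (rule lborel_pair.Fubini') measurable
  also have "\<dots> \<le> (LINT+ u. energy u * indicator K u)"
    by (intro nn_integral_mono) (simp add: nn_integral_multc increment_energy mult_right_mono)
  finally show ?thesis .
qed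

text \<open>Chebyshev's inequality applied to the p-th power of \<open>f'\<close>.\<close>

sublocale finite_levels f'
proof
  fix s :: real assume s: "0 < s"
  have "vol {x \<in> space lborel. 1 \<le> ennreal (1 / s powr p) * ennreal (\<bar>f' x\<bar> powr p)}
      \<le> ennreal (1 / s powr p) * (LINT+ x. ennreal (\<bar>f' x\<bar> powr p) * indicator UNIV x)"
    using nn_integral_Markov_inequality[of "\<lambda>x. ennreal (\<bar>f' x\<bar> powr p)" UNIV lborel "ennreal (1 / s powr p)"] by simp
  also have "\<dots> < \<infinity>" using fin_f by (simp add: ennreal_mult_less_top)
  finally have F: "vol {x \<in> space lborel. 1 \<le> ennreal (1 / s powr p) * ennreal (\<bar>f' x\<bar> powr p)} < \<infinity>" .
  have "{x. s < \<bar>f' x\<bar>} \<subseteq> {x \<in> space lborel. 1 \<le> ennreal (1 / s powr p) * ennreal (\<bar>f' x\<bar> powr p)}"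
  proof safe
    fix x assume "s < \<bar>f' x\<bar>"
    then have "s powr p \<le> \<bar>f' x\<bar> powr p" using s p by (intro powr_mono2) auto
    then show "1 \<le> ennreal (1 / s powr p) * ennreal (\<bar>f' x\<bar> powr p)"
      using s by (simp add: ennreal_mult[symmetric] divide_simps)
  qed simp
  then have "vol {x. s < \<bar>f' x\<bar>} \<le> vol {x \<in> space lborel. 1 \<le> ennreal (1 / s powr p) * ennreal (\<bar>f' x\<bar> powr p)}"
    by (rule emeasure_mono) measurable
  also note F
  finally show "vol {x. s < \<bar>f' x\<bar>} < \<infinity>" .
qed measurable

end

lemma epowr_antimono:
  assumes a: "a < 0" and xy: "x \<le> y" shows "y epowr a \<le> x epowr a"
proof (cases "x = 0 \<or> y = \<infinity>")
  case True then show ?thesis using a by (auto simp: epowr_def)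
next
  case False
  then obtain s where s: "y = ennreal s" "0 \<le> s" by (cases y) auto
  then obtain r where r: "x = ennreal r" "0 \<le> r" using xy by (cases x) (auto simp: top_unique)
  have "r \<le> s" using r s xy by (simp add: ennreal_le_iff)
  moreover have "0 < r" using False r by (cases "r = 0") auto
  ultimately have "0 < r" "r \<le> s" by auto
  then show ?thesis using a r s by (simp add: epowr_def ennreal_leI powr_mono2')
qed

section \<open>The unit ball of the directional energies and its volume\<close>

context sobolev_representative begin

text \<open>The set \<open>{x. energy x \<le> 1}\<close> may be unbounded, hence the truncation at radius \<open>R\<close>.\<close>

definition gauge_ball :: "real \<Rightarrow> (real, 'n) vec set" where
  "gauge_ball R = {x. norm x < R \<and> energy x \<le> 1}"

text \<open>The n-th power of the radius of \<open>gauge_ball R\<close> in the direction \<theta>: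
  since \<open>energy\<close> is the p-th power of the directional norm N, this is N(\<theta>)^(-n),
  cut off at R^n. The n-th power fits the radial variable of
  \<open>nn_integral_polar\<close>.\<close>

definition radial_volume :: "real \<Rightarrow> (real, 'n) vec \<Rightarrow> real" where
  "radial_volume R \<theta> = (if energy \<theta> = 0 then R ^ CARD('n)
     else min (R ^ CARD('n)) (enn2real (energy \<theta>) powr (- (CARD('n) / p))))"

lemma gauge_ball_borel [measurable]: "gauge_ball R \<in> sets borel"
  unfolding gauge_ball_def by measurable

lemma radial_volume_measurable [measurable]: "radial_volume R \<in> borel_measurable borel"
  unfolding radial_volume_def[abs_def] by measurable

lemma energy_polar: "energy x = ennreal ((norm x ^ CARD('n)) powr (p / CARD('n))) * energy (sgn x)"
proof -
  have "x = norm x *\<^sub>R sgn x" by (cases "x = 0") (auto simp: sgn_div_norm)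
  then have "energy x = energy (norm x *\<^sub>R sgn x)" by simp
  then show ?thesis by (simp add: energy_scale norm_power_powr)
qed

lemma radial_volume_bounds: "0 < R \<Longrightarrow> 0 < radial_volume R \<theta>" "radial_volume R \<theta> \<le> R ^ CARD('n)"
proof -
  have "0 < enn2real (energy \<theta>)" if "energy \<theta> \<noteq> 0"
    using that energy_eq_real[of \<theta>] by (metis enn2real_nonneg ennreal_0 order_le_less)
  then show "0 < R \<Longrightarrow> 0 < radial_volume R \<theta>" by (cases "energy \<theta> = 0") (simp_all add: radial_volume_def less_imp_neq[symmetric])
qed (simp add: radial_volume_def)

lemma energy_radial_volume:
  assumes R: "0 < R" shows "enn2real (energy \<theta>) * radial_volume R \<theta> powr (p / CARD('n)) \<le> 1"
proof (cases "energy \<theta> = 0")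
  case False
  let ?e = "enn2real (energy \<theta>)" and ?n = "real CARD('n)"
  have e: "0 < ?e" using False energy_eq_real[of \<theta>] by (metis enn2real_nonneg ennreal_0 order_le_less)
  have "radial_volume R \<theta> \<le> ?e powr (- (?n / p))" using False by (simp add: radial_volume_def)
  then have "radial_volume R \<theta> powr (p / ?n) \<le> (?e powr (- (?n / p))) powr (p / ?n)"
    using radial_volume_bounds(1)[OF R, of \<theta>] p by (intro powr_mono2) auto
  also have "\<dots> = ?e powr (-1)" using p by (simp add: powr_powr)
  finally show ?thesis using e mult_left_mono[of "radial_volume R \<theta> powr (p / ?n)" "?e powr (-1)" ?e] by (simp add: powr_minus)
qed simp

text \<open>The norm bound in \<open>gauge_ball\<close> is strict and the energy bound is not, so
  along a ray the end point may or may not belong to it; it is left out.\<close>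

lemma radial_volume_cut:
  assumes t: "0 < t" "t \<noteq> radial_volume R \<theta>" and R: "0 < R"
  shows "t < R ^ CARD('n) \<and> ennreal (t powr (p / CARD('n))) * energy \<theta> \<le> 1 \<longleftrightarrow> t < radial_volume R \<theta>"
proof (cases "energy \<theta> = 0")
  case True then show ?thesis by (simp add: radial_volume_def)
next
  case False
  let ?e = "enn2real (energy \<theta>)" and ?n = "real CARD('n)"
  have e: "0 < ?e" using False energy_eq_real[of \<theta>] by (metis enn2real_nonneg ennreal_0 order_le_less)
  define b where "b = ?e powr (- (?n / p))"
  have b0: "0 < b" using e by (simp add: b_def)
  have "b powr (p / ?n) = ?e powr (-1)" using p by (simp add: b_def powr_powr)
  then have b: "b powr (p / ?n) = 1 / ?e" using e by (simp add: powr_minus divide_simps)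
  have cut: "t powr (p / ?n) * ?e \<le> 1 \<longleftrightarrow> t \<le> b"
  proof
    assume "t \<le> b"
    then have "t powr (p / ?n) \<le> 1 / ?e" using t p by (subst b[symmetric], intro powr_mono2) auto
    then show "t powr (p / ?n) * ?e \<le> 1" using e by (simp add: divide_simps)
  next
    assume *: "t powr (p / ?n) * ?e \<le> 1"
    show "t \<le> b"
    proof (rule ccontr)
      assume "\<not> t \<le> b"
      then have "b powr (p / ?n) < t powr (p / ?n)" using b0 p by (intro powr_less_mono2) auto
      then show False using * e by (simp add: b divide_simps)
    qed
  qed
  have "ennreal (t powr (p / ?n)) * energy \<theta> \<le> 1 \<longleftrightarrow> t powr (p / ?n) * ?e \<le> 1"
    by (subst energy_eq_real) (simp add: ennreal_mult[symmetric])
  moreover have "radial_volume R \<theta> = min (R ^ CARD('n)) b" using False by (simp add: radial_volume_def b_def)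
  ultimately show ?thesis using cut t(2) by (auto simp: min_def split: if_splits)
qed

lemma gauge_ball_polar:
  fixes h :: "real \<Rightarrow> (real, 'n) vec \<Rightarrow> ennreal"
  assumes R: "0 < R" and [measurable]: "(\<lambda>(t, \<theta>). h t \<theta>) \<in> borel_measurable (borel \<Otimes>\<^sub>M borel)"
  shows "(LINT+ x. h (norm x ^ CARD('n)) (sgn x) * indicator (gauge_ball R) x) =
    ennreal (unit_ball_vol (real CARD('n))) * (\<integral>\<^sup>+\<theta>. (LINT+ t. h t \<theta> * indicator {0<..<radial_volume R \<theta>} t) \<partial>sphere_borel)"
proof -
  define H where "H t \<theta> = h t \<theta> * (if t < R ^ CARD('n) \<and> ennreal (t powr (p / CARD('n))) * energy \<theta> \<le> 1 then 1 else 0)" for t \<theta>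
  have Hm: "(\<lambda>(t, \<theta>). H t \<theta>) \<in> borel_measurable (borel \<Otimes>\<^sub>M borel)" unfolding H_def by measurable
  have "(LINT+ x. h (norm x ^ CARD('n)) (sgn x) * indicator (gauge_ball R) x) = (LINT+ x. H (norm x ^ CARD('n)) (sgn x))"
  proof (rule nn_integral_cong)
    fix x :: "(real, 'n) vec"
    have "x \<in> gauge_ball R \<longleftrightarrow> norm x ^ CARD('n) < R ^ CARD('n) \<and> ennreal ((norm x ^ CARD('n)) powr (p / CARD('n))) * energy (sgn x) \<le> 1"
      using R by (simp add: gauge_ball_def energy_polar[of x] norm_power_less_iff)
    then show "h (norm x ^ CARD('n)) (sgn x) * indicator (gauge_ball R) x = H (norm x ^ CARD('n)) (sgn x)"
      by (simp add: H_def indicator_def)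
  qed
  also have "\<dots> = ennreal (unit_ball_vol (real CARD('n))) * (\<integral>\<^sup>+\<theta>. (LINT+ t. H t \<theta> * indicator {0<..} t) \<partial>sphere_borel)"
    by (rule nn_integral_polar[OF Hm])
  also have "(\<integral>\<^sup>+\<theta>. (LINT+ t. H t \<theta> * indicator {0<..} t) \<partial>sphere_borel) =
      (\<integral>\<^sup>+\<theta>. (LINT+ t. h t \<theta> * indicator {0<..<radial_volume R \<theta>} t) \<partial>(sphere_borel :: ((real, 'n) vec) measure))"
  proof (rule nn_integral_cong)
    fix \<theta> :: "(real, 'n) vec"
    show "(LINT+ t. H t \<theta> * indicator {0<..} t) = (LINT+ t. h t \<theta> * indicator {0<..<radial_volume R \<theta>} t)"
    proof (rule nn_integral_cong_AE, use AE_lborel_singleton[of "radial_volume R \<theta>"] in eventually_elim)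
      case (elim t)
      then show ?case
        using radial_volume_cut[OF _ elim R] by (cases "0 < t") (auto simp: H_def indicator_def)
    qed
  qed
  finally show ?thesis .
qed

text \<open>The volume of the gauge ball in units of the unit ball, by
  \<open>emeasure_gauge_ball\<close>. As \<open>R\<close> grows it increases to the sphere integral
  of N^(-n).\<close>

definition V :: "real \<Rightarrow> real" where "V R = enn2real (\<integral>\<^sup>+\<theta>. ennreal (radial_volume R \<theta>) \<partial>sphere_borel)"

lemma V_eq: assumes R: "0 < R" shows "(\<integral>\<^sup>+\<theta>. ennreal (radial_volume R \<theta>) \<partial>sphere_borel) = ennreal (V R)" and "0 < V R"
proof -
  interpret S: prob_space "sphere_borel :: ((real, 'n) vec) measure" by (rule prob_space_sphere_borel)
  let ?I = "\<integral>\<^sup>+\<theta>. ennreal (radial_volume R \<theta>) \<partial>sphere_borel"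
  have "?I \<le> (\<integral>\<^sup>+\<theta>. ennreal (R ^ CARD('n)) \<partial>(sphere_borel :: ((real, 'n) vec) measure))"
    by (intro nn_integral_mono ennreal_leI radial_volume_bounds)
  also have "\<dots> < \<infinity>" by (simp add: S.emeasure_space_1)
  finally have f: "?I < \<infinity>" .
  then show e: "?I = ennreal (V R)" unfolding V_def by (intro ennreal_enn2real[symmetric]) (simp add: less_top)
  have "?I \<noteq> 0"
  proof
    assume "?I = 0"
    then have "AE \<theta> in sphere_borel. ennreal (radial_volume R \<theta>) = 0" by (subst (asm) nn_integral_0_iff_AE) auto
    then have "AE \<theta> in (sphere_borel :: ((real, 'n) vec) measure). False"
      by (rule eventually_mono) (use radial_volume_bounds(1)[OF R] in \<open>auto simp: ennreal_eq_0_iff not_le[symmetric]\<close>)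
    then show False using S.AE_False by simp
  qed
  then show "0 < V R" using e by (simp add: ennreal_eq_0_iff not_le)
qed

lemma emeasure_gauge_ball:
  assumes R: "0 < R" shows "vol (gauge_ball R) = ennreal (unit_ball_vol (real CARD('n)) * V R)"
proof -
  have "vol (gauge_ball R) = (LINT+ x. 1 * indicator (gauge_ball R) x)" by simp
  also have "\<dots> = ennreal (unit_ball_vol (real CARD('n))) * (\<integral>\<^sup>+\<theta>. (LINT+ t. 1 * indicator {0<..<radial_volume R \<theta>} t) \<partial>sphere_borel)"
    using R by (rule gauge_ball_polar) measurable
  also have "(\<integral>\<^sup>+\<theta>. (LINT+ t. 1 * indicator {0<..<radial_volume R \<theta>} t) \<partial>sphere_borel) = (\<integral>\<^sup>+\<theta>. ennreal (radial_volume R \<theta>) \<partial>sphere_borel)"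
    using radial_volume_bounds(1)[OF R] by (intro nn_integral_cong) (simp add: less_imp_le)
  also have "\<dots> = ennreal (V R)" by (rule V_eq[OF R])
  finally show ?thesis using V_eq(2)[OF R] by (simp add: ennreal_mult)
qed

text \<open>With v the radial volume, the integral of t^(p/n) over (0,v) is n/(n+p) times v^(p/n) v,
  and v^(p/n) times the energy of the direction is at most 1 by \<open>energy_radial_volume\<close>.
  The inequality is strict only for directions affected by the cut-off.\<close>

lemma energy_gauge_ball_le:
  assumes R: "0 < R"
  shows "(LINT+ x. energy x * indicator (gauge_ball R) x) \<le> ennreal (unit_ball_vol (real CARD('n)) * (CARD('n) / (CARD('n) + p)) * V R)"
proof -
  let ?n = "real CARD('n)"
  let ?c = "?n / (?n + p)"
  have c: "0 < ?c" using p by simp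
  have "(LINT+ x. energy x * indicator (gauge_ball R) x) =
      (LINT+ x. (ennreal ((norm x ^ CARD('n)) powr (p / ?n)) * energy (sgn x)) * indicator (gauge_ball R) x)"
    by (simp only: energy_polar[symmetric])
  also have "\<dots> = ennreal (unit_ball_vol ?n) * (\<integral>\<^sup>+\<theta>. (LINT+ t. (ennreal (t powr (p / ?n)) * energy \<theta>) * indicator {0<..<radial_volume R \<theta>} t) \<partial>sphere_borel)"
    using R by (rule gauge_ball_polar) measurable
  also have "\<dots> \<le> ennreal (unit_ball_vol ?n) * (\<integral>\<^sup>+\<theta>. ennreal ?c * ennreal (radial_volume R \<theta>) \<partial>sphere_borel)"
  proof (intro mult_left_mono nn_integral_mono)
    fix \<theta> :: "(real, 'n) vec"
    let ?v = "radial_volume R \<theta>" and ?e = "enn2real (energy \<theta>)"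
    have v: "0 < ?v" by (rule radial_volume_bounds(1)[OF R])
    have "(LINT+ t. (ennreal (t powr (p / ?n)) * energy \<theta>) * indicator {0<..<?v} t) =
       (LINT+ t. energy \<theta> * (ennreal (t powr (p / ?n)) * indicator {0<..<?v} t))" by (simp add: mult_ac)
    also have "\<dots> = ennreal ?e * ennreal (?v powr (p / ?n + 1) / (p / ?n + 1))"
    proof -
      have "0 \<le> p / ?n" using p by simp
      then have "-1 < p / ?n" by linarith
      from nn_integral_powr_from_0[OF this less_imp_le[OF v]] show ?thesis
        by (subst nn_integral_cmult) (auto simp: energy_eq_real[symmetric])
    qed
    also have "\<dots> = ennreal (?c * ((?e * ?v powr (p / ?n)) * ?v))"
    proof -
      have "?v powr (p / ?n + 1) = ?v powr (p / ?n) * ?v" using v by (simp add: powr_add)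
      moreover have "1 / (p / ?n + 1) = ?c" using p by (simp add: divide_simps add_ac)
      ultimately have "?v powr (p / ?n + 1) / (p / ?n + 1) = ?v powr (p / ?n) * ?v * ?c"
        by (metis times_divide_eq_right mult.right_neutral)
      then show ?thesis by (simp add: ennreal_mult'[symmetric] mult_ac)
    qed
    also have "\<dots> \<le> ennreal (?c * (1 * ?v))"
      using energy_radial_volume[OF R, of \<theta>] c v by (intro ennreal_leI mult_left_mono mult_right_mono) auto
    also have "\<dots> = ennreal ?c * ennreal ?v" using ennreal_mult'[OF less_imp_le[OF c], of ?v] by (simp only: mult_1_left)
    finally show "(LINT+ t. (ennreal (t powr (p / ?n)) * energy \<theta>) * indicator {0<..<?v} t) \<le> ennreal ?c * ennreal ?v" .
  qed simp
  also have "(\<integral>\<^sup>+\<theta>. ennreal ?c * ennreal (radial_volume R \<theta>) \<partial>sphere_borel) = ennreal ?c * ennreal (V R)"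
    by (simp add: nn_integral_cmult V_eq[OF R])
  also have "ennreal (unit_ball_vol ?n) * (ennreal ?c * ennreal (V R)) = ennreal (unit_ball_vol ?n * ?c * V R)"
    by (simp only: ennreal_mult'[OF less_imp_le[OF c], symmetric] ennreal_mult'[OF unit_ball_vol_nonneg, symmetric] mult.assoc of_nat_0_le_iff)
  finally show ?thesis .
qed

lemma radial_energy_bound:
  assumes R: "0 < R" and \<rho>: "0 < \<rho>"
  shows "nonlocal_energy p radial (ball 0 \<rho>) \<le>
    ennreal (unit_ball_vol (real CARD('n)) * (CARD('n) / (CARD('n) + p)) * V R powr (- (p / CARD('n))) * \<rho> powr (CARD('n) + p))"
proof -
  let ?n = "real CARD('n)" and ?\<omega> = "unit_ball_vol (real CARD('n))"
  have V0: "0 < V R" by (rule V_eq[OF R])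
  have \<omega>: "0 < ?\<omega>" by (intro unit_ball_vol_pos) simp
  \<comment> \<open>The dilation that gives the gauge ball the volume of the ball of radius \<rho>,
    so that its rearrangement is that ball.\<close>
  define \<epsilon> where "\<epsilon> = \<rho> / V R powr (1 / ?n)"
  have \<epsilon>: "0 < \<epsilon>" using V0 \<rho> by (simp add: \<epsilon>_def)
  define K where "K = {x. (1 / \<epsilon>) *\<^sub>R x \<in> gauge_ball R}"
  have [measurable]: "K \<in> sets borel" unfolding K_def by measurable
  have scale: "(LINT+ x. h x * indicator K x) = ennreal (\<epsilon> ^ CARD('n)) * (LINT+ x. h (\<epsilon> *\<^sub>R x) * indicator (gauge_ball R) x)"
    if [measurable]: "h \<in> borel_measurable borel" for h
  proof -
    have "(LINT+ x. h x * indicator K x) = ennreal (\<bar>\<epsilon>\<bar> ^ DIM((real, 'n) vec)) * (LINT+ x. h (0 + \<epsilon> *\<^sub>R x) * indicator K (0 + \<epsilon> *\<^sub>R x))"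
      by (rule nn_integral_lborel_affine) (use \<epsilon> in auto)
    moreover have "indicator K (\<epsilon> *\<^sub>R x) = (indicator (gauge_ball R) x :: ennreal)" for x
      using \<epsilon> by (simp add: K_def indicator_def)
    ultimately show ?thesis using \<epsilon> by simp
  qed
  have Vn: "(V R powr (1 / ?n)) ^ CARD('n) = V R" using V0 by (simp add: powr_powr flip: powr_realpow)
  then have \<epsilon>n: "\<epsilon> ^ CARD('n) * V R = \<rho> ^ CARD('n)" using V0 by (simp add: \<epsilon>_def power_divide)
  have em: "vol K = vol (ball (0::(real, 'n) vec) \<rho>)"
  proof -
    have "vol K = (LINT+ x. 1 * indicator K x)" by simp
    also have "\<dots> = ennreal (\<epsilon> ^ CARD('n)) * (LINT+ x. 1 * indicator (gauge_ball R) x)" by (rule scale) measurable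
    also have "\<dots> = ennreal (\<epsilon> ^ CARD('n) * (?\<omega> * V R))"
      using \<epsilon> \<omega> V0 by (simp add: emeasure_gauge_ball[OF R] ennreal_mult)
    also have "\<epsilon> ^ CARD('n) * (?\<omega> * V R) = ?\<omega> * \<rho> ^ CARD('n)" using \<epsilon>n by (simp add: mult_ac)
    finally show ?thesis using \<rho> by (simp add: emeasure_ball)
  qed
  have "nonlocal_energy p radial (centred_ball (measure lborel K)) \<le> nonlocal_energy p f' K"
    by (rule nonlocal_energy_radial_le[OF p]) (simp_all only: em emeasure_lborel_ball_finite, measurable)
  moreover have "centred_ball (measure lborel K) = ball (0::(real, 'n) vec) \<rho>"
    using centred_ball_measure_ball[of \<rho>] \<rho> em by (simp add: measure_def)
  moreover have "nonlocal_energy p f' K \<le> (LINT+ u. energy u * indicator K u)" by (rule nonlocal_energy_le) measurable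
  moreover have "(LINT+ u. energy u * indicator K u) = ennreal (\<epsilon> ^ CARD('n) * \<epsilon> powr p) * (LINT+ x. energy x * indicator (gauge_ball R) x)"
    using \<epsilon> by (subst scale) (simp_all add: energy_scale nn_integral_cmult mult.assoc ennreal_mult)
  moreover have "\<dots> \<le> ennreal (\<epsilon> ^ CARD('n) * \<epsilon> powr p) * ennreal (?\<omega> * (?n / (?n + p)) * V R)"
    by (intro mult_left_mono energy_gauge_ball_le R) simp
  moreover have "\<dots> = ennreal (?\<omega> * (?n / (?n + p)) * (\<epsilon> ^ CARD('n) * V R * \<epsilon> powr p))"
    using \<epsilon> p by (subst ennreal_mult'[symmetric]) (simp_all add: mult_ac)
  moreover have "\<epsilon> ^ CARD('n) * V R * \<epsilon> powr p = V R powr (- (p / ?n)) * \<rho> powr (?n + p)"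
    using \<rho> V0 by (simp add: \<epsilon>n \<epsilon>_def powr_divide powr_powr powr_add powr_realpow powr_minus divide_simps Vn)
  ultimately show ?thesis by (simp add: mult.assoc)
qed

lemma norm_le_energy_integral:
  fixes \<gamma> :: real
  assumes \<gamma>: "\<gamma> = 1 - 1 / p + 1 / CARD('n)"
  shows "ennreal (\<gamma> * CARD('n) * unit_ball_vol (real CARD('n)) powr (1 / CARD('n))) * norm_inf_p p f' \<le>
    ennreal (2 powr (1 / p) / I_const TYPE('n) p) * (\<integral>\<^sup>+u. (energy u epowr (1 / p)) epowr (- real CARD('n)) \<partial>sphere_borel) epowr (- 1 / CARD('n))"
proof -
  let ?n = "real CARD('n)" and ?\<omega> = "unit_ball_vol (real CARD('n))" and ?m = "sphere_moment TYPE('n) p"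
  let ?J = "\<integral>\<^sup>+u. (energy u epowr (1 / p)) epowr (- ?n) \<partial>sphere_borel"
  define C where "C = \<gamma> * ?n * ?\<omega> powr (1 / ?n)"
  define c where "c = ?\<omega> * (?n / (?n + p))"
  have p0: "0 < p" using p by simp
  have \<omega>: "0 < ?\<omega>" by (intro unit_ball_vol_pos) simp
  have \<gamma>0: "0 < \<gamma>" unfolding \<gamma> by (rule affine_exponent_pos[OF p])
  have C: "0 < C" using \<gamma>0 \<omega> by (simp add: C_def less_imp_neq[OF \<omega>, symmetric])
  have c: "0 < c" using \<omega> p by (simp add: c_def)
  have m: "0 < ?m" by (rule sphere_moment_pos[OF p0])
  have bound: "ennreal (c * (?m / 2) * C powr p) * norm_inf_p p f' epowr p \<le> ennreal (c * V R powr (- (p / ?n)))" if R: "0 < R" for R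
  proof -
    have "0 \<le> c * V R powr (- (p / ?n))" using c by simp
    from norm_inf_p_bound[OF p this[unfolded c_def] \<gamma> \<gamma>0 radial_energy_bound[OF R]] show ?thesis unfolding c_def C_def .
  qed
  show ?thesis
  proof (cases "norm_inf_p p f'")
    case top
    \<comment> \<open>For a single radius the right-hand side of \<open>bound\<close> is already
      finite while its left-hand side would be infinite.\<close>
    have "norm_inf_p p f' epowr p = \<infinity>" unfolding top using epowr_infinity[OF p0] by simp
    then show ?thesis using bound[of 1] c m C by (simp add: ennreal_mult_top top_unique)
  next
    case (real y)
    show ?thesis
    proof (cases "y = 0")
      case False
      then have y: "0 < y" using real by simp
      \<comment> \<open>Solved for \<open>V R\<close>, the bound says that \<open>V R\<close> is at
        most \<open>a powr (- ?n)\<close>, uniformly in \<open>R\<close>. Multiplying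
        \<open>a\<close> by \<open>2 powr (1 / p) / I_const TYPE('n) p\<close> gives
        \<open>C * y\<close>.\<close>
      define a where "a = (?m / 2) powr (1 / p) * (C * y)"
      have a: "0 < a" using m C y by (simp add: a_def)
      have "V R \<le> a powr (- ?n)" if R: "0 < R" for R
      proof -
        have V0: "0 < V R" by (rule V_eq[OF R])
        have "c * (?m / 2) * C powr p * y powr p \<le> c * V R powr (- (p / ?n))"
          using bound[OF R] p0 y c m C by (simp add: real epowr_ennreal ennreal_mult[symmetric] del: times_divide_eq_right)
        then have "(?m / 2) * (C * y) powr p \<le> V R powr (- (p / ?n))"
          using c C y by (simp add: powr_mult mult.assoc del: times_divide_eq_right)
        moreover have "a powr p = (?m / 2) * (C * y) powr p"
          using m C y p0 by (simp add: a_def powr_mult powr_powr)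
        ultimately have "(a powr p) powr (1 / p) \<le> (V R powr (- (p / ?n))) powr (1 / p)"
          using p0 by (intro powr_mono2) auto
        then have "a \<le> V R powr (- (1 / ?n))" using p0 a by (simp add: powr_powr)
        then have "(V R powr (- (1 / ?n))) powr (- ?n) \<le> a powr (- ?n)" using a by (intro powr_mono2') auto
        then show ?thesis using V0 by (simp add: powr_powr)
      qed note V_le = this
      have "?J \<le> (\<integral>\<^sup>+\<theta>. (SUP k. ennreal (radial_volume (real (Suc k)) \<theta>)) \<partial>sphere_borel)"
      proof (rule nn_integral_mono)
        fix \<theta> :: "(real, 'n) vec"
        show "(energy \<theta> epowr (1 / p)) epowr (- ?n) \<le> (SUP k. ennreal (radial_volume (real (Suc k)) \<theta>))"
        proof (cases "energy \<theta> = 0")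
          case True
          \<comment> \<open>In a direction of zero energy the integrand of \<open>?J\<close> is
            infinite; there the gauge ball is limited only by the cut-off, which tends to
            infinity.\<close>
          have "of_nat k \<le> ennreal (radial_volume (real (Suc k)) \<theta>)" for k
          proof -
            have "real k \<le> real (Suc k) ^ 1" by simp
            also have "\<dots> \<le> real (Suc k) ^ CARD('n)" by (intro power_increasing) (auto simp: Suc_le_eq)
            finally have "real k \<le> radial_volume (real (Suc k)) \<theta>" by (simp add: radial_volume_def True)
            then show ?thesis unfolding ennreal_of_nat_eq_real_of_nat by (rule ennreal_leI)
          qed
          then have "(SUP k. of_nat k) \<le> (SUP k. ennreal (radial_volume (real (Suc k)) \<theta>))" by (intro SUP_mono) auto
          then show ?thesis by (simp only: ennreal_SUP_of_nat_eq_top top_unique top_greatest)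
        next
          case False
          define e where "e = enn2real (energy \<theta>)"
          have e: "0 < e" using False energy_eq_real[of \<theta>] unfolding e_def by (metis enn2real_nonneg ennreal_0 order_le_less)
          obtain k where k: "e powr (- (?n / p)) \<le> real k" using real_arch_simple by blast
          also have "\<dots> \<le> real (Suc k) ^ 1" by simp
          also have "\<dots> \<le> real (Suc k) ^ CARD('n)" by (intro power_increasing) (auto simp: Suc_le_eq)
          finally have "radial_volume (real (Suc k)) \<theta> = e powr (- (?n / p))" by (simp add: radial_volume_def False e_def)
          moreover have "(energy \<theta> epowr (1 / p)) epowr (- ?n) = ennreal (e powr (- (?n / p)))"
            using e p0 energy_eq_real[of \<theta>] unfolding e_def[symmetric] by (simp add: epowr_ennreal) (simp add: epowr_def powr_powr)
          ultimately show ?thesis by (metis SUP_upper UNIV_I)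
        qed
      qed
      also have "\<dots> = (SUP k. \<integral>\<^sup>+\<theta>. ennreal (radial_volume (real (Suc k)) \<theta>) \<partial>sphere_borel)"
      proof (rule nn_integral_monotone_convergence_SUP)
        show "incseq (\<lambda>k \<theta>. ennreal (radial_volume (real (Suc k)) \<theta>))"
        proof (intro incseq_SucI le_funI ennreal_leI)
          fix k and \<theta> :: "(real, 'n) vec"
          have "real (Suc k) ^ CARD('n) \<le> real (Suc (Suc k)) ^ CARD('n)" by (intro power_mono) auto
          then show "radial_volume (real (Suc k)) \<theta> \<le> radial_volume (real (Suc (Suc k))) \<theta>"
            unfolding radial_volume_def by (simp add: min.coboundedI1)
        qed
      qed measurable
      also have "\<dots> \<le> ennreal (a powr (- ?n))"
        by (rule SUP_least) (simp only: V_eq(1) of_nat_0_less_iff zero_less_Suc, intro ennreal_leI V_le, simp)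
      finally have "ennreal (a powr (- ?n)) epowr (- 1 / ?n) \<le> ?J epowr (- 1 / ?n)" by (intro epowr_antimono) simp
      moreover have "ennreal (a powr (- ?n)) epowr (- 1 / ?n) = ennreal a"
        using a by (simp add: epowr_def powr_powr)
      ultimately have "ennreal a \<le> ?J epowr (- 1 / ?n)" by simp
      then have "ennreal (2 powr (1 / p) / I_const TYPE('n) p) * ennreal a \<le> ennreal (2 powr (1 / p) / I_const TYPE('n) p) * ?J epowr (- 1 / ?n)"
        by (rule mult_left_mono) simp
      moreover have "2 powr (1 / p) / I_const TYPE('n) p * a = C * y"
        using m by (simp add: I_const_eq a_def powr_divide)
      then have "ennreal (2 powr (1 / p) / I_const TYPE('n) p) * ennreal a = ennreal C * norm_inf_p p f'"
        using real C y a m by (simp add: ennreal_mult[symmetric] I_const_eq)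
      ultimately show ?thesis by (simp add: C_def)
    qed (simp add: real)
  qed
qed

end

lemma sobolev_inequality:
  fixes f :: "(real, 'n::{finite,wellorder}) vec \<Rightarrow> real" and p :: real
  assumes p: "1 \<le> p" and f: "f \<in> sobolev_W1 p"
  shows "ennreal ((1 - 1 / p + 1 / CARD('n)) * CARD('n) * unit_ball_vol (real CARD('n)) powr (1 / CARD('n))) * norm_inf_p p f \<le> energy_plus p f"
proof -
  obtain f' w where "sobolev_representative p f f' w" using sobolev_representative_exists[OF p f] .
  then interpret sobolev_representative p f f' w .
  have "norm_inf_p p f = norm_inf_p p f'"
    using ae_f fm measurable_completion[of f' lborel borel] by (intro norm_inf_p_cong_AE) auto
  moreover have "(\<integral>\<^sup>+u. Lp_norm p (D_plus u f) epowr (- real CARD('n)) \<partial>sphere_haar) = (\<integral>\<^sup>+u. (energy u epowr (1 / p)) epowr (- real CARD('n)) \<partial>sphere_borel)"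
    unfolding Lp_norm_D_plus by (rule nn_integral_sphere_haar) measurable
  ultimately show ?thesis
    using norm_le_energy_integral[OF refl] by (simp only: energy_plus_def)
qed

section \<open>Sharpness\<close>

lemma test_function_direction_DERIV:
  assumes \<phi>: "test_function \<phi>"
  shows "DERIV (\<lambda>s. \<phi> (x + s *\<^sub>R axis i 1)) 0 :> frechet_derivative \<phi> (at x) (axis i 1)"
proof -
  have D: "(\<phi> has_derivative frechet_derivative \<phi> (at x)) (at x)"
    by (rule Ck_differentiable) (rule test_function_CkD[OF \<phi>, of "Suc 0"])
  have "((\<lambda>s. x + s *\<^sub>R axis i 1) has_derivative (\<lambda>h. h *\<^sub>R axis i 1)) (at (0::real))" by (auto intro!: derivative_eq_intros)
  then have "(\<phi> \<circ> (\<lambda>s. x + s *\<^sub>R axis i 1) has_derivative frechet_derivative \<phi> (at x) \<circ> (\<lambda>h. h *\<^sub>R axis i 1)) (at (0::real))"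
    by (rule diff_chain_at) (simp add: D)
  moreover have "frechet_derivative \<phi> (at x) \<circ> (\<lambda>h. h *\<^sub>R axis i 1) = (*) (frechet_derivative \<phi> (at x) (axis i 1))"
    using linear_scale[OF has_derivative_linear[OF D]] by (auto simp: fun_eq_iff)
  ultimately show ?thesis by (simp add: has_field_derivative_def comp_def)
qed

lemma test_function_lipschitz:
  assumes \<phi>: "test_function \<phi>"
  obtains B where "0 \<le> B" "\<And>x s. \<bar>\<phi> (x + s *\<^sub>R axis i 1) - \<phi> x\<bar> \<le> B * \<bar>s\<bar>"
proof -
  obtain B where B: "0 \<le> B" "\<And>x. \<bar>dir_deriv \<phi> (axis i 1) x\<bar> \<le> B" using dir_deriv_bounded[OF \<phi>] by blast
  have "\<bar>\<phi> (x + s *\<^sub>R axis i 1) - \<phi> x\<bar> \<le> B * \<bar>s\<bar>" for x s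
  proof -
    let ?u = "s *\<^sub>R axis i 1" and ?k = "\<lambda>t. dir_deriv \<phi> (s *\<^sub>R axis i 1) (x + s *\<^sub>R axis i 1 - t *\<^sub>R (s *\<^sub>R axis i 1)) * indicator {0..1} t"
    have FTC: "\<phi> (x + ?u) - \<phi> x = (LINT t|lborel. ?k t)" using test_function_FTC[OF \<phi>, of ?u "x + ?u"] by simp
    have sc: "dir_deriv \<phi> ?u y = s * dir_deriv \<phi> (axis i 1) y" for y
      by (simp add: dir_deriv_def sum_distrib_left mult_ac)
    show ?thesis
    proof (cases "integrable lborel ?k")
      case True
      have "\<bar>LINT t|lborel. ?k t\<bar> \<le> (LINT t|lborel. (B * \<bar>s\<bar>) * indicator {0..1} (t::real))"
      proof (rule integral_abs_bound_integral[OF True])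
        fix t
        have "\<bar>s\<bar> * \<bar>dir_deriv \<phi> (axis i 1) (x + ?u - t *\<^sub>R ?u)\<bar> \<le> \<bar>s\<bar> * B" by (intro mult_left_mono B) simp
        then show "\<bar>?k t\<bar> \<le> B * \<bar>s\<bar> * indicator {0..1} t" by (simp only: sc) (auto simp: indicator_def abs_mult mult.commute)
      qed simp
      then show ?thesis by (simp add: FTC)
    next
      case False
      \<comment> \<open>A nonexistent integral has the value 0, so by the formula for the increment
        there is nothing to bound.\<close>
      have "\<phi> (x + ?u) - \<phi> x = 0" by (rule trans[OF FTC not_integrable_integral_eq[OF False]])
      then show ?thesis using B(1) by simp
    qed
  qed
  then show ?thesis using that B(1) by blast
qed

lemma integrable_bounded_support:
  fixes g :: "'a::euclidean_space \<Rightarrow> 'b::{banach, second_countable_topology}"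
  assumes [measurable]: "g \<in> borel_measurable borel" and B: "\<And>x. norm (g x) \<le> B" and r: "\<And>x. r < norm x \<Longrightarrow> g x = 0"
  shows "integrable lborel g"
proof (rule Bochner_Integration.integrable_bound)
  show "integrable lborel (\<lambda>x. B * indicator (cball (0::'a) r) x)"
    using emeasure_lborel_cball_finite[of "0::'a" r] by (intro integrable_mult_right integrable_real_indicator) (auto simp: less_top)
  show "AE x in lborel. norm (g x) \<le> norm (B * indicator (cball 0 r) x)"
  proof (rule AE_I2)
    fix x show "norm (g x) \<le> norm (B * indicator (cball 0 r) x)"
      using B[of x] r[of x] by (cases "norm x \<le> r") (auto intro: order_trans[OF _ abs_ge_self])
  qed
qed simp

lemma locally_integrable_bounded:
  fixes g :: "real^'n \<Rightarrow> 'b::{banach, second_countable_topology}"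
  assumes [measurable]: "g \<in> borel_measurable borel" and B: "\<And>x. norm (g x) \<le> B"
  shows "locally_integrable g"
  unfolding locally_integrable_def set_integrable_def
proof (intro allI impI)
  fix K :: "(real^'n) set" assume K: "compact K"
  then have [measurable]: "K \<in> sets borel" by (auto simp: compact_imp_closed)
  obtain r where r: "\<And>x. x \<in> K \<Longrightarrow> norm x \<le> r" using compact_imp_bounded[OF K] unfolding bounded_iff by blast
  have "0 \<le> B" using B[of 0] by (rule order_trans[OF norm_ge_zero])
  then have "integrable lborel (\<lambda>x. indicator K x *\<^sub>R g x)"
    using B r by (intro integrable_bounded_support[where B=B and r=r]) (auto simp: indicator_def not_le[symmetric])
  then show "integrable lebesgue (\<lambda>x. indicator K x *\<^sub>R g x)" by (subst integrable_completion) auto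
qed

lemma Lp_functions_bounded_support:
  fixes g :: "real^'n \<Rightarrow> 'b::euclidean_space"
  assumes [measurable]: "g \<in> borel_measurable borel" and B: "\<And>x. norm (g x) \<le> B" and r: "\<And>x. r < norm x \<Longrightarrow> g x = 0" and p: "0 < p"
  shows "g \<in> Lp_functions p"
proof -
  have "integrable lborel (\<lambda>x. norm (g x) powr p)"
    using B r p by (intro integrable_bounded_support[where B="B powr p" and r=r]) (auto intro: powr_mono2)
  then have "integrable lebesgue (\<lambda>x. norm (g x) powr p)" by (subst integrable_completion) auto
  then show ?thesis by (simp add: Lp_functions_def measurable_completion)
qed

text \<open>The difference quotients of the product of \<open>f\<close> and a test function have
  integral 0 by translation invariance. The Lipschitz bounds of both factors dominate them, and
  their limit is the product rule, whose integral is the claim.\<close>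

lemma lipschitz_has_weak_gradient:
  fixes f :: "real^'n \<Rightarrow> real" and g :: "real^'n \<Rightarrow> real^'n"
  assumes lip: "\<And>x y. \<bar>f x - f y\<bar> \<le> L * norm (x - y)" and F0: "\<And>x. \<bar>f x\<bar> \<le> F0"
    and g [measurable]: "g \<in> borel_measurable borel" and G0: "\<And>x. norm (g x) \<le> G0"
    and D: "\<And>i. AE x in lborel. DERIV (\<lambda>s. f (x + s *\<^sub>R axis i 1)) 0 :> g x $ i"
  shows "has_weak_gradient f g"
  unfolding has_weak_gradient_def
proof (intro conjI allI impI)
  have "\<bar>f (axis undefined 1) - f 0\<bar> \<le> L" using lip[of "axis undefined 1" 0] by simp
  then have L: "0 \<le> L" by linarith
  have "L-lipschitz_on UNIV f" by (rule lipschitz_onI) (use lip L in \<open>auto simp: dist_norm\<close>)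
  then have [measurable]: "f \<in> borel_measurable borel" by (intro borel_measurable_continuous_onI lipschitz_on_continuous_on)
  show lf: "locally_integrable f" using F0 by (intro locally_integrable_bounded[where B=F0]) auto
  show "locally_integrable g" using G0 by (intro locally_integrable_bounded) auto
  have gi: "(\<lambda>x. g x $ i) \<in> borel_measurable borel" for i
    by (rule measurable_compose[OF g borel_measurable_continuous_onI]) (intro continuous_intros)
  have loc_f: "loc_int f" by (rule locally_integrable_imp_loc_int[OF lf]) auto
  have loc_g: "loc_int (\<lambda>x. g x $ i)" for i
  proof (rule locally_integrable_imp_loc_int[OF _ gi])
    have "norm (g x $ i) \<le> G0" for x using component_le_norm_cart[of "g x" i] G0[of x] by simp
    then show "locally_integrable (\<lambda>x. g x $ i)" by (rule locally_integrable_bounded[OF gi])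
  qed simp
  fix \<phi> :: "real^'n \<Rightarrow> real" and i assume \<phi>: "test_function \<phi>"
  define e :: "real^'n" where "e = axis i 1"
  define \<phi>' where "\<phi>' x = frechet_derivative \<phi> (at x) (axis i 1)" for x
  have \<phi>': "test_function \<phi>'" unfolding \<phi>'_def[abs_def] by (rule test_function_partial[OF \<phi>])
  have [measurable]: "\<phi> \<in> borel_measurable borel" "\<phi>' \<in> borel_measurable borel" "(\<lambda>x. g x $ i) \<in> borel_measurable borel"
    using \<phi> \<phi>' gi by (auto intro: borel_measurable_continuous_onI test_function_continuous)
  obtain r where r: "0 \<le> r" "\<And>x. r < norm x \<Longrightarrow> \<phi> x = 0" using test_function_bounded_support[OF \<phi>] by blast
  obtain B where B: "0 \<le> B" "\<And>x. \<bar>\<phi> x\<bar> \<le> B" using test_function_bounded[OF \<phi>] by blast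
  obtain B' where B': "0 \<le> B'" "\<And>x s. \<bar>\<phi> (x + s *\<^sub>R e) - \<phi> x\<bar> \<le> B' * \<bar>s\<bar>" using test_function_lipschitz[OF \<phi>, of i] unfolding e_def by blast
  define h where "h x = f x * \<phi> x" for x
  have hint: "integrable lborel h" unfolding h_def[abs_def] by (rule loc_int_test_integrable[OF loc_f \<phi>])
  have [measurable]: "h \<in> borel_measurable borel" unfolding h_def[abs_def] by measurable
  define \<epsilon> where "\<epsilon> k = 1 / real (Suc k)" for k
  have \<epsilon>: "0 < \<epsilon> k" "\<epsilon> k \<le> 1" for k by (simp_all add: \<epsilon>_def)
  have \<epsilon>0: "\<epsilon> \<longlonglongrightarrow> 0" unfolding \<epsilon>_def[abs_def] using LIMSEQ_inverse_real_of_nat by (simp add: inverse_eq_divide)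
  define q where "q k x = (h (x + \<epsilon> k *\<^sub>R e) - h x) / \<epsilon> k" for k x
  have [measurable]: "q k \<in> borel_measurable borel" for k unfolding q_def[abs_def] by measurable
  have q0: "(LINT x|lborel. q k x) = 0" for k
  proof -
    have d: "(LINT x|lborel. h x) = (LINT x|distr lborel borel ((+) (\<epsilon> k *\<^sub>R e)). h x)" by (simp only: lborel_distr_plus)
    also have "\<dots> = (LINT x|lborel. h (x + \<epsilon> k *\<^sub>R e))" by (subst integral_distr) (auto simp: add.commute)
    finally have 1: "(LINT x|lborel. h (x + \<epsilon> k *\<^sub>R e)) = (LINT x|lborel. h x)" by simp
    have "integrable (distr lborel borel ((+) (\<epsilon> k *\<^sub>R e))) h" using hint by (simp only: lborel_distr_plus)
    then have "integrable lborel (\<lambda>x. h (x + \<epsilon> k *\<^sub>R e))" by (subst (asm) integrable_distr_eq) (auto simp: add.commute)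
    then show ?thesis unfolding q_def using 1 hint by simp
  qed
  have lim: "AE x in lborel. (\<lambda>k. q k x) \<longlonglongrightarrow> f x * \<phi>' x + g x $ i * \<phi> x"
    using D[of i]
  proof eventually_elim
    case (elim x)
    have "DERIV (\<lambda>s. f (x + s *\<^sub>R e) * \<phi> (x + s *\<^sub>R e)) 0 :> g x $ i * \<phi> (x + 0 *\<^sub>R e) + \<phi>' x * f (x + 0 *\<^sub>R e)"
      using elim test_function_direction_DERIV[OF \<phi>, of x i] unfolding e_def \<phi>'_def by (rule DERIV_mult)
    then have "((\<lambda>s. (h (x + s *\<^sub>R e) - h x) / s) \<longlongrightarrow> f x * \<phi>' x + g x $ i * \<phi> x) (at 0)"
      by (simp add: DERIV_def h_def add.commute mult.commute)
    moreover have "filterlim \<epsilon> (at 0) sequentially" using \<epsilon>0 \<epsilon> by (intro filterlim_atI) (auto intro!: always_eventually less_imp_neq[symmetric])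
    ultimately show ?case unfolding q_def by (rule filterlim_compose)
  qed
  have bnd: "norm (q k x) \<le> (F0 * B' + L * B) * indicator (cball 0 (r + 1)) x" for k x
  proof (cases "norm x \<le> r + 1")
    case True
    have "h (x + \<epsilon> k *\<^sub>R e) - h x = f (x + \<epsilon> k *\<^sub>R e) * (\<phi> (x + \<epsilon> k *\<^sub>R e) - \<phi> x) + (f (x + \<epsilon> k *\<^sub>R e) - f x) * \<phi> x"
      by (simp add: h_def algebra_simps)
    then have "\<bar>h (x + \<epsilon> k *\<^sub>R e) - h x\<bar> \<le> \<bar>f (x + \<epsilon> k *\<^sub>R e)\<bar> * \<bar>\<phi> (x + \<epsilon> k *\<^sub>R e) - \<phi> x\<bar> + \<bar>f (x + \<epsilon> k *\<^sub>R e) - f x\<bar> * \<bar>\<phi> x\<bar>"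
      by (metis abs_mult abs_triangle_ineq)
    also have "\<dots> \<le> F0 * (B' * \<epsilon> k) + (L * \<epsilon> k) * B"
    proof (intro add_mono mult_mono F0 B)
      show "\<bar>\<phi> (x + \<epsilon> k *\<^sub>R e) - \<phi> x\<bar> \<le> B' * \<epsilon> k" using B'(2)[of x "\<epsilon> k"] \<epsilon>[of k] by simp
      show "\<bar>f (x + \<epsilon> k *\<^sub>R e) - f x\<bar> \<le> L * \<epsilon> k" using lip[of "x + \<epsilon> k *\<^sub>R e" x] \<epsilon>[of k] by (simp add: e_def)
      show "0 \<le> F0" using F0[of x] by linarith
    qed (use L \<epsilon>[of k] in auto)
    also have "\<dots> = (F0 * B' + L * B) * \<epsilon> k" by (simp add: algebra_simps)
    finally show ?thesis using True \<epsilon>[of k] by (simp add: q_def divide_simps)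
  next
    case False
    have "norm x \<le> norm (x + \<epsilon> k *\<^sub>R e) + norm (\<epsilon> k *\<^sub>R e)" using norm_triangle_ineq4[of "x + \<epsilon> k *\<^sub>R e" "\<epsilon> k *\<^sub>R e"] by simp
    moreover have "norm (\<epsilon> k *\<^sub>R e) \<le> 1" using \<epsilon>[of k] by (simp add: e_def)
    ultimately have "r < norm (x + \<epsilon> k *\<^sub>R e)" "r < norm x" using False by linarith+
    then show ?thesis using False by (simp add: q_def h_def r)
  qed
  have "(\<lambda>k. LINT x|lborel. q k x) \<longlonglongrightarrow> (LINT x|lborel. f x * \<phi>' x + g x $ i * \<phi> x)"
  proof (rule integral_dominated_convergence[where w="\<lambda>x. (F0 * B' + L * B) * indicator (cball 0 (r + 1)) x"])
    show "integrable lborel (\<lambda>x. (F0 * B' + L * B) * indicator (cball (0::real^'n) (r + 1)) x)"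
      using emeasure_lborel_cball_finite[of "0::real^'n" "r + 1"] by (intro integrable_mult_right integrable_real_indicator) (auto simp: less_top)
    show "AE x in lborel. (\<lambda>k. q k x) \<longlonglongrightarrow> f x * \<phi>' x + g x $ i * \<phi> x" by (rule lim)
    show "AE x in lborel. norm (q k x) \<le> (F0 * B' + L * B) * indicator (cball 0 (r + 1)) x" for k by (rule AE_I2) (rule bnd)
  qed measurable
  then have "(LINT x|lborel. f x * \<phi>' x + g x $ i * \<phi> x) = 0" unfolding q0 by (simp add: LIMSEQ_const_iff)
  then have "(LINT x|lborel. f x * \<phi>' x) + (LINT x|lborel. g x $ i * \<phi> x) = 0"
    by (subst (asm) Bochner_Integration.integral_add) (auto intro: loc_int_test_integrable loc_f loc_g \<phi> \<phi>')
  moreover have "(LINT x|lebesgue. f x * \<phi>' x) = (LINT x|lborel. f x * \<phi>' x)" by (rule integral_completion) measurable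
  moreover have "(LINT x|lebesgue. g x $ i * \<phi> x) = (LINT x|lborel. g x $ i * \<phi> x)" by (rule integral_completion) measurable
  ultimately show "(LINT x|lebesgue. f x * frechet_derivative \<phi> (at x) (axis i 1)) = - (LINT x|lebesgue. g x $ i * \<phi> x)"
    unfolding \<phi>'_def by linarith
qed

section \<open>The extremal family\<close>

definition power_primitive :: "real \<Rightarrow> real \<Rightarrow> real" where
  "power_primitive a r = (if a = 1 then ln r else r powr (1 - a) / (1 - a))"

lemma DERIV_power_primitive:
  assumes "0 < r" shows "DERIV (power_primitive a) r :> r powr (- a)"
proof (cases "a = 1")
  case True
  have "DERIV ln r :> 1 / r" using assms by (auto intro!: derivative_eq_intros simp: divide_inverse)
  then show ?thesis using True assms by (simp add: power_primitive_def[abs_def] powr_minus_divide)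
next
  case False
  have "DERIV (\<lambda>r. r powr (1 - a) / (1 - a)) r :> ((1 - a) * r powr (1 - a - 1)) / (1 - a)"
    by (intro DERIV_cdivide has_real_derivative_powr assms)
  then show ?thesis using False by (simp add: power_primitive_def[abs_def])
qed

lemma power_primitive_increment:
  assumes a: "0 \<le> a" and r: "1 \<le> r" "r \<le> s"
  shows "0 \<le> power_primitive a s - power_primitive a r" "power_primitive a s - power_primitive a r \<le> s - r"
proof -
  have "0 \<le> power_primitive a s - power_primitive a r \<and> power_primitive a s - power_primitive a r \<le> s - r"
  proof (cases "r = s")
    case False
    then obtain z where z: "r < z" "z < s" "power_primitive a s - power_primitive a r = (s - r) * z powr (- a)"
      using MVT2[of r s "power_primitive a" "\<lambda>r. r powr (- a)"] r DERIV_power_primitive[of _ a] by force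
    have "z powr (- a) \<le> z powr 0" using z r a by (intro powr_mono) auto
    then have "(s - r) * z powr (- a) \<le> (s - r) * 1" using z r by (intro mult_left_mono) auto
    then show ?thesis using z r by simp
  qed simp
  then show "0 \<le> power_primitive a s - power_primitive a r" "power_primitive a s - power_primitive a r \<le> s - r" by auto
qed

text \<open>The integral of \<open>r powr (- a)\<close> up to \<rho>, starting from \<open>r\<close>
  clamped to the interval from 1 to \<rho>. For a = n/p the p-th power of the gradient is |x|^(-n),
  whose integral diverges logarithmically at both ends; the cuts at 1 and \<rho> keep the function
  bounded and of bounded support.\<close>

definition cap_profile :: "real \<Rightarrow> real \<Rightarrow> real \<Rightarrow> real" where
  "cap_profile a \<rho> r = power_primitive a \<rho> - power_primitive a (max 1 (min r \<rho>))"

definition extremal :: "real \<Rightarrow> real \<Rightarrow> real^'n \<Rightarrow> real" where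
  "extremal a \<rho> x = cap_profile a \<rho> (norm x)"

definition extremal_gradient :: "real \<Rightarrow> real \<Rightarrow> real^'n \<Rightarrow> real^'n" where
  "extremal_gradient a \<rho> x = (if 1 < norm x \<and> norm x < \<rho> then - (norm x powr (- a)) *\<^sub>R sgn x else 0)"

locale extremal_family =
  fixes a \<rho> :: real assumes a: "0 \<le> a" and \<rho>: "1 < \<rho>"
begin

lemma cap_profile_antimono: "r \<le> s \<Longrightarrow> cap_profile a \<rho> s \<le> cap_profile a \<rho> r"
  unfolding cap_profile_def
  using power_primitive_increment(1)[OF a, of "max 1 (min r \<rho>)" "max 1 (min s \<rho>)"] by (auto simp: min_def max_def)

lemma cap_profile_lipschitz: "\<bar>cap_profile a \<rho> r - cap_profile a \<rho> s\<bar> \<le> \<bar>r - s\<bar>"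
proof -
  have *: "\<bar>cap_profile a \<rho> r - cap_profile a \<rho> s\<bar> \<le> \<bar>r - s\<bar>" if "r \<le> s" for r s
    unfolding cap_profile_def
    using power_primitive_increment[OF a, of "max 1 (min r \<rho>)" "max 1 (min s \<rho>)"] that \<rho> by (auto simp: min_def max_def split: if_splits)
  show ?thesis using *[of r s] *[of s r] by (cases "r \<le> s") (auto simp: abs_minus_commute)
qed

lemma cap_profile_eq_0: "\<rho> \<le> r \<Longrightarrow> cap_profile a \<rho> r = 0"
  using \<rho> by (simp add: cap_profile_def)

lemma cap_profile_nonneg: "0 \<le> cap_profile a \<rho> r"
  using cap_profile_antimono[of r "max r \<rho>"] cap_profile_eq_0[of "max r \<rho>"] by simp

lemma cap_profile_le: "cap_profile a \<rho> r \<le> cap_profile a \<rho> 1"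
  using cap_profile_antimono[of 1 r] \<rho> by (cases "1 \<le> r") (auto simp: cap_profile_def min_def max_def)

lemma extremal_lipschitz: "\<bar>extremal a \<rho> x - extremal a \<rho> y\<bar> \<le> 1 * norm (x - y)"
  unfolding extremal_def using cap_profile_lipschitz[of "norm x" "norm y"] norm_triangle_ineq3[of x y] by linarith

lemma extremal_borel [measurable]: "(extremal a \<rho> :: real^'n \<Rightarrow> real) \<in> borel_measurable borel"
proof -
  have "1-lipschitz_on UNIV (extremal a \<rho> :: real^'n \<Rightarrow> real)"
    by (rule lipschitz_onI) (use extremal_lipschitz in \<open>auto simp: dist_norm\<close>)
  then show ?thesis by (intro borel_measurable_continuous_onI lipschitz_on_continuous_on)
qed

lemma sgn_borel: "(sgn :: 'a::euclidean_space \<Rightarrow> 'a) \<in> borel_measurable borel"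
  unfolding sgn_div_norm[abs_def] by measurable

lemma extremal_gradient_borel [measurable]: "(extremal_gradient a \<rho> :: real^'n \<Rightarrow> real^'n) \<in> borel_measurable borel"
  unfolding extremal_gradient_def[abs_def] using sgn_borel[measurable] by measurable

lemma extremal_gradient_le: "norm (extremal_gradient a \<rho> x) \<le> 1"
proof (cases "1 < norm x \<and> norm x < \<rho>")
  case True
  have "norm x powr (- a) \<le> norm x powr 0" using True a by (intro powr_mono) auto
  then show ?thesis using True by (auto simp: extremal_gradient_def norm_sgn)
qed (auto simp: extremal_gradient_def)

lemma extremal_DERIV:
  fixes x :: "real^'n"
  assumes x: "norm x \<noteq> 1" "norm x \<noteq> \<rho>"
  shows "DERIV (\<lambda>s. extremal a \<rho> (x + s *\<^sub>R axis i 1)) 0 :> extremal_gradient a \<rho> x $ i"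
proof -
  have c: "isCont (\<lambda>s. norm (x + s *\<^sub>R axis i 1)) 0" by (intro continuous_intros)
  have ev: "eventually (\<lambda>s. norm (x + s *\<^sub>R axis i 1) \<in> U) (nhds 0)" if "open U" "norm x \<in> U" for U
  proof -
    have "((\<lambda>s. norm (x + s *\<^sub>R axis i 1)) \<longlongrightarrow> norm (x + 0 *\<^sub>R axis i 1)) (nhds 0)"
      using tendsto_at_iff_tendsto_nhds c[unfolded isCont_def] by (rule iffD1)
    then show ?thesis by (rule topological_tendstoD) (use that in auto)
  qed
  have const: "DERIV (\<lambda>s. extremal a \<rho> (x + s *\<^sub>R axis i 1)) 0 :> 0"
    if U: "open U" "norm x \<in> U" "\<And>r. r \<in> U \<Longrightarrow> cap_profile a \<rho> r = k" for U k
  proof -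
    have "eventually (\<lambda>s. extremal a \<rho> (x + s *\<^sub>R axis i 1) = k) (nhds 0)"
      using ev[OF U(1,2)] by eventually_elim (simp add: extremal_def U(3))
    then have "(DERIV (\<lambda>s. extremal a \<rho> (x + s *\<^sub>R axis i 1)) 0 :> 0) \<longleftrightarrow> (DERIV (\<lambda>s::real. k) 0 :> 0)"
      by (intro DERIV_cong_ev) auto
    then show ?thesis by simp
  qed
  consider "norm x < 1" | "\<rho> < norm x" | "1 < norm x" "norm x < \<rho>" using x by linarith
  then show ?thesis
  proof cases
    case 1
    then show ?thesis using const[of "{..<1}" "cap_profile a \<rho> 1"] \<rho> by (auto simp: extremal_gradient_def cap_profile_def min_def max_def)
  next
    case 2
    then show ?thesis using const[of "{\<rho><..}" 0] cap_profile_eq_0 by (auto simp: extremal_gradient_def)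
  next
    case 3
    then have x0: "x \<noteq> 0" by auto
    have "((\<lambda>s. x + s *\<^sub>R axis i 1) has_derivative (\<lambda>h. h *\<^sub>R axis i 1)) (at (0::real))" by (auto intro!: derivative_eq_intros)
    then have "(norm \<circ> (\<lambda>s. x + s *\<^sub>R axis i 1) has_derivative (\<lambda>h. sgn x \<bullet> h) \<circ> (\<lambda>h. h *\<^sub>R axis i 1)) (at (0::real))"
      using has_derivative_norm[OF x0] by (intro diff_chain_at) (auto simp: inner_commute)
    moreover have "(\<lambda>h. sgn x \<bullet> h) \<circ> (\<lambda>h. h *\<^sub>R axis i 1) = (*) (sgn x $ i)" by (auto simp: fun_eq_iff inner_axis)
    ultimately have n: "DERIV (\<lambda>s. norm (x + s *\<^sub>R axis i 1)) 0 :> sgn x $ i" by (simp add: has_field_derivative_def comp_def)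
    have "DERIV (\<lambda>s. power_primitive a \<rho> - power_primitive a (norm (x + s *\<^sub>R axis i 1))) 0 :> 0 - norm x powr (- a) * sgn x $ i"
    proof (intro DERIV_diff DERIV_const DERIV_chain2[OF _ n])
      have "0 < norm x" using 3 by linarith
      then show "DERIV (power_primitive a) (norm (x + 0 *\<^sub>R axis i 1)) :> norm x powr (- a)" using DERIV_power_primitive[of "norm x" a] by simp
    qed
    moreover have "eventually (\<lambda>s. extremal a \<rho> (x + s *\<^sub>R axis i 1) = power_primitive a \<rho> - power_primitive a (norm (x + s *\<^sub>R axis i 1))) (nhds 0)"
      using ev[of "{1<..<\<rho>}"] 3 by (auto simp: extremal_def cap_profile_def elim!: eventually_mono)
    then have "(DERIV (\<lambda>s. extremal a \<rho> (x + s *\<^sub>R axis i 1)) 0 :> - (norm x powr (- a)) * sgn x $ i) \<longleftrightarrow>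
      (DERIV (\<lambda>s. power_primitive a \<rho> - power_primitive a (norm (x + s *\<^sub>R axis i 1))) 0 :> - (norm x powr (- a)) * sgn x $ i)"
      by (intro DERIV_cong_ev) auto
    ultimately show ?thesis using 3 by (simp add: extremal_gradient_def)
  qed
qed

lemma extremal_has_weak_gradient: "has_weak_gradient (extremal a \<rho>) (extremal_gradient a \<rho> :: real^'n \<Rightarrow> real^'n)"
proof (rule lipschitz_has_weak_gradient[OF extremal_lipschitz _ extremal_gradient_borel extremal_gradient_le])
  show "\<bar>extremal a \<rho> x\<bar> \<le> cap_profile a \<rho> 1" for x :: "real^'n"
    using cap_profile_nonneg[of "norm x"] cap_profile_le[of "norm x"] by (simp add: extremal_def)
  fix i
  have "AE x in lborel. norm (x :: real^'n) \<noteq> r" for r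
  proof (rule AE_I')
    show "sphere (0::real^'n) r \<in> null_sets lborel" using negligible_sphere[of "0::real^'n" r] by (simp add: negligible_iff_null_sets null_sets_completion_iff)
  qed auto
  from this[of 1] this[of \<rho>] show "AE x in lborel. DERIV (\<lambda>s. extremal a \<rho> (x + s *\<^sub>R axis i 1)) 0 :> (extremal_gradient a \<rho> x :: real^'n) $ i"
    by eventually_elim (rule extremal_DERIV)
qed

lemma extremal_sobolev:
  assumes p: "0 < p" shows "(extremal a \<rho> :: real^'n \<Rightarrow> real) \<in> sobolev_W1 p"
proof -
  have "(extremal a \<rho> :: real^'n \<Rightarrow> real) \<in> Lp_functions p"
  proof (rule Lp_functions_bounded_support[where r=\<rho> and B="cap_profile a \<rho> 1"])
    show "norm (extremal a \<rho> x) \<le> cap_profile a \<rho> 1" for x :: "real^'n"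
      using cap_profile_nonneg[of "norm x"] cap_profile_le[of "norm x"] by (simp add: extremal_def)
  qed (use p cap_profile_eq_0 in \<open>auto simp: extremal_def\<close>)
  moreover have "(extremal_gradient a \<rho> :: real^'n \<Rightarrow> real^'n) \<in> Lp_functions p"
    by (rule Lp_functions_bounded_support[OF extremal_gradient_borel extremal_gradient_le, where r=\<rho>])
      (use p in \<open>auto simp: extremal_gradient_def\<close>)
  ultimately show ?thesis using extremal_has_weak_gradient by (auto simp: sobolev_W1_def)
qed

end

text \<open>In the variable t = |x|^n the p-th power of the gradient is 1/t on the interval from 1
  to \<rho>^n, which gives the logarithm. The function is radial, so the norm of the directional
  derivative is the same for every unit vector and the mean over the sphere is trivial; the moment
  cancels against \<open>I_const\<close>.\<close>

lemma extremal_energy_eq: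
  fixes p \<rho> :: real
  assumes p: "1 \<le> p" and \<rho>: "1 < \<rho>"
  shows "energy_plus p (extremal (CARD('n) / p) \<rho> :: (real, 'n::{finite,wellorder}) vec \<Rightarrow> real) =
    ennreal ((unit_ball_vol (real CARD('n)) * ln (\<rho> ^ CARD('n))) powr (1 / p))"
proof -
  let ?n = "real CARD('n)" and ?\<omega> = "unit_ball_vol (real CARD('n))" and ?m = "sphere_moment TYPE('n) p"
  let ?f = "extremal (?n / p) \<rho> :: (real, 'n) vec \<Rightarrow> real"
  let ?g = "extremal_gradient (?n / p) \<rho> :: (real, 'n) vec \<Rightarrow> (real, 'n) vec"
  interpret extremal_family "?n / p" \<rho> by unfold_locales (use p \<rho> in auto)
  interpret S: prob_space "sphere_haar :: ((real, 'n) vec) measure" using is_sphere_haar_sphere_haar[where ?'n='n] by (simp add: is_sphere_haar_def)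
  have p0: "0 < p" and n0: "0 < CARD('n)" using p by auto
  have \<omega>: "0 < ?\<omega>" by (intro unit_ball_vol_pos) simp
  have m: "0 < ?m" by (rule sphere_moment_pos[OF p0])
  define L where "L = ln (\<rho> ^ CARD('n))"
  have \<rho>n: "1 < \<rho> ^ CARD('n)" using \<rho> by (intro one_less_power) auto
  then have L: "0 < L" by (simp add: L_def)
  define b where "b = (?\<omega> * (L * (?m / 2))) powr (1 / p)"
  have b: "0 < b" using L m by (simp add: b_def less_imp_neq[OF \<omega>, symmetric])
  have wg: "has_weak_gradient ?f (weak_gradient ?f)"
    unfolding weak_gradient_def by (rule someI[of "has_weak_gradient ?f", OF extremal_has_weak_gradient])
  have ae: "AE x in lebesgue. weak_gradient ?f x = ?g x" by (rule has_weak_gradient_unique[OF wg extremal_has_weak_gradient])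
  have "Lp_norm p (D_plus u ?f) = ennreal b" if u: "norm u = 1" for u
  proof -
    define H where "H t \<theta> = ennreal (1 / t) * indicator {1<..<\<rho> ^ CARD('n)} t * ennreal (max 0 (\<theta> \<bullet> (- u)) powr p)" for t :: real and \<theta> :: "(real, 'n) vec"
    have Hm: "(\<lambda>(t, \<theta>). H t \<theta>) \<in> borel_measurable (borel \<Otimes>\<^sub>M borel)" unfolding H_def by measurable
    have inner: "(LINT+ t. H t \<theta> * indicator {0<..} t) = ennreal L * ennreal (max 0 (\<theta> \<bullet> (- u)) powr p)" for \<theta>
    proof -
      have "(LINT+ t. H t \<theta> * indicator {0<..} t) = (LINT+ t. ennreal (1 / t) * indicator {1<..<exp L * 1} t * ennreal (max 0 (\<theta> \<bullet> (- u)) powr p))"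
        using \<rho> by (intro nn_integral_cong) (auto simp: H_def L_def indicator_def)
      also have "\<dots> = (LINT+ t. ennreal (1 / t) * indicator {1<..<exp L * 1} t) * ennreal (max 0 (\<theta> \<bullet> (- u)) powr p)"
        by (rule nn_integral_multc) measurable
      also have "(LINT+ t. ennreal (1 / t) * indicator {1<..<exp L * 1} t) = ennreal L" by (rule nn_integral_inverse) (use L in auto)
      finally show ?thesis .
    qed
    have "(\<integral>\<^sup>+x. ennreal (\<bar>D_plus u ?f x\<bar> powr p) \<partial>lebesgue) = (\<integral>\<^sup>+x. ennreal (max 0 (?g x \<bullet> u) powr p) \<partial>lebesgue)"
      using ae by (intro nn_integral_cong_AE, eventually_elim) (simp add: D_plus_def max.commute)
    also have "\<dots> = (LINT+ x. ennreal (max 0 (?g x \<bullet> u) powr p))" by (rule nn_integral_completion)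
    also have "\<dots> = (LINT+ x. H (norm x ^ CARD('n)) (sgn x))"
    proof (rule nn_integral_cong)
      fix x :: "(real, 'n) vec"
      have lo: "1 < norm x ^ CARD('n) \<longleftrightarrow> 1 < norm x"
        using one_less_power[of "norm x" "CARD('n)"] power_le_one[of "norm x" "CARD('n)"] by (cases "1 < norm x") (auto simp: not_less)
      have hi: "norm x ^ CARD('n) < \<rho> ^ CARD('n) \<longleftrightarrow> norm x < \<rho>" using \<rho> by (intro norm_power_less_iff) auto
      show "ennreal (max 0 (?g x \<bullet> u) powr p) = H (norm x ^ CARD('n)) (sgn x)"
      proof (cases "1 < norm x \<and> norm x < \<rho>")
        case True
        have "max 0 (?g x \<bullet> u) = norm x powr (- (?n / p)) * max 0 (sgn x \<bullet> (- u))"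
          using True max_0_mult_left[of "norm x powr (- (?n / p))" "sgn x \<bullet> (- u)"] by (simp add: extremal_gradient_def)
        then have "max 0 (?g x \<bullet> u) powr p = norm x powr (- ?n) * max 0 (sgn x \<bullet> (- u)) powr p"
          using p0 by (simp add: powr_mult powr_powr)
        also have "norm x powr (- ?n) = 1 / norm x ^ CARD('n)"
          using True by (subst powr_minus_divide, subst powr_realpow) auto
        finally show ?thesis using True lo hi by (simp add: H_def ennreal_mult[symmetric])
      next
        case False
        then show ?thesis using lo hi p0 by (auto simp: H_def extremal_gradient_def)
      qed
    qed
    also have "\<dots> = ennreal ?\<omega> * (\<integral>\<^sup>+\<theta>. (LINT+ t. H t \<theta> * indicator {0<..} t) \<partial>sphere_borel)" by (rule nn_integral_polar[OF Hm])
    also have "\<dots> = ennreal ?\<omega> * (ennreal L * ennreal (?m / 2))"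
      unfolding inner using u p0 sphere_pos_moment[of p "- u"] by (subst nn_integral_cmult) auto
    also have "\<dots> = ennreal (?\<omega> * (L * (?m / 2)))" using L by (simp only: ennreal_mult'[OF less_imp_le[OF \<omega>]] ennreal_mult'[OF less_imp_le[OF L]])
    finally have "(\<integral>\<^sup>+x. ennreal (\<bar>D_plus u ?f x\<bar> powr p) \<partial>lebesgue) = ennreal (?\<omega> * (L * (?m / 2)))" .
    moreover have "0 \<le> ?\<omega> * (L * (?m / 2))" using \<omega> L m by (intro mult_nonneg_nonneg) auto
    ultimately show ?thesis using p0 by (simp only: Lp_norm_def b_def) (rule epowr_ennreal, auto)
  qed note Lp = this
  have "(\<integral>\<^sup>+u. Lp_norm p (D_plus u ?f) epowr (- ?n) \<partial>sphere_haar) = (\<integral>\<^sup>+u. ennreal (b powr (- ?n)) \<partial>(sphere_haar :: ((real, 'n) vec) measure))"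
    using b n0 by (intro nn_integral_cong) (simp add: sphere_haar_space[OF is_sphere_haar_sphere_haar] Lp epowr_def)
  also have "\<dots> = ennreal (b powr (- ?n))" by (simp add: S.emeasure_space_1)
  also have "ennreal (b powr (- ?n)) epowr (- 1 / ?n) = ennreal b" using b by (simp add: epowr_def powr_powr)
  ultimately have "energy_plus p ?f = ennreal (2 powr (1 / p) / I_const TYPE('n) p) * ennreal b" by (simp add: energy_plus_def)
  also have "\<dots> = ennreal (2 powr (1 / p) / I_const TYPE('n) p * b)" using b by (intro ennreal_mult''[symmetric]) simp
  also have "2 powr (1 / p) / I_const TYPE('n) p * b = (?\<omega> * L) powr (1 / p)"
    using m L \<omega> by (simp add: I_const_eq b_def powr_mult powr_divide)
  finally show ?thesis by (simp add: L_def)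
qed

section \<open>Growth of the norm with the outer radius\<close>

lemma powr_Bernoulli:
  fixes p y :: real
  assumes p: "1 \<le> p" and y: "0 \<le> y" "y < 1"
  shows "1 - p * y \<le> (1 - y) powr p"
proof -
  have "(1 - 0) powr p - 1 + p * 0 \<le> (1 - y) powr p - 1 + p * y"
  proof (rule DERIV_nonneg_imp_nondecreasing[of 0 y "\<lambda>z. (1 - z) powr p - 1 + p * z"])
    fix z :: real assume z: "0 \<le> z" "z \<le> y"
    have "DERIV (\<lambda>z. (1 - z) powr p - 1 + p * z) z :> - (p * (1 - z) powr (p - 1)) + p"
      using z y by (auto intro!: derivative_eq_intros simp: powr_diff)
    moreover have "(1 - z) powr (p - 1) \<le> 1 powr (p - 1)" using z y p by (intro powr_mono2) auto
    then have "p * (1 - z) powr (p - 1) \<le> p * 1" using p by (intro mult_left_mono) auto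
    ultimately show "\<exists>D. DERIV (\<lambda>z. (1 - z) powr p - 1 + p * z) z :> D \<and> 0 \<le> D" by (intro exI conjI) auto
  qed (use y in auto)
  then show ?thesis by simp
qed

text \<open>Only volumes corresponding to radii between 1 and \<rho> are treated. The remaining part
  of the norm is nonnegative, so it may be dropped from a lower bound.\<close>

lemma extremal_mean_osc:
  fixes p \<rho> t \<gamma> :: real and f :: "(real, 'n::{finite,wellorder}) vec \<Rightarrow> real"
  defines "\<gamma> \<equiv> 1 - 1 / p + 1 / CARD('n)" and "f \<equiv> extremal (CARD('n) / p) \<rho>"
  assumes p: "1 \<le> p" and \<rho>: "1 < \<rho>" and t: "1 < t" "t < \<rho> ^ CARD('n)"
  shows "finite_levels f"
    and "decreasing_profile.mean_osc (finite_levels.profile f) (unit_ball_vol (real CARD('n)) * t) = ennreal ((t powr \<gamma> - 1) / (CARD('n) * \<gamma> * t))"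
proof -
  let ?n = "real CARD('n)" and ?\<omega> = "unit_ball_vol (real CARD('n))"
  define a where "a = ?n / p"
  interpret E: extremal_family a \<rho> by unfold_locales (use p \<rho> in \<open>auto simp: a_def\<close>)
  have f_eq: "f = extremal a \<rho>" by (simp add: f_def a_def)
  have p0: "0 < p" and n0: "0 < ?n" using p by auto
  have \<omega>: "0 < ?\<omega>" by (intro unit_ball_vol_pos) simp
  have \<gamma>: "0 < \<gamma>" unfolding \<gamma>_def by (rule affine_exponent_pos[OF p])
  have ball: "vol (ball (0::(real, 'n) vec) r) = ennreal (?\<omega> * r ^ CARD('n))" if "0 \<le> r" for r
    using that by (simp add: emeasure_ball)
  have fa: "\<bar>f x\<bar> = cap_profile a \<rho> (norm x)" for x
    using E.cap_profile_nonneg[of "norm x"] by (simp add: f_eq extremal_def)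
  show fl: "finite_levels f"
  proof
    show "f \<in> borel_measurable borel" unfolding f_eq by (rule E.extremal_borel)
    fix s :: real assume s: "0 < s"
    have "{x. s < \<bar>f x\<bar>} \<subseteq> ball 0 \<rho>"
    proof
      fix x assume "x \<in> {x. s < \<bar>f x\<bar>}"
      then show "x \<in> ball 0 \<rho>" using s E.cap_profile_eq_0[of "norm x"] by (cases "\<rho> \<le> norm x") (auto simp: fa)
    qed
    then have "vol {x. s < \<bar>f x\<bar>} \<le> vol (ball (0::(real, 'n) vec) \<rho>)" by (intro emeasure_mono) auto
    then show "vol {x. s < \<bar>f x\<bar>} < \<infinity>" using ball[of \<rho>] \<rho> by (simp add: le_less_trans[OF _ ennreal_less_top])
  qed
  interpret finite_levels f by (rule fl)
  have root: "(s powr (1 / ?n)) ^ CARD('n) = s" if "0 < s" for s :: real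
    using that by (simp add: powr_powr flip: powr_realpow)
  have profile: "profile (?\<omega> * s) = cap_profile a \<rho> (s powr (1 / ?n))" if s: "0 < s" for s
  proof (rule antisym)
    let ?r = "s powr (1 / ?n)"
    have \<omega>s: "0 < ?\<omega> * s" using \<omega> s by simp
    have r0: "0 < ?r" using s by simp
    have "{x. cap_profile a \<rho> ?r < \<bar>f x\<bar>} \<subseteq> ball 0 ?r"
    proof
      fix x assume "x \<in> {x. cap_profile a \<rho> ?r < \<bar>f x\<bar>}"
      then show "x \<in> ball 0 ?r" using E.cap_profile_antimono[of ?r "norm x"] by (cases "?r \<le> norm x") (auto simp: fa)
    qed
    then have "vol {x. cap_profile a \<rho> ?r < \<bar>f x\<bar>} \<le> vol (ball (0::(real, 'n) vec) ?r)" by (intro emeasure_mono) auto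
    also have "\<dots> = ennreal (?\<omega> * s)" using r0 by (simp add: ball root[OF s])
    finally show "profile (?\<omega> * s) \<le> cap_profile a \<rho> ?r" using profile_le_iff[OF \<omega>s E.cap_profile_nonneg] by blast
    show "cap_profile a \<rho> ?r \<le> profile (?\<omega> * s)"
    proof (rule ccontr)
      assume "\<not> cap_profile a \<rho> ?r \<le> profile (?\<omega> * s)"
      \<comment> \<open>The cap profile is 1-Lipschitz, so it still exceeds
        \<open>profile (?\<omega> * s)\<close> on a ball with radius larger by \<open>d\<close>; the
        volume of that ball contradicts the definition of the profile.\<close>
      define d where "d = cap_profile a \<rho> ?r - profile (?\<omega> * s)"
      have d: "0 < d" using \<open>\<not> _\<close> by (simp add: d_def)
      have "ball 0 (?r + d) \<subseteq> {x. profile (?\<omega> * s) < \<bar>f x\<bar>}"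
      proof
        fix x :: "(real, 'n) vec" assume "x \<in> ball 0 (?r + d)"
        then have "norm x < ?r + d" by simp
        then have "cap_profile a \<rho> ?r - d < cap_profile a \<rho> (norm x)"
          using E.cap_profile_lipschitz[of "norm x" ?r] E.cap_profile_antimono[of "norm x" ?r] d by (cases "norm x \<le> ?r") auto
        then show "x \<in> {x. profile (?\<omega> * s) < \<bar>f x\<bar>}" by (simp add: fa d_def)
      qed
      then have "vol (ball (0::(real, 'n) vec) (?r + d)) \<le> vol {x. profile (?\<omega> * s) < \<bar>f x\<bar>}" by (intro emeasure_mono) auto
      also have "\<dots> \<le> ennreal (?\<omega> * s)" using profile_le_iff[OF \<omega>s profile_nonneg] by blast
      finally have "?\<omega> * (?r + d) ^ CARD('n) \<le> ?\<omega> * s" using r0 d \<omega>s by (simp add: ball ennreal_le_iff)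
      moreover have "?r ^ CARD('n) < (?r + d) ^ CARD('n)" using r0 d by (intro power_strict_mono) auto
      ultimately show False using \<omega> root[OF s] by simp
    qed
  qed
  \<comment> \<open>The primitive as a function of the enclosed volume in units of the unit ball;
    volume \<open>?\<omega> * s\<close> belongs to the radius
    \<open>s powr (1 / ?n)\<close>.\<close>
  define A where "A s = power_primitive a (s powr (1 / ?n))" for s
  have DA: "DERIV A s :> s powr (\<gamma> - 2) / ?n" if s: "0 < s" for s
  proof -
    have "DERIV A s :> (s powr (1 / ?n)) powr (- a) * (1 / ?n * s powr (1 / ?n - 1))"
      unfolding A_def[abs_def] using s by (intro DERIV_chain2[OF DERIV_power_primitive] has_real_derivative_powr) auto
    moreover have "(s powr (1 / ?n)) powr (- a) * s powr (1 / ?n - 1) = s powr (\<gamma> - 2)"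
      using s p0 by (simp add: powr_powr powr_add[symmetric] a_def \<gamma>_def algebra_simps)
    ultimately show ?thesis by (simp add: mult.assoc[symmetric] mult.commute[of _ "1 / ?n"] divide_inverse) (simp add: mult_ac)
  qed
  have clamp: "max 1 (min (s powr (1 / ?n)) \<rho>) = (max 1 s) powr (1 / ?n)" if s: "0 < s" "s \<le> t" for s
  proof -
    have "s powr (1 / ?n) \<le> (\<rho> ^ CARD('n)) powr (1 / ?n)" using s t by (intro powr_mono2) auto
    also have "\<dots> = \<rho>" using \<rho> by (simp add: powr_powr flip: powr_realpow)
    finally have *: "s powr (1 / ?n) \<le> \<rho>" .
    show ?thesis
    proof (cases "1 \<le> s")
      case True
      then have "1 \<le> s powr (1 / ?n)" by (intro ge_one_powr_ge_zero) auto
      then show ?thesis using * True by (simp add: min_def max_def)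
    next
      case False
      then have "s powr (1 / ?n) \<le> 1 powr (1 / ?n)" using s by (intro powr_mono2) auto
      then show ?thesis using * False by (simp add: min_def max_def)
    qed
  qed
  have diff: "profile (?\<omega> * s) - profile (?\<omega> * t) = A t - A (max 1 s)" if s: "0 < s" "s \<le> t" for s
    using s t clamp[OF s] clamp[of t] by (simp add: profile cap_profile_def A_def)
  have A_mono: "A s \<le> A t" if s: "1 \<le> s" "s \<le> t" for s
  proof -
    have "1 \<le> s powr (1 / ?n)" using s by (intro ge_one_powr_ge_zero) auto
    moreover have "s powr (1 / ?n) \<le> t powr (1 / ?n)" using s by (intro powr_mono2) auto
    ultimately show ?thesis unfolding A_def using power_primitive_increment(1)[of a "s powr (1 / ?n)" "t powr (1 / ?n)"] E.a by simp
  qed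
  have [measurable]: "A \<in> borel_measurable borel" unfolding A_def[abs_def] power_primitive_def by measurable
  \<comment> \<open>Integration by parts: the boundary term plus a primitive of s times the
    derivative of \<open>A\<close>, which is \<open>s powr (\<gamma> - 1) / ?n\<close>.\<close>
  define Q where "Q s = s * (A t - A s) + s powr \<gamma> / (?n * \<gamma>)" for s
  have DQ: "DERIV Q s :> A t - A s" if s: "1 \<le> s" for s
  proof -
    have "DERIV (\<lambda>s. s powr \<gamma>) s :> \<gamma> * s powr (\<gamma> - 1)" using s by (intro has_real_derivative_powr) auto
    then have "DERIV Q s :> (A t - A s) * 1 + (0 - s powr (\<gamma> - 2) / ?n) * s + \<gamma> * s powr (\<gamma> - 1) / (?n * \<gamma>)"
      unfolding Q_def[abs_def] using s DA[of s] by (auto intro!: derivative_eq_intros)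
    moreover have "s powr (\<gamma> - 1) = s powr (\<gamma> - 2) * s" using s powr_add[of s "\<gamma> - 2" 1] by simp
    ultimately show ?thesis using \<gamma> n0 by simp
  qed
  have "P.mean_osc (?\<omega> * t) = ennreal (1 / (?\<omega> * t)) * (ennreal ?\<omega> * (LINT+ s. ennreal (profile (?\<omega> * s) - profile (?\<omega> * t)) * indicator {0<..<?\<omega> * t} (?\<omega> * s)))"
    unfolding P.mean_osc_def by (subst nn_integral_real_scale[of _ ?\<omega>]) (use \<omega> in auto)
  also have "(LINT+ s. ennreal (profile (?\<omega> * s) - profile (?\<omega> * t)) * indicator {0<..<?\<omega> * t} (?\<omega> * s)) =
      (LINT+ s. ennreal (A t - A 1) * indicator {0<..<1} s + ennreal (A t - A s) * indicator {1..t} s)"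
  proof (rule nn_integral_cong)
    fix s :: real
    have iff: "0 < ?\<omega> * s \<longleftrightarrow> 0 < s" "?\<omega> * s < ?\<omega> * t \<longleftrightarrow> s < t"
      using \<omega> by (metis mult_pos_pos zero_less_mult_pos, simp only: mult_less_cancel_left_pos)
    consider "s \<le> 0" | "0 < s" "s < 1" | "1 \<le> s" "s < t" | "t \<le> s" by linarith
    then show "ennreal (profile (?\<omega> * s) - profile (?\<omega> * t)) * indicator {0<..<?\<omega> * t} (?\<omega> * s) = ennreal (A t - A 1) * indicator {0<..<1} s + ennreal (A t - A s) * indicator {1..t} s"
      using t diff[of s] by cases (auto simp: indicator_def iff)
  qed
  also have "\<dots> = (LINT+ s. ennreal (A t - A 1) * indicator {0<..<1} (s::real)) + (LINT+ s. ennreal (A t - A s) * indicator {1..t} s)"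
    by (rule nn_integral_add) measurable
  also have "(LINT+ s. ennreal (A t - A s) * indicator {1..t} s) = ennreal (Q t - Q 1)"
    using t DQ A_mono by (intro nn_integral_FTC_Icc) auto
  also have "(LINT+ s. ennreal (A t - A 1) * indicator {0<..<1} (s::real)) = ennreal (A t - A 1)"
    by (simp add: nn_integral_cmult)
  also have "ennreal (A t - A 1) + ennreal (Q t - Q 1) = ennreal ((t powr \<gamma> - 1) / (?n * \<gamma>))"
  proof -
    have "\<exists>D. DERIV Q s :> D \<and> 0 \<le> D" if "1 \<le> s" "s \<le> t" for s
      using DQ A_mono that by (intro exI[of _ "A t - A s"]) auto
    then have "Q 1 \<le> Q t" using t by (intro DERIV_nonneg_imp_nondecreasing[of 1 t Q]) auto
    then show ?thesis using A_mono[of 1] t by (subst ennreal_plus[symmetric]) (auto simp: Q_def diff_divide_distrib)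
  qed
  also have "ennreal (1 / (?\<omega> * t)) * (ennreal ?\<omega> * ennreal ((t powr \<gamma> - 1) / (?n * \<gamma>))) = ennreal (1 / (?\<omega> * t) * (?\<omega> * ((t powr \<gamma> - 1) / (?n * \<gamma>))))"
    using \<omega> t by (simp only: ennreal_mult'[OF less_imp_le[OF \<omega>], symmetric]) (rule ennreal_mult'[symmetric], simp)
  finally show "P.mean_osc (?\<omega> * t) = ennreal ((t powr \<gamma> - 1) / (?n * \<gamma> * t))"
    using \<omega> t by (simp add: mult_ac less_imp_neq[OF \<omega>, symmetric])
qed

text \<open>By Bernoulli's inequality the integrand falls short of \<open>c\<close> times 1/t by at
  most \<open>c * p * t powr (- \<gamma> - 1)\<close>. This error is integrable at infinity with
  integral at most \<open>c * p / \<gamma>\<close>, whatever \<rho> is.\<close>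

lemma extremal_norm_ge:
  fixes p \<rho> \<gamma> :: real and f :: "(real, 'n::{finite,wellorder}) vec \<Rightarrow> real"
  defines "\<gamma> \<equiv> 1 - 1 / p + 1 / CARD('n)" and "f \<equiv> extremal (CARD('n) / p) \<rho>"
  assumes p: "1 \<le> p" and \<rho>: "1 < \<rho>"
  shows "ennreal (unit_ball_vol (real CARD('n)) * (unit_ball_vol (real CARD('n)) powr (- (p / CARD('n))) * (CARD('n) * \<gamma>) powr (- p)) * (ln (\<rho> ^ CARD('n)) - p / \<gamma>))
    \<le> norm_inf_p p f epowr p"
proof -
  let ?n = "real CARD('n)" and ?\<omega> = "unit_ball_vol (real CARD('n))"
  define T where "T = \<rho> ^ CARD('n)"
  define L where "L = ln T"
  \<comment> \<open>The limit of \<open>t * k t\<close> for large t. The powers of t combine to 1/t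
    because \<open>p * (\<gamma> - 1) - p / ?n = - 1\<close>.\<close>
  define c where "c = ?\<omega> powr (- (p / ?n)) * (?n * \<gamma>) powr (- p)"
  have p0: "0 < p" and n0: "0 < ?n" using p by auto
  have T: "1 < T" using \<rho> unfolding T_def by (intro one_less_power) auto
  then have L: "0 < L" by (simp add: L_def)
  have \<omega>: "0 < ?\<omega>" by (intro unit_ball_vol_pos) simp
  have \<gamma>: "0 < \<gamma>" unfolding \<gamma>_def by (rule affine_exponent_pos[OF p])
  have c: "0 < c" using \<gamma> n0 by (simp add: c_def less_imp_neq[OF \<omega>, symmetric])
  obtain t0 where t0: "1 < t0" "t0 < T" using T dense by blast
  interpret finite_levels f unfolding f_def by (rule extremal_mean_osc(1)[OF p \<rho> t0[unfolded T_def]])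
  have osc: "P.mean_osc (?\<omega> * t) = ennreal ((t powr \<gamma> - 1) / (?n * \<gamma> * t))" if "1 < t" "t < T" for t
    unfolding f_def \<gamma>_def by (rule extremal_mean_osc(2)[OF p \<rho> that[unfolded T_def]])
  define k where "k t = ((t powr \<gamma> - 1) / (?n * \<gamma> * t)) powr p * (?\<omega> * t) powr (- (p / ?n))" for t
  have k: "c * (1 / t) \<le> k t + c * p * t powr (- \<gamma> - 1)" if t: "1 < t" for t
  proof -
    have y: "0 \<le> t powr (- \<gamma>)" "t powr (- \<gamma>) < 1" using t \<gamma> powr_less_mono[of "- \<gamma>" 0 t] by auto
    have "(t powr \<gamma> - 1) / (?n * \<gamma> * t) = (1 - t powr (- \<gamma>)) * t powr (\<gamma> - 1) * inverse (?n * \<gamma>)"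
      using t \<gamma> n0 by (simp add: powr_minus powr_diff field_simps)
    then have ratio: "((t powr \<gamma> - 1) / (?n * \<gamma> * t)) powr p = (1 - t powr (- \<gamma>)) powr p * t powr (p * (\<gamma> - 1)) * (?n * \<gamma>) powr (- p)"
      using t y \<gamma> n0 by (simp add: powr_mult powr_powr powr_minus inverse_powr mult.commute[of p])
    have expo: "t powr (p * (\<gamma> - 1)) * t powr (- (p / ?n)) = 1 / t"
    proof -
      have "p * (\<gamma> - 1) + - (p / ?n) = - 1" using p0 by (simp add: \<gamma>_def algebra_simps)
      then show ?thesis using t unfolding powr_add[symmetric] by (simp add: powr_minus_divide)
    qed
    have "k t = c * (1 - t powr (- \<gamma>)) powr p * (t powr (p * (\<gamma> - 1)) * t powr (- (p / ?n)))"
      unfolding k_def ratio using t by (simp add: c_def powr_mult mult_ac)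
    then have "k t = c * (1 - t powr (- \<gamma>)) powr p * (1 / t)" unfolding expo .
    moreover have "c * (1 - p * t powr (- \<gamma>)) * (1 / t) \<le> c * (1 - t powr (- \<gamma>)) powr p * (1 / t)"
      using powr_Bernoulli[OF p y] c t by (intro mult_left_mono mult_right_mono) auto
    moreover have "t powr (- \<gamma> - 1) = t powr (- \<gamma>) * (1 / t)" using t by (simp add: powr_diff)
    ultimately show ?thesis by (simp add: algebra_simps)
  qed
  let ?Y = "LINT+ t. ennreal (k t) * indicator {1<..<T} t"
  have "ennreal (c * L) \<le> ?Y + ennreal (c * p / \<gamma>)"
  proof -
    have "ennreal (c * L) = ennreal c * (LINT+ t. ennreal (1 / t) * indicator {1<..<exp L * 1} t)"
      using nn_integral_inverse[of 1 L] L c by (simp add: ennreal_mult)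
    also have "\<dots> = (LINT+ t. ennreal c * (ennreal (1 / t) * indicator {1<..<exp L * 1} t))" by (rule nn_integral_cmult[symmetric]) measurable
    also have "\<dots> \<le> (LINT+ t. ennreal (k t) * indicator {1<..<T} t + ennreal (c * p * t powr (- \<gamma> - 1)) * indicator {1..T} t)"
    proof (rule nn_integral_mono)
      fix t :: real
      show "ennreal c * (ennreal (1 / t) * indicator {1<..<exp L * 1} t) \<le> ennreal (k t) * indicator {1<..<T} t + ennreal (c * p * t powr (- \<gamma> - 1)) * indicator {1..T} t"
      proof (cases "1 < t \<and> t < T")
        case True
        have "0 \<le> k t" "0 \<le> c * p * t powr (- \<gamma> - 1)" using c p0 by (auto simp: k_def)
        then show ?thesis using True k[of t] c T by (simp add: L_def ennreal_mult'[symmetric] ennreal_plus[symmetric] ennreal_leI del: ennreal_plus)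
      qed (use T in \<open>auto simp: L_def indicator_def\<close>)
    qed
    also have "\<dots> = ?Y + (LINT+ t. ennreal (c * p * t powr (- \<gamma> - 1)) * indicator {1..T} t)"
      unfolding k_def by (rule nn_integral_add) measurable
    also have "(LINT+ t. ennreal (c * p * t powr (- \<gamma> - 1)) * indicator {1..T} t) = ennreal (- (c * p * T powr (- \<gamma>) / \<gamma>) - (- (c * p * 1 powr (- \<gamma>) / \<gamma>)))"
    proof (rule nn_integral_FTC_Icc[where F="\<lambda>t. - (c * p * t powr (- \<gamma>) / \<gamma>)"])
      fix t :: real assume t: "t \<in> {1..T}"
      have "DERIV (\<lambda>t. t powr (- \<gamma>)) t :> - \<gamma> * t powr (- \<gamma> - 1)" using t by (intro has_real_derivative_powr) auto
      then show "DERIV (\<lambda>t. - (c * p * t powr (- \<gamma>) / \<gamma>)) t :> c * p * t powr (- \<gamma> - 1)"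
        using \<gamma> t by (auto intro!: derivative_eq_intros)
      show "0 \<le> c * p * t powr (- \<gamma> - 1)" using c p0 by simp
    qed (use T in auto)
    also have "\<dots> \<le> ennreal (c * p / \<gamma>)" using c p0 \<gamma> by (intro ennreal_leI) simp
    finally show ?thesis by (simp add: add_left_mono)
  qed
  then have Y: "ennreal (c * (L - p / \<gamma>)) \<le> ?Y"
  proof (cases ?Y)
    case (real r)
    have "0 \<le> c * p / \<gamma>" using c p0 \<gamma> by simp
    then have "c * L \<le> r + c * p / \<gamma>" using \<open>_ \<le> ?Y + _\<close> real by (simp add: ennreal_plus[symmetric] ennreal_le_iff del: ennreal_plus)
    then show ?thesis unfolding real by (intro ennreal_leI) (simp add: right_diff_distrib)
  qed simp
  have "ennreal (?\<omega> * c * (L - p / \<gamma>)) = ennreal ?\<omega> * ennreal (c * (L - p / \<gamma>))"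
    using \<omega> by (simp only: ennreal_mult'[OF less_imp_le[OF \<omega>], symmetric] mult.assoc)
  also have "\<dots> \<le> ennreal ?\<omega> * ?Y" by (rule mult_left_mono[OF Y]) simp
  also have "\<dots> = ennreal ?\<omega> * (LINT+ t. ennreal (k ((?\<omega> * t) / ?\<omega>)) * indicator {1<..<T} ((?\<omega> * t) / ?\<omega>))"
    by (simp add: less_imp_neq[OF \<omega>, symmetric])
  also have "\<dots> = (LINT+ \<tau>. ennreal (k (\<tau> / ?\<omega>)) * indicator {1<..<T} (\<tau> / ?\<omega>))"
    unfolding k_def by (rule nn_integral_real_scale[symmetric, OF _ \<omega>]) measurable
  also have "\<dots> \<le> (LINT+ \<tau>. P.mean_osc \<tau> epowr p * ennreal (\<tau> powr (- (p / ?n))) * indicator {0<..} \<tau>)"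
  proof (rule nn_integral_mono)
    fix \<tau> :: real
    show "ennreal (k (\<tau> / ?\<omega>)) * indicator {1<..<T} (\<tau> / ?\<omega>) \<le> P.mean_osc \<tau> epowr p * ennreal (\<tau> powr (- (p / ?n))) * indicator {0<..} \<tau>"
    proof (cases "1 < \<tau> / ?\<omega> \<and> \<tau> / ?\<omega> < T")
      case True
      define t where "t = \<tau> / ?\<omega>"
      have \<tau>: "\<tau> = ?\<omega> * t" by (simp add: t_def less_imp_neq[OF \<omega>, symmetric])
      have t: "1 < t" "t < T" using True by (auto simp: t_def)
      have "0 \<le> (t powr \<gamma> - 1) / (?n * \<gamma> * t)" using t \<gamma> n0 by (intro divide_nonneg_nonneg) (auto intro: ge_one_powr_ge_zero)
      then have "P.mean_osc \<tau> epowr p = ennreal (((t powr \<gamma> - 1) / (?n * \<gamma> * t)) powr p)"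
        unfolding \<tau> osc[OF t] using p0 by (intro epowr_ennreal)
      moreover have "0 < \<tau>" unfolding \<tau> using \<omega> t by (intro mult_pos_pos) auto
      ultimately show ?thesis using t by (simp add: t_def[symmetric] k_def \<tau>[symmetric] ennreal_mult'[symmetric])
    qed (auto simp: indicator_def)
  qed
  also have "\<dots> = norm_inf_p p f epowr p" by (rule norm_inf_p_epowr[OF p0, symmetric])
  finally show ?thesis by (simp add: c_def L_def T_def)
qed

lemma sobolev_inequality_sharp:
  fixes p C :: real
  assumes p: "1 \<le> p"
    and C: "(1 - 1 / p + 1 / CARD('n)) * CARD('n) * unit_ball_vol (real CARD('n)) powr (1 / CARD('n)) < C"
  obtains f :: "(real, 'n::{finite,wellorder}) vec \<Rightarrow> real" where "f \<in> sobolev_W1 p" "energy_plus p f < ennreal C * norm_inf_p p f"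
proof -
  let ?n = "real CARD('n)" and ?\<omega> = "unit_ball_vol (real CARD('n))"
  define \<gamma> where "\<gamma> = 1 - 1 / p + 1 / ?n"
  define D where "D = \<gamma> * ?n * ?\<omega> powr (1 / ?n)"
  define \<kappa> where "\<kappa> = (C / D) powr p"
  define \<delta> where "\<delta> = p / \<gamma>"
  \<comment> \<open>A length \<open>L\<close> with \<open>\<kappa> * (L - \<delta>) > L\<close>
    contradicts the larger constant \<open>C\<close>; twice the threshold
    \<open>\<kappa> * \<delta> / (\<kappa> - 1)\<close> is taken, and \<rho> is chosen to make
    \<open>L\<close> the logarithm of its n-th power.\<close>
  define L where "L = 2 * \<kappa> * \<delta> / (\<kappa> - 1)"
  define \<rho> where "\<rho> = exp (L / ?n)"
  let ?f = "extremal (?n / p) \<rho> :: (real, 'n) vec \<Rightarrow> real"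
  have p0: "0 < p" and n0: "0 < ?n" using p by auto
  have \<omega>: "0 < ?\<omega>" by (intro unit_ball_vol_pos) simp
  have \<gamma>: "0 < \<gamma>" unfolding \<gamma>_def by (rule affine_exponent_pos[OF p])
  have D: "0 < D" "D < C" using \<gamma> n0 C by (simp_all add: D_def \<gamma>_def less_imp_neq[OF \<omega>, symmetric])
  have \<delta>: "0 < \<delta>" using p0 \<gamma> by (simp add: \<delta>_def)
  have \<kappa>: "1 < \<kappa>" using D p0 powr_less_mono2[of p 1 "C / D"] by (simp add: \<kappa>_def)
  have L: "0 < L" using \<kappa> \<delta> by (simp add: L_def)
  have \<rho>: "1 < \<rho>" using L n0 by (simp add: \<rho>_def)
  have lnp: "ln (\<rho> ^ CARD('n)) = L" using \<rho> by (simp add: ln_realpow) (simp add: \<rho>_def)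
  interpret extremal_family "?n / p" \<rho> by unfold_locales (use p \<rho> in auto)
  have "\<not> ennreal C * norm_inf_p p ?f \<le> energy_plus p ?f"
  proof
    assume "ennreal C * norm_inf_p p ?f \<le> energy_plus p ?f"
    then have le: "ennreal C * norm_inf_p p ?f \<le> ennreal ((?\<omega> * L) powr (1 / p))"
      using extremal_energy_eq[OF p \<rho>, where ?'n='n] by (simp only: lnp)
    have "norm_inf_p p ?f \<noteq> \<top>" using le D by (auto simp: ennreal_mult_top top_unique)
    then obtain y where y: "norm_inf_p p ?f = ennreal y" "0 \<le> y" by (cases "norm_inf_p p ?f") auto
    have "C * y \<le> (?\<omega> * L) powr (1 / p)" using le y D by (simp add: ennreal_mult[symmetric] ennreal_le_iff)
    then have "(C * y) powr p \<le> ((?\<omega> * L) powr (1 / p)) powr p" using p0 D y by (intro powr_mono2) auto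
    then have 1: "C powr p * y powr p \<le> ?\<omega> * L" using p0 D y L \<omega> by (simp add: powr_powr powr_mult)
    have "?\<omega> * (?\<omega> powr (- (p / ?n)) * (?n * \<gamma>) powr (- p)) * (L - \<delta>) \<le> y powr p"
      using extremal_norm_ge[OF p \<rho>, where ?'n='n] p0 y
      by (simp add: lnp epowr_ennreal \<delta>_def \<gamma>_def ennreal_le_iff)
    then have "C powr p * (?\<omega> * (?\<omega> powr (- (p / ?n)) * (?n * \<gamma>) powr (- p)) * (L - \<delta>)) \<le> C powr p * y powr p"
      by (rule mult_left_mono) simp
    also note 1
    also have "C powr p = \<kappa> * ((?n * \<gamma>) powr p * ?\<omega> powr (p / ?n))"
      using D \<gamma> n0 \<omega> by (simp add: \<kappa>_def powr_divide D_def powr_mult powr_powr mult_ac less_imp_neq[OF \<omega>, symmetric])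
    also have "?\<omega> powr (- (p / ?n)) * (?n * \<gamma>) powr (- p) = inverse ((?n * \<gamma>) powr p * ?\<omega> powr (p / ?n))"
      by (simp add: powr_minus mult.commute)
    finally have *: "\<kappa> * ?\<omega> * (L - \<delta>) * (((?n * \<gamma>) powr p * ?\<omega> powr (p / ?n)) * inverse ((?n * \<gamma>) powr p * ?\<omega> powr (p / ?n))) \<le> ?\<omega> * L"
      by (simp only: mult_ac)
    have nz: "(?n * \<gamma>) powr p * ?\<omega> powr (p / ?n) \<noteq> 0" using \<gamma> n0 by (simp add: less_imp_neq[OF \<omega>, symmetric])
    have "\<kappa> * ?\<omega> * (L - \<delta>) \<le> ?\<omega> * L" using * by (simp only: right_inverse[OF nz] mult_1_right)
    then have "\<kappa> * (L - \<delta>) \<le> L" using \<omega> by simp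
    moreover have "(\<kappa> - 1) * L = 2 * \<kappa> * \<delta>" using \<kappa> by (simp add: L_def)
    ultimately have "\<kappa> * \<delta> \<le> 0" by (simp add: algebra_simps)
    then show False using \<kappa> \<delta> by (simp add: mult_le_0_iff)
  qed
  then show ?thesis using extremal_sobolev[OF p0] by (intro that[of ?f]) (auto simp: not_le)
qed

theorem theorem2p1:
  fixes p :: real and q :: ereal
  assumes "CARD('n::{finite,wellorder}) \<ge> 2" and "1 \<le> p"
    and "q \<in> {-\<infinity><..<ereal (- real CARD('n))} \<union> {ereal (real CARD('n) / (real CARD('n) - 1))..\<infinity>}"
    and "1 / q = ereal (1 / p - 1 / real CARD('n))"
  shows "(\<forall>f :: (real, 'n) vec \<Rightarrow> real. f \<in> sobolev_W1 p \<longrightarrow>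
            energy_plus p f \<ge> ennreal (affine_const TYPE('n) q) * norm_inf_p p f) \<and>
         (\<forall>C > affine_const TYPE('n) q.
            \<not> (\<forall>f :: (real, 'n) vec \<Rightarrow> real. f \<in> sobolev_W1 p \<longrightarrow>
                 energy_plus p f \<ge> ennreal C * norm_inf_p p f))"
proof -
  have "measure lebesgue (ball (0 :: (real, 'n) vec) 1) = unit_ball_vol (real CARD('n))"
    using content_ball[of 1 "0 :: (real, 'n) vec"] by simp
  then have c: "affine_const TYPE('n) q = (1 - 1 / p + 1 / CARD('n)) * CARD('n) * unit_ball_vol (real CARD('n)) powr (1 / CARD('n))"
    using assms(4) by (simp add: affine_const_def)
  show ?thesis
  proof (intro conjI allI impI)
    fix f :: "(real, 'n) vec \<Rightarrow> real" assume "f \<in> sobolev_W1 p"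
    then show "ennreal (affine_const TYPE('n) q) * norm_inf_p p f \<le> energy_plus p f"
      unfolding c by (rule sobolev_inequality[OF assms(2)])
  next
    fix C assume "affine_const TYPE('n) q < C"
    then obtain f :: "(real, 'n) vec \<Rightarrow> real" where "f \<in> sobolev_W1 p" "energy_plus p f < ennreal C * norm_inf_p p f"
      using sobolev_inequality_sharp[OF assms(2)] unfolding c by blast
    then show "\<not> (\<forall>f :: (real, 'n) vec \<Rightarrow> real. f \<in> sobolev_W1 p \<longrightarrow> ennreal C * norm_inf_p p f \<le> energy_plus p f)"
      by (auto simp: not_le)
  qed
qed

end
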